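(* For any (not necessarily Hausdorff) étale Lie groupoid $G$ over a Hausdorff manifold $M$, the convolution algebra $\mathcal{C}^{\infty}_{c}(G)$ of smooth functions with compact support on $G$ has a natural structure of a cocommutative coassociative Hopf algebroid over $\mathcal{C}^{\infty}_{c}(M)$ (namely the structure maps $\mu,\Delta,\epsilon,S$ described in the context), and this gives, with $\phi\mapsto\phi_{+}$ on morphisms, a functor $$\mathcal{C}^{\infty}_{c}:\mathrm{EtGrpd}(M)\to\mathrm{HoAlgd}(\mathcal{C}^{\infty}_{c}(M)).$$
   Context: All manifolds and maps are smooth; $\mathbb{F}\in\{\mathbb{R},\mathbb{C}\}$ is fixed; $\mathcal{C}^{\infty}_{c}(M)$ is the ring of $\mathbb{F}$-valued smooth functions with compact support on the Hausdorff manifold $M$. Hopf algebroids. Algebras are associative $\mathbb{F}$-algebras, possibly without identity. Let $R$ be a commutative algebra with local identities (for all $r_{1},\dots,r_{k}\in R$ there is $r\in R$ with $rr_{i}=r_{i}$ for all $i$). A Hopf algebroid over $R$ is an algebra $A$ containing $R$ as a subalgebra, with local identities in $R$ (for all $a_{1},\dots,a_{k}\in A$ there is $r\in R$ with $ra_{i}=a_{i}r=a_{i}$ for all $i$), with $\mathbb{F}$-linear maps $\Delta:A\to A\otimes_{R}^{ll}A$, $\epsilon:A\to R$, $S:A\to A$ such that: (i) $\Delta,\epsilon$ are left $R$-linear and $(\mathrm{id}\otimes\epsilon)\circ\Delta=\mathrm{id}=(\epsilon\otimes\mathrm{id})\circ\Delta$; (ii) $\epsilon|_{R}=\mathrm{id}$,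 $\Delta|_{R}$ is the canonical embedding $R\cong R\otimes_{R}R\subset A\otimes_{R}^{ll}A$, and the two right $R$-actions on $A\otimes^{ll}_{R}A$ coincide on $\Delta A$; (iii) $\Delta(ab)=\Delta(a)\Delta(b)$; (iv) $S|_{R}=\mathrm{id}$, $S\circ S=\mathrm{id}$; (v) $S(ab)=S(b)S(a)$; (vi) $\mu\circ(S\otimes\mathrm{id})\circ\Delta=\epsilon\circ S$ with $\mu:A\otimes_{R}^{rl}A\to A$ the multiplication. Here $\otimes^{ll}_{R}$ is the tensor product with respect to the left $R$-actions on both factors, $\otimes^{rl}_{R}$ that with respect to the right action on the first and left action on the second factor. It is coassociative if $(\Delta\otimes\mathrm{id})\circ\Delta=(\mathrm{id}\otimes\Delta)\circ\Delta$ and cocommutative if $\sigma\circ\Delta=\Delta$ with $\sigma$ the flip. A homomorphism of Hopf algebroids over $R$ is an algebra homomorphism $\alpha$ with $\alpha|_{R}=\mathrm{id}$, $\epsilon\circ\alpha=\epsilon$, $(\alpha\otimes\alpha)\circ\Delta=\Delta\circ\alpha$, $S\circ\alpha=\alpha\circ S$. The category is $\mathrm{HoAlgd}(R)$. Functions on non-Hausdorff manifolds. For a (not necessarily Hausdorff) manifold $E$, with sheaf of germs of smooth functions $\mathcal{C}^{\infty}_{E}$, $\mathcal{C}^{\infty}_{c}(E)$ is the subspace of the space of all (not necessarily continuous) global sections of $\mathcal{C}^{\infty}_{E}$ spanned by the extensions by zero of functions in $\mathcal{C}^{\infty}_{c}(U)$, $U\subset E$ Hausdorff open. $u_{y}$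 is the value (a germ) of $u$ at $y$. A local diffeomorphism $\phi:E\to F$ induces $\phi_{+}:\mathcal{C}^{\infty}_{c}(E)\to\mathcal{C}^{\infty}_{c}(F)$, $\phi_{+}(u)_{z}=\sum_{y\in\phi^{-1}(z)}\phi_{*y}(u_{y})$, where $\phi_{*y}$ is the inverse of pull-back of germs $(\mathcal{C}^{\infty}_{F})_{\phi(y)}\to(\mathcal{C}^{\infty}_{E})_{y}$. If $\pi:E\to M$ is a local diffeomorphism, $\mathcal{C}^{\infty}_{c}(E)$ is a $\mathcal{C}^{\infty}_{c}(M)$-module by $(pu)_{y}=\pi^{*}_{y}(p_{\pi(y)})u_{y}$. If also $\xi:F\to M$ is a local diffeomorphism, there is an isomorphism of $\mathcal{C}^{\infty}_{c}(M)$-modules $\Omega_{\pi,\xi}:\mathcal{C}^{\infty}_{c}(E)\otimes_{\mathcal{C}^{\infty}_{c}(M)}\mathcal{C}^{\infty}_{c}(F)\to\mathcal{C}^{\infty}_{c}(E\times_{M}F)$, $\Omega_{\pi,\xi}(u\otimes v)_{(y,z)}=(\mathrm{pr}_{1})^{*}_{(y,z)}(u_{y})(\mathrm{pr}_{2})^{*}_{(y,z)}(v_{z})$. Étale groupoids. An étale Lie groupoid over $M$ is a (not necessarily Hausdorff, no second countability required) manifold $G$ with a groupoid structure with object manifold $M$ all of whose structure maps (source $s$, target $t$, multiplication $\mathrm{mlt}:G\times_{M}^{st}G\to G$, inverse $\mathrm{inv}$, unit) are local diffeomorphisms; $M$ is identified with an open submanifold of $G$ via units, whence $\mathcal{C}^{\infty}_{c}(M)\subset\mathcal{C}^{\infty}_{c}(G)$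 by extension by zero. $\mathrm{EtGrpd}(M)$ has as morphisms the smooth groupoid maps $\phi$ with $\phi|_{M}=\mathrm{id}$. Structure maps on $\mathcal{C}^{\infty}_{c}(G)$. The left (resp. right) $\mathcal{C}^{\infty}_{c}(M)$-action is the module structure given by $t$ (resp. $s$). The convolution product is $\mu=\mathrm{mlt}_{+}\circ\Omega_{s,t}:\mathcal{C}^{\infty}_{c}(G)\otimes^{rl}_{\mathcal{C}^{\infty}_{c}(M)}\mathcal{C}^{\infty}_{c}(G)\to\mathcal{C}^{\infty}_{c}(G)$; the comultiplication is $\Delta=\Omega_{t,t}^{-1}\circ\mathrm{diag}_{+}$ with $\mathrm{diag}:G\to G\times_{M}^{tt}G$ the diagonal; the counit is $\epsilon=t_{+}$; the antipode is $S=\mathrm{inv}_{+}$. *)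

theory Defs
  imports "HOL-Analysis.Analysis" "HOL-Algebra.Module" "HOL-Algebra.AbelCoset" "HOL-Library.Poly_Mapping"
begin

section \<open>Smooth manifolds, not necessarily Hausdorff\<close>

text \<open>For open \<open>S\<close> in a finite-dimensional space this is the class \<open>C\<^sup>k\<close>.\<close>

fun k_smooth_on :: "nat \<Rightarrow> 'e::real_normed_vector set \<Rightarrow> ('e \<Rightarrow> 'b::real_normed_vector) \<Rightarrow> bool" where
  "k_smooth_on 0 S f \<longleftrightarrow> continuous_on S f"
| "k_smooth_on (Suc k) S f \<longleftrightarrow>
     (\<forall>x\<in>S. f differentiable at x) \<and> (\<forall>v. k_smooth_on k S (\<lambda>x. frechet_derivative f (at x) v))"

definition smooth_on :: "'e::real_normed_vector set \<Rightarrow> ('e \<Rightarrow> 'b::real_normed_vector) \<Rightarrow> bool" where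
  "smooth_on S f \<longleftrightarrow> (\<forall>k. k_smooth_on k S f)"

text \<open>The model space \<open>'e\<close> is of class \<open>{real_inner, heine_borel}\<close>, i.e. a finite-dimensional
  Euclidean space; in contrast to the class \<open>euclidean_space\<close> this includes dimension 0. A manifold
  is given by an atlas, which need not be maximal. No separation or countability axiom is imposed.\<close>

record ('p, 'e) manifold =
  mtop :: "'p topology"
  atlas :: "('p set \<times> ('p \<Rightarrow> 'e)) set"

definition smooth_manifold :: "('p, 'e::{real_inner,heine_borel}) manifold \<Rightarrow> bool" where
  "smooth_manifold E \<longleftrightarrow>
     \<Union> (fst ` atlas E) = topspace (mtop E) \<and>
     (\<forall>(U, \<kappa>)\<in>atlas E. openin (mtop E) U \<and> open (\<kappa> ` U) \<and>
        homeomorphic_map (subtopology (mtop E) U) (top_of_set (\<kappa> ` U)) \<kappa>) \<and>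
     (\<forall>(U, \<kappa>)\<in>atlas E. \<forall>(V, \<psi>)\<in>atlas E. smooth_on (\<kappa> ` (U \<inter> V)) (\<psi> \<circ> inv_into U \<kappa>))"

definition smooth_fun_on ::
  "('p, 'e::{real_inner,heine_borel}) manifold \<Rightarrow> 'p set \<Rightarrow> ('p \<Rightarrow> 'f::real_normed_field) \<Rightarrow> bool" where
  "smooth_fun_on E W f \<longleftrightarrow> (\<forall>(U, \<kappa>)\<in>atlas E. smooth_on (\<kappa> ` (U \<inter> W)) (f \<circ> inv_into U \<kappa>))"

definition smooth_map ::
  "('p, 'e::{real_inner,heine_borel}) manifold \<Rightarrow> ('q, 'd::{real_inner,heine_borel}) manifold
    \<Rightarrow> ('p \<Rightarrow> 'q) \<Rightarrow> bool" where
  "smooth_map E F f \<longleftrightarrow> continuous_map (mtop E) (mtop F) f \<and>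
     (\<forall>(U, \<kappa>)\<in>atlas E. \<forall>(V, \<psi>)\<in>atlas F.
        smooth_on (\<kappa> ` (U \<inter> f -` V)) (\<psi> \<circ> f \<circ> inv_into U \<kappa>))"

definition open_sub :: "('p, 'e) manifold \<Rightarrow> 'p set \<Rightarrow> ('p, 'e) manifold" where
  "open_sub E U = \<lparr>mtop = subtopology (mtop E) U, atlas = {(V \<inter> U, \<kappa>) |V \<kappa>. (V, \<kappa>) \<in> atlas E}\<rparr>"

definition diffeomorphism ::
  "('p, 'e::{real_inner,heine_borel}) manifold \<Rightarrow> ('q, 'd::{real_inner,heine_borel}) manifold
    \<Rightarrow> ('p \<Rightarrow> 'q) \<Rightarrow> bool" where
  "diffeomorphism E F f \<longleftrightarrow> bij_betw f (topspace (mtop E)) (topspace (mtop F)) \<and>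
     smooth_map E F f \<and> smooth_map F E (inv_into (topspace (mtop E)) f)"

definition local_diffeo ::
  "('p, 'e::{real_inner,heine_borel}) manifold \<Rightarrow> ('q, 'd::{real_inner,heine_borel}) manifold
    \<Rightarrow> ('p \<Rightarrow> 'q) \<Rightarrow> bool" where
  "local_diffeo E F f \<longleftrightarrow> (\<forall>y\<in>topspace (mtop E). \<exists>U V. openin (mtop E) U \<and> y \<in> U \<and>
     openin (mtop F) V \<and> diffeomorphism (open_sub E U) (open_sub F V) f)"

text \<open>The fibre product of two local diffeomorphisms \<open>\<pi>\<close>, \<open>\<xi>\<close> into the same manifold, with the
  topology induced from the product and the smooth structure for which the first
  (equivalently, the second) projection is a local diffeomorphism.\<close>

definition fib_top ::
  "('p, 'e) manifold \<Rightarrow> ('p \<Rightarrow> 'm) \<Rightarrow> ('q, 'e) manifold \<Rightarrow> ('q \<Rightarrow> 'm) \<Rightarrow> ('p \<times> 'q) topology" where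
  "fib_top E \<pi> F \<xi> = subtopology (prod_topology (mtop E) (mtop F)) {(y, z). \<pi> y = \<xi> z}"

definition fib_prod ::
  "('p, 'e) manifold \<Rightarrow> ('p \<Rightarrow> 'm) \<Rightarrow> ('q, 'e) manifold \<Rightarrow> ('q \<Rightarrow> 'm) \<Rightarrow> ('p \<times> 'q, 'e) manifold" where
  "fib_prod E \<pi> F \<xi> =
     \<lparr>mtop = fib_top E \<pi> F \<xi>,
      atlas = {(W, \<kappa> \<circ> fst) |W U \<kappa>.
        (U, \<kappa>) \<in> atlas E \<and> openin (fib_top E \<pi> F \<xi>) W \<and> fst ` W \<subseteq> U \<and> inj_on fst W}\<rparr>"


section \<open>Algebras and tensor products\<close>

text \<open>The ground field \<open>\<F>\<close> is a type \<open>'f\<close> of class \<open>real_normed_field\<close>. The instances \<open>real\<close> and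
  \<open>complex\<close> are the intended ones, and by the Gelfand-Mazur theorem the only ones up to isomorphism.\<close>

definition scalars :: "'f::real_normed_field ring" where
  "scalars = \<lparr>carrier = UNIV, mult = (*), one = 1, zero = 0, add = (+)\<rparr>"

inductive_set lin_span :: "('f, 'a, 'z) module_scheme \<Rightarrow> 'a set \<Rightarrow> 'a set"
  for A :: "('f, 'a, 'z) module_scheme" and B :: "'a set" where
  "\<zero>\<^bsub>A\<^esub> \<in> lin_span A B"
| "b \<in> B \<Longrightarrow> v \<in> lin_span A B \<Longrightarrow> (c \<odot>\<^bsub>A\<^esub> b) \<oplus>\<^bsub>A\<^esub> v \<in> lin_span A B"

definition linear_maps :: "('f, 'a, 'z) module_scheme \<Rightarrow> ('f, 'b, 'y) module_scheme \<Rightarrow> ('a \<Rightarrow> 'b) set" where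
  "linear_maps A B = {f \<in> carrier A \<rightarrow> carrier B.
     (\<forall>a\<in>carrier A. \<forall>a'\<in>carrier A. f (a \<oplus>\<^bsub>A\<^esub> a') = f a \<oplus>\<^bsub>B\<^esub> f a') \<and>
     (\<forall>c. \<forall>a\<in>carrier A. f (c \<odot>\<^bsub>A\<^esub> a) = c \<odot>\<^bsub>B\<^esub> f a)}"

text \<open>The \<open>one\<close> field of the record is not used: algebras need not have an identity.\<close>

locale assoc_algebra =
  fixes A :: "('f::real_normed_field, 'a, 'z) module_scheme" (structure)
  assumes vector_space: "module scalars A"
    and mult_closed: "a \<in> carrier A \<Longrightarrow> b \<in> carrier A \<Longrightarrow> a \<otimes> b \<in> carrier A"
    and mult_assoc: "a \<in> carrier A \<Longrightarrow> b \<in> carrier A \<Longrightarrow> d \<in> carrier A \<Longrightarrow> (a \<otimes> b) \<otimes> d = a \<otimes> (b \<otimes> d)"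
    and mult_linear_right: "a \<in> carrier A \<Longrightarrow> (\<lambda>b. a \<otimes> b) \<in> linear_maps A A"
    and mult_linear_left: "b \<in> carrier A \<Longrightarrow> (\<lambda>a. a \<otimes> b) \<in> linear_maps A A"

locale comm_local_algebra = assoc_algebra R for R :: "('f::real_normed_field, 'r, 'z) module_scheme" (structure) +
  assumes mult_comm: "a \<in> carrier R \<Longrightarrow> b \<in> carrier R \<Longrightarrow> a \<otimes> b = b \<otimes> a"
    and local_identities: "finite B \<Longrightarrow> B \<subseteq> carrier R \<Longrightarrow> \<exists>r\<in>carrier R. \<forall>b\<in>B. r \<otimes> b = b"

text \<open>Modules over an algebra \<open>R\<close> with elements of type \<open>'r\<close>: vector spaces with an action.\<close>

record ('f, 'r, 'a) rmodule = "('f, 'a) module" +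
  act :: "'r \<Rightarrow> 'a \<Rightarrow> 'a"

definition with_act :: "('f, 'a, 'z) module_scheme \<Rightarrow> ('r \<Rightarrow> 'a \<Rightarrow> 'a) \<Rightarrow> ('f, 'r, 'a) rmodule" where
  "with_act A l = \<lparr>carrier = carrier A, mult = mult A, one = one A, zero = zero A, add = add A,
     smult = smult A, act = l\<rparr>"

definition free_space :: "'k set \<Rightarrow> ('f::real_normed_field, 'k \<Rightarrow>\<^sub>0 'f) module" where
  "free_space K = \<lparr>carrier = {x. Poly_Mapping.keys x \<subseteq> K}, mult = undefined, one = undefined,
     zero = 0, add = (+), smult = (\<lambda>c. Poly_Mapping.map ((*) c))\<rparr>"

text \<open>The tensor product over \<open>R\<close> is the free vector space on \<open>carrier X \<times> carrier Y\<close> modulo the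
  subspace generated by the relations of bilinearity and of \<open>R\<close>-balancedness; its elements are
  cosets.\<close>

definition tensor_rel ::
  "('f::real_normed_field, 'r, 'z) module_scheme \<Rightarrow> ('f, 'r, 'a) rmodule \<Rightarrow> ('f, 'r, 'b) rmodule
    \<Rightarrow> ('a \<times> 'b \<Rightarrow>\<^sub>0 'f) set" where
  "tensor_rel R X Y = lin_span (free_space (carrier X \<times> carrier Y))
    ({Poly_Mapping.single (x \<oplus>\<^bsub>X\<^esub> x', y) 1 - Poly_Mapping.single (x, y) 1 - Poly_Mapping.single (x', y) 1
        |x x' y. x \<in> carrier X \<and> x' \<in> carrier X \<and> y \<in> carrier Y} \<union>
     {Poly_Mapping.single (x, y \<oplus>\<^bsub>Y\<^esub> y') 1 - Poly_Mapping.single (x, y) 1 - Poly_Mapping.single (x, y') 1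
        |x y y'. x \<in> carrier X \<and> y \<in> carrier Y \<and> y' \<in> carrier Y} \<union>
     {Poly_Mapping.single (c \<odot>\<^bsub>X\<^esub> x, y) 1 - Poly_Mapping.single (x, y) c
        |c x y. x \<in> carrier X \<and> y \<in> carrier Y} \<union>
     {Poly_Mapping.single (x, c \<odot>\<^bsub>Y\<^esub> y) 1 - Poly_Mapping.single (x, y) c
        |c x y. x \<in> carrier X \<and> y \<in> carrier Y} \<union>
     {Poly_Mapping.single (act X r x, y) 1 - Poly_Mapping.single (x, act Y r y) 1
        |r x y. r \<in> carrier R \<and> x \<in> carrier X \<and> y \<in> carrier Y})"

definition tensor_coset ::
  "('f::real_normed_field, 'r, 'z) module_scheme \<Rightarrow> ('f, 'r, 'a) rmodule \<Rightarrow> ('f, 'r, 'b) rmodule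
    \<Rightarrow> ('a \<times> 'b \<Rightarrow>\<^sub>0 'f) \<Rightarrow> ('a \<times> 'b \<Rightarrow>\<^sub>0 'f) set" where
  "tensor_coset R X Y x = tensor_rel R X Y +>\<^bsub>free_space (carrier X \<times> carrier Y)\<^esub> x"

definition pure_tensor ::
  "('f::real_normed_field, 'r, 'z) module_scheme \<Rightarrow> ('f, 'r, 'a) rmodule \<Rightarrow> ('f, 'r, 'b) rmodule
    \<Rightarrow> 'a \<Rightarrow> 'b \<Rightarrow> ('a \<times> 'b \<Rightarrow>\<^sub>0 'f) set" where
  "pure_tensor R X Y x y = tensor_coset R X Y (Poly_Mapping.single (x, y) 1)"

definition tensor_space ::
  "('f::real_normed_field, 'r, 'z) module_scheme \<Rightarrow> ('f, 'r, 'a) rmodule \<Rightarrow> ('f, 'r, 'b) rmodule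
    \<Rightarrow> ('f, ('a \<times> 'b \<Rightarrow>\<^sub>0 'f) set) module" where
  "tensor_space R X Y =
     \<lparr>carrier = a_rcosets\<^bsub>free_space (carrier X \<times> carrier Y)\<^esub> (tensor_rel R X Y),
      mult = undefined, one = undefined, zero = tensor_rel R X Y,
      add = set_add (free_space (carrier X \<times> carrier Y)),
      smult = (\<lambda>c T. \<Union>x\<in>T. tensor_coset R X Y (c \<odot>\<^bsub>free_space (carrier X \<times> carrier Y)\<^esub> x))\<rparr>"

text \<open>The linear map on a tensor product that sends \<open>x \<otimes> y\<close> to \<open>b x y\<close>. It does not depend on the
  choice of the representative if \<open>b\<close> is bilinear and balanced.\<close>

definition tensor_lift ::
  "('f::real_normed_field, 'c, 'z) module_scheme \<Rightarrow> ('a \<Rightarrow> 'b \<Rightarrow> 'c) \<Rightarrow> ('a \<times> 'b \<Rightarrow>\<^sub>0 'f) set \<Rightarrow> 'c" where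
  "tensor_lift N b T = (let x = SOME x. x \<in> T in
     \<Oplus>\<^bsub>N\<^esub>p\<in>Poly_Mapping.keys x. Poly_Mapping.lookup x p \<odot>\<^bsub>N\<^esub> b (fst p) (snd p))"

text \<open>The tensor product as a module over the commutative algebra \<open>R\<close>, with
  \<open>r (x \<otimes> y) = (r x) \<otimes> y = x \<otimes> (r y)\<close>.\<close>

definition tensor ::
  "('f::real_normed_field, 'r, 'z) module_scheme \<Rightarrow> ('f, 'r, 'a) rmodule \<Rightarrow> ('f, 'r, 'b) rmodule
    \<Rightarrow> ('f, 'r, ('a \<times> 'b \<Rightarrow>\<^sub>0 'f) set) rmodule" where
  "tensor R X Y = with_act (tensor_space R X Y)
     (\<lambda>r. tensor_lift (tensor_space R X Y) (\<lambda>x y. pure_tensor R X Y (act X r x) y))"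

text \<open>The map \<open>f \<otimes> g\<close> with values in the tensor product of \<open>X\<close> and \<open>Y\<close>.\<close>

definition tensor_map ::
  "('f::real_normed_field, 'r, 'z) module_scheme \<Rightarrow> ('f, 'r, 'c) rmodule \<Rightarrow> ('f, 'r, 'd) rmodule
    \<Rightarrow> ('a \<Rightarrow> 'c) \<Rightarrow> ('b \<Rightarrow> 'd) \<Rightarrow> ('a \<times> 'b \<Rightarrow>\<^sub>0 'f) set \<Rightarrow> ('c \<times> 'd \<Rightarrow>\<^sub>0 'f) set" where
  "tensor_map R X Y f g = tensor_lift (tensor R X Y) (\<lambda>x y. pure_tensor R X Y (f x) (g y))"


section \<open>Hopf algebroids\<close>

text \<open>The inclusion of \<open>R\<close> as a subalgebra is rendered by an injective homomorphism \<open>inc\<close>.\<close>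

record (overloaded) ('f::real_normed_field, 'r, 'a) hopf_data = "('f, 'a) module" +
  inc :: "'r \<Rightarrow> 'a"
  comult :: "'a \<Rightarrow> ('a \<times> 'a \<Rightarrow>\<^sub>0 'f) set"
  counit :: "'a \<Rightarrow> 'r"
  antipode :: "'a \<Rightarrow> 'a"

definition left_mod :: "('f::real_normed_field, 'r, 'a) hopf_data \<Rightarrow> ('f, 'r, 'a) rmodule" where
  "left_mod A = with_act A (\<lambda>r a. inc A r \<otimes>\<^bsub>A\<^esub> a)"

definition right_mod :: "('f::real_normed_field, 'r, 'a) hopf_data \<Rightarrow> ('f, 'r, 'a) rmodule" where
  "right_mod A = with_act A (\<lambda>r a. a \<otimes>\<^bsub>A\<^esub> inc A r)"

definition self_mod :: "('f, 'r, 'z) module_scheme \<Rightarrow> ('f, 'r, 'r) rmodule" where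
  "self_mod R = with_act R (mult R)"

abbreviation tensor_ll ::
  "('f::real_normed_field, 'r) module \<Rightarrow> ('f, 'r, 'a) hopf_data
    \<Rightarrow> ('f, 'r, ('a \<times> 'a \<Rightarrow>\<^sub>0 'f) set) rmodule" where
  "tensor_ll R A \<equiv> tensor R (left_mod A) (left_mod A)"

abbreviation pure_ll ::
  "('f::real_normed_field, 'r) module \<Rightarrow> ('f, 'r, 'a) hopf_data \<Rightarrow> 'a \<Rightarrow> 'a \<Rightarrow> ('a \<times> 'a \<Rightarrow>\<^sub>0 'f) set" where
  "pure_ll R A \<equiv> pure_tensor R (left_mod A) (left_mod A)"

text \<open>The two right actions, \<open>(a \<otimes> b) r = a r \<otimes> b\<close> and \<open>(a \<otimes> b) r = a \<otimes> b r\<close>.\<close>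

definition right_act1 where
  "right_act1 R A r = tensor_lift (tensor_ll R A) (\<lambda>a b. pure_ll R A (a \<otimes>\<^bsub>A\<^esub> inc A r) b)"

definition right_act2 where
  "right_act2 R A r = tensor_lift (tensor_ll R A) (\<lambda>a b. pure_ll R A a (b \<otimes>\<^bsub>A\<^esub> inc A r))"

text \<open>The componentwise product \<open>(a \<otimes> b) (c \<otimes> d) = a c \<otimes> b d\<close>. It is independent of the
  representatives as soon as the two right actions coincide on the left factor \<open>T\<close>.\<close>

definition tensor_mult where
  "tensor_mult R A T T' = tensor_lift (tensor_ll R A)
     (\<lambda>c d. tensor_lift (tensor_ll R A) (\<lambda>a b. pure_ll R A (a \<otimes>\<^bsub>A\<^esub> c) (b \<otimes>\<^bsub>A\<^esub> d)) T) T'"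

text \<open>In \<open>counit_right\<close> and \<open>counit_left\<close> the tensor products of \<open>A\<close> with \<open>R\<close> are identified with \<open>A\<close> by
  the left action, so \<open>(id \<otimes> \<epsilon>) (a \<otimes> b) = \<epsilon>(b) a\<close> and \<open>(\<epsilon> \<otimes> id) (a \<otimes> b) = \<epsilon>(a) b\<close>. In \<open>comult_inc\<close>
  the isomorphism of \<open>R\<close> with its tensor square is the inverse of the multiplication.\<close>

locale hopf_algebroid =
  fixes R :: "('f::real_normed_field, 'r) module" and A :: "('f, 'r, 'a) hopf_data"
  assumes base: "comm_local_algebra R"
    and algebra: "assoc_algebra A"
    and inc_linear: "inc A \<in> linear_maps R A"
    and inc_mult: "r \<in> carrier R \<Longrightarrow> r' \<in> carrier R \<Longrightarrow> inc A (r \<otimes>\<^bsub>R\<^esub> r') = inc A r \<otimes>\<^bsub>A\<^esub> inc A r'"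
    and inc_inj: "inj_on (inc A) (carrier R)"
    and local_identities: "finite B \<Longrightarrow> B \<subseteq> carrier A \<Longrightarrow>
      \<exists>r\<in>carrier R. \<forall>a\<in>B. inc A r \<otimes>\<^bsub>A\<^esub> a = a \<and> a \<otimes>\<^bsub>A\<^esub> inc A r = a"
    and comult_linear: "comult A \<in> linear_maps A (tensor_ll R A)"
    and counit_linear: "counit A \<in> linear_maps A R"
    and antipode_linear: "antipode A \<in> linear_maps A A"
    and comult_left: "r \<in> carrier R \<Longrightarrow> a \<in> carrier A \<Longrightarrow>
      comult A (inc A r \<otimes>\<^bsub>A\<^esub> a) = act (tensor_ll R A) r (comult A a)"
    and counit_left_linear: "r \<in> carrier R \<Longrightarrow> a \<in> carrier A \<Longrightarrow>
      counit A (inc A r \<otimes>\<^bsub>A\<^esub> a) = r \<otimes>\<^bsub>R\<^esub> counit A a"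
    and counit_right: "a \<in> carrier A \<Longrightarrow>
      tensor_lift A (\<lambda>b c. inc A (counit A c) \<otimes>\<^bsub>A\<^esub> b) (comult A a) = a"
    and counit_left: "a \<in> carrier A \<Longrightarrow>
      tensor_lift A (\<lambda>b c. inc A (counit A b) \<otimes>\<^bsub>A\<^esub> c) (comult A a) = a"
    and counit_inc: "r \<in> carrier R \<Longrightarrow> counit A (inc A r) = r"
    and comult_inc: "r \<in> carrier R \<Longrightarrow> comult A (inc A r) =
      tensor_map R (left_mod A) (left_mod A) (inc A) (inc A)
        (inv_into (carrier (tensor R (self_mod R) (self_mod R))) (tensor_lift R (mult R)) r)"
    and right_acts: "r \<in> carrier R \<Longrightarrow> a \<in> carrier A \<Longrightarrow>
      right_act1 R A r (comult A a) = right_act2 R A r (comult A a)"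
    and comult_mult: "a \<in> carrier A \<Longrightarrow> b \<in> carrier A \<Longrightarrow>
      comult A (a \<otimes>\<^bsub>A\<^esub> b) = tensor_mult R A (comult A a) (comult A b)"
    and antipode_inc: "r \<in> carrier R \<Longrightarrow> antipode A (inc A r) = inc A r"
    and antipode_antipode: "a \<in> carrier A \<Longrightarrow> antipode A (antipode A a) = a"
    and antipode_mult: "a \<in> carrier A \<Longrightarrow> b \<in> carrier A \<Longrightarrow>
      antipode A (a \<otimes>\<^bsub>A\<^esub> b) = antipode A b \<otimes>\<^bsub>A\<^esub> antipode A a"
    and antipode_comult: "a \<in> carrier A \<Longrightarrow>
      tensor_lift A (mult A) (tensor_map R (right_mod A) (left_mod A) (antipode A) (\<lambda>b. b) (comult A a)) =
      inc A (counit A (antipode A a))"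

text \<open>The associativity isomorphism \<open>(a \<otimes> b) \<otimes> c \<mapsto> a \<otimes> (b \<otimes> c)\<close>.\<close>

definition tensor_assoc where
  "tensor_assoc R A = tensor_lift (tensor R (left_mod A) (tensor_ll R A))
     (\<lambda>T c. tensor_lift (tensor R (left_mod A) (tensor_ll R A))
       (\<lambda>a b. pure_tensor R (left_mod A) (tensor_ll R A) a (pure_ll R A b c)) T)"

definition coassociative :: "('f::real_normed_field, 'r) module \<Rightarrow> ('f, 'r, 'a) hopf_data \<Rightarrow> bool" where
  "coassociative R A \<longleftrightarrow> (\<forall>a\<in>carrier A.
     tensor_assoc R A (tensor_map R (tensor_ll R A) (left_mod A) (comult A) (\<lambda>b. b) (comult A a)) =
     tensor_map R (left_mod A) (tensor_ll R A) (\<lambda>b. b) (comult A) (comult A a))"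

definition cocommutative :: "('f::real_normed_field, 'r) module \<Rightarrow> ('f, 'r, 'a) hopf_data \<Rightarrow> bool" where
  "cocommutative R A \<longleftrightarrow> (\<forall>a\<in>carrier A.
     tensor_lift (tensor_ll R A) (\<lambda>b c. pure_ll R A c b) (comult A a) = comult A a)"

definition hopf_hom ::
  "('f::real_normed_field, 'r) module \<Rightarrow> ('f, 'r, 'a) hopf_data \<Rightarrow> ('f, 'r, 'b) hopf_data
    \<Rightarrow> ('a \<Rightarrow> 'b) \<Rightarrow> bool" where
  "hopf_hom R A B \<alpha> \<longleftrightarrow> \<alpha> \<in> linear_maps A B \<and>
     (\<forall>a\<in>carrier A. \<forall>b\<in>carrier A. \<alpha> (a \<otimes>\<^bsub>A\<^esub> b) = \<alpha> a \<otimes>\<^bsub>B\<^esub> \<alpha> b) \<and>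
     (\<forall>r\<in>carrier R. \<alpha> (inc A r) = inc B r) \<and>
     (\<forall>a\<in>carrier A. counit B (\<alpha> a) = counit A a) \<and>
     (\<forall>a\<in>carrier A. tensor_map R (left_mod B) (left_mod B) \<alpha> \<alpha> (comult A a) = comult B (\<alpha> a)) \<and>
     (\<forall>a\<in>carrier A. antipode B (\<alpha> a) = \<alpha> (antipode A a))"


section \<open>Germs and smooth functions with compact support\<close>

text \<open>A germ at \<open>y\<close> is the class of all functions that coincide with a given one near \<open>y\<close>.\<close>

definition germ :: "('p, 'e) manifold \<Rightarrow> 'p \<Rightarrow> ('p \<Rightarrow> 'f) \<Rightarrow> ('p \<Rightarrow> 'f) set" where
  "germ E y f = {h. \<forall>\<^sub>F x in nhdsin (mtop E) y. h x = f x}"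

definition stalk ::
  "('p, 'e::{real_inner,heine_borel}) manifold \<Rightarrow> 'p \<Rightarrow> ('f::real_normed_field, ('p \<Rightarrow> 'f) set) module" where
  "stalk E y =
     \<lparr>carrier = {germ E y f |f. \<exists>W. openin (mtop E) W \<and> y \<in> W \<and> smooth_fun_on E W f},
      mult = (\<lambda>a b. {h. \<exists>f\<in>a. \<exists>g\<in>b. h \<in> germ E y (\<lambda>x. f x * g x)}),
      one = germ E y (\<lambda>_. 1),
      zero = germ E y (\<lambda>_. 0),
      add = (\<lambda>a b. {h. \<exists>f\<in>a. \<exists>g\<in>b. h \<in> germ E y (\<lambda>x. f x + g x)}),
      smult = (\<lambda>c a. {h. \<exists>f\<in>a. h \<in> germ E y (\<lambda>x. c * f x)})\<rparr>"

text \<open>All (not necessarily continuous) global sections of the sheaf, with the pointwise operations.\<close>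

definition sections ::
  "('p, 'e::{real_inner,heine_borel}) manifold
    \<Rightarrow> ('f::real_normed_field, 'p \<Rightarrow> ('p \<Rightarrow> 'f) set) module" where
  "sections E =
     \<lparr>carrier = (\<Pi>\<^sub>E y\<in>topspace (mtop E). carrier (stalk E y)),
      mult = (\<lambda>u v. \<lambda>y\<in>topspace (mtop E). u y \<otimes>\<^bsub>stalk E y\<^esub> v y),
      one = (\<lambda>y\<in>topspace (mtop E). \<one>\<^bsub>stalk E y\<^esub>),
      zero = (\<lambda>y\<in>topspace (mtop E). \<zero>\<^bsub>stalk E y\<^esub>),
      add = (\<lambda>u v. \<lambda>y\<in>topspace (mtop E). u y \<oplus>\<^bsub>stalk E y\<^esub> v y),
      smult = (\<lambda>c u. \<lambda>y\<in>topspace (mtop E). c \<odot>\<^bsub>stalk E y\<^esub> u y)\<rparr>"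

text \<open>Smooth functions on the open subset \<open>U\<close> whose support, taken in \<open>U\<close>, is compact.\<close>

definition compact_smooth_on ::
  "('p, 'e::{real_inner,heine_borel}) manifold \<Rightarrow> 'p set \<Rightarrow> ('p \<Rightarrow> 'f::real_normed_field) \<Rightarrow> bool" where
  "compact_smooth_on E U f \<longleftrightarrow> smooth_fun_on E U f \<and>
     compactin (mtop E) (subtopology (mtop E) U closure_of {x \<in> U. f x \<noteq> 0})"

definition ext_by_zero ::
  "('p, 'e::{real_inner,heine_borel}) manifold \<Rightarrow> 'p set \<Rightarrow> ('p \<Rightarrow> 'f::real_normed_field)
    \<Rightarrow> 'p \<Rightarrow> ('p \<Rightarrow> 'f) set" where
  "ext_by_zero E U f = (\<lambda>y\<in>topspace (mtop E). if y \<in> U then germ E y f else \<zero>\<^bsub>stalk E y\<^esub>)"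

text \<open>For Hausdorff \<open>E\<close> the elements of \<open>Cc E\<close> are the sections of germs of the smooth functions
  with compact support on \<open>E\<close>, and \<open>Cc E\<close> is an algebra under the pointwise multiplication
  inherited from \<open>sections E\<close>.\<close>

definition Cc ::
  "('p, 'e::{real_inner,heine_borel}) manifold
    \<Rightarrow> ('f::real_normed_field, 'p \<Rightarrow> ('p \<Rightarrow> 'f) set) module" where
  "Cc E = sections E \<lparr>carrier := lin_span (sections E)
     {ext_by_zero E U f |U f. openin (mtop E) U \<and> Hausdorff_space (subtopology (mtop E) U) \<and>
        compact_smooth_on E U f}\<rparr>"

definition germ_pullback ::
  "('p, 'e) manifold \<Rightarrow> ('p \<Rightarrow> 'q) \<Rightarrow> 'p \<Rightarrow> ('q \<Rightarrow> 'f) set \<Rightarrow> ('p \<Rightarrow> 'f) set" where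
  "germ_pullback E \<phi> y a = {h. \<exists>f\<in>a. h \<in> germ E y (\<lambda>x. f (\<phi> x))}"

definition germ_push ::
  "('p, 'e::{real_inner,heine_borel}) manifold \<Rightarrow> ('q, 'e) manifold \<Rightarrow> ('p \<Rightarrow> 'q) \<Rightarrow> 'p
    \<Rightarrow> ('p \<Rightarrow> 'f::real_normed_field) set \<Rightarrow> ('q \<Rightarrow> 'f) set" where
  "germ_push E F \<phi> y = inv_into (carrier (stalk F (\<phi> y))) (germ_pullback E \<phi> y)"

text \<open>The map \<open>\<phi>\<^sub>+\<close>. The fibre may be infinite, but only finitely many of its points carry a non-zero
  germ of \<open>u\<close>; the sum is restricted to these because \<open>finsum\<close> over an infinite set is 0.\<close>

definition push ::
  "('p, 'e::{real_inner,heine_borel}) manifold \<Rightarrow> ('q, 'e) manifold \<Rightarrow> ('p \<Rightarrow> 'q)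
    \<Rightarrow> ('p \<Rightarrow> ('p \<Rightarrow> 'f::real_normed_field) set) \<Rightarrow> ('q \<Rightarrow> ('q \<Rightarrow> 'f) set)" where
  "push E F \<phi> = (\<lambda>u\<in>carrier (Cc E). \<lambda>z\<in>topspace (mtop F).
     \<Oplus>\<^bsub>stalk F z\<^esub>y\<in>{y \<in> topspace (mtop E). \<phi> y = z \<and> u y \<noteq> \<zero>\<^bsub>stalk E y\<^esub>}. germ_push E F \<phi> y (u y))"

definition Cc_mod ::
  "('p, 'e::{real_inner,heine_borel}) manifold \<Rightarrow> ('p \<Rightarrow> 'm)
    \<Rightarrow> ('f::real_normed_field, 'm \<Rightarrow> ('m \<Rightarrow> 'f) set, 'p \<Rightarrow> ('p \<Rightarrow> 'f) set) rmodule" where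
  "Cc_mod E \<pi> = with_act (Cc E)
     (\<lambda>p u. \<lambda>y\<in>topspace (mtop E). germ_pullback E \<pi> y (p (\<pi> y)) \<otimes>\<^bsub>stalk E y\<^esub> u y)"

definition Omega ::
  "('p, 'e::{real_inner,heine_borel}) manifold \<Rightarrow> ('p \<Rightarrow> 'm) \<Rightarrow> ('q, 'e) manifold \<Rightarrow> ('q \<Rightarrow> 'm)
    \<Rightarrow> (('p \<Rightarrow> ('p \<Rightarrow> 'f)set) \<times> ('q \<Rightarrow> ('q \<Rightarrow> 'f) set) \<Rightarrow>\<^sub>0 'f::real_normed_field) set
    \<Rightarrow> ('p \<times> 'q \<Rightarrow> ('p \<times> 'q \<Rightarrow> 'f) set)" where
  "Omega E \<pi> F \<xi> = tensor_lift (Cc (fib_prod E \<pi> F \<xi>))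
     (\<lambda>u v. \<lambda>w\<in>topspace (mtop (fib_prod E \<pi> F \<xi>)).
        germ_pullback (fib_prod E \<pi> F \<xi>) fst w (u (fst w))
          \<otimes>\<^bsub>stalk (fib_prod E \<pi> F \<xi>) w\<^esub> germ_pullback (fib_prod E \<pi> F \<xi>) snd w (v (snd w)))"


section \<open>Etale Lie groupoids and their convolution algebras\<close>

text \<open>Arrows \<open>g\<close>, \<open>h\<close> with \<open>src g = tgt h\<close> are composable, with product \<open>mlt (g, h)\<close>.\<close>

record ('g, 'm, 'e) groupoid =
  arr :: "('g, 'e) manifold"
  src :: "'g \<Rightarrow> 'm"
  tgt :: "'g \<Rightarrow> 'm"
  mlt :: "'g \<times> 'g \<Rightarrow> 'g"
  ivt :: "'g \<Rightarrow> 'g"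
  unt :: "'m \<Rightarrow> 'g"

abbreviation arrows :: "('g, 'm, 'e) groupoid \<Rightarrow> 'g set" where
  "arrows G \<equiv> topspace (mtop (arr G))"

definition comp_st :: "('g, 'm, 'e) groupoid \<Rightarrow> ('g \<times> 'g, 'e) manifold" where
  "comp_st G = fib_prod (arr G) (src G) (arr G) (tgt G)"

definition comp_tt :: "('g, 'm, 'e) groupoid \<Rightarrow> ('g \<times> 'g, 'e) manifold" where
  "comp_tt G = fib_prod (arr G) (tgt G) (arr G) (tgt G)"

locale etale_groupoid =
  fixes M :: "('m, 'e::{real_inner,heine_borel}) manifold" and G :: "('g, 'm, 'e) groupoid"
  assumes objects: "smooth_manifold M"
    and arrows: "smooth_manifold (arr G)"
    and src: "local_diffeo (arr G) M (src G)"
    and tgt: "local_diffeo (arr G) M (tgt G)"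
    and mlt: "local_diffeo (comp_st G) (arr G) (mlt G)"
    and ivt: "local_diffeo (arr G) (arr G) (ivt G)"
    and unt: "local_diffeo M (arr G) (unt G)"
    and src_mlt: "g \<in> arrows G \<Longrightarrow> h \<in> arrows G \<Longrightarrow> src G g = tgt G h \<Longrightarrow> src G (mlt G (g, h)) = src G h"
    and tgt_mlt: "g \<in> arrows G \<Longrightarrow> h \<in> arrows G \<Longrightarrow> src G g = tgt G h \<Longrightarrow> tgt G (mlt G (g, h)) = tgt G g"
    and mlt_assoc: "g \<in> arrows G \<Longrightarrow> h \<in> arrows G \<Longrightarrow> k \<in> arrows G \<Longrightarrow> src G g = tgt G h \<Longrightarrow>
      src G h = tgt G k \<Longrightarrow> mlt G (mlt G (g, h), k) = mlt G (g, mlt G (h, k))"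
    and src_unt: "x \<in> topspace (mtop M) \<Longrightarrow> src G (unt G x) = x"
    and tgt_unt: "x \<in> topspace (mtop M) \<Longrightarrow> tgt G (unt G x) = x"
    and unt_left: "g \<in> arrows G \<Longrightarrow> mlt G (unt G (tgt G g), g) = g"
    and unt_right: "g \<in> arrows G \<Longrightarrow> mlt G (g, unt G (src G g)) = g"
    and src_ivt: "g \<in> arrows G \<Longrightarrow> src G (ivt G g) = tgt G g"
    and tgt_ivt: "g \<in> arrows G \<Longrightarrow> tgt G (ivt G g) = src G g"
    and ivt_left: "g \<in> arrows G \<Longrightarrow> mlt G (ivt G g, g) = unt G (src G g)"
    and ivt_right: "g \<in> arrows G \<Longrightarrow> mlt G (g, ivt G g) = unt G (tgt G g)"

text \<open>Compatibility with \<open>unt\<close> is the condition that the map restricts to the identity of \<open>M\<close>;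
  the induced map on objects is then the identity as well.\<close>

definition etale_hom ::
  "('m, 'e::{real_inner,heine_borel}) manifold \<Rightarrow> ('g, 'm, 'e) groupoid \<Rightarrow> ('h, 'm, 'e) groupoid
    \<Rightarrow> ('g \<Rightarrow> 'h) \<Rightarrow> bool" where
  "etale_hom M G H \<phi> \<longleftrightarrow> smooth_map (arr G) (arr H) \<phi> \<and>
     (\<forall>g\<in>arrows G. src H (\<phi> g) = src G g \<and> tgt H (\<phi> g) = tgt G g) \<and>
     (\<forall>g\<in>arrows G. \<forall>h\<in>arrows G. src G g = tgt G h \<longrightarrow> \<phi> (mlt G (g, h)) = mlt H (\<phi> g, \<phi> h)) \<and>
     (\<forall>x\<in>topspace (mtop M). \<phi> (unt G x) = unt H x)"

text \<open>The convolution algebra with its structure maps. Since the unit map is an injective local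
  diffeomorphism, its push-forward is the extension by zero along the inclusion of \<open>M\<close> in \<open>G\<close>.
  The \<open>one\<close> field is irrelevant.\<close>

definition convolution_hopf ::
  "('m, 'e::{real_inner,heine_borel}) manifold \<Rightarrow> ('g, 'm, 'e) groupoid
    \<Rightarrow> ('f::real_normed_field, 'm \<Rightarrow> ('m \<Rightarrow> 'f) set, 'g \<Rightarrow> ('g \<Rightarrow> 'f) set) hopf_data" where
  "convolution_hopf M G =
     \<lparr>carrier = carrier (Cc (arr G)),
      mult = (\<lambda>u v. push (comp_st G) (arr G) (mlt G)
        (Omega (arr G) (src G) (arr G) (tgt G)
          (pure_tensor (Cc M) (Cc_mod (arr G) (src G)) (Cc_mod (arr G) (tgt G)) u v))),
      one = undefined,
      zero = zero (Cc (arr G)),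
      add = add (Cc (arr G)),
      smult = smult (Cc (arr G)),
      inc = push M (arr G) (unt G),
      comult = (\<lambda>u. inv_into
        (carrier (tensor (Cc M) (Cc_mod (arr G) (tgt G)) (Cc_mod (arr G) (tgt G))))
        (Omega (arr G) (tgt G) (arr G) (tgt G))
        (push (arr G) (comp_tt G) (\<lambda>g. (g, g)) u)),
      counit = push (arr G) M (tgt G),
      antipode = push (arr G) (arr G) (ivt G)\<rparr>"


section \<open>Categories and functors\<close>

text \<open>A category with hom-sets \<open>Hom a b\<close>; \<open>Cmp a b c g f\<close> is the composite of \<open>f \<in> Hom a b\<close> and
  \<open>g \<in> Hom b c\<close>. Morphisms that are maps are represented by functions that are \<open>undefined\<close> outside
  the carrier of their domain.\<close>

record ('o, 'm) cat =
  Obj :: "'o set"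
  Hom :: "'o \<Rightarrow> 'o \<Rightarrow> 'm set"
  Idt :: "'o \<Rightarrow> 'm"
  Cmp :: "'o \<Rightarrow> 'o \<Rightarrow> 'o \<Rightarrow> 'm \<Rightarrow> 'm \<Rightarrow> 'm"

locale is_category =
  fixes C :: "('o, 'm) cat"
  assumes idt: "a \<in> Obj C \<Longrightarrow> Idt C a \<in> Hom C a a"
    and cmp: "a \<in> Obj C \<Longrightarrow> b \<in> Obj C \<Longrightarrow> c \<in> Obj C \<Longrightarrow> f \<in> Hom C a b \<Longrightarrow> g \<in> Hom C b c \<Longrightarrow>
      Cmp C a b c g f \<in> Hom C a c"
    and cmp_idt: "a \<in> Obj C \<Longrightarrow> b \<in> Obj C \<Longrightarrow> f \<in> Hom C a b \<Longrightarrow> Cmp C a a b f (Idt C a) = f"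
    and idt_cmp: "a \<in> Obj C \<Longrightarrow> b \<in> Obj C \<Longrightarrow> f \<in> Hom C a b \<Longrightarrow> Cmp C a b b (Idt C b) f = f"
    and cmp_assoc: "a \<in> Obj C \<Longrightarrow> b \<in> Obj C \<Longrightarrow> c \<in> Obj C \<Longrightarrow> d \<in> Obj C \<Longrightarrow>
      f \<in> Hom C a b \<Longrightarrow> g \<in> Hom C b c \<Longrightarrow> h \<in> Hom C c d \<Longrightarrow>
      Cmp C a b d (Cmp C b c d h g) f = Cmp C a c d h (Cmp C a b c g f)"

locale is_functor =
  fixes C :: "('o, 'm) cat" and D :: "('p, 'n) cat"
    and obj_map :: "'o \<Rightarrow> 'p" and mor_map :: "'o \<Rightarrow> 'o \<Rightarrow> 'm \<Rightarrow> 'n"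
  assumes source: "is_category C"
    and target: "is_category D"
    and obj_map: "a \<in> Obj C \<Longrightarrow> obj_map a \<in> Obj D"
    and mor_map: "a \<in> Obj C \<Longrightarrow> b \<in> Obj C \<Longrightarrow> f \<in> Hom C a b \<Longrightarrow>
      mor_map a b f \<in> Hom D (obj_map a) (obj_map b)"
    and mor_map_idt: "a \<in> Obj C \<Longrightarrow> mor_map a a (Idt C a) = Idt D (obj_map a)"
    and mor_map_cmp: "a \<in> Obj C \<Longrightarrow> b \<in> Obj C \<Longrightarrow> c \<in> Obj C \<Longrightarrow> f \<in> Hom C a b \<Longrightarrow> g \<in> Hom C b c \<Longrightarrow>
      mor_map a c (Cmp C a b c g f) =
      Cmp D (obj_map a) (obj_map b) (obj_map c) (mor_map b c g) (mor_map a b f)"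

definition EtGrpd ::
  "('m, 'e::{real_inner,heine_borel}) manifold \<Rightarrow> (('g, 'm, 'e) groupoid, 'g \<Rightarrow> 'g) cat" where
  "EtGrpd M =
     \<lparr>Obj = {G. etale_groupoid M G},
      Hom = (\<lambda>G H. {\<phi> \<in> extensional (arrows G). etale_hom M G H \<phi>}),
      Idt = (\<lambda>G. \<lambda>g\<in>arrows G. g),
      Cmp = (\<lambda>G H K \<psi> \<phi>. compose (arrows G) \<psi> \<phi>)\<rparr>"

definition HoAlgd ::
  "('f::real_normed_field, 'r) module \<Rightarrow> (('f, 'r, 'a) hopf_data, 'a \<Rightarrow> 'a) cat" where
  "HoAlgd R =
     \<lparr>Obj = {A. hopf_algebroid R A},
      Hom = (\<lambda>A B. {\<alpha> \<in> extensional (carrier A). hopf_hom R A B \<alpha>}),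
      Idt = (\<lambda>A. \<lambda>a\<in>carrier A. a),
      Cmp = (\<lambda>A B C \<beta> \<alpha>. compose (carrier A) \<beta> \<alpha>)\<rparr>"

end

theory Submission
  imports Defs
begin

text \<open>
  Everything is checked on functions \<open>f\<close> with compact support in an open set \<open>U\<close> on which source and target
  are injective. These span \<open>C\<^sub>c(G)\<close>, because a function can be cut off into small pieces. On them convolution is
  the product along the injective map \<open>mlt\<close>, and \<open>\<Delta> f = f \<otimes> f'\<close> for any \<open>f'\<close> supported in \<open>U\<close> with
  \<open>f f' = f\<close>; with a suitable choice of \<open>f'\<close> each axiom becomes an identity between pure tensors.
  The formula for \<open>\<Delta>\<close> rests on the injectivity of \<open>\<Omega>\<close>, which follows by localization: near a point of
  \<open>M\<close> every tensor is a finite sum of terms concentrated at different points of the fibre product, and such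
  a sum vanishes as soon as each of its terms does.\<close>

text \<open>Two definitions rest on choice. \<open>tensor_lift\<close> evaluates at an arbitrary
  representative of a coset, which becomes computable through the universal property in
  \<open>lift_linear_pure\<close>. \<open>comult\<close> is an \<open>inv_into\<close> under
  \<open>Omega\<close>, which needs injectivity of \<open>Omega\<close> and also the fact that the
  pushed diagonal is attained. The base, in contrast, is Hausdorff: its elements are single
  functions that act on everything, and compact supports survive in fibre products over it. The
  mechanism behind the axioms: on a set where the target is injective, every function of the arrow
  is a function of the target. Multiplication by it is therefore left multiplication by a base
  element, and this passes through the tensor sign. The coincidence of the right actions and
  cocommutativity are direct instances.\<close>

type_synonym ('p, 'f) germs = "'p => ('p => 'f) set"

section \<open>Calculus\<close>

lemma frechet_derivative_eqI: "(f has_derivative f') (at x) ==> frechet_derivative f (at x) = f'"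
  by (metis frechet_derivative_at)

lemma k_smooth_on_subset: "k_smooth_on k S f ==> T \<subseteq> S ==> k_smooth_on k T f"
proof (induction k arbitrary: f)
  case 0 then show ?case using continuous_on_subset by auto
next
  case (Suc k) then show ?case by (metis k_smooth_on.simps(2) subsetD)
qed

text \<open>Openness of \<open>S\<close> lets agreement on \<open>S\<close> pass to derivatives: the
  derivative at a point depends on the values in a full neighbourhood.\<close>

lemma k_smooth_on_cong:
  assumes "open S" "\<And>x. x \<in> S ==> f x = g x" "k_smooth_on k S f"
  shows "k_smooth_on k S g"
  using assms(2,3)
proof (induction k arbitrary: f g)
  case 0 then show ?case by (metis continuous_on_cong k_smooth_on.simps(1))
next
  case (Suc k)
  have d: "(g has_derivative frechet_derivative f (at x)) (at x)" if "x \<in> S" for x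
    using has_derivative_transform_within_open[OF _ assms(1) that Suc.prems(1)] Suc.prems(2) that
    by (simp add: frechet_derivative_works)
  have e: "frechet_derivative f (at x) = frechet_derivative g (at x)" if "x \<in> S" for x
    using frechet_derivative_eqI[OF d[OF that]] by simp
  show ?case
    using Suc.prems d Suc.IH[of "\<lambda>x. frechet_derivative f (at x) v" "\<lambda>x. frechet_derivative g (at x) v" for v] e
    by (auto simp: differentiable_def)
qed

text \<open>Lets any explicit formula for the derivative stand in for the
  \<open>frechet_derivative\<close> of the definition; most calculus rules below enter through
  it.\<close>

lemma k_smooth_on_SucI:
  assumes "open S" "\<And>x. x \<in> S ==> (f has_derivative f' x) (at x)"
    and "\<And>v. k_smooth_on k S (\<lambda>x. f' x v)"
  shows "k_smooth_on (Suc k) S f"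
proof -
  have "k_smooth_on k S (\<lambda>x. frechet_derivative f (at x) v)" for v
    by (rule k_smooth_on_cong[OF assms(1) _ assms(3)[of v]]) (simp add: frechet_derivative_eqI[OF assms(2)])
  then show ?thesis using assms(2) by (auto simp: differentiable_def)
qed

lemma k_smooth_on_SucD:
  assumes "k_smooth_on (Suc k) S f"
  shows "x \<in> S ==> (f has_derivative frechet_derivative f (at x)) (at x)"
    and "k_smooth_on k S (\<lambda>x. frechet_derivative f (at x) v)"
  using assms by (auto simp: frechet_derivative_works)

text \<open>Not built into the recursion, yet needed by the product and chain rules, where an
  undifferentiated factor survives next to a derivative of one order less.\<close>

lemma k_smooth_on_Suc: "k_smooth_on (Suc k) S f ==> k_smooth_on k S f"
proof (induction k arbitrary: f)
  case 0
  then show ?case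
    by (simp add: continuous_at_imp_continuous_on differentiable_imp_continuous_within)
next
  case (Suc k)
  then show ?case by (metis k_smooth_on.simps(2))
qed

lemma k_smooth_on_const: "k_smooth_on k S (\<lambda>_. c)"
  by (induction k arbitrary: c) auto

lemma k_smooth_on_linear:
  assumes "open S" "bounded_linear h"
  shows "k_smooth_on k S h"
proof (cases k)
  case 0 then show ?thesis using assms linear_continuous_on by simp
next
  case (Suc n)
  show ?thesis unfolding Suc
    by (rule k_smooth_on_SucI[OF assms(1) bounded_linear_imp_has_derivative[OF assms(2)] k_smooth_on_const])
qed

lemma k_smooth_on_add:
  assumes "open S" "k_smooth_on k S f" "k_smooth_on k S g"
  shows "k_smooth_on k S (\<lambda>x. f x + g x)"
  using assms(2,3)
proof (induction k arbitrary: f g)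
  case 0 then show ?case by (simp add: continuous_on_add)
next
  case (Suc k)
  show ?case
    by (rule k_smooth_on_SucI[OF assms(1) has_derivative_add[OF k_smooth_on_SucD(1)[OF Suc.prems(1)] k_smooth_on_SucD(1)[OF Suc.prems(2)]]])
      (auto intro!: Suc.IH k_smooth_on_SucD Suc.prems)
qed

lemma k_smooth_on_sum:
  assumes "open S" "finite B" "\<And>b. b \<in> B ==> k_smooth_on k S (f b)"
  shows "k_smooth_on k S (\<lambda>x. \<Sum>b\<in>B. f b x)"
  using assms(2,3) by (induction B) (auto intro: k_smooth_on_const k_smooth_on_add[OF assms(1)])

text \<open>Stated for an arbitrary bounded bilinear map so that products in the field, scalar
  multiples and inner products are covered at once.\<close>

lemma (in bounded_bilinear) k_smooth_on:
  assumes "open S" "k_smooth_on k S f" "k_smooth_on k S g"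
  shows "k_smooth_on k S (\<lambda>x. prod (f x) (g x))"
  using assms(2,3)
proof (induction k arbitrary: f g)
  case 0 then show ?case by (simp add: continuous_on)
next
  case (Suc k)
  show ?case
    by (rule k_smooth_on_SucI[OF assms(1) FDERIV[OF k_smooth_on_SucD(1)[OF Suc.prems(1)] k_smooth_on_SucD(1)[OF Suc.prems(2)]]])
      (assumption | rule k_smooth_on_add[OF assms(1)] | rule Suc.IH |
        rule k_smooth_on_SucD(2)[OF Suc.prems(1)] k_smooth_on_SucD(2)[OF Suc.prems(2)]
          k_smooth_on_Suc[OF Suc.prems(1)] k_smooth_on_Suc[OF Suc.prems(2)])+
qed

lemma k_smooth_on_linear_compose:
  assumes "open S" "bounded_linear h" "k_smooth_on k S f"
  shows "k_smooth_on k S (\<lambda>x. h (f x))"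
  using assms(3)
proof (induction k arbitrary: f)
  case 0 then show ?case using bounded_linear.continuous_on[OF assms(2)] by simp
next
  case (Suc k)
  show ?case
    by (rule k_smooth_on_SucI[OF assms(1) bounded_linear.has_derivative[OF assms(2) k_smooth_on_SucD(1)[OF Suc.prems]]])
      (auto intro!: Suc.IH k_smooth_on_SucD Suc.prems)
qed

text \<open>The class \<open>{real_inner, heine_borel}\<close> has no dimension function; finite-dimensionality is extracted
  from the compactness of the unit ball, since orthonormal vectors have distance \<open>\<surd>2\<close>.\<close>

definition orthonormal :: "'e::real_inner set => bool" where
  "orthonormal B \<longleftrightarrow> (\<forall>b\<in>B. \<forall>c\<in>B. b \<bullet> c = (if b = c then 1 else 0))"

lemma orthonormal_card_bounded:
  "\<exists>n. \<forall>B::'e::{real_inner,heine_borel} set. finite B \<and> orthonormal B \<longrightarrow> card B \<le> n"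
proof -
  have "compact (cball (0::'e) 1)" by (rule compact_cball)
  then obtain K where K: "finite K" "cball (0::'e) 1 \<subseteq> (\<Union>x\<in>K. ball x (1/2))"
    using compact_eq_totally_bounded[of "cball (0::'e) 1"] by (auto dest!: spec[of _ "1/2"])
  have "card B \<le> card K" if "finite B" "orthonormal B" for B :: "'e set"
  proof -
    have "\<exists>x\<in>K. b \<in> ball x (1/2)" if "b \<in> B" for b
    proof -
      have "b \<bullet> b = 1" using that \<open>orthonormal B\<close> by (auto simp: orthonormal_def)
      then have "norm b = 1" by (simp add: norm_eq_sqrt_inner)
      then show ?thesis using K(2) by (auto simp: subset_iff)
    qed
    then obtain g where g: "\<And>b. b \<in> B ==> g b \<in> K \<and> b \<in> ball (g b) (1/2)" by metis
    \<comment> \<open>Two members in one ball of radius 1/2 would have distance below 1, while their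
      squared distance is 2. So the choice of centres is injective and \<open>card K\<close> bounds
      \<open>card B\<close>.\<close>
    have "inj_on g B"
    proof (rule inj_onI, rule ccontr)
      fix b c assume bc: "b \<in> B" "c \<in> B" "g b = g c" "b \<noteq> c"
      have "dist b c < 1"
        using g[OF bc(1)] g[OF bc(2)] bc(3) dist_triangle_half_r[of "g b" b 1 c] by auto
      moreover have "dist b c ^ 2 = 2"
        using bc \<open>orthonormal B\<close>
        by (simp add: dist_norm power2_norm_eq_inner inner_diff inner_commute orthonormal_def)
      ultimately show False
        by (smt (verit) power_le_one zero_le_dist)
    qed
    then show ?thesis using g K(1) by (meson card_inj_on_le image_subsetI)
  qed
  then show ?thesis by blast
qed

text \<open>An orthonormal set of greatest cardinality spans: the normalized difference between a
  vector and its projection would otherwise enlarge it.\<close>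

lemma orthonormal_basis_exists:
  "\<exists>B::'e::{real_inner,heine_borel} set. finite B \<and> (\<forall>x. x = (\<Sum>b\<in>B. (x \<bullet> b) *\<^sub>R b))"
proof -
  obtain n where n: "\<And>B::'e set. finite B ==> orthonormal B ==> card B \<le> n"
    using orthonormal_card_bounded by blast
  have "finite {} \<and> orthonormal ({}::'e set)" by (simp add: orthonormal_def)
  then obtain B :: "'e set" where B: "finite B" "orthonormal B"
    and mx: "\<And>C::'e set. finite C ==> orthonormal C ==> card C \<le> card B"
    using ex_has_greatest_nat[of "\<lambda>B::'e set. finite B \<and> orthonormal B" "{}" card "Suc n"] n
    by (metis le_imp_less_Suc)
  have "x = (\<Sum>b\<in>B. (x \<bullet> b) *\<^sub>R b)" for x
  proof (rule ccontr)
    define y where "y = x - (\<Sum>b\<in>B. (x \<bullet> b) *\<^sub>R b)"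
    assume "x \<noteq> (\<Sum>b\<in>B. (x \<bullet> b) *\<^sub>R b)"
    hence y0: "y \<noteq> 0" by (simp add: y_def)
    have yb: "y \<bullet> c = 0" if "c \<in> B" for c
    proof -
      have "(\<Sum>b\<in>B. (x \<bullet> b) *\<^sub>R b) \<bullet> c = (\<Sum>b\<in>B. if b = c then x \<bullet> c else 0)"
        unfolding inner_sum_left by (rule sum.cong) (use B that in \<open>auto simp: orthonormal_def\<close>)
      then show ?thesis using that B by (simp add: y_def inner_diff)
    qed
    define z where "z = y /\<^sub>R norm y"
    have z: "z \<bullet> z = 1" "\<And>c. c \<in> B ==> z \<bullet> c = 0"
      using y0 yb by (auto simp: z_def power2_norm_eq_inner[symmetric] power2_eq_square)
    then have "z \<notin> B" by force
    have "orthonormal (insert z B)"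
      using B z \<open>z \<notin> B\<close> by (auto simp: orthonormal_def inner_commute)
    from mx[OF _ this] show False using B \<open>z \<notin> B\<close> by simp
  qed
  then show ?thesis using B by blast
qed

text \<open>The derivative of the composite applies the derivative of \<open>f\<close> at
  \<open>g x\<close> to a vector that itself varies with \<open>x\<close>, whereas the recursion
  differentiates in fixed directions. Expanding the vector in a finite orthonormal basis leaves only
  fixed directions \<open>b\<close>, to which the induction hypothesis applies. This is where finite
  dimension of the intermediate space enters.\<close>

lemma k_smooth_on_compose:
  fixes g :: "'e::real_normed_vector => 'd::{real_inner,heine_borel}"
  assumes "open S" "open T" "g ` S \<subseteq> T" "k_smooth_on k T f" "k_smooth_on k S g"
  shows "k_smooth_on k S (\<lambda>x. f (g x))"
  using assms(4,5)
proof (induction k arbitrary: f)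
  case 0 then show ?case using continuous_on_compose2 assms(3) by (metis k_smooth_on.simps(1))
next
  case (Suc k)
  obtain B :: "'d set" where B: "finite B" "\<And>x. x = (\<Sum>b\<in>B. (x \<bullet> b) *\<^sub>R b)"
    using orthonormal_basis_exists by blast
  let ?f' = "\<lambda>x. frechet_derivative f (at x)" and ?g' = "\<lambda>x. frechet_derivative g (at x)"
  show ?case
  proof (rule k_smooth_on_SucI[OF assms(1)])
    fix x assume x: "x \<in> S"
    then show "((\<lambda>x. f (g x)) has_derivative (\<lambda>v. ?f' (g x) (?g' x v))) (at x)"
      by (intro has_derivative_compose[of g "?g' x" x UNIV f "?f' (g x)"] k_smooth_on_SucD[OF Suc.prems(1)] k_smooth_on_SucD[OF Suc.prems(2)])
        (use assms(3) in auto)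
  next
    fix v
    have eq: "?f' (g x) (?g' x v) = (\<Sum>b\<in>B. (?g' x v \<bullet> b) *\<^sub>R ?f' (g x) b)" if "x \<in> S" for x
    proof -
      have "linear (?f' (g x))"
        using k_smooth_on_SucD(1)[OF Suc.prems(1), of "g x"] assms(3) that
        by (auto intro: has_derivative_linear)
      then show ?thesis by (subst B(2)[of "?g' x v"]) (simp add: linear_sum linear_cmul)
    qed
    have "k_smooth_on k S (\<lambda>x. \<Sum>b\<in>B. (?g' x v \<bullet> b) *\<^sub>R ?f' (g x) b)"
    proof (intro k_smooth_on_sum[OF assms(1) B(1)] bounded_bilinear.k_smooth_on[OF bounded_bilinear_scaleR assms(1)])
      fix b
      show "k_smooth_on k S (\<lambda>x. ?g' x v \<bullet> b)"
        by (rule k_smooth_on_linear_compose[OF assms(1) bounded_linear_inner_left k_smooth_on_SucD(2)[OF Suc.prems(2)]])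
      show "k_smooth_on k S (\<lambda>x. ?f' (g x) b)"
        by (rule Suc.IH[OF k_smooth_on_SucD(2)[OF Suc.prems(1)] k_smooth_on_Suc[OF Suc.prems(2)]])
    qed
    then show "k_smooth_on k S (\<lambda>x. ?f' (g x) (?g' x v))"
      by (rule k_smooth_on_cong[OF assms(1), rotated]) (simp add: eq)
  qed
qed

lemma smooth_on_cong: "open S ==> (\<And>x. x \<in> S ==> f x = g x) ==> smooth_on S f ==> smooth_on S g"
  unfolding smooth_on_def by (blast intro: k_smooth_on_cong)

lemma smooth_on_subset: "smooth_on S f ==> T \<subseteq> S ==> smooth_on T f"
  unfolding smooth_on_def by (blast intro: k_smooth_on_subset)

lemma smooth_on_const: "smooth_on S (\<lambda>_. c)"
  unfolding smooth_on_def by (blast intro: k_smooth_on_const)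

lemma smooth_on_add: "open S ==> smooth_on S f ==> smooth_on S g ==> smooth_on S (\<lambda>x. f x + g x)"
  unfolding smooth_on_def by (blast intro: k_smooth_on_add)

lemma smooth_on_mult:
  fixes f g :: "'e::real_normed_vector => 'f::real_normed_algebra"
  shows "open S ==> smooth_on S f ==> smooth_on S g ==> smooth_on S (\<lambda>x. f x * g x)"
  unfolding smooth_on_def by (blast intro: bounded_bilinear.k_smooth_on[OF bounded_bilinear_mult])

lemma smooth_on_compose:
  fixes g :: "'e::real_normed_vector => 'd::{real_inner,heine_borel}"
  shows "open S ==> open T ==> g ` S \<subseteq> T ==> smooth_on T f ==> smooth_on S g ==> smooth_on S (\<lambda>x. f (g x))"
  unfolding smooth_on_def by (blast intro: k_smooth_on_compose)

lemma smooth_on_linear: "open S ==> bounded_linear h ==> smooth_on S h"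
  unfolding smooth_on_def by (blast intro: k_smooth_on_linear)

lemma smooth_on_local:
  assumes "\<And>x. x \<in> S ==> \<exists>T. open T \<and> x \<in> T \<and> smooth_on T f"
  shows "smooth_on S f"
proof -
  have "k_smooth_on k S f" if "\<And>x. x \<in> S ==> \<exists>T. open T \<and> x \<in> T \<and> k_smooth_on k T f" for k
    using that
  proof (induction k arbitrary: f)
    case 0
    then have "isCont f x" if "x \<in> S" for x
      using that by (metis continuous_on_eq_continuous_at k_smooth_on.simps(1))
    then show ?case by (simp add: continuous_at_imp_continuous_on)
  next
    case (Suc k)
    have "k_smooth_on k S (\<lambda>x. frechet_derivative f (at x) v)" for v
      by (rule Suc.IH) (metis Suc.prems k_smooth_on.simps(2))
    moreover have "f differentiable at x" if "x \<in> S" for x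
      using Suc.prems[OF that] by auto
    ultimately show ?case by simp
  qed
  then show ?thesis using assms unfolding smooth_on_def by blast
qed

subsection \<open>Bump functions\<close>

text \<open>The negative power is included so that derivatives of members are linear combinations of
  members; smoothness of the whole family then follows by one induction on the order.\<close>

definition exp_decay :: "nat => real => real" where
  "exp_decay n x = (if x > 0 then (inverse x) ^ n * exp (- inverse x) else 0)"

lemma exp_decay_has_derivative:
  "(exp_decay n has_real_derivative exp_decay (n + 2) x - real n * exp_decay (n + 1) x) (at x)"
proof (cases x "0::real" rule: linorder_cases)
  case less
  have "((\<lambda>_. 0) has_real_derivative 0) (at x)" by simp
  then have "(exp_decay n has_real_derivative 0) (at x)"
    by (rule has_field_derivative_transform_within_open[where S = "{..<0}"]) (use less in \<open>auto simp: exp_decay_def\<close>)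
  then show ?thesis using less by (simp add: exp_decay_def)
next
  case equal
  \<comment> \<open>This is the difference quotient at 0 from the right; with
    \<open>t = inverse h\<close> it becomes \<open>t ^ (n + 1) / exp t\<close> at infinity.\<close>
  have lim: "((\<lambda>h. (inverse h) ^ (n + 1) * exp (- inverse h)) \<longlongrightarrow> 0) (at_right (0::real))"
  proof -
    have "((\<lambda>t. t ^ (n + 1) / exp t) \<longlongrightarrow> (0::real)) at_top"
      by (rule tendsto_power_div_exp_0)
    from filterlim_compose[OF this filterlim_inverse_at_top_right]
    show ?thesis by (simp add: exp_minus field_simps)
  qed
  have "((\<lambda>h. (exp_decay n (0 + h) - exp_decay n 0) / h) \<longlongrightarrow> 0) (at 0)"
    unfolding filterlim_at_split
  proof
    show "((\<lambda>h. (exp_decay n (0 + h) - exp_decay n 0) / h) \<longlongrightarrow> 0) (at_left 0)"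
      by (rule tendsto_eventually) (auto simp: eventually_at_filter exp_decay_def)
    show "((\<lambda>h. (exp_decay n (0 + h) - exp_decay n 0) / h) \<longlongrightarrow> 0) (at_right 0)"
      by (rule Lim_transform_eventually[OF lim]) (auto simp: eventually_at_filter exp_decay_def field_simps)
  qed
  then show ?thesis using equal by (simp add: DERIV_def exp_decay_def)
next
  case greater
  have *: "((\<lambda>x. (inverse x) ^ n * exp (- inverse x)) has_real_derivative
     (inverse x) ^ (n+2) * exp (- inverse x) - real n * ((inverse x) ^ (n+1) * exp (- inverse x))) (at x)"
  proof (cases n)
    case 0 then show ?thesis using greater by (auto intro!: derivative_eq_intros simp: power2_eq_square)
  next
    case (Suc m)
    have "((\<lambda>x. inverse x ^ n) has_real_derivative real n * inverse x ^ m * (- (inverse x * inverse x))) (at x)"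
      unfolding Suc using greater
      by (auto intro!: derivative_eq_intros simp: power2_eq_square simp del: power_Suc)
    moreover have "((\<lambda>x. exp (- inverse x)) has_real_derivative exp (- inverse x) * (inverse x * inverse x)) (at x)"
      using greater by (auto intro!: derivative_eq_intros)
    ultimately show ?thesis
      by (rule DERIV_cong[OF DERIV_mult]) (simp add: Suc algebra_simps)
  qed
  have "(exp_decay n has_real_derivative
     (inverse x) ^ (n+2) * exp (- inverse x) - real n * ((inverse x) ^ (n+1) * exp (- inverse x))) (at x)"
    by (rule has_field_derivative_transform_within_open[OF *, where S = "{0<..}"]) (use greater in \<open>auto simp: exp_decay_def\<close>)
  then show ?thesis using greater by (simp add: exp_decay_def)
qed

lemma k_smooth_on_exp_decay: "k_smooth_on k UNIV (exp_decay n)"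
proof (induction k arbitrary: n)
  case 0
  then show ?case
    by (auto intro!: continuous_at_imp_continuous_on DERIV_isCont[OF exp_decay_has_derivative])
next
  case (Suc k)
  show ?case
  proof (rule k_smooth_on_SucI[OF open_UNIV exp_decay_has_derivative[unfolded has_field_derivative_def]])
    fix v :: real
    have "k_smooth_on k UNIV (\<lambda>x. exp_decay (n + 2) x + (- real n) * exp_decay (n + 1) x)"
      by (intro k_smooth_on_add[OF open_UNIV] bounded_bilinear.k_smooth_on[OF bounded_bilinear_mult open_UNIV]
          k_smooth_on_const Suc.IH)
    from bounded_bilinear.k_smooth_on[OF bounded_bilinear_mult open_UNIV this k_smooth_on_const[of _ _ v]]
    show "k_smooth_on k UNIV (\<lambda>x. (exp_decay (n + 2) x - real n * exp_decay (n + 1) x) * v)" by simp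
  qed
qed

lemma k_smooth_on_inverse: "k_smooth_on k {x::real. x \<noteq> 0} inverse"
proof (induction k)
  case 0 then show ?case by (auto intro!: continuous_intros)
next
  case (Suc k)
  have o: "open {x::real. x \<noteq> 0}" by (simp add: open_Collect_neq)
  show ?case
  proof (rule k_smooth_on_SucI[OF o])
    fix x :: real assume "x \<in> {x. x \<noteq> 0}"
    then show "(inverse has_derivative (\<lambda>v. (- v) * (inverse x * inverse x))) (at x)"
      by (auto intro!: derivative_eq_intros simp: field_simps)
  next
    fix v :: real
    show "k_smooth_on k {x. x \<noteq> 0} (\<lambda>x. (- v) * (inverse x * inverse x))"
      by (intro bounded_bilinear.k_smooth_on[OF bounded_bilinear_mult o] k_smooth_on_const Suc)
  qed
qed

text \<open>The usual quotient that passes smoothly from 0 on the negative axis to 1 beyond the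
  point 1.\<close>

definition smooth_step :: "real => real" where
  "smooth_step x = exp_decay 0 x * inverse (exp_decay 0 x + exp_decay 0 (1 - x))"

lemma smooth_step_values: "x \<le> 0 ==> smooth_step x = 0" "x \<ge> 1 ==> smooth_step x = 1"
  by (auto simp: smooth_step_def exp_decay_def)

lemma smooth_on_smooth_step: "smooth_on UNIV smooth_step"
proof -
  have o: "open {x::real. x \<noteq> 0}" by (simp add: open_Collect_neq)
  \<comment> \<open>\<open>x\<close> and \<open>1 - x\<close> are never both nonpositive, so one of
    the summands is positive.\<close>
  have *: "exp_decay 0 x + exp_decay 0 (1 - x) \<noteq> 0" for x
    by (auto simp: exp_decay_def add_pos_pos less_imp_neq[symmetric])
  have e: "smooth_on UNIV (exp_decay 0)" by (simp add: smooth_on_def k_smooth_on_exp_decay)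
  have "smooth_on UNIV (\<lambda>x::real. 1 + (- 1) * x)"
    by (intro smooth_on_add smooth_on_const smooth_on_linear bounded_linear_mult_right open_UNIV)
  then have "smooth_on UNIV (\<lambda>x. exp_decay 0 (1 - x))"
    using smooth_on_compose[OF open_UNIV open_UNIV _ e] by simp
  then have "smooth_on UNIV (\<lambda>x. exp_decay 0 x + exp_decay 0 (1 - x))"
    by (intro smooth_on_add e open_UNIV)
  then have "smooth_on UNIV (\<lambda>x. inverse (exp_decay 0 x + exp_decay 0 (1 - x)))"
    by (intro smooth_on_compose[OF open_UNIV o, where f = inverse])
      (use * in \<open>auto simp: smooth_on_def k_smooth_on_inverse\<close>)
  then show ?thesis
    unfolding smooth_step_def[abs_def] by (intro smooth_on_mult e open_UNIV)
qed

text \<open>The squared distance is used because it is smooth also at the centre. The argument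
  \<open>2 - (dist a x / r)^2\<close> of the step function is at least 1 for distance at most
  \<open>r\<close> and at most -2 for distance at least \<open>2 * r\<close>.\<close>

lemma bump_function_exists:
  fixes a :: "'e::{real_inner,heine_borel}"
  assumes "r > 0"
  obtains b :: "'e => real" where "smooth_on UNIV b"
    "\<And>x. dist a x \<le> r ==> b x = 1" "\<And>x. dist a x \<ge> 2 * r ==> b x = 0"
proof -
  define b where "b = (\<lambda>x. smooth_step (2 + (- inverse (r^2)) * ((x + (- a)) \<bullet> (x + (- a)))))"
  have l: "smooth_on UNIV (\<lambda>x. x + (- a))"
    by (intro smooth_on_add smooth_on_const smooth_on_linear bounded_linear_ident open_UNIV)
  have "smooth_on UNIV (\<lambda>x. (x + (- a)) \<bullet> (x + (- a)))"
    using l unfolding smooth_on_def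
    by (intro allI bounded_bilinear.k_smooth_on[OF bounded_bilinear_inner open_UNIV]) auto
  then have "smooth_on UNIV (\<lambda>x. 2 + (- inverse (r^2)) * ((x + (- a)) \<bullet> (x + (- a))))"
    by (intro smooth_on_add smooth_on_mult smooth_on_const open_UNIV)
  then have smooth: "smooth_on UNIV b"
    unfolding b_def by (intro smooth_on_compose[OF open_UNIV open_UNIV _ smooth_on_smooth_step]) auto
  have eq: "(x + (- a)) \<bullet> (x + (- a)) = (dist a x)^2" for x
    by (simp add: dist_norm power2_norm_eq_inner norm_minus_commute[of a x])
  have beq: "b x = smooth_step (2 - (dist a x / r)^2)" for x
    unfolding b_def eq by (simp add: power_mult_distrib divide_inverse power_inverse mult.commute)
  have one: "b x = 1" if "dist a x \<le> r" for x
  proof -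
    have "dist a x / r \<le> 1" using that assms by simp
    then have "(dist a x / r)^2 \<le> 1" using assms by (intro power_le_one) auto
    then show ?thesis unfolding beq by (intro smooth_step_values(2)) simp
  qed
  have zero: "b x = 0" if "dist a x \<ge> 2 * r" for x
  proof -
    have "dist a x / r \<ge> 2" using that assms by (simp add: le_divide_eq)
    then have "2^2 \<le> (dist a x / r)^2" by (intro power_mono) auto
    then show ?thesis unfolding beq by (intro smooth_step_values(1)) simp
  qed
  show ?thesis using that[of b] smooth one zero by blast
qed

section \<open>Vector spaces and tensor products\<close>

lemma scalars_simps [simp]:
  "carrier scalars = UNIV" "mult scalars = (*)" "one scalars = 1" "zero scalars = 0" "add scalars = (+)"
  by (simp_all add: scalars_def)

lemma cring_scalars: "cring (scalars :: 'f::real_normed_field ring)"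
proof (rule cringI)
  show "abelian_group (scalars :: 'f ring)"
  proof (rule abelian_groupI)
    show "\<exists>y\<in>carrier scalars. y \<oplus>\<^bsub>scalars\<^esub> x = \<zero>\<^bsub>scalars\<^esub>" for x :: 'f
      by (rule bexI[of _ "- x"]) simp_all
  qed (simp_all add: ac_simps)
  show "comm_monoid (scalars :: 'f ring)"
    by (rule comm_monoidI) (simp_all add: ac_simps)
qed (simp_all add: algebra_simps)

text \<open>Negatives need not be exhibited: the multiple of \<open>x\<close> by -1 is one, because
  the multiple by 0 is required to be zero.\<close>

lemma vector_spaceI:
  fixes V :: "('f::real_normed_field, 'a, 'z) module_scheme"
  assumes "\<And>x y. x \<in> carrier V ==> y \<in> carrier V ==> x \<oplus>\<^bsub>V\<^esub> y \<in> carrier V"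
    and zero: "\<zero>\<^bsub>V\<^esub> \<in> carrier V"
    and smult: "\<And>c x. x \<in> carrier V ==> c \<odot>\<^bsub>V\<^esub> x \<in> carrier V"
    and "\<And>x y z. x \<in> carrier V ==> y \<in> carrier V ==> z \<in> carrier V ==> (x \<oplus>\<^bsub>V\<^esub> y) \<oplus>\<^bsub>V\<^esub> z = x \<oplus>\<^bsub>V\<^esub> (y \<oplus>\<^bsub>V\<^esub> z)"
    and comm: "\<And>x y. x \<in> carrier V ==> y \<in> carrier V ==> x \<oplus>\<^bsub>V\<^esub> y = y \<oplus>\<^bsub>V\<^esub> x"
    and l_zero: "\<And>x. x \<in> carrier V ==> \<zero>\<^bsub>V\<^esub> \<oplus>\<^bsub>V\<^esub> x = x"
    and zero_smult: "\<And>x. x \<in> carrier V ==> 0 \<odot>\<^bsub>V\<^esub> x = \<zero>\<^bsub>V\<^esub>"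
    and l_distr: "\<And>c d x. x \<in> carrier V ==> (c + d) \<odot>\<^bsub>V\<^esub> x = c \<odot>\<^bsub>V\<^esub> x \<oplus>\<^bsub>V\<^esub> d \<odot>\<^bsub>V\<^esub> x"
    and "\<And>c x y. x \<in> carrier V ==> y \<in> carrier V ==> c \<odot>\<^bsub>V\<^esub> (x \<oplus>\<^bsub>V\<^esub> y) = c \<odot>\<^bsub>V\<^esub> x \<oplus>\<^bsub>V\<^esub> c \<odot>\<^bsub>V\<^esub> y"
    and "\<And>c d x. x \<in> carrier V ==> (c * d) \<odot>\<^bsub>V\<^esub> x = c \<odot>\<^bsub>V\<^esub> (d \<odot>\<^bsub>V\<^esub> x)"
    and one: "\<And>x. x \<in> carrier V ==> 1 \<odot>\<^bsub>V\<^esub> x = x"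
  shows "module scalars V"
proof (rule moduleI)
  show "abelian_group V"
  proof (rule abelian_groupI)
    fix x assume x: "x \<in> carrier V"
    have "(- 1) \<odot>\<^bsub>V\<^esub> x \<oplus>\<^bsub>V\<^esub> x = (- 1 + 1) \<odot>\<^bsub>V\<^esub> x"
      using x l_distr[of x "- 1" 1] one by simp
    then show "\<exists>y\<in>carrier V. y \<oplus>\<^bsub>V\<^esub> x = \<zero>\<^bsub>V\<^esub>"
      using x smult zero_smult by auto
  qed (use assms in auto)
qed (use assms cring_scalars in auto)

lemma linear_mapsI:
  assumes "\<And>a. a \<in> carrier A ==> f a \<in> carrier B"
    and "\<And>a a'. a \<in> carrier A ==> a' \<in> carrier A ==> f (a \<oplus>\<^bsub>A\<^esub> a') = f a \<oplus>\<^bsub>B\<^esub> f a'"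
    and "\<And>c a. a \<in> carrier A ==> f (c \<odot>\<^bsub>A\<^esub> a) = c \<odot>\<^bsub>B\<^esub> f a"
  shows "f \<in> linear_maps A B"
  using assms unfolding linear_maps_def by auto

lemma linear_mapsD:
  assumes "f \<in> linear_maps A B" "a \<in> carrier A"
  shows "f a \<in> carrier B"
    and "a' \<in> carrier A ==> f (a \<oplus>\<^bsub>A\<^esub> a') = f a \<oplus>\<^bsub>B\<^esub> f a'"
    and "f (c \<odot>\<^bsub>A\<^esub> a) = c \<odot>\<^bsub>B\<^esub> f a"
  using assms unfolding linear_maps_def by auto

locale vspace =
  fixes V :: "('f::real_normed_field, 'a, 'z) module_scheme" (structure)
  assumes module_scalars: "module scalars V"
begin

sublocale module scalars V by (rule module_scalars)

lemma smult_zero_left: "x \<in> carrier V ==> 0 \<odot> x = \<zero>"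
  using smult_l_null by simp

lemma smult_zero_right: "c \<odot> \<zero> = \<zero>"
  using smult_r_null by simp

lemma smult_add: "x \<in> carrier V ==> (c + d) \<odot> x = c \<odot> x \<oplus> d \<odot> x"
  using smult_l_distr[of c d x] by simp

lemma smult_add_right: "x \<in> carrier V ==> y \<in> carrier V ==> c \<odot> (x \<oplus> y) = c \<odot> x \<oplus> c \<odot> y"
  using smult_r_distr[of c x y] by simp

lemma smult_mult: "x \<in> carrier V ==> (c * d) \<odot> x = c \<odot> (d \<odot> x)"
  using smult_assoc1[of c d x] by simp

lemma smult_in: "x \<in> carrier V ==> c \<odot> x \<in> carrier V"
  using smult_closed[of c x] by simp

lemma smult_unit: "x \<in> carrier V ==> 1 \<odot> x = x"
  using smult_one[of x] by simp

lemma smult_finsum: "finite I ==> f \<in> I \<rightarrow> carrier V ==> c \<odot> finsum V f I = (\<Oplus>i\<in>I. c \<odot> f i)"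
  using finsum_smult_ldistr[of I c f] by simp

end

lemma linear_maps_zero:
  assumes "f \<in> linear_maps A B" "vspace A" "vspace B"
  shows "f \<zero>\<^bsub>A\<^esub> = \<zero>\<^bsub>B\<^esub>"
proof -
  interpret A: vspace A by fact
  interpret B: vspace B by fact
  have "f (0 \<odot>\<^bsub>A\<^esub> \<zero>\<^bsub>A\<^esub>) = 0 \<odot>\<^bsub>B\<^esub> f \<zero>\<^bsub>A\<^esub>" by (rule linear_mapsD[OF assms(1)]) simp
  then show ?thesis using linear_mapsD(1)[OF assms(1)] by (simp add: A.smult_zero_right B.smult_zero_left)
qed

lemma linear_maps_finsum:
  assumes "f \<in> linear_maps A B" "vspace A" "vspace B" "finite I" "g \<in> I \<rightarrow> carrier A"
  shows "f (finsum A g I) = finsum B (\<lambda>i. f (g i)) I"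
proof -
  interpret A: vspace A by fact
  interpret B: vspace B by fact
  show ?thesis using assms(4,5)
  proof (induction I)
    case empty then show ?case by (simp add: linear_maps_zero[OF assms(1-3)])
  next
    case (insert i I)
    then show ?case using linear_mapsD[OF assms(1)]
      by (subst A.finsum_insert) (auto simp: Pi_iff intro!: A.finsum_closed B.finsum_insert[symmetric])
  qed
qed

lemma linear_maps_compose: "f \<in> linear_maps A B ==> g \<in> linear_maps B C ==> (\<lambda>x. g (f x)) \<in> linear_maps A C"
  by (rule linear_mapsI) (simp_all add: linear_mapsD[of f] linear_mapsD[of g])

subsection \<open>Spans\<close>

context vspace
begin

lemma lin_span_subset: assumes "B \<subseteq> carrier V" shows "lin_span V B \<subseteq> carrier V"
proof
  fix x assume "x \<in> lin_span V B"
  then show "x \<in> carrier V" by induction (use assms smult_in in auto)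
qed

lemma lin_span_add:
  assumes "B \<subseteq> carrier V" "x \<in> lin_span V B" "y \<in> lin_span V B"
  shows "x \<oplus> y \<in> lin_span V B"
  using assms(2)
proof induction
  case 1
  have "y \<in> carrier V" using assms lin_span_subset by blast
  then show ?case using assms by simp
next
  case (2 b v c)
  have "c \<odot> b \<oplus> v \<oplus> y = c \<odot> b \<oplus> (v \<oplus> y)"
    using 2 assms lin_span_subset smult_in by (intro a_assoc) blast+
  then show ?case using 2 by (auto intro: lin_span.intros(2))
qed

lemma lin_span_smult:
  assumes "B \<subseteq> carrier V" "x \<in> lin_span V B"
  shows "c \<odot> x \<in> lin_span V B"
  using assms(2)
proof induction
  case 1 then show ?case by (simp add: smult_zero_right lin_span.intros)
next
  case (2 b v d)
  have "c \<odot> (d \<odot> b \<oplus> v) = (c * d) \<odot> b \<oplus> c \<odot> v"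
    using 2 assms(1) lin_span_subset[OF assms(1)] by (simp add: smult_add_right smult_mult smult_in subset_iff)
  then show ?case using 2 by (auto intro: lin_span.intros(2))
qed

lemma lin_span_base: "B \<subseteq> carrier V ==> b \<in> B ==> b \<in> lin_span V B"
  using lin_span.intros(2)[where A = V and B = B and b = b and c = 1, OF _ lin_span.intros(1)]
  by (auto simp: smult_unit subset_iff)

lemma vspace_lin_span: "B \<subseteq> carrier V ==> vspace (V\<lparr>carrier := lin_span V B\<rparr>)"
  unfolding vspace_def using lin_span_subset[of B]
  by (intro vector_spaceI)
    (auto simp: lin_span_add lin_span.intros lin_span_smult a_ac subset_iff
      smult_zero_left smult_add smult_add_right smult_mult smult_unit)

end

subsection \<open>Modules and tensor products over \<open>R\<close>\<close>

lemma with_act_simps [simp]: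
  "carrier (with_act A l) = carrier A" "add (with_act A l) = add A" "zero (with_act A l) = zero A"
  "smult (with_act A l) = smult A" "act (with_act A l) = l"
  by (simp_all add: with_act_def)

text \<open>Being a vector space ignores the fields \<open>mult\<close> and \<open>one\<close> and
  all record extensions, so it passes between the record types that carry the same space.\<close>

lemma vspace_cong:
  fixes A :: "('f::real_normed_field, 'a, 'z) module_scheme" and B :: "('f, 'a, 'y) module_scheme"
  assumes "vspace A" "carrier B = carrier A" "add B = add A" "zero B = zero A" "smult B = smult A"
  shows "vspace B"
proof -
  interpret vspace A by fact
  show ?thesis unfolding vspace_def
    by (rule vector_spaceI)
      (simp_all add: assms(2-) smult_in a_ac smult_zero_left smult_add smult_add_right smult_mult smult_unit)
qed

lemma finsum_cong_record:
  assumes "carrier B = carrier A" "add B = add A" "zero B = zero A"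
  shows "finsum B = finsum A"
  by (intro ext) (simp add: finsum_def finprod_def assms)

lemma tensor_lift_cong_record:
  assumes "carrier B = carrier A" "add B = add A" "zero B = zero A" "smult B = smult A"
  shows "tensor_lift B = tensor_lift A"
  unfolding tensor_lift_def[abs_def] finsum_cong_record[OF assms(1-3)] using assms by simp

text \<open>The action is recorded as a family of commuting linear operators; commutation is what
  makes the action on a tensor product well defined. Compatibility with the product of
  \<open>R\<close> is established for the function modules in \<open>act_mult\<close>.\<close>

definition r_module :: "('f::real_normed_field, 'r, 'z) module_scheme => ('f, 'r, 'a) rmodule => bool" where
  "r_module R X \<longleftrightarrow> vspace X \<and> (\<forall>r\<in>carrier R. act X r \<in> linear_maps X X) \<and>
     (\<forall>r\<in>carrier R. \<forall>r'\<in>carrier R. \<forall>x\<in>carrier X. act X r (act X r' x) = act X r' (act X r x))"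

definition balanced ::
  "('f::real_normed_field, 'r, 'z) module_scheme => ('f, 'r, 'a) rmodule => ('f, 'r, 'b) rmodule
    => ('f, 'c, 'y) module_scheme => ('a => 'b => 'c) => bool" where
  "balanced R X Y N b \<longleftrightarrow> (\<forall>x\<in>carrier X. b x \<in> linear_maps Y N) \<and>
     (\<forall>y\<in>carrier Y. (\<lambda>x. b x y) \<in> linear_maps X N) \<and>
     (\<forall>r\<in>carrier R. \<forall>x\<in>carrier X. \<forall>y\<in>carrier Y. b (act X r x) y = b x (act Y r y))"

lemma balancedI:
  assumes "\<And>x. x \<in> carrier X ==> b x \<in> linear_maps Y N" "\<And>y. y \<in> carrier Y ==> (\<lambda>x. b x y) \<in> linear_maps X N"
    "\<And>r x y. r \<in> carrier R ==> x \<in> carrier X ==> y \<in> carrier Y ==> b (act X r x) y = b x (act Y r y)"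
  shows "balanced R X Y N b"
  using assms unfolding balanced_def by auto

lemma balancedD:
  assumes "balanced R X Y N b"
  shows "x \<in> carrier X ==> b x \<in> linear_maps Y N" "y \<in> carrier Y ==> (\<lambda>x. b x y) \<in> linear_maps X N"
    "r \<in> carrier R ==> x \<in> carrier X ==> y \<in> carrier Y ==> b (act X r x) y = b x (act Y r y)"
  using assms unfolding balanced_def by auto

lemma free_space_simps [simp]:
  "carrier (free_space K) = {x. Poly_Mapping.keys x \<subseteq> K}" "zero (free_space K) = 0" "add (free_space K) = (+)"
  "smult (free_space K) = (\<lambda>c. Poly_Mapping.map ((*) c))"
  by (simp_all add: free_space_def)

lemma lookup_map_times: "Poly_Mapping.lookup (Poly_Mapping.map ((*) c) x) k = (c::'f::real_normed_field) * Poly_Mapping.lookup x k"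
  by (simp add: Poly_Mapping.map.rep_eq when_def)

lemma keys_map_times: "Poly_Mapping.keys (Poly_Mapping.map ((*) (c::'f::real_normed_field)) x) \<subseteq> Poly_Mapping.keys x"
  by (auto simp: in_keys_iff lookup_map_times)

lemma vspace_free_space: "vspace (free_space K :: ('f::real_normed_field, 'k \<Rightarrow>\<^sub>0 'f) module)"
  unfolding vspace_def
proof (rule vector_spaceI, goal_cases)
  case (1 x y) then show ?case using Poly_Mapping.keys_add[of x y] by auto
next
  case (3 c x) then show ?case using keys_map_times[of c x] by auto
qed (auto intro!: poly_mapping_eqI simp: lookup_map_times lookup_add algebra_simps)

locale tensor_setup =
  fixes R :: "('f::real_normed_field, 'r, 'z) module_scheme"
    and X :: "('f, 'r, 'a) rmodule" and Y :: "('f, 'r, 'b) rmodule"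
  assumes rX: "r_module R X" and rY: "r_module R Y"
begin

sublocale X: vspace X using rX by (simp add: r_module_def)
sublocale Y: vspace Y using rY by (simp add: r_module_def)

abbreviation "free \<equiv> free_space (carrier X \<times> carrier Y) :: ('f, ('a \<times> 'b) \<Rightarrow>\<^sub>0 'f) module"
abbreviation "rel \<equiv> tensor_rel R X Y"
abbreviation "pt \<equiv> pure_tensor R X Y"
abbreviation "T \<equiv> tensor R X Y"
abbreviation "coset \<equiv> tensor_coset R X Y"

sublocale F: vspace free by (rule vspace_free_space)

lemma act_closed:
  "r \<in> carrier R ==> x \<in> carrier X ==> act X r x \<in> carrier X"
  "r \<in> carrier R ==> y \<in> carrier Y ==> act Y r y \<in> carrier Y"
  using rX rY linear_mapsD(1) unfolding r_module_def by metis+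

lemma keys_diff': "Poly_Mapping.keys x \<subseteq> K ==> Poly_Mapping.keys y \<subseteq> K ==> Poly_Mapping.keys (x - y :: 'k \<Rightarrow>\<^sub>0 'f) \<subseteq> K"
  using keys_diff[of x y] by auto

lemma rel_generators:
  shows rel_add1: "x \<in> carrier X ==> x' \<in> carrier X ==> y \<in> carrier Y ==>
      Poly_Mapping.single (x \<oplus>\<^bsub>X\<^esub> x', y) 1 - Poly_Mapping.single (x, y) 1 - Poly_Mapping.single (x', y) 1 \<in> rel"
    and rel_add2: "x \<in> carrier X ==> y \<in> carrier Y ==> y' \<in> carrier Y ==>
      Poly_Mapping.single (x, y \<oplus>\<^bsub>Y\<^esub> y') 1 - Poly_Mapping.single (x, y) 1 - Poly_Mapping.single (x, y') 1 \<in> rel"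
    and rel_smult1: "x \<in> carrier X ==> y \<in> carrier Y ==>
      Poly_Mapping.single (c \<odot>\<^bsub>X\<^esub> x, y) 1 - Poly_Mapping.single (x, y) c \<in> rel"
    and rel_smult2: "x \<in> carrier X ==> y \<in> carrier Y ==>
      Poly_Mapping.single (x, c \<odot>\<^bsub>Y\<^esub> y) 1 - Poly_Mapping.single (x, y) c \<in> rel"
    and rel_act: "r \<in> carrier R ==> x \<in> carrier X ==> y \<in> carrier Y ==>
      Poly_Mapping.single (act X r x, y) 1 - Poly_Mapping.single (x, act Y r y) 1 \<in> rel"
    and rel_subset: "rel \<subseteq> carrier free"
    and rel_add: "z \<in> rel ==> w \<in> rel ==> z + w \<in> rel"
    and rel_smult: "z \<in> rel ==> Poly_Mapping.map ((*) c) z \<in> rel"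
    and rel_zero: "0 \<in> rel"
proof -
  let ?B = "{Poly_Mapping.single (x \<oplus>\<^bsub>X\<^esub> x', y) 1 - Poly_Mapping.single (x, y) 1 - Poly_Mapping.single (x', y) 1
        |x x' y. x \<in> carrier X \<and> x' \<in> carrier X \<and> y \<in> carrier Y} \<union>
     {Poly_Mapping.single (x, y \<oplus>\<^bsub>Y\<^esub> y') 1 - Poly_Mapping.single (x, y) 1 - Poly_Mapping.single (x, y') 1
        |x y y'. x \<in> carrier X \<and> y \<in> carrier Y \<and> y' \<in> carrier Y} \<union>
     {Poly_Mapping.single (c \<odot>\<^bsub>X\<^esub> x, y) 1 - Poly_Mapping.single (x, y) c
        |c x y. x \<in> carrier X \<and> y \<in> carrier Y} \<union>
     {Poly_Mapping.single (x, c \<odot>\<^bsub>Y\<^esub> y) 1 - Poly_Mapping.single (x, y) c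
        |c x y. x \<in> carrier X \<and> y \<in> carrier Y} \<union>
     {Poly_Mapping.single (act X r x, y) 1 - Poly_Mapping.single (x, act Y r y) 1
        |r x y. r \<in> carrier R \<and> x \<in> carrier X \<and> y \<in> carrier Y} :: ('a \<times> 'b \<Rightarrow>\<^sub>0 'f) set"
  have rel: "rel = lin_span free ?B" by (simp add: tensor_rel_def)
  have B: "?B \<subseteq> carrier free"
  proof -
    have ks: "Poly_Mapping.keys (Poly_Mapping.single (x, y) c) \<subseteq> carrier X \<times> carrier Y"
      if "x \<in> carrier X" "y \<in> carrier Y" for x y and c :: 'f
      using that by (simp add: keys_single)
    show ?thesis
      by (intro Un_least subsetI; elim CollectE exE conjE; hypsubst; unfold free_space_simps mem_Collect_eq;
          intro keys_diff' ks; (assumption | rule X.a_closed Y.a_closed X.smult_in Y.smult_in act_closed)+)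
  qed
  note base = F.lin_span_base[OF B, folded rel]
  show "x \<in> carrier X ==> x' \<in> carrier X ==> y \<in> carrier Y ==>
      Poly_Mapping.single (x \<oplus>\<^bsub>X\<^esub> x', y) 1 - Poly_Mapping.single (x, y) 1 - Poly_Mapping.single (x', y) 1 \<in> rel"
    by (rule base) blast
  show "x \<in> carrier X ==> y \<in> carrier Y ==> y' \<in> carrier Y ==>
      Poly_Mapping.single (x, y \<oplus>\<^bsub>Y\<^esub> y') 1 - Poly_Mapping.single (x, y) 1 - Poly_Mapping.single (x, y') 1 \<in> rel"
    by (rule base) blast
  show "x \<in> carrier X ==> y \<in> carrier Y ==>
      Poly_Mapping.single (c \<odot>\<^bsub>X\<^esub> x, y) 1 - Poly_Mapping.single (x, y) c \<in> rel"
    by (rule base) blast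
  show "x \<in> carrier X ==> y \<in> carrier Y ==>
      Poly_Mapping.single (x, c \<odot>\<^bsub>Y\<^esub> y) 1 - Poly_Mapping.single (x, y) c \<in> rel"
    by (rule base) blast
  show "r \<in> carrier R ==> x \<in> carrier X ==> y \<in> carrier Y ==>
      Poly_Mapping.single (act X r x, y) 1 - Poly_Mapping.single (x, act Y r y) 1 \<in> rel"
    by (rule base) blast
  show "rel \<subseteq> carrier free" unfolding rel by (rule F.lin_span_subset[OF B])
  show "z \<in> rel ==> w \<in> rel ==> z + w \<in> rel" unfolding rel using F.lin_span_add[OF B] by simp
  show "z \<in> rel ==> Poly_Mapping.map ((*) c) z \<in> rel" unfolding rel using F.lin_span_smult[OF B] by simp
  show "0 \<in> rel" unfolding rel using lin_span.intros(1)[of free] by simp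
qed

lemma rel_uminus: assumes "z \<in> rel" shows "- z \<in> rel"
proof -
  have "Poly_Mapping.map ((*) (- 1)) z = - z" by (intro poly_mapping_eqI) (simp add: lookup_map_times)
  then show ?thesis using rel_smult[OF assms, of "- 1"] by simp
qed

lemma coset_mem: "z \<in> coset x \<longleftrightarrow> z - x \<in> rel"
proof
  assume "z \<in> coset x" then show "z - x \<in> rel" by (auto simp: tensor_coset_def a_r_coset_def r_coset_def)
next
  assume "z - x \<in> rel" then show "z \<in> coset x"
    by (auto simp: tensor_coset_def a_r_coset_def r_coset_def intro!: bexI[of _ "z - x"])
qed

lemma coset_eq: "coset x = coset y \<longleftrightarrow> x - y \<in> rel"
proof
  assume "coset x = coset y" then show "x - y \<in> rel" using coset_mem[of x x] coset_mem[of x y] rel_zero by simp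
next
  assume xy: "x - y \<in> rel"
  have "z - x \<in> rel \<longleftrightarrow> z - y \<in> rel" for z
    using rel_add[OF _ xy, of "z - x"] rel_add[OF _ rel_uminus[OF xy], of "z - y"] by auto
  then show "coset x = coset y" by (auto simp: coset_mem)
qed

lemma coset_zero: "rel = coset 0" by (auto simp: coset_mem)

lemma coset_add: "set_add free (coset x) (coset y) = coset (x + y)"
proof (intro Set.set_eqI iffI)
  fix z assume "z \<in> set_add free (coset x) (coset y)"
  then obtain a b where ab: "a - x \<in> rel" "b - y \<in> rel" "z = a + b"
    by (auto simp: set_add_def set_mult_def coset_mem)
  have "(a - x) + (b - y) \<in> rel" using ab rel_add by blast
  then show "z \<in> coset (x + y)" using ab by (simp add: coset_mem algebra_simps)
next
  fix z assume "z \<in> coset (x + y)"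
  then have "z - y \<in> coset x" "y \<in> coset y" "z = (z - y) + y" using rel_zero by (auto simp: coset_mem algebra_simps)
  then show "z \<in> set_add free (coset x) (coset y)"
    unfolding set_add_def set_mult_def by (simp only: monoid.simps free_space_simps) blast
qed

lemma map_times:
  fixes c d :: 'f
  shows "Poly_Mapping.map ((*) 0) x = (0 :: 'k \<Rightarrow>\<^sub>0 'f)"
    and "Poly_Mapping.map ((*) 1) x = x"
    and "Poly_Mapping.map ((*) (c + d)) x = Poly_Mapping.map ((*) c) x + Poly_Mapping.map ((*) d) x"
    and "Poly_Mapping.map ((*) c) (x + y) = Poly_Mapping.map ((*) c) x + Poly_Mapping.map ((*) c) y"
    and "Poly_Mapping.map ((*) (c * d)) x = Poly_Mapping.map ((*) c) (Poly_Mapping.map ((*) d) x)"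
  by (auto intro!: poly_mapping_eqI simp: lookup_map_times lookup_add algebra_simps)

lemma map_times_diff: "Poly_Mapping.map ((*) c) (x - y) = Poly_Mapping.map ((*) (c::'f)) x - Poly_Mapping.map ((*) c) y"
  by (intro poly_mapping_eqI) (simp add: lookup_map_times lookup_minus algebra_simps)

lemma T_carrier: "carrier T = coset ` {x. Poly_Mapping.keys x \<subseteq> carrier X \<times> carrier Y}"
  unfolding tensor_def with_act_simps tensor_space_def
  by (auto simp: A_RCOSETS_def' tensor_coset_def)

lemma T_ops:
  "zero T = coset 0" "add T (coset x) (coset y) = coset (x + y)" "smult T c (coset x) = coset (Poly_Mapping.map ((*) c) x)"
proof -
  show "zero T = coset 0" "add T (coset x) (coset y) = coset (x + y)"
    unfolding tensor_def with_act_simps by (simp_all add: tensor_space_def coset_zero coset_add)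
  \<comment> \<open>Scalar multiplication is defined as a union over all representatives; every
    member of the union is the same coset, and the union is not empty.\<close>
  have "coset (Poly_Mapping.map ((*) c) z) = coset (Poly_Mapping.map ((*) c) x)" if "z \<in> coset x" for z
    using that rel_smult[of "z - x" c] by (simp add: coset_eq coset_mem map_times_diff)
  moreover have "x \<in> coset x" using rel_zero by (simp add: coset_mem)
  moreover have "smult T c (coset x) = (\<Union>z\<in>coset x. coset (Poly_Mapping.map ((*) c) z))"
    unfolding tensor_def with_act_simps by (simp add: tensor_space_def)
  ultimately show "smult T c (coset x) = coset (Poly_Mapping.map ((*) c) x)" by blast
qed

lemma vspace_T: "vspace T"
  unfolding vspace_def
proof (rule vector_spaceI)
  fix t t' c assume "t \<in> carrier T" "t' \<in> carrier T"
  then obtain x x' where x: "t = coset x" "t' = coset x'" "Poly_Mapping.keys x \<subseteq> carrier X \<times> carrier Y"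
      "Poly_Mapping.keys x' \<subseteq> carrier X \<times> carrier Y" by (auto simp: T_carrier)
  show "t \<oplus>\<^bsub>T\<^esub> t' \<in> carrier T"
    using x Poly_Mapping.keys_add[of x x'] by (auto simp: T_carrier T_ops)
next
  show "\<zero>\<^bsub>T\<^esub> \<in> carrier T" by (auto simp: T_carrier T_ops)
next
  fix c t assume "t \<in> carrier T"
  then obtain x where x: "t = coset x" "Poly_Mapping.keys x \<subseteq> carrier X \<times> carrier Y" by (auto simp: T_carrier)
  then show "c \<odot>\<^bsub>T\<^esub> t \<in> carrier T" using keys_map_times[of c x] by (auto simp: T_carrier T_ops)
qed (auto simp: T_carrier T_ops map_times ac_simps)

sublocale T: vspace T by (rule vspace_T)

lemma pure_closed: "x \<in> carrier X ==> y \<in> carrier Y ==> pt x y \<in> carrier T"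
  by (auto simp: T_carrier pure_tensor_def keys_single intro!: imageI)

lemma coset_single_closed: "x \<in> carrier X ==> y \<in> carrier Y ==> coset (Poly_Mapping.single (x, y) 1) \<in> carrier T"
  using pure_closed by (simp add: pure_tensor_def)

lemma pure_linear2: "x \<in> carrier X ==> pt x \<in> linear_maps Y T"
  by (rule linear_mapsI)
    (use rel_add2[of x] rel_smult2[of x] in \<open>auto simp: coset_single_closed pure_tensor_def T_ops coset_eq algebra_simps map_single\<close>)

lemma pure_linear1: "y \<in> carrier Y ==> (\<lambda>x. pt x y) \<in> linear_maps X T"
  by (rule linear_mapsI)
    (use rel_add1[of _ _ y] rel_smult1[of _ y] in \<open>auto simp: coset_single_closed pure_tensor_def T_ops coset_eq algebra_simps map_single\<close>)

lemma pure_balanced: "balanced R X Y T pt"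
proof (rule balancedI)
  fix r x y assume "r \<in> carrier R" "x \<in> carrier X" "y \<in> carrier Y"
  then show "pt (act X r x) y = pt x (act Y r y)" unfolding pure_tensor_def coset_eq by (rule rel_act)
qed (simp_all add: pure_linear1 pure_linear2)

lemma coset_expand:
  assumes "Poly_Mapping.keys x \<subseteq> carrier X \<times> carrier Y"
  shows "(\<Oplus>\<^bsub>T\<^esub>p\<in>Poly_Mapping.keys x. Poly_Mapping.lookup x p \<odot>\<^bsub>T\<^esub> pt (fst p) (snd p)) = coset x"
proof -
  have *: "(\<Oplus>\<^bsub>T\<^esub>p\<in>K. Poly_Mapping.lookup x p \<odot>\<^bsub>T\<^esub> pt (fst p) (snd p)) = coset (\<Sum>p\<in>K. Poly_Mapping.single p (Poly_Mapping.lookup x p))"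
    if "finite K" "K \<subseteq> carrier X \<times> carrier Y" for K
    using that
  proof (induction K)
    case empty then show ?case by (simp add: T_ops)
  next
    case (insert p K)
    have "(\<Oplus>\<^bsub>T\<^esub>p\<in>insert p K. Poly_Mapping.lookup x p \<odot>\<^bsub>T\<^esub> pt (fst p) (snd p)) =
      Poly_Mapping.lookup x p \<odot>\<^bsub>T\<^esub> pt (fst p) (snd p) \<oplus>\<^bsub>T\<^esub> (\<Oplus>\<^bsub>T\<^esub>p\<in>K. Poly_Mapping.lookup x p \<odot>\<^bsub>T\<^esub> pt (fst p) (snd p))"
      using insert by (intro T.finsum_insert) (auto intro!: T.smult_in pure_closed)
    also have "\<dots> = coset (Poly_Mapping.single p (Poly_Mapping.lookup x p) + (\<Sum>p\<in>K. Poly_Mapping.single p (Poly_Mapping.lookup x p)))"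
      using insert by (simp add: pure_tensor_def T_ops map_single)
    finally show ?case using insert by simp
  qed
  have "(\<Sum>p\<in>Poly_Mapping.keys x. Poly_Mapping.single p (Poly_Mapping.lookup x p)) = x"
    by (rule poly_mapping_eqI)
      (auto simp: lookup_sum lookup_single when_def sum.delta in_keys_iff)
  then show ?thesis using *[OF finite_keys assms] by simp
qed

text \<open>A coefficient can be absorbed into the first factor, so neither scalar multiples nor the
  empty sum need a case of their own: zero is the pure tensor of two zeros.\<close>

lemma tensor_induct [consumes 1, case_names pure add]:
  assumes "t \<in> carrier T"
    and pure: "\<And>x y. x \<in> carrier X ==> y \<in> carrier Y ==> P (pt x y)"
    and add: "\<And>t t'. t \<in> carrier T ==> t' \<in> carrier T ==> P t ==> P t' ==> P (t \<oplus>\<^bsub>T\<^esub> t')"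
  shows "P t"
proof -
  obtain x where x: "t = coset x" "Poly_Mapping.keys x \<subseteq> carrier X \<times> carrier Y"
    using assms(1) by (auto simp: T_carrier)
  have "P (\<Oplus>\<^bsub>T\<^esub>p\<in>K. Poly_Mapping.lookup x p \<odot>\<^bsub>T\<^esub> pt (fst p) (snd p))"
    if "finite K" "K \<subseteq> carrier X \<times> carrier Y" for K
    using that
  proof (induction K)
    case empty
    have "pt \<zero>\<^bsub>X\<^esub> \<zero>\<^bsub>Y\<^esub> = \<zero>\<^bsub>T\<^esub>"
      by (rule linear_maps_zero[OF pure_linear2]) (auto intro: Y.vspace_axioms T.vspace_axioms)
    then show ?case using pure[of "\<zero>\<^bsub>X\<^esub>" "\<zero>\<^bsub>Y\<^esub>"] by simp
  next
    case (insert p K)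
    have "Poly_Mapping.lookup x p \<odot>\<^bsub>T\<^esub> pt (fst p) (snd p) = pt (Poly_Mapping.lookup x p \<odot>\<^bsub>X\<^esub> fst p) (snd p)"
      using insert by (auto intro!: linear_mapsD(3)[OF pure_linear1, symmetric])
    then have "P (Poly_Mapping.lookup x p \<odot>\<^bsub>T\<^esub> pt (fst p) (snd p))"
      using pure insert by (auto simp: X.smult_in)
    moreover have "(\<Oplus>\<^bsub>T\<^esub>p\<in>insert p K. Poly_Mapping.lookup x p \<odot>\<^bsub>T\<^esub> pt (fst p) (snd p)) =
      Poly_Mapping.lookup x p \<odot>\<^bsub>T\<^esub> pt (fst p) (snd p) \<oplus>\<^bsub>T\<^esub> (\<Oplus>\<^bsub>T\<^esub>p\<in>K. Poly_Mapping.lookup x p \<odot>\<^bsub>T\<^esub> pt (fst p) (snd p))"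
      using insert by (intro T.finsum_insert) (auto intro!: T.smult_in pure_closed)
    ultimately show ?case using insert
      by (auto intro!: add T.smult_in pure_closed T.finsum_closed)
  qed
  from this[OF finite_keys x(2)] show ?thesis using coset_expand[OF x(2)] x(1) by simp
qed

text \<open>The universal property of the tensor product. Since \<open>tensor_lift\<close> evaluates
  at a representative picked by choice, the point is that evaluation on the free space kills every
  generator of the relations.\<close>

lemma lift_linear_pure:
  fixes N :: "('f, 'c, 'y) module_scheme"
  assumes "vspace N" and b: "balanced R X Y N b"
  shows lift_linear: "tensor_lift N b \<in> linear_maps T N"
    and lift_pure: "x \<in> carrier X ==> y \<in> carrier Y ==> tensor_lift N b (pt x y) = b x y"
proof -
  interpret N: vspace N by fact
  define L where "L x = (\<Oplus>\<^bsub>N\<^esub>p\<in>Poly_Mapping.keys x. Poly_Mapping.lookup x p \<odot>\<^bsub>N\<^esub> b (fst p) (snd p))" for x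
  let ?F = "carrier free"
  note bl = balancedD[OF b]
  have bc: "b x y \<in> carrier N" if "x \<in> carrier X" "y \<in> carrier Y" for x y
    using linear_mapsD(1)[OF bl(1)] that by blast
  \<comment> \<open>Allows summation over a finite set larger than the keys, so that two elements
    can be added over a common index set.\<close>
  have Leq: "L x = (\<Oplus>\<^bsub>N\<^esub>p\<in>K. Poly_Mapping.lookup x p \<odot>\<^bsub>N\<^esub> b (fst p) (snd p))"
    if "finite K" "Poly_Mapping.keys x \<subseteq> K" "K \<subseteq> carrier X \<times> carrier Y" for x K
    unfolding L_def
    by (rule N.add.finprod_mono_neutral_cong_left)
      (use that in \<open>auto simp: in_keys_iff bc N.smult_zero_left intro!: N.smult_in\<close>)
  have Lc: "L x \<in> carrier N" if "x \<in> ?F" for x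
    unfolding L_def by (rule N.finsum_closed) (use that in \<open>auto intro!: N.smult_in bc\<close>)
  have Ladd: "L (x + y) = L x \<oplus>\<^bsub>N\<^esub> L y" if "x \<in> ?F" "y \<in> ?F" for x y
  proof -
    let ?K = "Poly_Mapping.keys x \<union> Poly_Mapping.keys y"
    have K: "finite ?K" "?K \<subseteq> carrier X \<times> carrier Y" using that by auto
    have "L (x + y) = (\<Oplus>\<^bsub>N\<^esub>p\<in>?K. Poly_Mapping.lookup (x + y) p \<odot>\<^bsub>N\<^esub> b (fst p) (snd p))"
      by (rule Leq[OF K(1) Poly_Mapping.keys_add K(2)])
    also have "\<dots> = (\<Oplus>\<^bsub>N\<^esub>p\<in>?K. Poly_Mapping.lookup x p \<odot>\<^bsub>N\<^esub> b (fst p) (snd p) \<oplus>\<^bsub>N\<^esub> Poly_Mapping.lookup y p \<odot>\<^bsub>N\<^esub> b (fst p) (snd p))"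
      by (rule N.add.finprod_cong') (use K in \<open>auto simp: lookup_add N.smult_add bc intro!: N.smult_in\<close>)
    also have "\<dots> = L x \<oplus>\<^bsub>N\<^esub> L y"
      unfolding Leq[OF K(1) Un_upper1 K(2)] Leq[OF K(1) Un_upper2 K(2)]
      by (rule N.finsum_addf) (use K in \<open>auto intro!: N.smult_in bc\<close>)
    finally show ?thesis .
  qed
  have Lsm: "L (Poly_Mapping.map ((*) c) x) = c \<odot>\<^bsub>N\<^esub> L x" if "x \<in> ?F" for c x
  proof -
    have K: "Poly_Mapping.keys x \<subseteq> carrier X \<times> carrier Y" using that by auto
    have "L (Poly_Mapping.map ((*) c) x) = (\<Oplus>\<^bsub>N\<^esub>p\<in>Poly_Mapping.keys x. (c * Poly_Mapping.lookup x p) \<odot>\<^bsub>N\<^esub> b (fst p) (snd p))"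
      unfolding Leq[OF finite_keys keys_map_times K] lookup_map_times ..
    also have "\<dots> = (\<Oplus>\<^bsub>N\<^esub>p\<in>Poly_Mapping.keys x. c \<odot>\<^bsub>N\<^esub> (Poly_Mapping.lookup x p \<odot>\<^bsub>N\<^esub> b (fst p) (snd p)))"
      by (rule N.add.finprod_cong') (use K in \<open>auto simp: N.smult_mult bc intro!: N.smult_in\<close>)
    also have "\<dots> = c \<odot>\<^bsub>N\<^esub> L x"
      unfolding L_def by (rule N.smult_finsum[symmetric]) (use K in \<open>auto intro!: N.smult_in bc\<close>)
    finally show ?thesis .
  qed
  have Lsingle: "L (Poly_Mapping.single (x, y) c) = c \<odot>\<^bsub>N\<^esub> b x y" if "x \<in> carrier X" "y \<in> carrier Y" for x y c
  proof -
    have "L (Poly_Mapping.single (x, y) c) = (\<Oplus>\<^bsub>N\<^esub>p\<in>{(x,y)}. Poly_Mapping.lookup (Poly_Mapping.single (x, y) c) p \<odot>\<^bsub>N\<^esub> b (fst p) (snd p))"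
      by (rule Leq) (use that in \<open>auto simp: keys_single split: if_splits\<close>)
    then show ?thesis using that by (simp add: bc N.smult_in)
  qed
  have Ldiff: "L (x - y) = L x \<oplus>\<^bsub>N\<^esub> (- 1) \<odot>\<^bsub>N\<^esub> L y" if "x \<in> ?F" "y \<in> ?F" for x y
  proof -
    have eq: "x - y = x + Poly_Mapping.map ((*) (- 1)) y"
      by (intro poly_mapping_eqI) (simp add: lookup_map_times lookup_add lookup_minus)
    show ?thesis unfolding eq using Ladd[of x "Poly_Mapping.map ((*) (- 1)) y"] Lsm[OF that(2)] that keys_map_times[of "-1" y] by auto
  qed
  have neg: "(- 1) \<odot>\<^bsub>N\<^esub> n = \<ominus>\<^bsub>N\<^esub> n" if "n \<in> carrier N" for n
  proof -
    have "(- 1) \<odot>\<^bsub>N\<^esub> n \<oplus>\<^bsub>N\<^esub> n = (- 1 + 1) \<odot>\<^bsub>N\<^esub> n"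
      using that N.smult_add[of n "- 1" 1] by (simp add: N.smult_unit)
    then show ?thesis using that
      by (intro N.minus_equality[symmetric]) (auto simp: N.smult_zero_left N.smult_in)
  qed
  have Lrel: "L z = \<zero>\<^bsub>N\<^esub>" if "z \<in> rel" for z
  proof -
    have inF: "Poly_Mapping.single (x, y) c \<in> ?F" if "x \<in> carrier X" "y \<in> carrier Y" for x y c
      using that by (auto simp: keys_single split: if_splits)
    have inFd: "z - w \<in> ?F" if "z \<in> ?F" "w \<in> ?F" for z w :: "'a \<times> 'b \<Rightarrow>\<^sub>0 'f"
      using keys_diff'[of z _ w] that by auto
    have cancel: "a \<oplus>\<^bsub>N\<^esub> d \<oplus>\<^bsub>N\<^esub> \<ominus>\<^bsub>N\<^esub> a \<oplus>\<^bsub>N\<^esub> \<ominus>\<^bsub>N\<^esub> d = \<zero>\<^bsub>N\<^esub>" if "a \<in> carrier N" "d \<in> carrier N" for a d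
      using that N.r_neg[of "a \<oplus>\<^bsub>N\<^esub> d"] by (simp add: N.minus_add N.a_assoc)
    show ?thesis
      using that unfolding tensor_rel_def
    proof (induction rule: lin_span.induct)
      case 1 then show ?case by (simp add: L_def)
    next
      case (2 g v c)
      have g: "g \<in> ?F \<and> L g = \<zero>\<^bsub>N\<^esub>"
        using 2(1)
      proof (elim UnE CollectE exE conjE, goal_cases)
        case (1 x x' y)
        then show ?case
          using linear_mapsD(2)[OF bl(2), of y x x'] cancel[of "b x y" "b x' y"]
          by (auto simp: Ldiff inF inFd Lsingle bc neg N.smult_unit simp del: free_space_simps(1))
      next
        case (2 x y y')
        then show ?case
          using linear_mapsD(2)[OF bl(1), of x y y'] cancel[of "b x y" "b x y'"]
          by (auto simp: Ldiff inF inFd Lsingle bc neg N.smult_unit simp del: free_space_simps(1))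
      next
        case (3 d x y)
        then show ?case
          using linear_mapsD(3)[OF bl(2), of y x d]
          by (auto simp: Ldiff inF inFd Lsingle bc neg N.smult_unit N.smult_in X.smult_in N.r_neg simp del: free_space_simps(1))
      next
        case (4 d x y)
        then show ?case
          using linear_mapsD(3)[OF bl(1), of x y d]
          by (auto simp: Ldiff inF inFd Lsingle bc neg N.smult_unit N.smult_in Y.smult_in N.r_neg simp del: free_space_simps(1))
      next
        case (5 r x y)
        then show ?case
          using bl(3)[of r x y]
          by (auto simp: Ldiff inF inFd Lsingle bc neg N.smult_unit N.r_neg act_closed simp del: free_space_simps(1))
      qed
      have v: "v \<in> ?F" using 2(2) rel_subset unfolding tensor_rel_def by auto
      have "L (Poly_Mapping.map ((*) c) g + v) = L (Poly_Mapping.map ((*) c) g) \<oplus>\<^bsub>N\<^esub> L v"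
        using g v keys_map_times[of c g] by (intro Ladd) auto
      then show ?case using g 2(3) Lsm[of g c] by (simp add: N.smult_zero_right)
    qed
  qed
  \<comment> \<open>The chosen representative differs from \<open>x\<close> by a relation, on which
    \<open>L\<close> vanishes.\<close>
  have lift: "tensor_lift N b (coset x) = L x" if "x \<in> ?F" for x
  proof -
    have "x \<in> coset x" using rel_zero by (simp add: coset_mem)
    then have "(SOME z. z \<in> coset x) \<in> coset x" by (rule someI)
    then have z: "(SOME z. z \<in> coset x) - x \<in> rel" (is "?z - x \<in> rel") by (simp add: coset_mem)
    have "L ((?z - x) + x) = L (?z - x) \<oplus>\<^bsub>N\<^esub> L x" using that z rel_subset by (intro Ladd) auto
    then have "L ?z = L x" using Lrel[OF z] Lc[OF that] by simp
    then show ?thesis by (simp add: tensor_lift_def L_def[symmetric])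
  qed
  show "tensor_lift N b \<in> linear_maps T N"
  proof (rule linear_mapsI)
    fix t t' c assume "t \<in> carrier T"
    then obtain x where x: "t = coset x" "x \<in> ?F" by (auto simp: T_carrier)
    then show "tensor_lift N b t \<in> carrier N" by (simp add: lift Lc)
    have "Poly_Mapping.map ((*) c) x \<in> ?F" using x keys_map_times[of c x] by auto
    then show "tensor_lift N b (c \<odot>\<^bsub>T\<^esub> t) = c \<odot>\<^bsub>N\<^esub> tensor_lift N b t"
      using x by (simp add: T_ops lift Lsm del: free_space_simps(1))
    assume "t' \<in> carrier T"
    then obtain x' where x': "t' = coset x'" "x' \<in> ?F" by (auto simp: T_carrier)
    have "x + x' \<in> ?F" using x x' Poly_Mapping.keys_add[of x x'] by auto
    then show "tensor_lift N b (t \<oplus>\<^bsub>T\<^esub> t') = tensor_lift N b t \<oplus>\<^bsub>N\<^esub> tensor_lift N b t'"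
      using x x' by (simp add: T_ops lift Ladd del: free_space_simps(1))
  qed
  show "tensor_lift N b (pt x y) = b x y" if "x \<in> carrier X" "y \<in> carrier Y"
    unfolding pure_tensor_def using that by (subst lift) (auto simp: Lsingle bc N.smult_unit keys_single)
qed

lemma linear_eq_on_pure:
  assumes "f \<in> linear_maps T N" "g \<in> linear_maps T N" "t \<in> carrier T"
    and "\<And>x y. x \<in> carrier X ==> y \<in> carrier Y ==> f (pt x y) = g (pt x y)"
  shows "f t = g t"
  using assms(3)
proof (induction rule: tensor_induct)
  case (add t t') then show ?case using linear_mapsD[OF assms(1)] linear_mapsD[OF assms(2)] by simp
qed (rule assms(4))

lemma act_balanced: "r \<in> carrier R ==> balanced R X Y T (\<lambda>x y. pt (act X r x) y)"
proof (rule balancedI)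
  assume r: "r \<in> carrier R"
  fix x assume x: "x \<in> carrier X" then show "pt (act X r x) \<in> linear_maps Y T" using r by (simp add: pure_linear2 act_closed)
next
  assume r: "r \<in> carrier R"
  fix y assume y: "y \<in> carrier Y"
  show "(\<lambda>x. pt (act X r x) y) \<in> linear_maps X T"
    by (rule linear_maps_compose[OF _ pure_linear1[OF y]]) (use r rX in \<open>auto simp: r_module_def\<close>)
next
  assume r: "r \<in> carrier R"
  fix r' x y assume *: "r' \<in> carrier R" "x \<in> carrier X" "y \<in> carrier Y"
  then have "act X r (act X r' x) = act X r' (act X r x)" using r rX by (auto simp: r_module_def)
  then show "pt (act X r (act X r' x)) y = pt (act X r x) (act Y r' y)"
    using balancedD(3)[OF pure_balanced] * r by (simp add: act_closed)
qed

lemma act_T: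
  shows act_T_linear: "r \<in> carrier R ==> act T r \<in> linear_maps T T"
    and act_T_pure: "r \<in> carrier R ==> x \<in> carrier X ==> y \<in> carrier Y ==> act T r (pt x y) = pt (act X r x) y"
proof -
  have eq: "act T r = tensor_lift T (\<lambda>x y. pt (act X r x) y)" for r
    unfolding tensor_def with_act_simps
    by (rule fun_cong[OF tensor_lift_cong_record]) simp_all
  show "r \<in> carrier R ==> act T r \<in> linear_maps T T"
    unfolding eq by (rule lift_linear[OF vspace_T act_balanced])
  show "r \<in> carrier R ==> x \<in> carrier X ==> y \<in> carrier Y ==> act T r (pt x y) = pt (act X r x) y"
    unfolding eq by (rule lift_pure[OF vspace_T act_balanced])
qed

lemma r_module_T: "r_module R T"
  unfolding r_module_def
proof (intro conjI ballI vspace_T act_T_linear)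
  fix r r' t assume r: "r \<in> carrier R" "r' \<in> carrier R" and t: "t \<in> carrier T"
  show "act T r (act T r' t) = act T r' (act T r t)"
  proof (rule linear_eq_on_pure[OF _ _ t])
    show "(\<lambda>t. act T r (act T r' t)) \<in> linear_maps T T" "(\<lambda>t. act T r' (act T r t)) \<in> linear_maps T T"
      using r by (blast intro: linear_maps_compose act_T_linear)+
    fix x y assume "x \<in> carrier X" "y \<in> carrier Y"
    then show "act T r (act T r' (pt x y)) = act T r' (act T r (pt x y))"
      using r rX by (simp add: act_T_pure act_closed r_module_def)
  qed
qed

end

text \<open>The relations see the actions only on the carriers, so modules whose actions differ
  elsewhere have literally the same cosets. This later identifies the tensor product of the Hopf
  structure with the domain of \<open>Omega\<close>.\<close>

lemma pure_tensor_cong: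
  fixes X X' :: "('f::real_normed_field, 'r, 'a) rmodule" and Y Y' :: "('f, 'r, 'b) rmodule"
  assumes "carrier X' = carrier X" "add X' = add X" "smult X' = smult X"
    and "carrier Y' = carrier Y" "add Y' = add Y" "smult Y' = smult Y"
    and "\<And>r x. r \<in> carrier R ==> x \<in> carrier X ==> act X' r x = act X r x"
    and "\<And>r y. r \<in> carrier R ==> y \<in> carrier Y ==> act Y' r y = act Y r y"
  shows "pure_tensor R X' Y' = pure_tensor R X Y"
    and "carrier (tensor R X' Y') = carrier (tensor R X Y)"
    and "add (tensor R X' Y') = add (tensor R X Y)"
    and "zero (tensor R X' Y') = zero (tensor R X Y)"
    and "smult (tensor R X' Y') = smult (tensor R X Y)"
proof -
  have "{Poly_Mapping.single (act X' r x, y) 1 - Poly_Mapping.single (x, act Y' r y) 1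
      |r x y. r \<in> carrier R \<and> x \<in> carrier X \<and> y \<in> carrier Y} =
    {Poly_Mapping.single (act X r x, y) 1 - Poly_Mapping.single (x, act Y r y) (1::'f)
      |r x y. r \<in> carrier R \<and> x \<in> carrier X \<and> y \<in> carrier Y}"
    by (intro Collect_cong) (metis assms(7,8))
  then have rel: "tensor_rel R X' Y' = tensor_rel R X Y"
    unfolding tensor_rel_def assms(1-6) by (simp only:)
  then have "tensor_coset R X' Y' = tensor_coset R X Y"
    unfolding tensor_coset_def[abs_def] by (simp add: assms(1,4))
  then show "pure_tensor R X' Y' = pure_tensor R X Y"
    and "carrier (tensor R X' Y') = carrier (tensor R X Y)"
    and "add (tensor R X' Y') = add (tensor R X Y)"
    and "zero (tensor R X' Y') = zero (tensor R X Y)"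
    and "smult (tensor R X' Y') = smult (tensor R X Y)"
    unfolding pure_tensor_def[abs_def] tensor_def with_act_simps tensor_space_def
    by (simp_all add: assms(1,4) rel)
qed

locale tensor_map_setup = D: tensor_setup R X Y + C: tensor_setup R X' Y'
  for R :: "('f::real_normed_field, 'r, 'z) module_scheme"
    and X :: "('f, 'r, 'a) rmodule" and Y :: "('f, 'r, 'b) rmodule"
    and X' :: "('f, 'r, 'c) rmodule" and Y' :: "('f, 'r, 'd) rmodule" +
  fixes f :: "'a => 'c" and g :: "'b => 'd"
  assumes f: "f \<in> linear_maps X X'" and g: "g \<in> linear_maps Y Y'"
    and f_act: "r \<in> carrier R ==> x \<in> carrier X ==> f (act X r x) = act X' r (f x)"
    and g_act: "r \<in> carrier R ==> y \<in> carrier Y ==> g (act Y r y) = act Y' r (g y)"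
begin

lemma map_balanced: "balanced R X Y C.T (\<lambda>x y. C.pt (f x) (g y))"
proof (rule balancedI)
  fix x assume "x \<in> carrier X"
  then show "(\<lambda>y. C.pt (f x) (g y)) \<in> linear_maps Y C.T"
    by (intro linear_maps_compose[OF g] C.pure_linear2 linear_mapsD(1)[OF f])
next
  fix y assume "y \<in> carrier Y"
  then show "(\<lambda>x. C.pt (f x) (g y)) \<in> linear_maps X C.T"
    by (intro linear_maps_compose[OF f] C.pure_linear1 linear_mapsD(1)[OF g])
next
  fix r x y assume "r \<in> carrier R" "x \<in> carrier X" "y \<in> carrier Y"
  then show "C.pt (f (act X r x)) (g y) = C.pt (f x) (g (act Y r y))"
    using balancedD(3)[OF C.pure_balanced] by (simp add: f_act g_act linear_mapsD(1)[OF f] linear_mapsD(1)[OF g])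
qed

lemma map_linear: "tensor_map R X' Y' f g \<in> linear_maps D.T C.T"
  unfolding tensor_map_def by (rule D.lift_linear[OF C.vspace_T map_balanced])

lemma map_pure: "x \<in> carrier X ==> y \<in> carrier Y ==> tensor_map R X' Y' f g (D.pt x y) = C.pt (f x) (g y)"
  unfolding tensor_map_def by (rule D.lift_pure[OF C.vspace_T map_balanced])

end

section \<open>Smooth functions and etale maps\<close>

lemma smooth_on_linear_compose:
  "open S ==> bounded_linear h ==> smooth_on S f ==> smooth_on S (\<lambda>x. h (f x))"
  unfolding smooth_on_def by (blast intro: k_smooth_on_linear_compose)

text \<open>Values lie in a normed vector space rather than a field, so that a chart composed with a
  map is itself a smooth function and maps can be treated like functions.\<close>

definition vsmooth ::
  "('p, 'e::{real_inner,heine_borel}) manifold => 'p set => ('p => 'b::real_normed_vector) => bool" where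
  "vsmooth E W f \<longleftrightarrow> (\<forall>(U, \<kappa>)\<in>atlas E. smooth_on (\<kappa> ` (U \<inter> W)) (f \<circ> inv_into U \<kappa>))"

lemma smooth_fun_on_vsmooth: "smooth_fun_on = vsmooth"
  by (intro ext) (simp add: smooth_fun_on_def vsmooth_def)

lemma smooth_map_vsmooth:
  "smooth_map E F f \<longleftrightarrow> continuous_map (mtop E) (mtop F) f \<and> (\<forall>(V, \<psi>)\<in>atlas F. vsmooth E (f -` V) (\<psi> \<circ> f))"
  unfolding smooth_map_def vsmooth_def by (auto simp: comp_assoc)

locale smanifold =
  fixes E :: "('p, 'e::{real_inner,heine_borel}) manifold"
  assumes mfd: "smooth_manifold E"
begin

lemma chart_exists: "y \<in> topspace (mtop E) ==> \<exists>U \<kappa>. (U, \<kappa>) \<in> atlas E \<and> y \<in> U"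
proof -
  assume "y \<in> topspace (mtop E)"
  then have "y \<in> \<Union> (fst ` atlas E)" using mfd by (simp add: smooth_manifold_def)
  then obtain p where "p \<in> atlas E" "y \<in> fst p" by blast
  then show ?thesis by (metis prod.collapse)
qed

lemma chart:
  assumes "(U, \<kappa>) \<in> atlas E"
  shows chart_openin: "openin (mtop E) U"
    and chart_homeo: "homeomorphic_map (subtopology (mtop E) U) (top_of_set (\<kappa> ` U)) \<kappa>"
    and chart_inj: "inj_on \<kappa> U"
    and chart_open: "openin (mtop E) W ==> open (\<kappa> ` (U \<inter> W))"
    and chart_trans: "(V, \<psi>) \<in> atlas E ==> smooth_on (\<kappa> ` (U \<inter> V)) (\<psi> \<circ> inv_into U \<kappa>)"
proof -
  show U: "openin (mtop E) U" and h: "homeomorphic_map (subtopology (mtop E) U) (top_of_set (\<kappa> ` U)) \<kappa>"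
    and "(V, \<psi>) \<in> atlas E ==> smooth_on (\<kappa> ` (U \<inter> V)) (\<psi> \<circ> inv_into U \<kappa>)"
    using mfd assms unfolding smooth_manifold_def by blast+
  have "open (\<kappa> ` U)" using mfd assms unfolding smooth_manifold_def by blast
  have "U \<subseteq> topspace (mtop E)" using U openin_subset by blast
  then show "inj_on \<kappa> U" using homeomorphic_imp_injective_map[OF h] by (simp add: Int_absorb1)
  assume "openin (mtop E) W"
  then have "openin (subtopology (mtop E) U) (U \<inter> W)"
    by (metis inf_commute openin_subtopology)
  then have "openin (top_of_set (\<kappa> ` U)) (\<kappa> ` (U \<inter> W))"
    using homeomorphic_imp_open_map[OF h] by (simp add: open_map_def)
  then show "open (\<kappa> ` (U \<inter> W))" using \<open>open (\<kappa> ` U)\<close> openin_open_trans by blast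
qed

lemma chart_homeo_sub:
  assumes c: "(U, \<kappa>) \<in> atlas E" and "W \<subseteq> U"
  shows "homeomorphic_map (subtopology (mtop E) W) (top_of_set (\<kappa> ` W)) \<kappa>"
proof -
  have U: "U \<subseteq> topspace (mtop E)" using openin_subset[OF chart_openin[OF c]] .
  have "homeomorphic_map (subtopology (subtopology (mtop E) U) W) (subtopology (top_of_set (\<kappa> ` U)) (\<kappa> ` W)) \<kappa>"
    by (rule homeomorphic_map_subtopologies[OF chart_homeo[OF c]])
      (use assms(2) U in \<open>simp add: Int_absorb1 Int_absorb2 image_mono\<close>)
  then show ?thesis using assms(2) by (simp add: subtopology_subtopology Int_absorb1 image_mono)
qed

lemma vsmooth_cong:
  assumes "openin (mtop E) W" "vsmooth E W f" "\<And>x. x \<in> W ==> f x = g x"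
  shows "vsmooth E W g"
  unfolding vsmooth_def
proof clarify
  fix U \<kappa> assume c: "(U, \<kappa>) \<in> atlas E"
  show "smooth_on (\<kappa> ` (U \<inter> W)) (g \<circ> inv_into U \<kappa>)"
  proof (rule smooth_on_cong[OF chart_open[OF c assms(1)]])
    show "smooth_on (\<kappa> ` (U \<inter> W)) (f \<circ> inv_into U \<kappa>)" using assms(2) c unfolding vsmooth_def by blast
  qed (use assms(3) chart_inj[OF c] in auto)
qed

lemma vsmooth_subset: "vsmooth E W f ==> V \<subseteq> W ==> vsmooth E V f"
  unfolding vsmooth_def by (clarify, rule smooth_on_subset, blast) blast

lemma vsmooth_local:
  assumes "\<And>y. y \<in> W ==> \<exists>V. openin (mtop E) V \<and> y \<in> V \<and> vsmooth E V f"
  shows "vsmooth E W f"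
  unfolding vsmooth_def
proof clarify
  fix U \<kappa> assume c: "(U, \<kappa>) \<in> atlas E"
  show "smooth_on (\<kappa> ` (U \<inter> W)) (f \<circ> inv_into U \<kappa>)"
  proof (rule smooth_on_local)
    fix x assume "x \<in> \<kappa> ` (U \<inter> W)"
    then obtain y where y: "x = \<kappa> y" "y \<in> U" "y \<in> W" by blast
    obtain V where V: "openin (mtop E) V" "y \<in> V" "vsmooth E V f" using assms[OF y(3)] by blast
    show "\<exists>T. open T \<and> x \<in> T \<and> smooth_on T (f \<circ> inv_into U \<kappa>)"
      using chart_open[OF c V(1)] V y c unfolding vsmooth_def by blast
  qed
qed

lemma vsmooth_const: "vsmooth E W (\<lambda>_. c)"
  by (simp add: vsmooth_def comp_def smooth_on_const)

lemma vsmooth_add: "openin (mtop E) W ==> vsmooth E W f ==> vsmooth E W g ==> vsmooth E W (\<lambda>x. f x + g x)"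
  unfolding vsmooth_def comp_def by (clarify, rule smooth_on_add[OF chart_open]) blast+

lemma vsmooth_mult:
  fixes f g :: "'p => 'f::real_normed_field"
  shows "openin (mtop E) W ==> vsmooth E W f ==> vsmooth E W g ==> vsmooth E W (\<lambda>x. f x * g x)"
  unfolding vsmooth_def comp_def by (clarify, rule smooth_on_mult[OF chart_open]) blast+

lemma vsmooth_chart:
  fixes b :: "'e => 'b::real_normed_vector"
  assumes c: "(U, \<kappa>) \<in> atlas E" and b: "smooth_on UNIV b"
  shows "vsmooth E U (\<lambda>y. b (\<kappa> y))"
  unfolding vsmooth_def
proof clarify
  fix V \<psi> assume d: "(V, \<psi>) \<in> atlas E"
  show "smooth_on (\<psi> ` (V \<inter> U)) ((\<lambda>y. b (\<kappa> y)) \<circ> inv_into V \<psi>)"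
    using smooth_on_compose[OF chart_open[OF d chart_openin[OF c]] open_UNIV _ b chart_trans[OF d c]]
    by (simp add: comp_def)
qed

end

text \<open>Around each point this is the chain rule in two charts. The chart of \<open>F\<close>
  depends on the point, whence the local criterion \<open>smooth_on_local\<close>.\<close>

lemma vsmooth_pullback:
  assumes "smooth_manifold E" "smooth_manifold F" "smooth_map E F \<phi>" "openin (mtop F) V" "vsmooth F V f"
  shows "vsmooth E (topspace (mtop E) \<inter> \<phi> -` V) (\<lambda>y. f (\<phi> y))"
proof -
  interpret E: smanifold E by unfold_locales fact
  interpret F: smanifold F by unfold_locales fact
  have cont: "continuous_map (mtop E) (mtop F) \<phi>" using assms(3) by (simp add: smooth_map_def)
  show ?thesis
    unfolding vsmooth_def
  proof clarify
    fix U \<kappa> assume c: "(U, \<kappa>) \<in> atlas E"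
    show "smooth_on (\<kappa> ` (U \<inter> (topspace (mtop E) \<inter> \<phi> -` V))) ((\<lambda>y. f (\<phi> y)) \<circ> inv_into U \<kappa>)"
    proof (rule smooth_on_local)
      fix x assume "x \<in> \<kappa> ` (U \<inter> (topspace (mtop E) \<inter> \<phi> -` V))"
      then obtain y where y: "x = \<kappa> y" "y \<in> U" "y \<in> topspace (mtop E)" "\<phi> y \<in> V" by blast
      then have "\<phi> y \<in> topspace (mtop F)" using cont by (auto simp: continuous_map_def)
      then obtain V' \<psi> where d: "(V', \<psi>) \<in> atlas F" "\<phi> y \<in> V'" using F.chart_exists by blast
      define W where "W = {y \<in> topspace (mtop E). \<phi> y \<in> V' \<inter> V}"
      have W: "openin (mtop E) W"
        unfolding W_def using cont F.chart_openin[OF d(1)] assms(4)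
        by (intro openin_continuous_map_preimage openin_Int)
      have o: "open (\<kappa> ` (U \<inter> W))" by (rule E.chart_open[OF c W])
      have o': "open (\<psi> ` (V' \<inter> V))" by (rule F.chart_open[OF d(1) assms(4)])
      have s: "smooth_on (\<kappa> ` (U \<inter> \<phi> -` V')) (\<psi> \<circ> \<phi> \<circ> inv_into U \<kappa>)"
        using assms(3) c d unfolding smooth_map_def by blast
      have inv: "inv_into U \<kappa> z \<in> U \<inter> W \<and> \<kappa> (inv_into U \<kappa> z) = z" if "z \<in> \<kappa> ` (U \<inter> W)" for z
        using that E.chart_inj[OF c] by auto
      have "smooth_on (\<kappa> ` (U \<inter> W)) (\<lambda>z. (f \<circ> inv_into V' \<psi>) ((\<psi> \<circ> \<phi> \<circ> inv_into U \<kappa>) z))"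
      proof (rule smooth_on_compose[OF o o'])
        show "(\<psi> \<circ> \<phi> \<circ> inv_into U \<kappa>) ` \<kappa> ` (U \<inter> W) \<subseteq> \<psi> ` (V' \<inter> V)"
          using E.chart_inj[OF c] by (auto simp: W_def)
        show "smooth_on (\<psi> ` (V' \<inter> V)) (f \<circ> inv_into V' \<psi>)"
          using assms(5) d unfolding vsmooth_def by blast
        show "smooth_on (\<kappa> ` (U \<inter> W)) (\<psi> \<circ> \<phi> \<circ> inv_into U \<kappa>)"
          by (rule smooth_on_subset[OF s]) (auto simp: W_def)
      qed
      then have "smooth_on (\<kappa> ` (U \<inter> W)) ((\<lambda>y. f (\<phi> y)) \<circ> inv_into U \<kappa>)"
        by (rule smooth_on_cong[OF o, rotated])
          (use inv F.chart_inj[OF d(1)] in \<open>auto simp: W_def inv_into_f_f\<close>)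
      moreover have "x \<in> \<kappa> ` (U \<inter> W)" using y d by (auto simp: W_def)
      ultimately show "\<exists>T. open T \<and> x \<in> T \<and> smooth_on T ((\<lambda>y. f (\<phi> y)) \<circ> inv_into U \<kappa>)"
        using o by blast
    qed
  qed
qed

text \<open>A chart of \<open>H\<close> after \<open>g\<close> is a vector-valued smooth function on
  part of \<open>F\<close>, and \<open>vsmooth_pullback\<close> carries it back along
  \<open>f\<close>, so the chain rule is not repeated.\<close>

lemma smooth_map_compose:
  assumes "smooth_manifold E" "smooth_manifold F" "smooth_manifold H" "smooth_map E F f" "smooth_map F H g"
  shows "smooth_map E H (g \<circ> f)"
  unfolding smooth_map_vsmooth
proof (intro conjI ballI)
  show "continuous_map (mtop E) (mtop H) (g \<circ> f)"
    using assms(4,5) by (auto simp: smooth_map_def intro: continuous_map_compose)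
  have cont: "continuous_map (mtop E) (mtop F) f" "continuous_map (mtop F) (mtop H) g"
    using assms(4,5) by (simp_all add: smooth_map_def)
  fix p assume p: "p \<in> atlas H"
  obtain V \<psi> where p': "p = (V, \<psi>)" by (cases p)
  let ?W = "{y \<in> topspace (mtop F). g y \<in> V}"
  interpret H: smanifold H by unfold_locales fact
  have W: "openin (mtop F) ?W"
    using cont(2) H.chart_openin p p' by (intro openin_continuous_map_preimage) auto
  have "vsmooth F (g -` V) (\<psi> \<circ> g)" using assms(5) p p' unfolding smooth_map_vsmooth by auto
  then have "vsmooth F ?W (\<psi> \<circ> g)"
    by (auto simp: vsmooth_def elim!: smooth_on_subset)
  from vsmooth_pullback[OF assms(1,2,4) W this]
  have v: "vsmooth E (topspace (mtop E) \<inter> f -` ?W) (\<lambda>y. (\<psi> \<circ> g) (f y))" .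
  have "smooth_on (\<kappa> ` (U \<inter> (g \<circ> f) -` V)) (\<psi> \<circ> (g \<circ> f) \<circ> inv_into U \<kappa>)" if c: "(U, \<kappa>) \<in> atlas E" for U \<kappa>
  proof -
    interpret E: smanifold E by unfold_locales fact
    have "U \<subseteq> topspace (mtop E)" using E.chart_openin[OF c] by (simp add: openin_subset)
    moreover have "f y \<in> topspace (mtop F)" if "y \<in> topspace (mtop E)" for y
      using that cont(1) by (auto simp: continuous_map_def)
    ultimately have "U \<inter> (g \<circ> f) -` V = U \<inter> (topspace (mtop E) \<inter> f -` ?W)" by auto
    then show ?thesis using v c unfolding vsmooth_def by (fastforce simp: comp_def)
  qed
  then show "case p of (V, \<psi>) => vsmooth E ((g \<circ> f) -` V) (\<psi> \<circ> (g \<circ> f))"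
    by (auto simp: vsmooth_def p')
qed

lemma smooth_map_cong:
  assumes "smooth_manifold E" "smooth_manifold F" "smooth_map E F f" "\<And>x. x \<in> topspace (mtop E) ==> f x = g x"
  shows "smooth_map E F g"
proof -
  interpret E: smanifold E by unfold_locales fact
  interpret F: smanifold F by unfold_locales fact
  have cont: "continuous_map (mtop E) (mtop F) f" using assms(3) by (simp add: smooth_map_def)
  show ?thesis
    unfolding smooth_map_def
  proof (intro conjI ballI, goal_cases)
    case 1 show ?case using cont assms(4) by (rule continuous_map_eq)
  next
    case (2 p)
    obtain U \<kappa> where p: "p = (U, \<kappa>)" by (cases p)
    have U: "openin (mtop E) U" using 2 p E.chart_openin by blast
    then have Us: "U \<subseteq> topspace (mtop E)" by (simp add: openin_subset)
    have "smooth_on (\<kappa> ` (U \<inter> g -` V)) (\<psi> \<circ> g \<circ> inv_into U \<kappa>)" if d: "(V, \<psi>) \<in> atlas F" for V \<psi>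
    proof -
      let ?W = "{y \<in> topspace (mtop E). f y \<in> V}"
      have W: "openin (mtop E) ?W" using cont F.chart_openin[OF d] by (intro openin_continuous_map_preimage)
      have eq: "U \<inter> g -` V = U \<inter> ?W" "U \<inter> f -` V = U \<inter> ?W" using Us assms(4) by auto
      have c: "(U, \<kappa>) \<in> atlas E" using 2 p by simp
      have "smooth_on (\<kappa> ` (U \<inter> ?W)) (\<psi> \<circ> f \<circ> inv_into U \<kappa>)"
        using assms(3) c d eq(2) unfolding smooth_map_def by fastforce
      then show ?thesis unfolding eq(1)
        by (rule smooth_on_cong[OF E.chart_open[OF c W], rotated])
          (use E.chart_inj[OF c] Us assms(4) in auto)
    qed
    then show ?case by (auto simp: p)
  qed
qed

lemma smooth_map_id: assumes "smooth_manifold E" shows "smooth_map E E (\<lambda>x. x)"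
proof -
  interpret smanifold E by unfold_locales fact
  show ?thesis unfolding smooth_map_def
  proof (intro conjI ballI, goal_cases)
    case 1 show ?case by simp
  next
    case (2 p) then show ?case using chart_trans by (auto simp: comp_def)
  qed
qed

lemma smooth_manifold_open_sub:
  assumes "smooth_manifold E" "openin (mtop E) U"
  shows "smooth_manifold (open_sub E U)"
proof -
  interpret smanifold E by unfold_locales fact
  have Us: "U \<subseteq> topspace (mtop E)" using assms(2) by (simp add: openin_subset)
  have top: "mtop (open_sub E U) = subtopology (mtop E) U" by (simp add: open_sub_def)
  have at: "atlas (open_sub E U) = {(V \<inter> U, \<kappa>) |V \<kappa>. (V, \<kappa>) \<in> atlas E}" by (simp add: open_sub_def)
  show ?thesis unfolding smooth_manifold_def
  proof (intro conjI)
    have "\<Union> (fst ` atlas (open_sub E U)) = \<Union> (fst ` atlas E) \<inter> U"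
      unfolding at by (auto simp: image_iff) blast
    then show "\<Union> (fst ` atlas (open_sub E U)) = topspace (mtop (open_sub E U))"
      using mfd by (simp add: smooth_manifold_def top)
    have "openin (mtop (open_sub E U)) (V \<inter> U) \<and> open (\<kappa> ` (V \<inter> U)) \<and>
       homeomorphic_map (subtopology (mtop (open_sub E U)) (V \<inter> U)) (top_of_set (\<kappa> ` (V \<inter> U))) \<kappa>"
      if c: "(V, \<kappa>) \<in> atlas E" for V \<kappa>
    proof (intro conjI)
      show "openin (mtop (open_sub E U)) (V \<inter> U)"
        unfolding top using chart_openin[OF c] by (simp add: openin_subtopology_Int)
      show "open (\<kappa> ` (V \<inter> U))" by (rule chart_open[OF c assms(2)])
      show "homeomorphic_map (subtopology (mtop (open_sub E U)) (V \<inter> U)) (top_of_set (\<kappa> ` (V \<inter> U))) \<kappa>"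
        using chart_homeo_sub[OF c, of "V \<inter> U"] by (simp add: top subtopology_subtopology inf_commute inf_left_commute)
    qed
    then show "\<forall>(V, \<kappa>)\<in>atlas (open_sub E U). openin (mtop (open_sub E U)) V \<and> open (\<kappa> ` V) \<and>
       homeomorphic_map (subtopology (mtop (open_sub E U)) V) (top_of_set (\<kappa> ` V)) \<kappa>"
      unfolding at by blast
    have "smooth_on (\<kappa> ` ((V \<inter> U) \<inter> (V' \<inter> U))) (\<kappa>' \<circ> inv_into (V \<inter> U) \<kappa>)"
      if c: "(V, \<kappa>) \<in> atlas E" "(V', \<kappa>') \<in> atlas E" for V \<kappa> V' \<kappa>'
    proof -
      have eq: "(V \<inter> U) \<inter> (V' \<inter> U) = V \<inter> (V' \<inter> U)" by blast
      have "smooth_on (\<kappa> ` (V \<inter> (V' \<inter> U))) (\<kappa>' \<circ> inv_into V \<kappa>)"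
        by (rule smooth_on_subset[OF chart_trans[OF c]]) auto
      then show ?thesis unfolding eq
      proof (rule smooth_on_cong[rotated 2])
        show "open (\<kappa> ` (V \<inter> (V' \<inter> U)))" using chart_open[OF c(1)] chart_openin[OF c(2)] assms(2) by blast
        fix x assume "x \<in> \<kappa> ` (V \<inter> (V' \<inter> U))"
        then obtain y where y: "x = \<kappa> y" "y \<in> V" "y \<in> U" by blast
        have "inj_on \<kappa> (V \<inter> U)" using chart_inj[OF c(1)] by (rule inj_on_subset) blast
        then show "(\<kappa>' \<circ> inv_into V \<kappa>) x = (\<kappa>' \<circ> inv_into (V \<inter> U) \<kappa>) x"
          using y chart_inj[OF c(1)] by simp
      qed
    qed
    then show "\<forall>(V, \<kappa>)\<in>atlas (open_sub E U). \<forall>(V', \<kappa>')\<in>atlas (open_sub E U). smooth_on (\<kappa> ` (V \<inter> V')) (\<kappa>' \<circ> inv_into V \<kappa>)"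
      unfolding at by blast
  qed
qed

lemma vsmooth_open_sub:
  assumes "smooth_manifold E" "openin (mtop E) U" "openin (mtop E) W" "W \<subseteq> U"
  shows "vsmooth (open_sub E U) W f \<longleftrightarrow> vsmooth E W f"
proof -
  interpret smanifold E by unfold_locales fact
  have *: "smooth_on (\<kappa> ` (V \<inter> U \<inter> W)) (f \<circ> inv_into (V \<inter> U) \<kappa>) \<longleftrightarrow> smooth_on (\<kappa> ` (V \<inter> W)) (f \<circ> inv_into V \<kappa>)"
    if c: "(V, \<kappa>) \<in> atlas E" for V \<kappa>
  proof -
    have eq: "V \<inter> U \<inter> W = V \<inter> W" using assms(4) by blast
    have e: "inv_into (V \<inter> U) \<kappa> x = inv_into V \<kappa> x" if "x \<in> \<kappa> ` (V \<inter> W)" for x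
    proof -
      obtain y where "x = \<kappa> y" "y \<in> V" "y \<in> U" using \<open>x \<in> \<kappa> ` (V \<inter> W)\<close> assms(4) by blast
      moreover have "inj_on \<kappa> (V \<inter> U)" using chart_inj[OF c] by (rule inj_on_subset) blast
      ultimately show ?thesis using chart_inj[OF c] by simp
    qed
    show ?thesis unfolding eq
      using smooth_on_cong[OF chart_open[OF c assms(3)], of "f \<circ> inv_into (V \<inter> U) \<kappa>" "f \<circ> inv_into V \<kappa>"]
        smooth_on_cong[OF chart_open[OF c assms(3)], of "f \<circ> inv_into V \<kappa>" "f \<circ> inv_into (V \<inter> U) \<kappa>"] e
      by auto
  qed
  have at: "atlas (open_sub E U) = (\<lambda>p. (fst p \<inter> U, snd p)) ` atlas E" by (force simp: open_sub_def)
  show ?thesis unfolding vsmooth_def at using * by (simp add: split_beta cong: ball_cong)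
qed

text \<open>A chart-free form of being a local diffeomorphism: a local isomorphism of the sheaves of smooth
  functions. In this form composition and cancellation need no chain rule.\<close>

definition etale ::
  "'f::real_normed_field itself => ('p, 'e::{real_inner,heine_borel}) manifold
    => ('q, 'd::{real_inner,heine_borel}) manifold => ('p => 'q) => bool" where
  "etale T E F \<phi> \<longleftrightarrow> continuous_map (mtop E) (mtop F) \<phi> \<and> open_map (mtop E) (mtop F) \<phi> \<and>
     (\<forall>y\<in>topspace (mtop E). \<exists>U. openin (mtop E) U \<and> y \<in> U \<and> inj_on \<phi> U) \<and>
     (\<forall>W (f :: 'q => 'f). openin (mtop E) W \<longrightarrow> (vsmooth F (\<phi> ` W) f \<longleftrightarrow> vsmooth E W (\<lambda>y. f (\<phi> y))))"

lemma etaleD: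
  assumes "etale T E F \<phi>"
  shows etale_cont: "continuous_map (mtop E) (mtop F) \<phi>"
    and etale_open: "openin (mtop E) W ==> openin (mtop F) (\<phi> ` W)"
    and etale_inj: "y \<in> topspace (mtop E) ==> \<exists>U. openin (mtop E) U \<and> y \<in> U \<and> inj_on \<phi> U"
    and etale_in: "y \<in> topspace (mtop E) ==> \<phi> y \<in> topspace (mtop F)"
    and etale_preimage: "openin (mtop F) V ==> openin (mtop E) {y \<in> topspace (mtop E). \<phi> y \<in> V}"
  using assms unfolding etale_def by (auto simp: open_map_def continuous_map_def)

lemma etale_smooth:
  fixes f :: "'q => 'f::real_normed_field" and T :: "'f itself"
  assumes "etale T E F \<phi>" "openin (mtop E) W"
  shows "vsmooth F (\<phi> ` W) f \<longleftrightarrow> vsmooth E W (\<lambda>y. f (\<phi> y))"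
  using assms unfolding etale_def by blast

text \<open>Pulling functions back along \<phi> and along its local inverse gives the two directions
  of the smoothness equivalence on small open sets; continuity, openness and smoothness are then
  glued.\<close>

lemma local_diffeo_etale:
  assumes "smooth_manifold E" "smooth_manifold F" "local_diffeo E F \<phi>"
  shows "etale TYPE('f::real_normed_field) E F \<phi>"
proof -
  interpret E: smanifold E by unfold_locales fact
  interpret F: smanifold F by unfold_locales fact
  have loc: "\<exists>U. openin (mtop E) U \<and> y \<in> U \<and> inj_on \<phi> U \<and> continuous_map (subtopology (mtop E) U) (mtop F) \<phi> \<and>
      (\<forall>W. openin (mtop E) W \<longrightarrow> W \<subseteq> U \<longrightarrow> openin (mtop F) (\<phi> ` W) \<and>
        (\<forall>f::_ => 'f. vsmooth F (\<phi> ` W) f \<longleftrightarrow> vsmooth E W (\<lambda>y. f (\<phi> y))))"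
    if "y \<in> topspace (mtop E)" for y
  proof -
    from assms(3)[unfolded local_diffeo_def, rule_format, OF that]
    obtain U V where UV: "openin (mtop E) U" "y \<in> U" "openin (mtop F) V"
      and d: "diffeomorphism (open_sub E U) (open_sub F V) \<phi>" by (elim exE conjE)
    have Us: "U \<subseteq> topspace (mtop E)" "V \<subseteq> topspace (mtop F)" using UV by (simp_all add: openin_subset)
    have tops: "topspace (mtop (open_sub E U)) = U" "topspace (mtop (open_sub F V)) = V"
      "mtop (open_sub E U) = subtopology (mtop E) U" "mtop (open_sub F V) = subtopology (mtop F) V"
      using Us by (auto simp: open_sub_def)
    let ?g = "inv_into U \<phi>"
    have bij: "bij_betw \<phi> U V" and s1: "smooth_map (open_sub E U) (open_sub F V) \<phi>"
      and s2: "smooth_map (open_sub F V) (open_sub E U) ?g"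
      using d unfolding diffeomorphism_def tops(1,2) by blast+
    have inj: "inj_on \<phi> U" using bij by (simp add: bij_betw_def)
    have m: "smooth_manifold (open_sub E U)" "smooth_manifold (open_sub F V)"
      by (rule smooth_manifold_open_sub[OF assms(1) UV(1)], rule smooth_manifold_open_sub[OF assms(2) UV(3)])
    have c1: "continuous_map (subtopology (mtop E) U) (subtopology (mtop F) V) \<phi>"
      and c2: "continuous_map (subtopology (mtop F) V) (subtopology (mtop E) U) ?g"
      using s1 s2 unfolding smooth_map_def tops(3,4) by blast+
    have pre: "{z \<in> V. ?g z \<in> W} = \<phi> ` W" if "W \<subseteq> U" for W
    proof (intro equalityI subsetI)
      fix z assume "z \<in> {z \<in> V. ?g z \<in> W}"
      moreover from this have "\<phi> (?g z) = z" using bij by (auto simp: bij_betw_def intro: f_inv_into_f)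
      ultimately show "z \<in> \<phi> ` W" by (metis imageI mem_Collect_eq)
    next
      fix z assume "z \<in> \<phi> ` W"
      then obtain w where "w \<in> W" "z = \<phi> w" by blast
      then show "z \<in> {z \<in> V. ?g z \<in> W}" using that inj bij by (auto simp: bij_betw_def subset_iff)
    qed
    show ?thesis
    proof (intro exI[of _ U] conjI allI impI)
      show "continuous_map (subtopology (mtop E) U) (mtop F) \<phi>"
        using c1 continuous_map_into_fulltopology by blast
      fix W assume W: "openin (mtop E) W" "W \<subseteq> U"
      have "openin (subtopology (mtop E) U) W" using W UV(1) by (simp add: openin_open_subtopology)
      from openin_continuous_map_preimage[OF c2 this] have "openin (subtopology (mtop F) V) (\<phi> ` W)"
        using pre[OF W(2)] Us(2) by (simp add: Int_absorb1)
      then show oW: "openin (mtop F) (\<phi> ` W)" using UV(3) by (simp add: openin_open_subtopology)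
      have WV: "\<phi> ` W \<subseteq> V" using W(2) bij by (auto simp: bij_betw_def)
      fix f :: "_ => 'f"
      have v1: "vsmooth (open_sub E U) W g \<longleftrightarrow> vsmooth E W g" for g :: "_ => 'f"
        by (rule vsmooth_open_sub[OF assms(1) UV(1) W])
      have v2: "vsmooth (open_sub F V) (\<phi> ` W) g \<longleftrightarrow> vsmooth F (\<phi> ` W) g" for g :: "_ => 'f"
        by (rule vsmooth_open_sub[OF assms(2) UV(3) oW WV])
      have o1: "openin (mtop (open_sub E U)) W" "openin (mtop (open_sub F V)) (\<phi> ` W)"
        unfolding tops(3,4) using oW W WV UV by (simp_all add: openin_open_subtopology)
      show "vsmooth F (\<phi> ` W) f \<longleftrightarrow> vsmooth E W (\<lambda>y. f (\<phi> y))"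
      proof
        assume "vsmooth F (\<phi> ` W) f"
        then have "vsmooth (open_sub F V) (\<phi> ` W) f" unfolding v2 .
        from vsmooth_pullback[OF m s1 o1(2) this]
        have "vsmooth (open_sub E U) (U \<inter> \<phi> -` \<phi> ` W) (\<lambda>y. f (\<phi> y))" unfolding tops(1) .
        then have "vsmooth (open_sub E U) W (\<lambda>y. f (\<phi> y))"
          by (rule smanifold.vsmooth_subset[OF smanifold.intro[OF m(1)]]) (use W in blast)
        then show "vsmooth E W (\<lambda>y. f (\<phi> y))" unfolding v1 .
      next
        assume "vsmooth E W (\<lambda>y. f (\<phi> y))"
        then have "vsmooth (open_sub E U) W (\<lambda>y. f (\<phi> y))" unfolding v1 .
        from vsmooth_pullback[OF m(2,1) s2 o1(1) this]
        have *: "vsmooth (open_sub F V) (V \<inter> ?g -` W) (\<lambda>z. f (\<phi> (?g z)))" unfolding tops(2) .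
        have "V \<inter> ?g -` W = \<phi> ` W" using pre[OF W(2)] by blast
        then have "vsmooth F (\<phi> ` W) (\<lambda>z. f (\<phi> (?g z)))" using * v2 by simp
        moreover have "f (\<phi> (?g z)) = f z" if "z \<in> \<phi> ` W" for z
          using that WV bij by (metis bij_betw_def f_inv_into_f subsetD)
        ultimately show "vsmooth F (\<phi> ` W) f" by (rule F.vsmooth_cong[OF oW])
      qed
    qed (use UV inj in blast)+
  qed
  have cont: "continuous_map (mtop E) (mtop F) \<phi>"
  proof -
    have "\<exists>U. U \<in> {U. openin (mtop E) U \<and> continuous_map (subtopology (mtop E) U) (mtop F) \<phi>} \<and> y \<in> U \<and> \<phi> y = \<phi> y"
      if "y \<in> topspace (mtop E)" for y
      using loc[OF that] by (elim exE conjE) (intro exI conjI CollectI refl)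
    then show ?thesis
      by (intro pasting_lemma[of "{U. openin (mtop E) U \<and> continuous_map (subtopology (mtop E) U) (mtop F) \<phi>}"
            "mtop E" "\<lambda>U. U" "mtop F" "\<lambda>_. \<phi>"]) simp_all
  qed
  \<comment> \<open>Intersecting with a neighbourhood on which \<phi> is a diffeomorphism yields
    good sets inside any given \<open>W\<close>.\<close>
  have pieces: "\<exists>W'. openin (mtop E) W' \<and> y \<in> W' \<and> W' \<subseteq> W \<and> openin (mtop F) (\<phi> ` W') \<and>
        (\<forall>f::_ => 'f. vsmooth F (\<phi> ` W') f \<longleftrightarrow> vsmooth E W' (\<lambda>y. f (\<phi> y)))"
    if "openin (mtop E) W" "y \<in> W" for W y
  proof -
    have "y \<in> topspace (mtop E)" using that openin_subset by blast
    from loc[OF this] obtain U where U: "openin (mtop E) U" "y \<in> U"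
      and UW: "\<forall>W. openin (mtop E) W \<longrightarrow> W \<subseteq> U \<longrightarrow> openin (mtop F) (\<phi> ` W) \<and>
        (\<forall>f::_ => 'f. vsmooth F (\<phi> ` W) f \<longleftrightarrow> vsmooth E W (\<lambda>y. f (\<phi> y)))" by (elim exE conjE)
    have o: "openin (mtop E) (U \<inter> W)" using U that by blast
    show ?thesis using UW[rule_format, OF o Int_lower1] o U(2) that(2)
      by (intro exI[of _ "U \<inter> W"]) simp
  qed
  show ?thesis
    unfolding etale_def
  proof (intro conjI ballI allI impI cont)
    show "open_map (mtop E) (mtop F) \<phi>"
      unfolding open_map_def
    proof (intro allI impI)
      fix W assume W: "openin (mtop E) W"
      show "openin (mtop F) (\<phi> ` W)"
      proof (subst openin_subopen, clarify)
        fix y assume y: "y \<in> W"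
        from pieces[OF W y] show "\<exists>T. openin (mtop F) T \<and> \<phi> y \<in> T \<and> T \<subseteq> \<phi> ` W" by (meson image_eqI image_mono)
      qed
    qed
    show "\<exists>U. openin (mtop E) U \<and> y \<in> U \<and> inj_on \<phi> U" if "y \<in> topspace (mtop E)" for y
      using loc[OF that] by (elim exE conjE) (intro exI conjI)
    fix W and f :: "_ => 'f" assume W: "openin (mtop E) W"
    show "vsmooth F (\<phi> ` W) f \<longleftrightarrow> vsmooth E W (\<lambda>y. f (\<phi> y))"
    proof
      assume f: "vsmooth F (\<phi> ` W) f"
      show "vsmooth E W (\<lambda>y. f (\<phi> y))"
      proof (rule E.vsmooth_local)
        fix y assume "y \<in> W"
        from pieces[OF W this] show "\<exists>V. openin (mtop E) V \<and> y \<in> V \<and> vsmooth E V (\<lambda>y. f (\<phi> y))"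
          using F.vsmooth_subset[OF f image_mono] by blast
      qed
    next
      assume f: "vsmooth E W (\<lambda>y. f (\<phi> y))"
      show "vsmooth F (\<phi> ` W) f"
      proof (rule F.vsmooth_local)
        fix z assume "z \<in> \<phi> ` W"
        then obtain y where y: "y \<in> W" "z = \<phi> y" by blast
        from pieces[OF W y(1)] show "\<exists>V. openin (mtop F) V \<and> z \<in> V \<and> vsmooth F V f"
          using E.vsmooth_subset[OF f] y(2) by blast
      qed
    qed
  qed
qed

lemma etale_compose:
  fixes T :: "'f::real_normed_field itself"
  assumes "etale T E F \<phi>" "etale T F H \<psi>"
  shows "etale T E H (\<lambda>y. \<psi> (\<phi> y))"
  unfolding etale_def
proof (intro conjI ballI allI impI)
  show "continuous_map (mtop E) (mtop H) (\<lambda>y. \<psi> (\<phi> y))"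
    using continuous_map_compose[OF etale_cont[OF assms(1)] etale_cont[OF assms(2)]] by (simp add: comp_def)
  have im: "(\<lambda>y. \<psi> (\<phi> y)) ` W = \<psi> ` \<phi> ` W" for W by auto
  show "open_map (mtop E) (mtop H) (\<lambda>y. \<psi> (\<phi> y))"
    unfolding open_map_def im using etale_open[OF assms(1)] etale_open[OF assms(2)] by blast
  fix W and f :: "_ => 'f" assume W: "openin (mtop E) W"
  show "vsmooth H ((\<lambda>y. \<psi> (\<phi> y)) ` W) f \<longleftrightarrow> vsmooth E W (\<lambda>y. f (\<psi> (\<phi> y)))"
  proof -
    have "vsmooth H (\<psi> ` \<phi> ` W) f \<longleftrightarrow> vsmooth F (\<phi> ` W) (\<lambda>z. f (\<psi> z))"
      by (rule etale_smooth[OF assms(2) etale_open[OF assms(1) W]])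
    also have "\<dots> \<longleftrightarrow> vsmooth E W (\<lambda>y. f (\<psi> (\<phi> y)))"
      by (rule etale_smooth[OF assms(1) W])
    finally show ?thesis unfolding im .
  qed
next
  fix y assume y: "y \<in> topspace (mtop E)"
  obtain U where U: "openin (mtop E) U" "y \<in> U" "inj_on \<phi> U" using etale_inj[OF assms(1) y] by blast
  obtain V where V: "openin (mtop F) V" "\<phi> y \<in> V" "inj_on \<psi> V"
    using etale_inj[OF assms(2) etale_in[OF assms(1) y]] by blast
  let ?U = "U \<inter> {y \<in> topspace (mtop E). \<phi> y \<in> V}"
  have "inj_on (\<lambda>y. \<psi> (\<phi> y)) ?U" using U V by (auto simp: inj_on_def)
  then show "\<exists>U. openin (mtop E) U \<and> y \<in> U \<and> inj_on (\<lambda>y. \<psi> (\<phi> y)) U"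
    using U V y etale_preimage[OF assms(1) V(1)] by (intro exI[of _ ?U]) auto
qed

text \<open>On a small set \<phi> is the projection \<pi> followed by a local inverse of \<xi>, so
  all its properties come from these two. The diagonal, the second projection of a fibre product and
  groupoid homomorphisms are treated in this way.\<close>

lemma etale_cancel:
  fixes T :: "'f::real_normed_field itself"
  assumes "smooth_manifold E" "smooth_manifold F"
    and \<pi>: "etale T E M \<pi>" and \<xi>: "etale T F M \<xi>"
    and \<phi>: "continuous_map (mtop E) (mtop F) \<phi>" and eq: "\<And>y. y \<in> topspace (mtop E) ==> \<xi> (\<phi> y) = \<pi> y"
  shows "etale T E F \<phi>"
proof -
  interpret E: smanifold E by unfold_locales fact
  interpret F: smanifold F by unfold_locales fact
  have loc: "\<exists>W'. openin (mtop E) W' \<and> y \<in> W' \<and> W' \<subseteq> W \<and> inj_on \<phi> W' \<and> openin (mtop F) (\<phi> ` W') \<and>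
        (\<forall>f::_ => 'f. vsmooth F (\<phi> ` W') f \<longleftrightarrow> vsmooth E W' (\<lambda>y. f (\<phi> y)))"
    if W: "openin (mtop E) W" "y \<in> W" for W y
  proof -
    have y: "y \<in> topspace (mtop E)" using W openin_subset by blast
    obtain U where U: "openin (mtop E) U" "y \<in> U" "inj_on \<pi> U" using etale_inj[OF \<pi> y] by blast
    have "\<phi> y \<in> topspace (mtop F)" using \<phi> y by (auto simp: continuous_map_def)
    then obtain V where V: "openin (mtop F) V" "\<phi> y \<in> V" "inj_on \<xi> V" using etale_inj[OF \<xi>] by blast
    define W' where "W' = W \<inter> U \<inter> {y \<in> topspace (mtop E). \<phi> y \<in> V}"
    have W': "openin (mtop E) W'"
      unfolding W'_def using W U \<phi> V by (intro openin_Int openin_continuous_map_preimage)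
    have sub: "W' \<subseteq> topspace (mtop E)" "\<phi> ` W' \<subseteq> V" by (auto simp: W'_def)
    have Vs: "V \<subseteq> topspace (mtop F)" using V by (simp add: openin_subset)
    \<comment> \<open>Injectivity of \<xi> on \<open>V\<close> describes the image of
      \<open>W'\<close> through the base, which shows that it is open.\<close>
    have im: "\<phi> ` W' = V \<inter> {z \<in> topspace (mtop F). \<xi> z \<in> \<pi> ` W'}"
    proof (intro equalityI subsetI)
      fix z assume "z \<in> \<phi> ` W'"
      then show "z \<in> V \<inter> {z \<in> topspace (mtop F). \<xi> z \<in> \<pi> ` W'}" using sub Vs eq by auto
    next
      fix z assume z: "z \<in> V \<inter> {z \<in> topspace (mtop F). \<xi> z \<in> \<pi> ` W'}"
      then obtain y' where y': "y' \<in> W'" "\<xi> z = \<pi> y'" by auto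
      then have "\<xi> z = \<xi> (\<phi> y')" using eq sub by auto
      then have "z = \<phi> y'" using V(3) z y' sub by (auto dest: inj_onD)
      then show "z \<in> \<phi> ` W'" using y' by blast
    qed
    have o: "openin (mtop F) (\<phi> ` W')"
      unfolding im using V etale_preimage[OF \<xi> etale_open[OF \<pi> W']] by blast
    have xi_im: "\<xi> ` \<phi> ` W' = \<pi> ` W'"
      unfolding image_image by (rule image_cong) (use sub eq in auto)
    have sm: "vsmooth F (\<phi> ` W') f \<longleftrightarrow> vsmooth E W' (\<lambda>y. f (\<phi> y))" for f :: "_ => 'f"
    proof -
      \<comment> \<open>\<open>f\<close> transported to the base along the local inverse of \<xi>,
        so that smoothness in \<open>F\<close> and smoothness in \<open>E\<close> can both be
        compared with smoothness in \<open>M\<close>.\<close>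
      define f' where "f' x = f (inv_into V \<xi> x)" for x
      have f': "f' (\<xi> z) = f z" if "z \<in> V" for z using that V(3) by (simp add: f'_def)
      have "vsmooth F (\<phi> ` W') f \<longleftrightarrow> vsmooth F (\<phi> ` W') (\<lambda>z. f' (\<xi> z))"
      proof -
        have e: "f' (\<xi> z) = f z" if "z \<in> \<phi> ` W'" for z using f' sub(2) that by blast
        show ?thesis
          by (rule iffI; erule F.vsmooth_cong[OF o]; simp add: e)
      qed
      also have "\<dots> \<longleftrightarrow> vsmooth M (\<pi> ` W') f'"
        using etale_smooth[OF \<xi> o, of f'] xi_im by simp
      also have "\<dots> \<longleftrightarrow> vsmooth E W' (\<lambda>y. f' (\<pi> y))"
        by (rule etale_smooth[OF \<pi> W'])
      also have "\<dots> \<longleftrightarrow> vsmooth E W' (\<lambda>y. f (\<phi> y))"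
      proof -
        have e: "f' (\<pi> y) = f (\<phi> y)" if "y \<in> W'" for y
        proof -
          have "\<phi> y \<in> V" "y \<in> topspace (mtop E)" using sub that by blast+
          then show ?thesis using f'[of "\<phi> y"] eq[of y] by simp
        qed
        show ?thesis
          by (rule iffI; erule E.vsmooth_cong[OF W']; simp add: e)
      qed
      finally show ?thesis .
    qed
    have "inj_on \<phi> W'"
    proof (rule inj_onI)
      fix a b assume ab: "a \<in> W'" "b \<in> W'" "\<phi> a = \<phi> b"
      then have "\<pi> a = \<pi> b" using eq sub by (metis subsetD)
      then show "a = b" using U(3) ab by (auto simp: W'_def dest: inj_onD)
    qed
    then show ?thesis using W' W U V y o sm by (intro exI[of _ W']) (auto simp: W'_def)
  qed
  show ?thesis
    unfolding etale_def
  proof (intro conjI ballI allI impI \<phi>)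
    show "open_map (mtop E) (mtop F) \<phi>"
      unfolding open_map_def
    proof (intro allI impI)
      fix W assume W: "openin (mtop E) W"
      show "openin (mtop F) (\<phi> ` W)"
      proof (subst openin_subopen, clarify)
        fix y assume y: "y \<in> W"
        from loc[OF W y] show "\<exists>T. openin (mtop F) T \<and> \<phi> y \<in> T \<and> T \<subseteq> \<phi> ` W" by (meson image_eqI image_mono)
      qed
    qed
    show "\<exists>U. openin (mtop E) U \<and> y \<in> U \<and> inj_on \<phi> U" if "y \<in> topspace (mtop E)" for y
      using loc[OF openin_topspace that] by blast
    fix W and f :: "_ => 'f" assume W: "openin (mtop E) W"
    show "vsmooth F (\<phi> ` W) f \<longleftrightarrow> vsmooth E W (\<lambda>y. f (\<phi> y))"
    proof
      assume f: "vsmooth F (\<phi> ` W) f"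
      show "vsmooth E W (\<lambda>y. f (\<phi> y))"
      proof (rule E.vsmooth_local)
        fix y assume "y \<in> W"
        from loc[OF W this] show "\<exists>V. openin (mtop E) V \<and> y \<in> V \<and> vsmooth E V (\<lambda>y. f (\<phi> y))"
          using F.vsmooth_subset[OF f image_mono] by blast
      qed
    next
      assume f: "vsmooth E W (\<lambda>y. f (\<phi> y))"
      show "vsmooth F (\<phi> ` W) f"
      proof (rule F.vsmooth_local)
        fix z assume "z \<in> \<phi> ` W"
        then obtain y where y: "y \<in> W" "z = \<phi> y" by blast
        from loc[OF W y(1)] show "\<exists>V. openin (mtop F) V \<and> z \<in> V \<and> vsmooth F V f"
          using E.vsmooth_subset[OF f] y(2) by blast
      qed
    qed
  qed
qed

lemma etale_id: "etale T E E (\<lambda>y. y)"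
  unfolding etale_def by (auto simp: open_map_def inj_on_def intro: exI[of _ "topspace (mtop E)"])

subsection \<open>Fibre products\<close>

locale fib =
  E: smanifold E + F: smanifold F + M: smanifold M
  for E :: "('p, 'e::{real_inner,heine_borel}) manifold" and F :: "('q, 'e) manifold" and M :: "('m, 'e) manifold" +
  fixes TF :: "'f::real_normed_field itself" and \<pi> :: "'p => 'm" and \<xi> :: "'q => 'm"
  assumes \<pi>: "etale TYPE('f) E M \<pi>" and \<xi>: "etale TYPE('f) F M \<xi>"
begin

abbreviation "P \<equiv> fib_prod E \<pi> F \<xi>"

lemma mtop_P: "mtop P = fib_top E \<pi> F \<xi>" by (simp add: fib_prod_def)

lemma topspace_P: "topspace (mtop P) = {(y, z). y \<in> topspace (mtop E) \<and> z \<in> topspace (mtop F) \<and> \<pi> y = \<xi> z}"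
  by (auto simp: mtop_P fib_top_def)

lemma cont_fst: "continuous_map (mtop P) (mtop E) fst"
  unfolding mtop_P fib_top_def by (intro continuous_map_from_subtopology continuous_map_fst)

lemma cont_snd: "continuous_map (mtop P) (mtop F) snd"
  unfolding mtop_P fib_top_def by (intro continuous_map_from_subtopology continuous_map_snd)

lemma openin_box:
  assumes "openin (mtop E) U" "openin (mtop F) V"
  shows "openin (mtop P) {(y, z). y \<in> U \<and> z \<in> V \<and> \<pi> y = \<xi> z}"
proof -
  have "openin (prod_topology (mtop E) (mtop F)) (U \<times> V)" using assms by (simp add: openin_prod_Times_iff)
  then have "openin (mtop P) ((U \<times> V) \<inter> {(y, z). \<pi> y = \<xi> z})"
    unfolding mtop_P fib_top_def by (rule openin_subtopology_Int)
  moreover have "(U \<times> V) \<inter> {(y, z). \<pi> y = \<xi> z} = {(y, z). y \<in> U \<and> z \<in> V \<and> \<pi> y = \<xi> z}" by auto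
  ultimately show ?thesis by simp
qed

lemma box_nbhd:
  assumes "openin (mtop P) W" "(y, z) \<in> W"
  obtains U V where "openin (mtop E) U" "openin (mtop F) V" "y \<in> U" "z \<in> V"
    "{(y, z). y \<in> U \<and> z \<in> V \<and> \<pi> y = \<xi> z} \<subseteq> W"
proof -
  obtain T where T: "openin (prod_topology (mtop E) (mtop F)) T" "W = T \<inter> {(y, z). \<pi> y = \<xi> z}"
    using assms(1) unfolding mtop_P fib_top_def openin_subtopology by blast
  have "(y, z) \<in> T" using T(2) assms(2) by blast
  with T(1) obtain U V where UV: "openin (mtop E) U" "openin (mtop F) V" "y \<in> U" "z \<in> V" "U \<times> V \<subseteq> T"
    unfolding openin_prod_topology_alt by meson
  show thesis by (rule that[OF UV(1-4)]) (use UV(5) T(2) in blast)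
qed

text \<open>A point near \<open>y\<close> has a partner in \<open>V\<close> exactly if \<pi> sends
  it into the image of \<open>V\<close> under \<xi>, and this image is open because \<xi> is an open
  map.\<close>

lemma open_fst: assumes "openin (mtop P) W" shows "openin (mtop E) (fst ` W)"
proof (subst openin_subopen, clarify)
  fix y z assume yz: "(y, z) \<in> W"
  obtain U V where UV: "openin (mtop E) U" "openin (mtop F) V" "y \<in> U" "z \<in> V"
    "{(y, z). y \<in> U \<and> z \<in> V \<and> \<pi> y = \<xi> z} \<subseteq> W" using box_nbhd[OF assms yz] by blast
  have eq: "\<pi> y = \<xi> z" "y \<in> topspace (mtop E)" using yz openin_subset[OF assms] topspace_P by auto
  let ?T = "U \<inter> {y \<in> topspace (mtop E). \<pi> y \<in> \<xi> ` V}"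
  have "openin (mtop E) ?T" using UV(1) etale_preimage[OF \<pi> etale_open[OF \<xi> UV(2)]] by blast
  moreover have "?T \<subseteq> fst ` W"
  proof
    fix a assume "a \<in> ?T"
    then obtain v where "v \<in> V" "\<pi> a = \<xi> v" "a \<in> U" by auto
    then have "(a, v) \<in> W" using UV(5) by auto
    then show "a \<in> fst ` W" by force
  qed
  ultimately show "\<exists>T. openin (mtop E) T \<and> fst (y, z) \<in> T \<and> T \<subseteq> fst ` W"
    using UV eq by (intro exI[of _ ?T]) auto
qed

text \<open>Where \<xi> is injective, the second coordinate is determined by the first. Such sets
  carry the charts of the fibre product.\<close>

lemma fst_loc_inj:
  assumes "(y, z) \<in> topspace (mtop P)" "openin (mtop E) U" "y \<in> U"
  shows "\<exists>W. openin (mtop P) W \<and> (y, z) \<in> W \<and> inj_on fst W \<and> fst ` W \<subseteq> U"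
proof -
  have yz: "z \<in> topspace (mtop F)" "\<pi> y = \<xi> z" using assms(1) topspace_P by auto
  obtain V where V: "openin (mtop F) V" "z \<in> V" "inj_on \<xi> V" using etale_inj[OF \<xi> yz(1)] by blast
  show ?thesis
    by (rule exI[of _ "{(y, z). y \<in> U \<and> z \<in> V \<and> \<pi> y = \<xi> z}"])
      (use V assms(2,3) yz openin_box in \<open>auto simp: inj_on_def\<close>)
qed

lemma atlas_P: "(W, \<rho>) \<in> atlas P \<longleftrightarrow> (\<exists>U \<kappa>. \<rho> = \<kappa> \<circ> fst \<and> (U, \<kappa>) \<in> atlas E \<and> openin (mtop P) W \<and> fst ` W \<subseteq> U \<and> inj_on fst W)"
  by (auto simp: fib_prod_def)

lemma inv_chart_P:
  assumes "(U, \<kappa>) \<in> atlas E" "fst ` W \<subseteq> U" "inj_on fst W" "p \<in> W"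
  shows "inv_into W (\<kappa> \<circ> fst) (\<kappa> (fst p)) = p" and "inv_into U \<kappa> (\<kappa> (fst p)) = fst p"
proof -
  have "inj_on \<kappa> (fst ` W)" using E.chart_inj[OF assms(1)] assms(2) by (rule inj_on_subset)
  then have "inj_on (\<kappa> \<circ> fst) W" using assms(3) by (rule comp_inj_on[rotated])
  then show "inv_into W (\<kappa> \<circ> fst) (\<kappa> (fst p)) = p"
    using inv_into_f_f[of "\<kappa> \<circ> fst" W p] assms(4) by simp
  show "inv_into U \<kappa> (\<kappa> (fst p)) = fst p" using E.chart_inj[OF assms(1)] assms(2,4) by auto
qed

text \<open>Where \<open>fst\<close> is injective it is a homeomorphism onto an open subset of
  \<open>E\<close>, so charts and transition maps are those of \<open>E\<close>.\<close>

lemma smooth_manifold_P: "smooth_manifold P"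
  unfolding smooth_manifold_def
proof (intro conjI ballI, goal_cases)
  case 1
  show ?case
  proof (intro equalityI subsetI)
    fix p assume "p \<in> \<Union> (fst ` atlas P)"
    then show "p \<in> topspace (mtop P)" using openin_subset by (fastforce simp: atlas_P)
  next
    fix p assume p: "p \<in> topspace (mtop P)"
    obtain y z where yz: "p = (y, z)" by (cases p)
    obtain U \<kappa> where c: "(U, \<kappa>) \<in> atlas E" "y \<in> U" using E.chart_exists p yz topspace_P by blast
    obtain W where W: "openin (mtop P) W" "(y, z) \<in> W" "inj_on fst W" "fst ` W \<subseteq> U"
      using fst_loc_inj[of y z U] p yz c E.chart_openin by blast
    then have "(W, \<kappa> \<circ> fst) \<in> atlas P" using c atlas_P by blast
    then show "p \<in> \<Union> (fst ` atlas P)" using W yz by force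
  qed
next
  case (2 q)
  obtain W U \<kappa> where q: "q = (W, \<kappa> \<circ> fst)" and c: "(U, \<kappa>) \<in> atlas E" and W: "openin (mtop P) W" "fst ` W \<subseteq> U" "inj_on fst W"
    using 2 by (cases q) (auto simp: atlas_P)
  have oW: "open (\<kappa> ` V)" if "openin (mtop E) V" "V \<subseteq> U" for V
    using E.chart_open[OF c that(1)] that(2) by (simp add: Int_absorb1)
  have f1: "homeomorphic_map (subtopology (mtop P) W) (subtopology (mtop E) (fst ` W)) fst"
  proof (rule bijective_open_imp_homeomorphic_map)
    show "continuous_map (subtopology (mtop P) W) (subtopology (mtop E) (fst ` W)) fst"
      by (auto simp: continuous_map_in_subtopology intro: continuous_map_from_subtopology[OF cont_fst])
    show "open_map (subtopology (mtop P) W) (subtopology (mtop E) (fst ` W)) fst"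
      unfolding open_map_def using W(1) open_fst by (auto simp: openin_open_subtopology)
    show "fst ` topspace (subtopology (mtop P) W) = topspace (subtopology (mtop E) (fst ` W))"
      using openin_subset[OF W(1)] openin_subset[OF open_fst[OF W(1)]] by (simp add: Int_absorb1)
    show "inj_on fst (topspace (subtopology (mtop P) W))" using W(3) by (auto intro: inj_on_subset)
  qed
  have f2: "homeomorphic_map (subtopology (mtop E) (fst ` W)) (top_of_set (\<kappa> ` fst ` W)) \<kappa>"
    by (rule E.chart_homeo_sub[OF c W(2)])
  have "homeomorphic_map (subtopology (mtop P) W) (top_of_set ((\<kappa> \<circ> fst) ` W)) (\<kappa> \<circ> fst)"
    using homeomorphic_map_compose[OF f1 f2] by (simp add: image_comp)
  moreover have "open ((\<kappa> \<circ> fst) ` W)" using oW[OF open_fst[OF W(1)] W(2)] by (simp add: image_comp)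
  ultimately show ?case using W q by simp
next
  case (3 q)
  obtain W U \<kappa> where q: "q = (W, \<kappa> \<circ> fst)" and c: "(U, \<kappa>) \<in> atlas E" and W: "openin (mtop P) W" "fst ` W \<subseteq> U" "inj_on fst W"
    using 3 by (cases q) (auto simp: atlas_P)
  have "smooth_on ((\<kappa> \<circ> fst) ` (W \<inter> W')) (\<rho>' \<circ> inv_into W (\<kappa> \<circ> fst))" if d0: "(W', \<rho>') \<in> atlas P" for W' \<rho>'
  proof -
    obtain U' \<kappa>' where d: "(U', \<kappa>') \<in> atlas E" "\<rho>' = \<kappa>' \<circ> fst" and W': "openin (mtop P) W'" "fst ` W' \<subseteq> U'" "inj_on fst W'"
      using d0 unfolding atlas_P by (elim exE conjE)
    have o: "openin (mtop E) (fst ` (W \<inter> W'))" using open_fst W(1) W'(1) by blast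
    have "open (\<kappa> ` (U \<inter> fst ` (W \<inter> W')))" by (rule E.chart_open[OF c o])
    moreover have e: "U \<inter> fst ` (W \<inter> W') = fst ` (W \<inter> W')" using W(2) by auto
    ultimately have o': "open (\<kappa> ` fst ` (W \<inter> W'))" by simp
    have "smooth_on (\<kappa> ` fst ` (W \<inter> W')) (\<kappa>' \<circ> inv_into U \<kappa>)"
      by (rule smooth_on_subset[OF E.chart_trans[OF c d(1)]]) (use W(2) W'(2) in auto)
    then have "smooth_on (\<kappa> ` fst ` (W \<inter> W')) (\<rho>' \<circ> inv_into W (\<kappa> \<circ> fst))"
    proof (rule smooth_on_cong[OF o', rotated])
      fix x assume "x \<in> \<kappa> ` fst ` (W \<inter> W')"
      then obtain p where p: "p \<in> W" "x = \<kappa> (fst p)" by auto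
      then show "(\<kappa>' \<circ> inv_into U \<kappa>) x = (\<rho>' \<circ> inv_into W (\<kappa> \<circ> fst)) x"
        using inv_chart_P[OF c W(2,3) p(1)] d(2) by simp
    qed
    then show ?thesis by (simp add: image_comp)
  qed
  then show ?case by (auto simp: q)
qed

sublocale P: smanifold P by unfold_locales (rule smooth_manifold_P)

lemma vsmooth_fst:
  assumes "openin (mtop P) W"
  shows "vsmooth E (fst ` W) f \<longleftrightarrow> vsmooth P W (\<lambda>p. f (fst p))"
proof
  assume f: "vsmooth E (fst ` W) f"
  show "vsmooth P W (\<lambda>p. f (fst p))"
    unfolding vsmooth_def
  proof clarify
    fix W' \<rho> assume "(W', \<rho>) \<in> atlas P"
    then obtain U \<kappa> where d: "(U, \<kappa>) \<in> atlas E" "\<rho> = \<kappa> \<circ> fst" and W': "openin (mtop P) W'" "fst ` W' \<subseteq> U" "inj_on fst W'"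
      by (auto simp: atlas_P)
    have o: "openin (mtop E) (fst ` (W' \<inter> W))" using open_fst assms W'(1) by blast
    have "open (\<kappa> ` (U \<inter> fst ` (W' \<inter> W)))" by (rule E.chart_open[OF d(1) o])
    moreover have e: "U \<inter> fst ` (W' \<inter> W) = fst ` (W' \<inter> W)" using W'(2) by auto
    ultimately have o': "open (\<kappa> ` fst ` (W' \<inter> W))" by simp
    have "smooth_on (\<kappa> ` (U \<inter> fst ` W)) (f \<circ> inv_into U \<kappa>)" using f d unfolding vsmooth_def by blast
    then have "smooth_on (\<kappa> ` fst ` (W' \<inter> W)) (f \<circ> inv_into U \<kappa>)"
      by (rule smooth_on_subset) (use W' in auto)
    then have "smooth_on (\<kappa> ` fst ` (W' \<inter> W)) ((\<lambda>p. f (fst p)) \<circ> inv_into W' \<rho>)"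
    proof (rule smooth_on_cong[OF o', rotated])
      fix x assume "x \<in> \<kappa> ` fst ` (W' \<inter> W)"
      then obtain p where p: "p \<in> W'" "x = \<kappa> (fst p)" by auto
      then show "(f \<circ> inv_into U \<kappa>) x = ((\<lambda>p. f (fst p)) \<circ> inv_into W' \<rho>) x"
        using inv_chart_P[OF d(1) W'(2,3) p(1)] d(2) by simp
    qed
    then show "smooth_on (\<rho> ` (W' \<inter> W)) ((\<lambda>p. f (fst p)) \<circ> inv_into W' \<rho>)" by (simp add: d(2) image_comp)
  qed
next
  assume f: "vsmooth P W (\<lambda>p. f (fst p))"
  show "vsmooth E (fst ` W) f"
    unfolding vsmooth_def
  proof clarify
    fix U \<kappa> assume c: "(U, \<kappa>) \<in> atlas E"
    show "smooth_on (\<kappa> ` (U \<inter> fst ` W)) (f \<circ> inv_into U \<kappa>)"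
    proof (rule smooth_on_local)
      fix x assume "x \<in> \<kappa> ` (U \<inter> fst ` W)"
      then obtain y z where yz: "(y, z) \<in> W" "y \<in> U" "x = \<kappa> y" by auto
      have "(y, z) \<in> topspace (mtop P)" using yz openin_subset[OF assms] by blast
      then obtain W' where W': "openin (mtop P) W'" "(y, z) \<in> W'" "inj_on fst W'" "fst ` W' \<subseteq> U"
        using fst_loc_inj[OF _ E.chart_openin[OF c] yz(2)] by blast
      have d: "(W', \<kappa> \<circ> fst) \<in> atlas P" using c W' atlas_P by blast
      have o: "openin (mtop E) (fst ` (W' \<inter> W))" using open_fst assms W'(1) by blast
      have "open (\<kappa> ` (U \<inter> fst ` (W' \<inter> W)))" by (rule E.chart_open[OF c o])
      moreover have e: "U \<inter> fst ` (W' \<inter> W) = fst ` (W' \<inter> W)" using W'(4) by auto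
      ultimately have o': "open (\<kappa> ` fst ` (W' \<inter> W))" by simp
      have "smooth_on ((\<kappa> \<circ> fst) ` (W' \<inter> W)) ((\<lambda>p. f (fst p)) \<circ> inv_into W' (\<kappa> \<circ> fst))"
        using f d unfolding vsmooth_def by blast
      then have "smooth_on (\<kappa> ` fst ` (W' \<inter> W)) ((\<lambda>p. f (fst p)) \<circ> inv_into W' (\<kappa> \<circ> fst))"
        by (simp add: image_comp)
      then have "smooth_on (\<kappa> ` fst ` (W' \<inter> W)) (f \<circ> inv_into U \<kappa>)"
      proof (rule smooth_on_cong[OF o', rotated])
        fix x assume "x \<in> \<kappa> ` fst ` (W' \<inter> W)"
        then obtain p where p: "p \<in> W'" "x = \<kappa> (fst p)" by auto
        then show "((\<lambda>p. f (fst p)) \<circ> inv_into W' (\<kappa> \<circ> fst)) x = (f \<circ> inv_into U \<kappa>) x"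
          using inv_chart_P[OF c W'(4,3) p(1)] by simp
      qed
      moreover have "x \<in> \<kappa> ` fst ` (W' \<inter> W)" using yz W' by (metis IntI fst_conv imageI)
      ultimately show "\<exists>T. open T \<and> x \<in> T \<and> smooth_on T (f \<circ> inv_into U \<kappa>)" using o' by blast
    qed
  qed
qed

lemma etale_fst: "etale TYPE('f) P E fst"
  unfolding etale_def open_map_def
proof (intro conjI ballI allI impI cont_fst open_fst vsmooth_fst)
  fix p assume "p \<in> topspace (mtop P)"
  then show "\<exists>U. openin (mtop P) U \<and> p \<in> U \<and> inj_on fst U"
    using fst_loc_inj[of "fst p" "snd p" "topspace (mtop E)"] topspace_P by (cases p) fastforce
qed

lemma etale_snd: "etale TYPE('f) P F snd"
proof (rule etale_cancel[OF smooth_manifold_P F.mfd etale_compose[OF etale_fst \<pi>] \<xi> cont_snd])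
  show "\<xi> (snd y) = \<pi> (fst y)" if "y \<in> topspace (mtop P)" for y using that topspace_P by auto
qed

end

section \<open>Smooth functions with compact support\<close>

text \<open>The support is controlled by some compact \<open>K\<close> instead of the closure of the
  nonvanishing set: such a \<open>K\<close> passes to products, sums and images without any closure
  argument.\<close>

definition local_fun ::
  "('p, 'e::{real_inner,heine_borel}) manifold => 'p set => ('p => 'f::real_normed_field) => bool" where
  "local_fun E U f \<longleftrightarrow> openin (mtop E) U \<and> Hausdorff_space (subtopology (mtop E) U) \<and> vsmooth E U f \<and>
     (\<exists>K. compactin (mtop E) K \<and> K \<subseteq> U \<and> (\<forall>x\<in>U - K. f x = 0))"

lemma local_funE:
  assumes "local_fun E U f"
  obtains K where "openin (mtop E) U" "Hausdorff_space (subtopology (mtop E) U)" "vsmooth E U f"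
    "compactin (mtop E) K" "K \<subseteq> U" "\<And>x. x \<in> U ==> x \<notin> K ==> f x = 0"
  using assms unfolding local_fun_def by blast

lemma local_funI:
  assumes "openin (mtop E) U" "Hausdorff_space (subtopology (mtop E) U)" "vsmooth E U f"
    "compactin (mtop E) K" "K \<subseteq> U" "\<And>x. x \<in> U ==> x \<notin> K ==> f x = 0"
  shows "local_fun E U f"
  unfolding local_fun_def by (intro conjI exI[of _ K] ballI assms) (simp_all add: assms(6))

lemma local_fun_openin: "local_fun E U f ==> openin (mtop E) U"
  by (simp add: local_fun_def)

lemma local_fun_Hausdorff: "local_fun E U f ==> Hausdorff_space (subtopology (mtop E) U)"
  by (simp add: local_fun_def)

text \<open>In the Hausdorff space \<open>U\<close> a compact \<open>K\<close> is closed, so it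
  contains the closure of the set where \<open>f\<close> is nonzero.\<close>

lemma local_fun_iff:
  "openin (mtop E) U \<and> Hausdorff_space (subtopology (mtop E) U) \<and> compact_smooth_on E U f \<longleftrightarrow> local_fun E U f"
proof (cases "openin (mtop E) U \<and> Hausdorff_space (subtopology (mtop E) U)")
  case True
  then have U: "openin (mtop E) U" "Hausdorff_space (subtopology (mtop E) U)" by auto
  have Us: "U \<subseteq> topspace (mtop E)" using U openin_subset by blast
  let ?C = "subtopology (mtop E) U closure_of {x \<in> U. f x \<noteq> 0}"
  have "compactin (mtop E) ?C \<longleftrightarrow> (\<exists>K. compactin (mtop E) K \<and> K \<subseteq> U \<and> (\<forall>x\<in>U - K. f x = 0))"
  proof
    assume "compactin (mtop E) ?C"
    moreover have "?C \<subseteq> U" using closure_of_subset_topspace[of "subtopology (mtop E) U"] Us by auto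
    moreover have "{x \<in> U. f x \<noteq> 0} \<subseteq> ?C" by (rule closure_of_subset) (use Us in auto)
    ultimately show "\<exists>K. compactin (mtop E) K \<and> K \<subseteq> U \<and> (\<forall>x\<in>U - K. f x = 0)" by (intro exI[of _ ?C]) auto
  next
    assume "\<exists>K. compactin (mtop E) K \<and> K \<subseteq> U \<and> (\<forall>x\<in>U - K. f x = 0)"
    then obtain K where K: "compactin (mtop E) K" "K \<subseteq> U" "\<forall>x\<in>U - K. f x = 0" by blast
    have Kc: "compactin (subtopology (mtop E) U) K" using K by (simp add: compactin_subtopology)
    then have "closedin (subtopology (mtop E) U) K" by (rule compactin_imp_closedin[OF U(2)])
    then have "?C \<subseteq> K" by (intro closure_of_minimal) (use K in auto)
    then have "compactin (subtopology (mtop E) U) ?C"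
      by (rule closed_compactin[OF Kc]) simp
    then show "compactin (mtop E) ?C" by (simp add: compactin_subtopology)
  qed
  then show ?thesis using U by (simp add: local_fun_def compact_smooth_on_def smooth_fun_on_vsmooth)
next
  case False then show ?thesis by (auto simp: local_fun_def)
qed

context smanifold
begin

lemma local_fun_cong:
  assumes "local_fun E U f" "\<And>x. x \<in> U ==> f x = g x"
  shows "local_fun E U g"
  using assms(1)
proof (rule local_funE)
  fix K assume K: "openin (mtop E) U" "Hausdorff_space (subtopology (mtop E) U)" "vsmooth E U f"
    "compactin (mtop E) K" "K \<subseteq> U" "\<And>x. x \<in> U ==> x \<notin> K ==> f x = 0"
  show ?thesis by (rule local_funI[OF K(1,2) vsmooth_cong[OF K(1,3) assms(2)] K(4,5)]) (simp_all add: assms(2)[symmetric] K(6))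
qed

lemma local_fun_zero:
  assumes "openin (mtop E) U" "Hausdorff_space (subtopology (mtop E) U)"
  shows "local_fun E U (\<lambda>_. 0)"
  unfolding local_fun_def using assms by (auto simp: vsmooth_const intro: exI[of _ "{}"])

lemma local_fun_mult:
  assumes "local_fun E U f" "vsmooth E U g"
  shows "local_fun E U (\<lambda>x. f x * g x)"
  using assms(1)
proof (rule local_funE)
  fix K assume K: "openin (mtop E) U" "Hausdorff_space (subtopology (mtop E) U)" "vsmooth E U f"
    "compactin (mtop E) K" "K \<subseteq> U" "\<And>x. x \<in> U ==> x \<notin> K ==> f x = 0"
  show ?thesis by (rule local_funI[OF K(1,2) vsmooth_mult[OF K(1,3) assms(2)] K(4,5)]) (simp add: K(6))
qed

lemma local_fun_add:
  assumes "local_fun E U f" "local_fun E U g"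
  shows "local_fun E U (\<lambda>x. f x + g x)"
proof -
  obtain K L where "compactin (mtop E) K" "K \<subseteq> U" "\<forall>x\<in>U - K. f x = 0"
    "compactin (mtop E) L" "L \<subseteq> U" "\<forall>x\<in>U - L. g x = 0" using assms unfolding local_fun_def by blast
  then have "compactin (mtop E) (K \<union> L) \<and> K \<union> L \<subseteq> U \<and> (\<forall>x\<in>U - (K \<union> L). f x + g x = 0)"
    by (auto intro: compactin_Un)
  then show ?thesis
    using assms vsmooth_add[of U f g] local_fun_openin[OF assms(1)] local_fun_Hausdorff[OF assms(1)]
    by (intro local_funI[of E U _ "K \<union> L"]) (auto simp: local_fun_def)
qed

lemma local_fun_smult: "local_fun E U f ==> local_fun E U (\<lambda>x. c * f x)"
  using local_fun_mult[OF _ vsmooth_const[of U c]] by (simp add: mult.commute)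

lemma open_complement_compact:
  assumes "openin (mtop E) U" "Hausdorff_space (subtopology (mtop E) U)" "compactin (mtop E) K" "K \<subseteq> U"
  shows "openin (mtop E) (U - K)"
proof -
  have "compactin (subtopology (mtop E) U) K" using assms by (simp add: compactin_subtopology)
  then have "closedin (subtopology (mtop E) U) K" by (rule compactin_imp_closedin[OF assms(2)])
  then have "openin (subtopology (mtop E) U) (topspace (subtopology (mtop E) U) - K)"
    by (intro openin_diff openin_topspace)
  then show ?thesis using assms(1) openin_subset[OF assms(1)] by (simp add: openin_open_subtopology Int_absorb1)
qed

text \<open>Hausdorffness of the larger set makes the compact support closed there, so
  \<open>f\<close> is zero on the open set \<open>U - K\<close>, and \<open>W\<close> together with
  \<open>U - K\<close> covers \<open>U\<close>. In a non-Hausdorff manifold an extension by zero can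
  fail to be continuous.\<close>

lemma local_fun_extend:
  assumes "local_fun E W f" "openin (mtop E) U" "Hausdorff_space (subtopology (mtop E) U)" "W \<subseteq> U"
    and "\<And>x. x \<in> U ==> x \<notin> W ==> f x = 0"
  shows "local_fun E U f"
proof -
  obtain K where K: "openin (mtop E) W" "vsmooth E W f" "compactin (mtop E) K" "K \<subseteq> W" "\<And>x. x \<in> W ==> x \<notin> K ==> f x = 0"
    using assms(1) by (rule local_funE) blast
  have o: "openin (mtop E) (U - K)" by (rule open_complement_compact) (use assms K in auto)
  have "vsmooth E U f"
  proof (rule vsmooth_local)
    fix y assume y: "y \<in> U"
    show "\<exists>V. openin (mtop E) V \<and> y \<in> V \<and> vsmooth E V f"
    proof (cases "y \<in> W")
      case True then show ?thesis using K by blast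
    next
      case False
      have "vsmooth E (U - K) f"
        by (rule vsmooth_cong[OF o vsmooth_const[of _ 0]]) (use K(5) assms(5) in force)
      then show ?thesis using o y False K(4) by blast
    qed
  qed
  then show ?thesis
    by (rule local_funI[OF assms(2,3) _ K(3)]) (use K(4,5) assms(4,5) in blast)+
qed

text \<open>A bump function read in a chart. It is made zero outside \<open>W\<close> as a function
  on the whole type, so that the same function can serve on a larger open set.\<close>

lemma cutoff_point:
  assumes "openin (mtop E) V" "y \<in> V"
  obtains W N and c :: "'p => 'f::real_normed_field" where "W \<subseteq> V" "local_fun E W c"
    "openin (mtop E) N" "y \<in> N" "N \<subseteq> W" "\<And>x. x \<in> N ==> c x = 1" "\<And>x. x \<notin> W ==> c x = 0"
proof -
  have "y \<in> topspace (mtop E)" using assms openin_subset by blast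
  then obtain U \<kappa> where c: "(U, \<kappa>) \<in> atlas E" "y \<in> U" using chart_exists by blast
  have U: "openin (mtop E) U" "U \<subseteq> topspace (mtop E)" using chart_openin[OF c(1)] openin_subset by auto
  have o: "open (\<kappa> ` (U \<inter> V))" by (rule chart_open[OF c(1) assms(1)])
  moreover have "\<kappa> y \<in> \<kappa> ` (U \<inter> V)" using c assms by blast
  ultimately obtain s where s: "s > 0" "cball (\<kappa> y) s \<subseteq> \<kappa> ` (U \<inter> V)" using open_contains_cball by blast
  \<comment> \<open>The bump function reaches out to radius \<open>2 * r\<close>, which has to fit
    into the ball found in the chart image.\<close>
  define r where "r = s / 2"
  have r: "r > 0" "cball (\<kappa> y) (2 * r) \<subseteq> \<kappa> ` (U \<inter> V)" using s by (auto simp: r_def)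
  obtain b :: "'e => real" where b: "smooth_on UNIV b" "\<And>x. dist (\<kappa> y) x \<le> r ==> b x = 1"
    "\<And>x. dist (\<kappa> y) x \<ge> 2 * r ==> b x = 0" using bump_function_exists[OF r(1)] by metis
  define W where "W = U \<inter> V"
  have W: "openin (mtop E) W" unfolding W_def using U assms by blast
  have Wh: "homeomorphic_map (subtopology (mtop E) W) (top_of_set (\<kappa> ` W)) \<kappa>"
    by (rule chart_homeo_sub[OF c(1)]) (simp add: W_def)
  have HW: "Hausdorff_space (subtopology (mtop E) W)"
  proof -
    have "Hausdorff_space (top_of_set (\<kappa> ` W))" by (intro Hausdorff_space_subtopology) simp
    then show ?thesis
      using homeomorphic_map_imp_homeomorphic_space[OF Wh] homeomorphic_Hausdorff_space by blast
  qed
  define ch where "ch x = (if x \<in> W then of_real (b (\<kappa> x)) else 0 :: 'f)" for x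
  obtain g where g: "homeomorphic_maps (subtopology (mtop E) W) (top_of_set (\<kappa> ` W)) \<kappa> g"
    using Wh homeomorphic_map_maps by blast
  have Ws: "topspace (subtopology (mtop E) W) = W" using W openin_subset by (auto simp: Int_absorb1)
  have g': "continuous_map (top_of_set (\<kappa> ` W)) (subtopology (mtop E) W) g" "\<And>x. x \<in> W ==> g (\<kappa> x) = x"
    using g Ws by (auto simp: homeomorphic_maps_def)
  define K where "K = g ` cball (\<kappa> y) (2 * r)"
  have "compactin (top_of_set (\<kappa> ` W)) (cball (\<kappa> y) (2 * r))"
    using r(2) by (simp add: compactin_subtopology W_def)
  then have "compactin (subtopology (mtop E) W) K" unfolding K_def using g'(1) by (rule image_compactin)
  then have K: "compactin (mtop E) K" "K \<subseteq> W" by (simp_all add: compactin_subtopology)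
  have z: "ch x = 0" if "x \<in> W" "x \<notin> K" for x
  proof -
    have "\<kappa> x \<notin> cball (\<kappa> y) (2 * r)" using that g'(2)[OF that(1)] unfolding K_def by (metis imageI)
    then show ?thesis using b(3)[of "\<kappa> x"] that by (simp add: ch_def)
  qed
  have "smooth_on UNIV (\<lambda>x. of_real (b x) :: 'f)"
    by (rule smooth_on_linear_compose[OF open_UNIV bounded_linear_of_real b(1)])
  from vsmooth_subset[OF vsmooth_chart[OF c(1) this], of W]
  have "vsmooth E W (\<lambda>x. of_real (b (\<kappa> x)) :: 'f)" by (simp add: W_def)
  then have "vsmooth E W ch" by (rule vsmooth_cong[OF W]) (simp add: ch_def)
  then have lf: "local_fun E W ch" using z by (intro local_funI[of E W ch K] W HW K)
  define N where "N = {x \<in> topspace (subtopology (mtop E) W). \<kappa> x \<in> ball (\<kappa> y) r}"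
  have "continuous_map (subtopology (mtop E) W) euclidean \<kappa>"
    using homeomorphic_imp_continuous_map[OF Wh] continuous_map_into_fulltopology by blast
  then have "openin (subtopology (mtop E) W) N"
    unfolding N_def by (rule openin_continuous_map_preimage) (simp add: open_openin[symmetric])
  then have N: "openin (mtop E) N" using W by (simp add: openin_open_subtopology)
  have NW: "N \<subseteq> W" using Ws by (auto simp: N_def)
  have "y \<in> W" using c assms by (simp add: W_def)
  then have yN: "y \<in> N" using r(1) Ws by (simp add: N_def)
  have one: "ch x = 1" if "x \<in> N" for x
    using that NW b(2)[of "\<kappa> x"] by (auto simp: ch_def N_def)
  have zero: "ch x = 0" if "x \<notin> W" for x using that by (simp add: ch_def)
  have WV: "W \<subseteq> V" by (simp add: W_def)
  show thesis by (rule that[OF WV lf N yN NW one zero])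
qed

text \<open>Finitely many pointwise cutoffs cover \<open>K\<close>. They are combined by
  \<open>c (1 - d) + d\<close>, which equals 1 wherever \<open>c\<close> or \<open>d\<close>
  does.\<close>

lemma cutoff_compact:
  assumes U: "openin (mtop E) U" "Hausdorff_space (subtopology (mtop E) U)" and K: "compactin (mtop E) K" "K \<subseteq> U"
  obtains N and c :: "'p => 'f::real_normed_field" where "local_fun E U c" "openin (mtop E) N" "K \<subseteq> N" "N \<subseteq> U"
    "\<And>x. x \<in> N ==> c x = 1" "\<And>x. x \<notin> U ==> c x = 0"
proof -
  define \<N> where "\<N> = {N. openin (mtop E) N \<and> N \<subseteq> U \<and>
    (\<exists>c :: 'p => 'f. local_fun E U c \<and> (\<forall>x\<in>N. c x = 1) \<and> (\<forall>x. x \<notin> U \<longrightarrow> c x = 0))}"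
  have cov: "K \<subseteq> \<Union>\<N>"
  proof
    fix y assume "y \<in> K"
    then have "y \<in> U" using K by blast
    obtain W N and c :: "'p => 'f" where c: "W \<subseteq> U" "local_fun E W c"
      "openin (mtop E) N" "y \<in> N" "N \<subseteq> W" "\<And>x. x \<in> N ==> c x = 1" "\<And>x. x \<notin> W ==> c x = 0"
      by (rule cutoff_point[OF U(1) \<open>y \<in> U\<close>]) blast
    have "local_fun E U c" by (rule local_fun_extend[OF c(2) U c(1)]) (rule c(7))
    then have "N \<in> \<N>" using c unfolding \<N>_def by blast
    then show "y \<in> \<Union>\<N>" using c by blast
  qed
  have "\<forall>N\<in>\<N>. openin (mtop E) N" by (simp add: \<N>_def)
  then obtain \<F> where F: "finite \<F>" "\<F> \<subseteq> \<N>" "K \<subseteq> \<Union>\<F>"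
    using K(1) cov unfolding compactin_def by meson
  have "\<exists>c :: 'p => 'f. local_fun E U c \<and> (\<forall>x\<in>\<Union>\<F>. c x = 1) \<and> (\<forall>x. x \<notin> U \<longrightarrow> c x = 0)"
    using F(1,2)
  proof (induction \<F>)
    case empty
    then show ?case using local_fun_zero[OF U] by (intro exI[of _ "\<lambda>_. 0"]) auto
  next
    case (insert N \<F>)
    then obtain c :: "'p => 'f" where c: "local_fun E U c" "\<forall>x\<in>\<Union>\<F>. c x = 1" "\<forall>x. x \<notin> U \<longrightarrow> c x = 0" by auto
    obtain d :: "'p => 'f" where d: "local_fun E U d" "\<forall>x\<in>N. d x = 1" "\<forall>x. x \<notin> U \<longrightarrow> d x = 0"
      using insert.prems by (auto simp: \<N>_def)
    have "vsmooth E U (\<lambda>x. 1 + (-1) * d x)"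
      using d(1) U(1) by (intro vsmooth_add vsmooth_mult vsmooth_const) (auto simp: local_fun_def)
    then have "local_fun E U (\<lambda>x. c x * (1 + (-1) * d x) + d x)"
      by (intro local_fun_add local_fun_mult c d)
    then show ?case
      by (intro exI[of _ "\<lambda>x. c x * (1 + (-1) * d x) + d x"]) (use c d in auto)
  qed
  then obtain c :: "'p => 'f" where c: "local_fun E U c" "\<forall>x\<in>\<Union>\<F>. c x = 1" "\<forall>x. x \<notin> U \<longrightarrow> c x = 0" by (elim exE conjE)
  have o: "openin (mtop E) (\<Union>\<F>)" "\<Union>\<F> \<subseteq> U" using F(2) by (auto simp: \<N>_def)
  show thesis by (rule that[OF c(1) o(1) F(3) o(2)]) (use c(2,3) in blast)+
qed

text \<open>Supplies the companion of \<open>f\<close> that appears in every formula for the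
  comultiplication.\<close>

lemma local_unit:
  fixes f :: "'p => 'f::real_normed_field"
  assumes "local_fun E U f"
  obtains c :: "'p => 'f" where "local_fun E U c" "\<And>x. x \<in> U ==> f x * c x = f x"
proof -
  obtain K where K: "openin (mtop E) U" "Hausdorff_space (subtopology (mtop E) U)"
    "compactin (mtop E) K" "K \<subseteq> U" "\<And>x. x \<in> U ==> x \<notin> K ==> f x = 0"
    using assms by (rule local_funE) blast
  obtain N and c :: "'p => 'f" where c: "local_fun E U c" "K \<subseteq> N" "\<And>x. x \<in> N ==> c x = 1"
    by (rule cutoff_compact[OF K(1-4)]) (rule that)
  show thesis
  proof (rule that[OF c(1)])
    fix x assume "x \<in> U"
    then show "f x * c x = f x" using K(5)[of x] c(2,3) by (cases "x \<in> K") auto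
  qed
qed

end

section \<open>Germs and sections\<close>

lemma germ_mem: "h \<in> germ E y f \<longleftrightarrow> (\<forall>\<^sub>F x in nhdsin (mtop E) y. h x = f x)"
  by (simp add: germ_def)

lemma germ_self: "f \<in> germ E y f"
  by (simp add: germ_mem)

lemma germ_eq_iff: "germ E y f = germ E y g \<longleftrightarrow> (\<forall>\<^sub>F x in nhdsin (mtop E) y. f x = g x)"
proof
  assume "germ E y f = germ E y g" then show "\<forall>\<^sub>F x in nhdsin (mtop E) y. f x = g x"
    using germ_self[of f E y] by (simp add: germ_mem)
next
  assume *: "\<forall>\<^sub>F x in nhdsin (mtop E) y. f x = g x"
  show "germ E y f = germ E y g"
    by (auto simp: germ_def intro: eventually_elim2[OF _ *])
qed

lemma germ_eqI: "openin (mtop E) W ==> y \<in> W ==> (\<And>x. x \<in> W ==> f x = g x) ==> germ E y f = germ E y g"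
  unfolding germ_eq_iff eventually_nhdsin by blast

lemma germ_eqD:
  assumes "germ E y f = germ E y g" "y \<in> topspace (mtop E)"
  obtains W where "openin (mtop E) W" "y \<in> W" "\<And>x. x \<in> W ==> f x = g x"
  using assms unfolding germ_eq_iff eventually_nhdsin by blast

lemma stalk_ops:
  "\<zero>\<^bsub>stalk E y\<^esub> = germ E y (\<lambda>_. 0)"
  "germ E y f \<oplus>\<^bsub>stalk E y\<^esub> germ E y g = germ E y (\<lambda>x. f x + g x)"
  "germ E y f \<otimes>\<^bsub>stalk E y\<^esub> germ E y g = germ E y (\<lambda>x. f x * g x)"
  "c \<odot>\<^bsub>stalk E y\<^esub> germ E y f = germ E y (\<lambda>x. c * f x)"
proof -
  show "\<zero>\<^bsub>stalk E y\<^esub> = germ E y (\<lambda>_. 0)" by (simp add: stalk_def)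
  have a: "germ E y (\<lambda>x. f' x + g' x) = germ E y (\<lambda>x. f x + g x)" if "f' \<in> germ E y f" "g' \<in> germ E y g" for f' g'
    using that unfolding germ_eq_iff germ_mem by eventually_elim simp
  have m: "germ E y (\<lambda>x. f' x * g' x) = germ E y (\<lambda>x. f x * g x)" if "f' \<in> germ E y f" "g' \<in> germ E y g" for f' g'
    using that unfolding germ_eq_iff germ_mem by eventually_elim simp
  have s: "germ E y (\<lambda>x. c * f' x) = germ E y (\<lambda>x. c * f x)" if "f' \<in> germ E y f" for f'
    using that unfolding germ_eq_iff germ_mem by eventually_elim simp
  have "germ E y f \<oplus>\<^bsub>stalk E y\<^esub> germ E y g =
      {h. \<exists>f'\<in>germ E y f. \<exists>g'\<in>germ E y g. h \<in> germ E y (\<lambda>x. f' x + g' x)}" by (simp add: stalk_def)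
  also have "\<dots> = germ E y (\<lambda>x. f x + g x)"
  proof (intro equalityI subsetI)
    fix h assume "h \<in> {h. \<exists>f'\<in>germ E y f. \<exists>g'\<in>germ E y g. h \<in> germ E y (\<lambda>x. f' x + g' x)}"
    then show "h \<in> germ E y (\<lambda>x. f x + g x)" by (elim CollectE bexE) (simp only: a)
  qed (intro CollectI bexI[of _ f] bexI[of _ g] germ_self)
  finally show "germ E y f \<oplus>\<^bsub>stalk E y\<^esub> germ E y g = germ E y (\<lambda>x. f x + g x)" .
  have "germ E y f \<otimes>\<^bsub>stalk E y\<^esub> germ E y g =
      {h. \<exists>f'\<in>germ E y f. \<exists>g'\<in>germ E y g. h \<in> germ E y (\<lambda>x. f' x * g' x)}" by (simp add: stalk_def)
  also have "\<dots> = germ E y (\<lambda>x. f x * g x)"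
  proof (intro equalityI subsetI)
    fix h assume "h \<in> {h. \<exists>f'\<in>germ E y f. \<exists>g'\<in>germ E y g. h \<in> germ E y (\<lambda>x. f' x * g' x)}"
    then show "h \<in> germ E y (\<lambda>x. f x * g x)" by (elim CollectE bexE) (simp only: m)
  qed (intro CollectI bexI[of _ f] bexI[of _ g] germ_self)
  finally show "germ E y f \<otimes>\<^bsub>stalk E y\<^esub> germ E y g = germ E y (\<lambda>x. f x * g x)" .
  have "c \<odot>\<^bsub>stalk E y\<^esub> germ E y f = {h. \<exists>f'\<in>germ E y f. h \<in> germ E y (\<lambda>x. c * f' x)}" by (simp add: stalk_def)
  also have "\<dots> = germ E y (\<lambda>x. c * f x)"
  proof (intro equalityI subsetI)
    fix h assume "h \<in> {h. \<exists>f'\<in>germ E y f. h \<in> germ E y (\<lambda>x. c * f' x)}"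
    then show "h \<in> germ E y (\<lambda>x. c * f x)" by (elim CollectE bexE) (simp only: s)
  qed (intro CollectI bexI[of _ f] germ_self)
  finally show "c \<odot>\<^bsub>stalk E y\<^esub> germ E y f = germ E y (\<lambda>x. c * f x)" .
qed

lemma stalk_carrier: "carrier (stalk E y) = {germ E y f |f. \<exists>W. openin (mtop E) W \<and> y \<in> W \<and> vsmooth E W f}"
  by (simp add: stalk_def smooth_fun_on_vsmooth)

lemma stalkE:
  assumes "a \<in> carrier (stalk E y)"
  obtains f W where "a = germ E y f" "openin (mtop E) W" "y \<in> W" "vsmooth E W f"
  using assms by (auto simp: stalk_carrier)

lemma germ_in_stalk: "openin (mtop E) W ==> y \<in> W ==> vsmooth E W f ==> germ E y f \<in> carrier (stalk E y)"
  by (auto simp: stalk_carrier)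

context smanifold
begin

lemma stalk_closed:
  fixes a b :: "('p => 'f::real_normed_field) set"
  assumes "a \<in> carrier (stalk E y)" "b \<in> carrier (stalk E y)"
  shows "a \<oplus>\<^bsub>stalk E y\<^esub> b \<in> carrier (stalk E y)" "a \<otimes>\<^bsub>stalk E y\<^esub> b \<in> carrier (stalk E y)"
    "c \<odot>\<^bsub>stalk E y\<^esub> a \<in> carrier (stalk E y)"
proof -
  obtain f W where f: "a = germ E y f" "openin (mtop E) W" "y \<in> W" "vsmooth E W f" by (rule stalkE[OF assms(1)])
  obtain g V where g: "b = germ E y g" "openin (mtop E) V" "y \<in> V" "vsmooth E V g" by (rule stalkE[OF assms(2)])
  have o: "openin (mtop E) (W \<inter> V)" "y \<in> W \<inter> V" using f g by auto
  have s: "vsmooth E (W \<inter> V) f" "vsmooth E (W \<inter> V) g" using f g by (auto intro: vsmooth_subset)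
  show "a \<oplus>\<^bsub>stalk E y\<^esub> b \<in> carrier (stalk E y)" "a \<otimes>\<^bsub>stalk E y\<^esub> b \<in> carrier (stalk E y)"
    unfolding f(1) g(1) stalk_ops using o s by (auto intro!: germ_in_stalk vsmooth_add vsmooth_mult)
  show "c \<odot>\<^bsub>stalk E y\<^esub> a \<in> carrier (stalk E y)"
    unfolding f(1) stalk_ops using f by (auto intro!: germ_in_stalk vsmooth_mult vsmooth_const)
qed

lemma vspace_stalk: "y \<in> topspace (mtop E) ==> vspace (stalk E y :: ('f::real_normed_field, ('p => 'f) set) module)"
proof -
  assume y: "y \<in> topspace (mtop E)"
  show ?thesis
  proof (rule vspace.intro, rule vector_spaceI)
    show "\<zero>\<^bsub>stalk E y\<^esub> \<in> carrier (stalk E y :: ('f, ('p => 'f) set) module)"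
      unfolding stalk_ops by (rule germ_in_stalk[OF openin_topspace y vsmooth_const])
  qed (simp_all add: stalk_closed, auto elim!: stalkE simp: stalk_ops algebra_simps)
qed

lemma sections_carrier: "carrier (sections E) = (\<Pi>\<^sub>E y\<in>topspace (mtop E). carrier (stalk E y))"
  by (simp add: sections_def)

lemma sections_ops:
  assumes "y \<in> topspace (mtop E)"
  shows "(u \<oplus>\<^bsub>sections E\<^esub> v) y = u y \<oplus>\<^bsub>stalk E y\<^esub> v y" "(u \<otimes>\<^bsub>sections E\<^esub> v) y = u y \<otimes>\<^bsub>stalk E y\<^esub> v y"
    "(c \<odot>\<^bsub>sections E\<^esub> u) y = c \<odot>\<^bsub>stalk E y\<^esub> u y" "\<zero>\<^bsub>sections E\<^esub> y = \<zero>\<^bsub>stalk E y\<^esub>"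
  using assms by (simp_all add: sections_def)

lemma sections_closed:
  fixes u v :: "('p, 'f::real_normed_field) germs"
  assumes "u \<in> carrier (sections E)" "v \<in> carrier (sections E)"
  shows "u \<oplus>\<^bsub>sections E\<^esub> v \<in> carrier (sections E)" "u \<otimes>\<^bsub>sections E\<^esub> v \<in> carrier (sections E)"
  using assms by (auto simp: sections_def PiE_iff stalk_closed)

lemma sections_smult_closed: "u \<in> carrier (sections E) ==> c \<odot>\<^bsub>sections E\<^esub> u \<in> carrier (sections E)"
  by (auto simp: sections_def PiE_iff stalk_closed(3))

lemma section_eqI:
  assumes "u \<in> carrier (sections E)" "v \<in> carrier (sections E)" "\<And>y. y \<in> topspace (mtop E) ==> u y = v y"
  shows "u = v"
  using assms unfolding sections_carrier by (metis PiE_ext)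

lemma section_in: "u \<in> carrier (sections E) ==> y \<in> topspace (mtop E) ==> u y \<in> carrier (stalk E y)"
  by (auto simp: sections_carrier)

lemma vspace_sections: "vspace (sections E :: ('f::real_normed_field, ('p, 'f) germs) module)"
proof (rule vspace.intro, rule vector_spaceI)
  show "\<zero>\<^bsub>sections E\<^esub> \<in> carrier (sections E :: ('f, ('p, 'f) germs) module)"
    by (auto simp: sections_def stalk_ops intro!: germ_in_stalk[OF openin_topspace _ vsmooth_const])
  then have z: "\<zero>\<^bsub>sections E\<^esub> \<in> carrier (sections E :: ('f, ('p, 'f) germs) module)" .
  fix c d :: 'f and x y w :: "('p, 'f) germs"
  assume x: "x \<in> carrier (sections E)"
  show "c \<odot>\<^bsub>sections E\<^esub> x \<in> carrier (sections E)" by (rule sections_smult_closed[OF x])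
  have v: "vspace (stalk E p :: ('f, ('p => 'f) set) module)" if "p \<in> topspace (mtop E)" for p
    by (rule vspace_stalk[OF that])
  note ab = abelian_group.axioms(1)[OF module.axioms(2)[OF vspace.module_scalars[OF v]]]
  note cl = sections_smult_closed[OF x] z
  show "\<zero>\<^bsub>sections E\<^esub> \<oplus>\<^bsub>sections E\<^esub> x = x"
    by (rule section_eqI)
      (use x cl z sections_closed(1)[OF z x] in \<open>auto simp: sections_ops section_in abelian_monoid.l_zero[OF ab]\<close>)
  show "0 \<odot>\<^bsub>sections E\<^esub> x = \<zero>\<^bsub>sections E\<^esub>"
    by (rule section_eqI) (use x cl in \<open>auto simp: sections_ops section_in vspace.smult_zero_left[OF v]\<close>)
  show "1 \<odot>\<^bsub>sections E\<^esub> x = x"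
    by (rule section_eqI) (use x cl in \<open>auto simp: sections_ops section_in vspace.smult_unit[OF v]\<close>)
  show "(c + d) \<odot>\<^bsub>sections E\<^esub> x = c \<odot>\<^bsub>sections E\<^esub> x \<oplus>\<^bsub>sections E\<^esub> d \<odot>\<^bsub>sections E\<^esub> x"
    by (rule section_eqI)
      (use x cl in \<open>auto simp: sections_closed sections_smult_closed sections_ops section_in vspace.smult_add[OF v]\<close>)
  show "(c * d) \<odot>\<^bsub>sections E\<^esub> x = c \<odot>\<^bsub>sections E\<^esub> (d \<odot>\<^bsub>sections E\<^esub> x)"
    by (rule section_eqI)
      (use x cl in \<open>auto simp: sections_closed sections_smult_closed sections_ops section_in vspace.smult_mult[OF v]\<close>)
  assume y: "y \<in> carrier (sections E)"
  show "x \<oplus>\<^bsub>sections E\<^esub> y \<in> carrier (sections E)" by (rule sections_closed(1)[OF x y])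
  show "x \<oplus>\<^bsub>sections E\<^esub> y = y \<oplus>\<^bsub>sections E\<^esub> x"
    by (rule section_eqI)
      (use x y in \<open>auto simp: sections_closed sections_smult_closed sections_ops section_in abelian_monoid.a_comm[OF ab]\<close>)
  show "c \<odot>\<^bsub>sections E\<^esub> (x \<oplus>\<^bsub>sections E\<^esub> y) = c \<odot>\<^bsub>sections E\<^esub> x \<oplus>\<^bsub>sections E\<^esub> c \<odot>\<^bsub>sections E\<^esub> y"
    by (rule section_eqI)
      (use x y in \<open>auto simp: sections_closed sections_smult_closed sections_ops section_in vspace.smult_add_right[OF v]\<close>)
  assume w: "w \<in> carrier (sections E)"
  show "(x \<oplus>\<^bsub>sections E\<^esub> y) \<oplus>\<^bsub>sections E\<^esub> w = x \<oplus>\<^bsub>sections E\<^esub> (y \<oplus>\<^bsub>sections E\<^esub> w)"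
    by (rule section_eqI)
      (use x y w in \<open>auto simp: sections_closed sections_smult_closed sections_ops section_in abelian_monoid.a_assoc[OF ab]\<close>)
qed

lemma ext_section: "local_fun E U f ==> ext_by_zero E U f \<in> carrier (sections E)"
  unfolding sections_carrier ext_by_zero_def
  by (auto simp: stalk_ops local_fun_def intro!: germ_in_stalk vsmooth_const)

lemma Cc_ops [simp]:
  "add (Cc E) = add (sections E)" "zero (Cc E) = zero (sections E)" "smult (Cc E) = smult (sections E)"
  "mult (Cc E) = mult (sections E)"
  by (simp_all add: Cc_def)

lemma Cc_carrier: "carrier (Cc E) = lin_span (sections E) {ext_by_zero E U f |U f. local_fun E U f}"
  by (simp add: Cc_def local_fun_iff)

lemma Cc_generators: "{ext_by_zero E U f |U f. local_fun E U f} \<subseteq> carrier (sections E)"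
  using ext_section by blast

lemma vspace_Cc: "vspace (Cc E :: ('f::real_normed_field, ('p, 'f) germs) module)"
  using vspace.vspace_lin_span[OF vspace_sections Cc_generators] by (simp add: Cc_def local_fun_iff)

lemma Cc_section: "u \<in> carrier (Cc E) ==> u \<in> carrier (sections E)"
  using vspace.lin_span_subset[OF vspace_sections Cc_generators] unfolding Cc_carrier by blast

lemma ext_in_Cc: "local_fun E U f ==> ext_by_zero E U f \<in> carrier (Cc E)"
  unfolding Cc_carrier by (rule vspace.lin_span_base[OF vspace_sections Cc_generators]) blast

lemma Cc_in_stalk: "u \<in> carrier (Cc E) ==> y \<in> topspace (mtop E) ==> u y \<in> carrier (stalk E y)"
  using Cc_section section_in by blast

text \<open>Sections record germs, so at the points lost by shrinking \<open>U\<close> to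
  \<open>V\<close> the germ of \<open>f\<close> has to vanish, not merely its value.\<close>

lemma ext_eqI:
  assumes "local_fun E U f" "openin (mtop E) V" "V \<subseteq> U"
    and "\<And>x. x \<in> V ==> f x = g x" "\<And>x. x \<in> U ==> x \<notin> V ==> germ E x f = germ E x (\<lambda>_. 0)"
  shows "ext_by_zero E U f = ext_by_zero E V g"
proof
  fix y
  show "ext_by_zero E U f y = ext_by_zero E V g y"
    using assms(3,5) germ_eqI[OF assms(2) _ assms(4)]
    by (cases "y \<in> topspace (mtop E)") (auto simp: ext_by_zero_def stalk_ops)
qed

lemma ext_cong: "openin (mtop E) U ==> (\<And>x. x \<in> U ==> f x = g x) ==> ext_by_zero E U f = ext_by_zero E U g"
  unfolding ext_by_zero_def using germ_eqI[of E U _ f g] by (auto simp: restrict_def fun_eq_iff)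

lemma ext_shrink:
  assumes "local_fun E U f" "openin (mtop E) V" "V \<subseteq> U"
    and "compactin (mtop E) K" "K \<subseteq> V" "\<And>x. x \<in> U ==> x \<notin> K ==> f x = 0"
  shows "ext_by_zero E U f = ext_by_zero E V f"
proof (rule ext_eqI[OF assms(1-3)])
  fix x assume x: "x \<in> U" "x \<notin> V"
  have "openin (mtop E) (U - K)"
    by (rule open_complement_compact) (use assms in \<open>auto simp: local_fun_def\<close>)
  then show "germ E x f = germ E x (\<lambda>_. 0)" by (rule germ_eqI) (use x assms in auto)
qed simp

lemma ext_extend:
  assumes "local_fun E W f" "openin (mtop E) U" "Hausdorff_space (subtopology (mtop E) U)" "W \<subseteq> U"
    and "\<And>x. x \<in> U ==> x \<notin> W ==> f x = 0"
  shows "ext_by_zero E U f = ext_by_zero E W f"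
proof -
  obtain K where K: "openin (mtop E) W" "compactin (mtop E) K" "K \<subseteq> W" "\<And>x. x \<in> W ==> x \<notin> K ==> f x = 0"
    using assms(1) by (rule local_funE) blast
  show ?thesis
  proof (rule ext_shrink[OF local_fun_extend[OF assms] K(1) assms(4) K(2,3)])
    fix x assume "x \<in> U" "x \<notin> K"
    then show "f x = 0" using K(4)[of x] assms(5)[of x] by (cases "x \<in> W") auto
  qed
qed

lemma ext_add: "ext_by_zero E U f \<oplus>\<^bsub>sections E\<^esub> ext_by_zero E U g = ext_by_zero E U (\<lambda>x. f x + g x)"
  by (rule ext) (simp add: sections_def ext_by_zero_def stalk_ops)

lemma ext_smult: "c \<odot>\<^bsub>sections E\<^esub> ext_by_zero E U f = ext_by_zero E U (\<lambda>x. c * f x)"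
  by (rule ext) (simp add: sections_def ext_by_zero_def stalk_ops)

lemma ext_zero: "openin (mtop E) U ==> (\<And>x. x \<in> U ==> f x = 0) ==> ext_by_zero E U f = \<zero>\<^bsub>sections E\<^esub>"
  using germ_eqI[of E U _ f "\<lambda>_. 0"] by (auto simp: sections_def ext_by_zero_def stalk_ops restrict_def fun_eq_iff)

text \<open>Cutting off repeatedly, \<open>f = f c + f (1 - c)\<close>, writes a compactly supported function as a finite sum
  of functions supported in members of any basis.\<close>

lemma Cc_induct [consumes 1, case_names basis zero ext add]:
  fixes u :: "('p, 'f::real_normed_field) germs"
  assumes u: "u \<in> carrier (Cc E)"
    and basis: "\<And>y. y \<in> topspace (mtop E) ==> \<exists>V. openin (mtop E) V \<and> y \<in> V \<and> (\<forall>W. openin (mtop E) W \<longrightarrow> W \<subseteq> V \<longrightarrow> Q W)"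
    and zero: "P \<zero>\<^bsub>sections E\<^esub>"
    and ext: "\<And>U f. local_fun E U f ==> Q U ==> P (ext_by_zero E U f)"
    and add: "\<And>u v. u \<in> carrier (Cc E) ==> v \<in> carrier (Cc E) ==> P u ==> P v ==> P (u \<oplus>\<^bsub>sections E\<^esub> v)"
  shows "P u"
proof -
  have loc: "P (ext_by_zero E U f)" if f: "local_fun E U f" for U and f :: "'p => 'f"
  proof -
    obtain K where K: "openin (mtop E) U" "Hausdorff_space (subtopology (mtop E) U)"
      "compactin (mtop E) K" "K \<subseteq> U" "\<And>x. x \<in> U ==> x \<notin> K ==> f x = 0"
      using f by (rule local_funE) blast
    define \<N> where "\<N> = {N. openin (mtop E) N \<and> N \<subseteq> U \<and>
      (\<exists>W (c :: 'p => 'f). Q W \<and> N \<subseteq> W \<and> W \<subseteq> U \<and> local_fun E W c \<and> (\<forall>x\<in>N. c x = 1) \<and> (\<forall>x. x \<notin> W \<longrightarrow> c x = 0))}"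
    have cov: "K \<subseteq> \<Union>\<N>"
    proof
      fix y assume "y \<in> K"
      then have y: "y \<in> U" using K by blast
      then have "y \<in> topspace (mtop E)" using openin_subset[OF K(1)] by blast
      then obtain V where V: "openin (mtop E) V" "y \<in> V" "\<forall>W. openin (mtop E) W \<longrightarrow> W \<subseteq> V \<longrightarrow> Q W"
        using basis by blast
      have VU: "openin (mtop E) (V \<inter> U)" "y \<in> V \<inter> U" using V y K by auto
      obtain W N and c :: "'p => 'f" where c: "W \<subseteq> V \<inter> U" "local_fun E W c"
        "openin (mtop E) N" "y \<in> N" "N \<subseteq> W" "\<And>x. x \<in> N ==> c x = 1" "\<And>x. x \<notin> W ==> c x = 0"
        by (rule cutoff_point[OF VU]) blast
      have "Q W" using V(3) c(1) local_fun_openin[OF c(2)] by blast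
      then have "N \<in> \<N>" unfolding \<N>_def
        by (intro CollectI conjI exI[of _ W] exI[of _ c]) (use c in auto)
      then show "y \<in> \<Union>\<N>" using c by blast
    qed
    have "\<forall>N\<in>\<N>. openin (mtop E) N" by (simp add: \<N>_def)
    then obtain \<F> where F: "finite \<F>" "\<F> \<subseteq> \<N>" "K \<subseteq> \<Union>\<F>"
      using K(3) cov unfolding compactin_def by meson
    \<comment> \<open>One covering set is removed at a time: after the part cut off at
      \<open>N\<close> is split off, the rest vanishes outside the compact set \<open>L - N\<close>,
      which the remaining sets cover.\<close>
    have "P (ext_by_zero E U g)"
      if "local_fun E U g" "compactin (mtop E) L" "L \<subseteq> U" "L \<subseteq> \<Union>\<F>" "\<And>x. x \<in> U ==> x \<notin> L ==> g x = 0" for g L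
      using F(1,2) that
    proof (induction \<F> arbitrary: g L)
      case empty
      then have "ext_by_zero E U g = \<zero>\<^bsub>sections E\<^esub>" by (intro ext_zero) (auto simp: K)
      then show ?case using zero by simp
    next
      case (insert N \<F>)
      obtain W and c :: "'p => 'f" where c: "Q W" "N \<subseteq> W" "W \<subseteq> U" "local_fun E W c" "\<forall>x\<in>N. c x = 1" "\<forall>x. x \<notin> W \<longrightarrow> c x = 0"
        and N: "openin (mtop E) N" "N \<subseteq> U"
        using insert.prems(1) by (auto simp: \<N>_def)
      have cU: "local_fun E U c" by (rule local_fun_extend[OF c(4) K(1,2) c(3)]) (use c(6) in blast)
      have gs: "vsmooth E U g" using insert.prems by (simp add: local_fun_def)
      have "local_fun E W (\<lambda>x. c x * g x)"
        by (rule local_fun_mult[OF c(4) vsmooth_subset[OF gs c(3)]])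
      then have "P (ext_by_zero E W (\<lambda>x. c x * g x))" using ext c(1) by blast
      moreover have e1: "ext_by_zero E U (\<lambda>x. c x * g x) = ext_by_zero E W (\<lambda>x. c x * g x)"
        by (rule ext_extend[OF _ K(1,2) c(3)]) (use \<open>local_fun E W (\<lambda>x. c x * g x)\<close> c(6) in auto)
      ultimately have P1: "P (ext_by_zero E U (\<lambda>x. c x * g x))" by simp
      have v: "vsmooth E U (\<lambda>x. 1 + (-1) * c x)"
        using cU K(1) by (intro vsmooth_add vsmooth_mult vsmooth_const) (auto simp: local_fun_def)
      have g2: "local_fun E U (\<lambda>x. g x * (1 + (-1) * c x))" by (rule local_fun_mult[OF insert.prems(2) v])
      have "closedin (subtopology (mtop E) U) (topspace (subtopology (mtop E) U) - N)"
        using N K(1) by (intro closedin_diff closedin_topspace) (simp add: openin_open_subtopology)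
      then have "compactin (subtopology (mtop E) U) (L \<inter> (topspace (subtopology (mtop E) U) - N))"
        using insert.prems by (intro compact_Int_closedin) (auto simp: compactin_subtopology)
      moreover have "L \<inter> (topspace (subtopology (mtop E) U) - N) = L - N"
        using insert.prems openin_subset[OF K(1)] by auto
      ultimately have "compactin (mtop E) (L - N)" by (simp add: compactin_subtopology)
      then have P2: "P (ext_by_zero E U (\<lambda>x. g x * (1 + (-1) * c x)))"
        by (intro insert.IH[of _ "L - N"] g2) (use insert.prems c(5) in auto)
      have "ext_by_zero E U g = ext_by_zero E U (\<lambda>x. c x * g x) \<oplus>\<^bsub>sections E\<^esub> ext_by_zero E U (\<lambda>x. g x * (1 + (-1) * c x))"
        unfolding ext_add by (rule ext_cong[OF K(1)]) (simp add: algebra_simps)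
      moreover have "ext_by_zero E U (\<lambda>x. c x * g x) \<in> carrier (Cc E)"
        by (rule ext_in_Cc[OF local_fun_mult[OF cU gs]])
      ultimately show ?case using add P1 P2 ext_in_Cc[OF g2] by simp
    qed
    then show ?thesis using f K F(3) by blast
  qed
  \<comment> \<open>Scalar multiples of generators are generators, so linear combinations reduce to
    sums.\<close>
  have gen: "\<And>b. b \<in> {ext_by_zero E U f |U f. local_fun E U f} ==> c \<odot>\<^bsub>sections E\<^esub> b \<in> {ext_by_zero E U f |U f. local_fun E U f}" for c :: 'f
    using local_fun_smult by (fastforce simp: ext_smult)
  show ?thesis using u unfolding Cc_carrier
  proof (induction rule: lin_span.induct)
    case 1 then show ?case by (rule zero)
  next
    case (2 b v c)
    have cb: "c \<odot>\<^bsub>sections E\<^esub> b \<in> {ext_by_zero E U f |U f. local_fun E U f}" by (rule gen[OF 2(1)])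
    then obtain U g where g: "c \<odot>\<^bsub>sections E\<^esub> b = ext_by_zero E U g" "local_fun E U g" by (elim CollectE exE conjE)
    then have "P (c \<odot>\<^bsub>sections E\<^esub> b)" by (simp add: loc)
    moreover have "c \<odot>\<^bsub>sections E\<^esub> b \<in> carrier (Cc E)" using g by (simp add: ext_in_Cc)
    moreover have "v \<in> carrier (Cc E)" using 2(2) by (simp add: Cc_carrier)
    ultimately show ?case using add 2(3) by blast
  qed
qed

lemma Cc_induct_ext [consumes 1, case_names zero ext add]:
  fixes u :: "('p, 'f::real_normed_field) germs"
  assumes u: "u \<in> carrier (Cc E)"
    and zero: "P \<zero>\<^bsub>sections E\<^esub>"
    and ext: "\<And>U f. local_fun E U f ==> P (ext_by_zero E U f)"
    and add: "\<And>u v. u \<in> carrier (Cc E) ==> v \<in> carrier (Cc E) ==> P u ==> P v ==> P (u \<oplus>\<^bsub>sections E\<^esub> v)"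
  shows "P u"
  by (rule Cc_induct[where Q = "\<lambda>_. True", OF u _ zero ext add]) auto

end

subsection \<open>Push-forward\<close>

lemma germ_pullback_germ:
  assumes "continuous_map (mtop E) (mtop F) \<phi>" "y \<in> topspace (mtop E)"
  shows "germ_pullback E \<phi> y (germ F (\<phi> y) f) = germ E y (\<lambda>x. f (\<phi> x))"
proof -
  have *: "germ E y (\<lambda>x. f' (\<phi> x)) = germ E y (\<lambda>x. f (\<phi> x))" if "f' \<in> germ F (\<phi> y) f" for f'
  proof -
    have y: "\<phi> y \<in> topspace (mtop F)" using assms by (auto simp: continuous_map_def)
    have "germ F (\<phi> y) f' = germ F (\<phi> y) f" using that by (simp add: germ_mem germ_eq_iff)
    then obtain V where V: "openin (mtop F) V" "\<phi> y \<in> V" "\<And>x. x \<in> V ==> f' x = f x"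
      using y by (rule germ_eqD) (rule that)
    show ?thesis
      by (rule germ_eqI[OF openin_continuous_map_preimage[OF assms(1) V(1)]]) (use V assms(2) in auto)
  qed
  show ?thesis
    unfolding germ_pullback_def
  proof (intro equalityI subsetI)
    fix h assume "h \<in> {h. \<exists>f'\<in>germ F (\<phi> y) f. h \<in> germ E y (\<lambda>x. f' (\<phi> x))}"
    then show "h \<in> germ E y (\<lambda>x. f (\<phi> x))" by (elim CollectE bexE) (simp only: *)
  qed (intro CollectI bexI[of _ f] germ_self)
qed

lemma germ_pullback_cong:
  fixes \<phi> :: "'p => 'q"
  assumes "\<And>x. x \<in> topspace (mtop E) ==> \<phi> x = \<psi> x" "y \<in> topspace (mtop E)"
  shows "germ_pullback E \<phi> y = (germ_pullback E \<psi> y :: ('q => 'f) set => _)"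
proof -
  have "germ E y (\<lambda>x. f (\<phi> x)) = germ E y (\<lambda>x. f (\<psi> x))" for f :: "'q => 'f"
    by (rule germ_eqI[OF openin_topspace assms(2)]) (simp add: assms(1))
  then show ?thesis unfolding germ_pullback_def[abs_def] by simp
qed

locale etmap = E: smanifold E + F: smanifold F
  for E :: "('p, 'e::{real_inner,heine_borel}) manifold" and F :: "('q, 'e) manifold" +
  fixes TF :: "'f::real_normed_field itself" and \<phi> :: "'p => 'q"
  assumes et: "etale TYPE('f) E F \<phi>"
begin

abbreviation "CE \<equiv> Cc E :: ('f, ('p, 'f) germs) module"
abbreviation "CF \<equiv> Cc F :: ('f, ('q, 'f) germs) module"

lemmas pullback_germ = germ_pullback_germ[OF etale_cont[OF et]]

text \<open>Equality of the pullbacks on \<open>W\<close> is equality on the image of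
  \<open>W\<close>, which is a neighbourhood because \<phi> is open.\<close>

lemma pullback_inj:
  assumes y: "y \<in> topspace (mtop E)"
  shows "inj_on (germ_pullback E \<phi> y) (carrier (stalk F (\<phi> y) :: ('f, ('q => 'f) set) module))"
proof (rule inj_onI)
  fix a b :: "('q => 'f) set"
  assume a: "a \<in> carrier (stalk F (\<phi> y))" and b: "b \<in> carrier (stalk F (\<phi> y))"
    and eq: "germ_pullback E \<phi> y a = germ_pullback E \<phi> y b"
  obtain f where f: "a = germ F (\<phi> y) f" using a by (rule stalkE)
  obtain g where g: "b = germ F (\<phi> y) g" using b by (rule stalkE)
  have "germ E y (\<lambda>x. f (\<phi> x)) = germ E y (\<lambda>x. g (\<phi> x))" using eq unfolding f g pullback_germ[OF y] .
  then obtain W where W: "openin (mtop E) W" "y \<in> W" "\<And>x. x \<in> W ==> f (\<phi> x) = g (\<phi> x)"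
    using y by (rule germ_eqD) (rule that)
  show "a = b" unfolding f g
    by (rule germ_eqI[OF etale_open[OF et W(1)]]) (use W in auto)
qed

text \<open>The form in which the inverse of the germ pullback is computed: no inverse of \<phi>
  appears, only a function downstairs through which \<open>f\<close> factors.\<close>

lemma germ_push_germ:
  fixes f' :: "'q => 'f"
  assumes W: "openin (mtop E) W" "y \<in> W" and f: "vsmooth E W f" and f': "\<And>x. x \<in> W ==> f' (\<phi> x) = f x"
  shows "germ F (\<phi> y) f' \<in> carrier (stalk F (\<phi> y))" "germ_push E F \<phi> y (germ E y f) = germ F (\<phi> y) f'"
proof -
  have y: "y \<in> topspace (mtop E)" using W openin_subset by blast
  have "vsmooth E W (\<lambda>x. f' (\<phi> x))" by (rule E.vsmooth_cong[OF W(1) f]) (simp add: f')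
  then have "vsmooth F (\<phi> ` W) f'" using etale_smooth[OF et W(1)] by blast
  then show s: "germ F (\<phi> y) f' \<in> carrier (stalk F (\<phi> y))"
    using W(2) by (intro germ_in_stalk[OF etale_open[OF et W(1)]]) auto
  have "germ E y f = germ_pullback E \<phi> y (germ F (\<phi> y) f')"
    unfolding pullback_germ[OF y] by (rule germ_eqI[OF W]) (simp add: f')
  then show "germ_push E F \<phi> y (germ E y f) = germ F (\<phi> y) f'"
    unfolding germ_push_def using inv_into_f_f[OF pullback_inj[OF y] s] by simp
qed

lemma stalk_factorE:
  assumes "a \<in> carrier (stalk E y :: ('f, ('p => 'f) set) module)"
  obtains W f' f where "openin (mtop E) W" "y \<in> W" "a = germ E y f" "vsmooth E W f" "\<And>x. x \<in> W ==> f' (\<phi> x) = f x"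
proof -
  obtain f W0 where f: "a = germ E y f" "openin (mtop E) W0" "y \<in> W0" "vsmooth E W0 f" using assms by (rule stalkE)
  have "y \<in> topspace (mtop E)" using f openin_subset by blast
  then obtain U where U: "openin (mtop E) U" "y \<in> U" "inj_on \<phi> U" using etale_inj[OF et] by blast
  have i: "inj_on \<phi> (U \<inter> W0)" using U(3) by (rule inj_on_subset) blast
  show thesis
  proof (rule that[of "U \<inter> W0" f "\<lambda>z. f (inv_into (U \<inter> W0) \<phi> z)"])
    show "vsmooth E (U \<inter> W0) f" by (rule E.vsmooth_subset[OF f(4)]) blast
    show "f (inv_into (U \<inter> W0) \<phi> (\<phi> x)) = f x" if "x \<in> U \<inter> W0" for x using i that by simp
  qed (use f U in auto)
qed

lemma germ_push_linear:
  assumes y: "y \<in> topspace (mtop E)"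
  shows "germ_push E F \<phi> y \<in> linear_maps (stalk E y :: ('f, ('p => 'f) set) module) (stalk F (\<phi> y))"
proof (rule linear_mapsI)
  fix a a' :: "('p => 'f) set" and c :: 'f
  assume a: "a \<in> carrier (stalk E y)"
  obtain W f' f where f: "openin (mtop E) W" "y \<in> W" "a = germ E y f" "vsmooth E W f" "\<And>x. x \<in> W ==> f' (\<phi> x) = f x"
    using a by (rule stalk_factorE) (rule that)
  note g1 = germ_push_germ[OF f(1,2,4,5), simplified]
  show "germ_push E F \<phi> y a \<in> carrier (stalk F (\<phi> y))" unfolding f(3) using g1 by simp
  have "vsmooth E W (\<lambda>x. c * f x)" by (intro E.vsmooth_mult f E.vsmooth_const)
  from germ_push_germ(2)[OF f(1,2) this, of "\<lambda>z. c * f' z"]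
  show "germ_push E F \<phi> y (c \<odot>\<^bsub>stalk E y\<^esub> a) = c \<odot>\<^bsub>stalk F (\<phi> y)\<^esub> germ_push E F \<phi> y a"
    unfolding f(3) by (simp add: stalk_ops g1 f(5))
  assume a': "a' \<in> carrier (stalk E y)"
  obtain W' g' g where g: "openin (mtop E) W'" "y \<in> W'" "a' = germ E y g" "vsmooth E W' g" "\<And>x. x \<in> W' ==> g' (\<phi> x) = g x"
    using a' by (rule stalk_factorE) (rule that)
  note g2 = germ_push_germ[OF g(1,2,4,5), simplified]
  have o: "openin (mtop E) (W \<inter> W')" "y \<in> W \<inter> W'" using f g by auto
  have "vsmooth E (W \<inter> W') (\<lambda>x. f x + g x)"
    by (intro E.vsmooth_add o E.vsmooth_subset[OF f(4)] E.vsmooth_subset[OF g(4)]) auto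
  from germ_push_germ(2)[OF o this, of "\<lambda>z. f' z + g' z"]
  show "germ_push E F \<phi> y (a \<oplus>\<^bsub>stalk E y\<^esub> a') = germ_push E F \<phi> y a \<oplus>\<^bsub>stalk F (\<phi> y)\<^esub> germ_push E F \<phi> y a'"
    unfolding f(3) g(3) by (simp add: stalk_ops g1 g2 f(5) g(5))
qed

abbreviation "fibre z \<equiv> {y \<in> topspace (mtop E). \<phi> y = z}"
abbreviation "supp_fibre u z \<equiv> {y \<in> topspace (mtop E). \<phi> y = z \<and> u y \<noteq> \<zero>\<^bsub>stalk E y\<^esub>}"

lemma inj_basis:
  "y \<in> topspace (mtop E) ==> \<exists>V. openin (mtop E) V \<and> y \<in> V \<and> (\<forall>W. openin (mtop E) W \<longrightarrow> W \<subseteq> V \<longrightarrow> inj_on \<phi> W)"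
  using etale_inj[OF et, of y] inj_on_subset by metis

text \<open>A set on which \<phi> is injective meets each fibre in at most one point, and finiteness
  survives sums. This makes the \<open>finsum\<close> in \<open>push\<close> an actual sum.\<close>

lemma finite_supp_fibre:
  assumes "u \<in> carrier CE" shows "finite (supp_fibre u z)"
  using assms
proof (induction rule: E.Cc_induct[where Q = "inj_on \<phi>"])
  case (basis y) then show ?case by (rule inj_basis)
next
  case zero
  have "supp_fibre \<zero>\<^bsub>sections E\<^esub> z \<subseteq> {}" by (auto simp: E.sections_ops)
  then show ?case by (rule finite_subset) (rule finite.emptyI)
next
  case (ext U f)
  have "supp_fibre (ext_by_zero E U f) z \<subseteq> {y \<in> U. \<phi> y = z}" by (auto simp: ext_by_zero_def)
  moreover have "finite {y \<in> U. \<phi> y = z}"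
  proof (rule finite_imageD)
    show "finite (\<phi> ` {y \<in> U. \<phi> y = z})" by (rule finite_subset[of _ "{z}"]) auto
    show "inj_on \<phi> {y \<in> U. \<phi> y = z}" using ext(2) by (rule inj_on_subset) blast
  qed
  ultimately show ?case by (rule finite_subset)
next
  case (add u v)
  have "supp_fibre (u \<oplus>\<^bsub>sections E\<^esub> v) z \<subseteq> supp_fibre u z \<union> supp_fibre v z"
  proof
    fix y assume y: "y \<in> supp_fibre (u \<oplus>\<^bsub>sections E\<^esub> v) z"
    then have "y \<in> topspace (mtop E)" by simp
    then show "y \<in> supp_fibre u z \<union> supp_fibre v z"
      using y by (auto simp: E.sections_ops stalk_ops)
  qed
  then show ?case by (rule finite_subset) (rule finite_UnI[OF add(3,4)])
qed

text \<open>The index set in the definition depends on \<open>u\<close>. A freely enlarged finite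
  set allows several sections to be summed over the same points, as additivity requires.\<close>

lemma push_eq:
  assumes u: "u \<in> carrier CE" and z: "z \<in> topspace (mtop F)"
    and S: "finite S" "supp_fibre u z \<subseteq> S" "S \<subseteq> fibre z"
  shows "push E F \<phi> u z = (\<Oplus>\<^bsub>stalk F z\<^esub>y\<in>S. germ_push E F \<phi> y (u y))"
proof -
  interpret Fz: vspace "stalk F z :: ('f, ('q => 'f) set) module" by (rule F.vspace_stalk[OF z])
  have "(\<Oplus>\<^bsub>stalk F z\<^esub>y\<in>supp_fibre u z. germ_push E F \<phi> y (u y)) = (\<Oplus>\<^bsub>stalk F z\<^esub>y\<in>S. germ_push E F \<phi> y (u y))"
  proof (rule Fz.add.finprod_mono_neutral_cong_left[OF S(1,2)])
    fix y assume "y \<in> S - supp_fibre u z"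
    then have y: "y \<in> topspace (mtop E)" "\<phi> y = z" "u y = \<zero>\<^bsub>stalk E y\<^esub>" using S(3) by auto
    show "germ_push E F \<phi> y (u y) = \<zero>\<^bsub>stalk F z\<^esub>"
      using linear_maps_zero[OF germ_push_linear[OF y(1)] E.vspace_stalk[OF y(1)]] Fz.vspace_axioms y by simp
  next
    show "(\<lambda>y. germ_push E F \<phi> y (u y)) \<in> S \<rightarrow> carrier (stalk F z)"
    proof
      fix y assume "y \<in> S"
      then have y: "y \<in> topspace (mtop E)" "\<phi> y = z" using S(3) by auto
      show "germ_push E F \<phi> y (u y) \<in> carrier (stalk F z)"
        using linear_mapsD(1)[OF germ_push_linear[OF y(1)] E.Cc_in_stalk[OF u y(1)]] y by simp
    qed
  qed simp_all
  then show ?thesis using u z by (simp add: push_def)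
qed

lemma push_section:
  assumes u: "u \<in> carrier CE" shows "push E F \<phi> u \<in> carrier (sections F)"
proof -
  have "push E F \<phi> u z \<in> carrier (stalk F z)" if z: "z \<in> topspace (mtop F)" for z
  proof -
    interpret Fz: vspace "stalk F z :: ('f, ('q => 'f) set) module" by (rule F.vspace_stalk[OF z])
    have "(\<Oplus>\<^bsub>stalk F z\<^esub>y\<in>supp_fibre u z. germ_push E F \<phi> y (u y)) \<in> carrier (stalk F z)"
    proof (rule Fz.finsum_closed, rule)
      fix y assume "y \<in> supp_fibre u z"
      then have y: "y \<in> topspace (mtop E)" "\<phi> y = z" by auto
      show "germ_push E F \<phi> y (u y) \<in> carrier (stalk F z)"
        using linear_mapsD(1)[OF germ_push_linear[OF y(1)] E.Cc_in_stalk[OF u y(1)]] y by simp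
    qed
    then show ?thesis using u z by (simp add: push_def)
  qed
  then show ?thesis using u by (auto simp: F.sections_carrier push_def)
qed

lemma push_add:
  assumes u: "u \<in> carrier CE" and v: "v \<in> carrier CE"
  shows "push E F \<phi> (u \<oplus>\<^bsub>sections E\<^esub> v) = push E F \<phi> u \<oplus>\<^bsub>sections F\<^esub> push E F \<phi> v"
proof (rule F.section_eqI)
  interpret CE: vspace CE by (rule E.vspace_Cc)
  have uv: "u \<oplus>\<^bsub>sections E\<^esub> v \<in> carrier CE" using CE.a_closed[OF u v] by simp
  show "push E F \<phi> (u \<oplus>\<^bsub>sections E\<^esub> v) \<in> carrier (sections F)" by (rule push_section[OF uv])
  show "push E F \<phi> u \<oplus>\<^bsub>sections F\<^esub> push E F \<phi> v \<in> carrier (sections F)"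
    by (rule F.sections_closed(1)[OF push_section[OF u] push_section[OF v]])
  fix z assume z: "z \<in> topspace (mtop F)"
  interpret Fz: vspace "stalk F z :: ('f, ('q => 'f) set) module" by (rule F.vspace_stalk[OF z])
  let ?S = "supp_fibre u z \<union> supp_fibre v z"
  have S: "finite ?S" "?S \<subseteq> fibre z" using finite_supp_fibre u v by auto
  have sub: "supp_fibre (u \<oplus>\<^bsub>sections E\<^esub> v) z \<subseteq> ?S"
    by (auto simp: E.sections_ops stalk_ops)
  have gl: "germ_push E F \<phi> y (w y) \<in> carrier (stalk F z)" if "y \<in> ?S" "w \<in> carrier CE" for y w
    using linear_mapsD(1)[OF germ_push_linear E.Cc_in_stalk[OF that(2)]] that(1) by auto
  have "push E F \<phi> (u \<oplus>\<^bsub>sections E\<^esub> v) z = (\<Oplus>\<^bsub>stalk F z\<^esub>y\<in>?S. germ_push E F \<phi> y ((u \<oplus>\<^bsub>sections E\<^esub> v) y))"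
    by (rule push_eq[OF uv z S(1) sub S(2)])
  also have "\<dots> = (\<Oplus>\<^bsub>stalk F z\<^esub>y\<in>?S. germ_push E F \<phi> y (u y) \<oplus>\<^bsub>stalk F z\<^esub> germ_push E F \<phi> y (v y))"
  proof (rule Fz.add.finprod_cong')
    fix y assume "y \<in> ?S"
    then have y: "y \<in> topspace (mtop E)" "\<phi> y = z" by auto
    show "germ_push E F \<phi> y ((u \<oplus>\<^bsub>sections E\<^esub> v) y) = germ_push E F \<phi> y (u y) \<oplus>\<^bsub>stalk F z\<^esub> germ_push E F \<phi> y (v y)"
      using linear_mapsD(2)[OF germ_push_linear[OF y(1)] E.Cc_in_stalk[OF u y(1)] E.Cc_in_stalk[OF v y(1)]] y
      by (simp add: E.sections_ops)
  qed (use gl u v in auto)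
  also have "\<dots> = push E F \<phi> u z \<oplus>\<^bsub>stalk F z\<^esub> push E F \<phi> v z"
    unfolding push_eq[OF u z S(1) Un_upper1 S(2)] push_eq[OF v z S(1) Un_upper2 S(2)]
    by (rule Fz.finsum_addf) (use gl u v in auto)
  finally show "push E F \<phi> (u \<oplus>\<^bsub>sections E\<^esub> v) z = (push E F \<phi> u \<oplus>\<^bsub>sections F\<^esub> push E F \<phi> v) z"
    by (simp add: F.sections_ops[OF z])
qed

lemma push_smult:
  assumes u: "u \<in> carrier CE"
  shows "push E F \<phi> (c \<odot>\<^bsub>sections E\<^esub> u) = c \<odot>\<^bsub>sections F\<^esub> push E F \<phi> u"
proof (rule F.section_eqI)
  interpret CE: vspace CE by (rule E.vspace_Cc)
  have uv: "c \<odot>\<^bsub>sections E\<^esub> u \<in> carrier CE" using CE.smult_in[OF u, of c] by simp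
  show "push E F \<phi> (c \<odot>\<^bsub>sections E\<^esub> u) \<in> carrier (sections F)" by (rule push_section[OF uv])
  show "c \<odot>\<^bsub>sections F\<^esub> push E F \<phi> u \<in> carrier (sections F)"
    by (rule F.sections_smult_closed[OF push_section[OF u]])
  fix z assume z: "z \<in> topspace (mtop F)"
  interpret Fz: vspace "stalk F z :: ('f, ('q => 'f) set) module" by (rule F.vspace_stalk[OF z])
  let ?S = "supp_fibre u z"
  have S: "finite ?S" "?S \<subseteq> fibre z" using finite_supp_fibre u by auto
  have sub: "supp_fibre (c \<odot>\<^bsub>sections E\<^esub> u) z \<subseteq> ?S"
    by (auto simp: E.sections_ops stalk_ops)
  have gl: "germ_push E F \<phi> y (w y) \<in> carrier (stalk F z)" if "y \<in> ?S" "w \<in> carrier CE" for y w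
    using linear_mapsD(1)[OF germ_push_linear E.Cc_in_stalk[OF that(2)]] that(1) by auto
  have "push E F \<phi> (c \<odot>\<^bsub>sections E\<^esub> u) z = (\<Oplus>\<^bsub>stalk F z\<^esub>y\<in>?S. germ_push E F \<phi> y ((c \<odot>\<^bsub>sections E\<^esub> u) y))"
    by (rule push_eq[OF uv z S(1) sub S(2)])
  also have "\<dots> = (\<Oplus>\<^bsub>stalk F z\<^esub>y\<in>?S. c \<odot>\<^bsub>stalk F z\<^esub> germ_push E F \<phi> y (u y))"
  proof (rule Fz.add.finprod_cong')
    fix y assume "y \<in> ?S"
    then have y: "y \<in> topspace (mtop E)" "\<phi> y = z" by auto
    show "germ_push E F \<phi> y ((c \<odot>\<^bsub>sections E\<^esub> u) y) = c \<odot>\<^bsub>stalk F z\<^esub> germ_push E F \<phi> y (u y)"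
      using linear_mapsD(3)[OF germ_push_linear[OF y(1)] E.Cc_in_stalk[OF u y(1)]] y
      by (simp add: E.sections_ops)
  qed (use gl u in \<open>auto intro!: Fz.smult_in\<close>)
  also have "\<dots> = c \<odot>\<^bsub>stalk F z\<^esub> push E F \<phi> u z"
    unfolding push_eq[OF u z S(1) subset_refl S(2)]
    by (rule Fz.smult_finsum[symmetric]) (use S gl u in auto)
  finally show "push E F \<phi> (c \<odot>\<^bsub>sections E\<^esub> u) z = (c \<odot>\<^bsub>sections F\<^esub> push E F \<phi> u) z"
    by (simp add: F.sections_ops[OF z])
qed

lemma homeo_on:
  assumes U: "openin (mtop E) U" and inj: "inj_on \<phi> U"
  shows "homeomorphic_map (subtopology (mtop E) U) (subtopology (mtop F) (\<phi> ` U)) \<phi>"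
proof (rule bijective_open_imp_homeomorphic_map)
  show "continuous_map (subtopology (mtop E) U) (subtopology (mtop F) (\<phi> ` U)) \<phi>"
    by (auto simp: continuous_map_in_subtopology intro: continuous_map_from_subtopology[OF etale_cont[OF et]])
  show "open_map (subtopology (mtop E) U) (subtopology (mtop F) (\<phi> ` U)) \<phi>"
    unfolding open_map_def using U etale_open[OF et] by (auto simp: openin_open_subtopology)
  show "\<phi> ` topspace (subtopology (mtop E) U) = topspace (subtopology (mtop F) (\<phi> ` U))"
    using openin_subset[OF U] openin_subset[OF etale_open[OF et U]] by (simp add: Int_absorb1)
  show "inj_on \<phi> (topspace (subtopology (mtop E) U))" using inj by (auto intro: inj_on_subset)
qed

text \<open>Since \<phi> is injective on \<open>U\<close>, the sum over a fibre has at most one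
  term. The function \<open>f'\<close> is left open so that later computations can choose it to fit
  a composite or a product.\<close>

lemma push_local:
  fixes f :: "'p => 'f"
  assumes f: "local_fun E U f" and inj: "inj_on \<phi> U" and f': "\<And>y. y \<in> U ==> f' (\<phi> y) = f y"
  shows "local_fun F (\<phi> ` U) f'" "push E F \<phi> (ext_by_zero E U f) = ext_by_zero F (\<phi> ` U) f'"
proof -
  obtain K where K: "openin (mtop E) U" "Hausdorff_space (subtopology (mtop E) U)" "vsmooth E U f"
    "compactin (mtop E) K" "K \<subseteq> U" "\<And>x. x \<in> U ==> x \<notin> K ==> f x = 0"
    using f by (rule local_funE) (rule that)
  have Us: "U \<subseteq> topspace (mtop E)" using K openin_subset by blast
  show loc: "local_fun F (\<phi> ` U) f'"
  proof (rule local_funI[of _ _ _ "\<phi> ` K"])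
    show "openin (mtop F) (\<phi> ` U)" by (rule etale_open[OF et K(1)])
    show "Hausdorff_space (subtopology (mtop F) (\<phi> ` U))"
      using homeomorphic_map_imp_homeomorphic_space[OF homeo_on[OF K(1) inj]] K(2) homeomorphic_Hausdorff_space by blast
    have "vsmooth E U (\<lambda>y. f' (\<phi> y))" by (rule E.vsmooth_cong[OF K(1,3)]) (simp add: f')
    then show "vsmooth F (\<phi> ` U) f'" using etale_smooth[OF et K(1)] by blast
    show "compactin (mtop F) (\<phi> ` K)" by (rule image_compactin[OF K(4) etale_cont[OF et]])
    show "\<phi> ` K \<subseteq> \<phi> ` U" using K(5) by blast
    fix x assume "x \<in> \<phi> ` U" "x \<notin> \<phi> ` K"
    then obtain y where "y \<in> U" "x = \<phi> y" "y \<notin> K" by blast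
    then show "f' x = 0" using K(6) f' by simp
  qed
  have c: "ext_by_zero E U f \<in> carrier CE" by (rule E.ext_in_Cc[OF f])
  show "push E F \<phi> (ext_by_zero E U f) = ext_by_zero F (\<phi> ` U) f'"
  proof (rule F.section_eqI[OF push_section[OF c] F.ext_section[OF loc]])
    fix z assume z: "z \<in> topspace (mtop F)"
    interpret Fz: vspace "stalk F z :: ('f, ('q => 'f) set) module" by (rule F.vspace_stalk[OF z])
    have sub: "supp_fibre (ext_by_zero E U f) z \<subseteq> {y \<in> U. \<phi> y = z}" by (auto simp: ext_by_zero_def)
    show "push E F \<phi> (ext_by_zero E U f) z = ext_by_zero F (\<phi> ` U) f' z"
    proof (cases "z \<in> \<phi> ` U")
      case True
      then obtain y where y: "y \<in> U" "z = \<phi> y" by blast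
      then have eq: "{y \<in> U. \<phi> y = z} = {y}" using inj by (auto dest: inj_onD)
      have yE: "y \<in> topspace (mtop E)" using y Us by blast
      have p: "germ_push E F \<phi> y (germ E y f) = germ F z f'"
        unfolding y(2) by (rule germ_push_germ[OF K(1) y(1) K(3) f'])
      have gz: "germ F z f' \<in> carrier (stalk F z)"
        unfolding y(2) by (rule germ_push_germ[OF K(1) y(1) K(3) f'])
      have "push E F \<phi> (ext_by_zero E U f) z = (\<Oplus>\<^bsub>stalk F z\<^esub>y\<in>{y}. germ_push E F \<phi> y (ext_by_zero E U f y))"
        by (rule push_eq[OF c z]) (use sub eq yE y in auto)
      also have "\<dots> = germ F z f'"
      proof -
        have ey: "germ_push E F \<phi> y (ext_by_zero E U f y) = germ F z f'" using yE y(1) by (simp add: ext_by_zero_def p)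
        then show ?thesis
          using Fz.finsum_insert[of "{}" y "\<lambda>y. germ_push E F \<phi> y (ext_by_zero E U f y)"] gz by simp
      qed
      finally show ?thesis using True z by (simp add: ext_by_zero_def)
    next
      case False
      have "push E F \<phi> (ext_by_zero E U f) z = (\<Oplus>\<^bsub>stalk F z\<^esub>y\<in>{}. germ_push E F \<phi> y (ext_by_zero E U f y))"
        by (rule push_eq[OF c z]) (use sub False in auto)
      then show ?thesis using False z by (simp add: ext_by_zero_def)
    qed
  qed
qed

lemma push_local_inv:
  fixes f :: "'p => 'f"
  assumes "local_fun E U f" "inj_on \<phi> U"
  shows "local_fun F (\<phi> ` U) (\<lambda>z. f (inv_into U \<phi> z))"
    "push E F \<phi> (ext_by_zero E U f) = ext_by_zero F (\<phi> ` U) (\<lambda>z. f (inv_into U \<phi> z))"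
  using push_local[OF assms, of "\<lambda>z. f (inv_into U \<phi> z)"] assms(2) by simp_all

lemma push_linear: "push E F \<phi> \<in> linear_maps CE CF"
proof (rule linear_mapsI)
  interpret CF: vspace CF by (rule F.vspace_Cc)
  interpret CE: vspace CE by (rule E.vspace_Cc)
  fix u v c
  assume u: "u \<in> carrier CE"
  show "push E F \<phi> (c \<odot>\<^bsub>CE\<^esub> u) = c \<odot>\<^bsub>CF\<^esub> push E F \<phi> u" using push_smult[OF u] by simp
  show "push E F \<phi> u \<in> carrier CF"
    using u
  proof (induction rule: E.Cc_induct[where Q = "inj_on \<phi>"])
    case (basis y) then show ?case by (rule inj_basis)
  next
    case zero
    \<comment> \<open>Homogeneity with scalar 0 gives the value at zero; linearity of
      \<open>push\<close> as a map into \<open>CF\<close> is only being established here.\<close>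
    have "push E F \<phi> (0 \<odot>\<^bsub>sections E\<^esub> \<zero>\<^bsub>CE\<^esub>) = 0 \<odot>\<^bsub>sections F\<^esub> push E F \<phi> \<zero>\<^bsub>CE\<^esub>"
      by (rule push_smult[OF CE.zero_closed])
    moreover have "0 \<odot>\<^bsub>sections E\<^esub> \<zero>\<^bsub>CE\<^esub> = \<zero>\<^bsub>sections E\<^esub>"
      using CE.smult_zero_left[OF CE.zero_closed] by simp
    moreover have "0 \<odot>\<^bsub>sections F\<^esub> push E F \<phi> \<zero>\<^bsub>CE\<^esub> = \<zero>\<^bsub>sections F\<^esub>"
      by (rule vspace.smult_zero_left[OF F.vspace_sections push_section[OF CE.zero_closed]])
    ultimately show ?case using CF.zero_closed by simp
  next
    case (ext U f)
    then show ?case using push_local_inv[OF ext] F.ext_in_Cc by simp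
  next
    case (add u v)
    then show ?case using CF.a_closed[of "push E F \<phi> u" "push E F \<phi> v"] by (simp add: push_add)
  qed
  assume v: "v \<in> carrier CE"
  show "push E F \<phi> (u \<oplus>\<^bsub>CE\<^esub> v) = push E F \<phi> u \<oplus>\<^bsub>CF\<^esub> push E F \<phi> v" using push_add[OF u v] by simp
qed

text \<open>Groupoid identities hold on arrows only, while the maps passed to \<open>push\<close>
  are total functions.\<close>

lemma push_cong:
  assumes "\<And>x. x \<in> topspace (mtop E) ==> \<phi> x = \<psi> x"
  shows "push E F \<psi> = (push E F \<phi> :: (('p, 'f) germs) => _)"
proof (rule ext, rule ext)
  fix u :: "('p, 'f) germs" and z
  show "push E F \<psi> u z = push E F \<phi> u z"
  proof (cases "u \<in> carrier CE \<and> z \<in> topspace (mtop F)")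
    case True
    then have u: "u \<in> carrier CE" and z: "z \<in> topspace (mtop F)" by auto
    interpret Fz: vspace "stalk F z :: ('f, ('q => 'f) set) module" by (rule F.vspace_stalk[OF z])
    have S: "{y \<in> topspace (mtop E). \<psi> y = z \<and> u y \<noteq> \<zero>\<^bsub>stalk E y\<^esub>} = supp_fibre u z" using assms by auto
    have "(\<Oplus>\<^bsub>stalk F z\<^esub>y\<in>supp_fibre u z. germ_push E F \<psi> y (u y)) = (\<Oplus>\<^bsub>stalk F z\<^esub>y\<in>supp_fibre u z. germ_push E F \<phi> y (u y))"
    proof (rule Fz.add.finprod_cong'[OF refl])
      fix y assume "y \<in> supp_fibre u z"
      then have y: "y \<in> topspace (mtop E)" by simp
      show "germ_push E F \<psi> y (u y) = germ_push E F \<phi> y (u y)"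
      proof -
        have "germ_pullback E \<psi> y = (germ_pullback E \<phi> y :: ('q => 'f) set => _)"
          by (rule germ_pullback_cong) (simp_all add: assms y)
        then show ?thesis unfolding germ_push_def by (simp add: assms[OF y])
      qed
    next
      show "(\<lambda>y. germ_push E F \<phi> y (u y)) \<in> supp_fibre u z \<rightarrow> carrier (stalk F z)"
        using linear_mapsD(1)[OF germ_push_linear E.Cc_in_stalk[OF u]] by auto
    qed
    then show ?thesis unfolding push_def using u z by (simp add: S)
  qed (auto simp: push_def)
qed

lemma push_in: "u \<in> carrier CE ==> push E F \<phi> u \<in> carrier CF"
  by (rule linear_mapsD(1)[OF push_linear])

end

text \<open>Agreement propagates along the decomposition of \<open>Cc_induct\<close>. The free
  predicate \<open>Q\<close> is later instantiated with injectivity of a map or with being a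
  bisection.\<close>

lemma (in smanifold) Cc_linear_eqI:
  assumes "f \<in> linear_maps (Cc E :: ('f::real_normed_field, ('p, 'f) germs) module) N" "g \<in> linear_maps (Cc E) N"
    and "vspace N" and u: "u \<in> carrier (Cc E)"
    and basis: "\<And>y. y \<in> topspace (mtop E) ==> \<exists>V. openin (mtop E) V \<and> y \<in> V \<and> (\<forall>W. openin (mtop E) W \<longrightarrow> W \<subseteq> V \<longrightarrow> Q W)"
    and ext: "\<And>U h. local_fun E U h ==> Q U ==> f (ext_by_zero E U h) = g (ext_by_zero E U h)"
  shows "f u = g u"
  using u
proof (induction rule: Cc_induct[where Q = Q])
  case (basis y) then show ?case by (rule assms(5))
next
  case zero
  show ?case using linear_maps_zero[OF assms(1) vspace_Cc assms(3)] linear_maps_zero[OF assms(2) vspace_Cc assms(3)] by simp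
next
  case (ext U h) then show ?case by (rule assms(6))
next
  case (add u v)
  then show ?case using linear_mapsD(2)[OF assms(1), of u v] linear_mapsD(2)[OF assms(2), of u v] by simp
qed

lemma push_compose:
  assumes E: "smooth_manifold E" and F: "smooth_manifold F" and H: "smooth_manifold H"
    and \<phi>: "etale TYPE('f::real_normed_field) E F \<phi>" and \<psi>: "etale TYPE('f) F H \<psi>"
    and u: "u \<in> carrier (Cc E :: ('f, ('p, 'f) germs) module)"
  shows "push F H \<psi> (push E F \<phi> u) = push E H (\<lambda>y. \<psi> (\<phi> y)) u"
proof -
  interpret A: etmap E F "TYPE('f)" \<phi> by unfold_locales fact+
  interpret B: etmap F H "TYPE('f)" \<psi> by unfold_locales fact+
  interpret C: etmap E H "TYPE('f)" "\<lambda>y. \<psi> (\<phi> y)" by unfold_locales (rule etale_compose[OF \<phi> \<psi>])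
  show ?thesis
  proof (rule A.E.Cc_linear_eqI[OF linear_maps_compose[OF A.push_linear B.push_linear] C.push_linear B.F.vspace_Cc u C.inj_basis])
    fix U and h :: "'p => 'f" assume h: "local_fun E U h" and inj: "inj_on (\<lambda>y. \<psi> (\<phi> y)) U"
    have i1: "inj_on \<phi> U" using inj by (auto simp: inj_on_def)
    have i2: "inj_on \<psi> (\<phi> ` U)" using inj by (auto simp: inj_on_def)
    \<comment> \<open>Read off on the final space: the intermediate function is then
      \<open>k\<close> after \<psi>, and both ways of pushing end in the same extension by
      zero.\<close>
    define k where "k z = h (inv_into U (\<lambda>y. \<psi> (\<phi> y)) z)" for z
    have k: "k (\<psi> (\<phi> y)) = h y" if "y \<in> U" for y using that inv_into_f_f[OF inj that] by (simp add: k_def)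
    have 1: "local_fun F (\<phi> ` U) (\<lambda>z. k (\<psi> z))" "push E F \<phi> (ext_by_zero E U h) = ext_by_zero F (\<phi> ` U) (\<lambda>z. k (\<psi> z))"
      using A.push_local[OF h i1, of "\<lambda>z. k (\<psi> z)"] k by auto
    have 2: "push F H \<psi> (ext_by_zero F (\<phi> ` U) (\<lambda>z. k (\<psi> z))) = ext_by_zero H (\<psi> ` \<phi> ` U) k"
      by (rule B.push_local(2)[OF 1(1) i2]) simp
    have 3: "push E H (\<lambda>y. \<psi> (\<phi> y)) (ext_by_zero E U h) = ext_by_zero H ((\<lambda>y. \<psi> (\<phi> y)) ` U) k"
      by (rule C.push_local(2)[OF h inj]) (simp add: k)
    show "push F H \<psi> (push E F \<phi> (ext_by_zero E U h)) = push E H (\<lambda>y. \<psi> (\<phi> y)) (ext_by_zero E U h)"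
      unfolding 1(2) 2 3 by (simp add: image_image)
  qed
qed

lemma push_id:
  assumes E: "smooth_manifold E" and u: "u \<in> carrier (Cc E :: ('f::real_normed_field, ('p, 'f) germs) module)"
  shows "push E E (\<lambda>y. y) u = u"
proof -
  interpret A: etmap E E "TYPE('f)" "\<lambda>y. y" by unfold_locales (rule E etale_id)+
  have id: "(\<lambda>u. u) \<in> linear_maps (Cc E) (Cc E :: ('f, ('p, 'f) germs) module)" by (rule linear_mapsI) simp_all
  show ?thesis
  proof (rule A.E.Cc_linear_eqI[OF A.push_linear id A.E.vspace_Cc u A.inj_basis])
    fix U and h :: "'p => 'f" assume h: "local_fun E U h" and "inj_on (\<lambda>y. y) U"
    then show "push E E (\<lambda>y. y) (ext_by_zero E U h) = ext_by_zero E U h" using A.push_local(2)[OF h, of h] by simp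
  qed
qed

section \<open>The base algebra and its modules\<close>

lemma (in smanifold) Cc_linear_eqI_ext:
  assumes "f \<in> linear_maps (Cc E :: ('f::real_normed_field, ('p, 'f) germs) module) N" "g \<in> linear_maps (Cc E) N"
    and "vspace N" and u: "u \<in> carrier (Cc E)"
    and ext: "\<And>U h. local_fun E U h ==> f (ext_by_zero E U h) = g (ext_by_zero E U h)"
  shows "f u = g u"
  by (rule Cc_linear_eqI[OF assms(1-4), where Q = "\<lambda>_. True"]) (auto intro: ext)

lemma (in smanifold) stalk_mult_linear:
  fixes a :: "('p => 'f::real_normed_field) set"
  assumes a: "a \<in> carrier (stalk E y)"
  shows "(\<lambda>b. a \<otimes>\<^bsub>stalk E y\<^esub> b) \<in> linear_maps (stalk E y) (stalk E y)"
    and "(\<lambda>b. b \<otimes>\<^bsub>stalk E y\<^esub> a) \<in> linear_maps (stalk E y) (stalk E y)"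
proof -
  obtain f where f: "a = germ E y f" using a by (rule stalkE)
  show "(\<lambda>b. a \<otimes>\<^bsub>stalk E y\<^esub> b) \<in> linear_maps (stalk E y) (stalk E y)"
  proof (rule linear_mapsI)
    fix b b' :: "('p => 'f) set" and c
    assume b: "b \<in> carrier (stalk E y)"
    obtain g where g: "b = germ E y g" using b by (rule stalkE)
    show "a \<otimes>\<^bsub>stalk E y\<^esub> b \<in> carrier (stalk E y)" by (rule stalk_closed(2)[OF a b])
    show "a \<otimes>\<^bsub>stalk E y\<^esub> (c \<odot>\<^bsub>stalk E y\<^esub> b) = c \<odot>\<^bsub>stalk E y\<^esub> (a \<otimes>\<^bsub>stalk E y\<^esub> b)"
      unfolding f g stalk_ops by (simp add: algebra_simps)
    assume b': "b' \<in> carrier (stalk E y)"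
    obtain h where h: "b' = germ E y h" using b' by (rule stalkE)
    show "a \<otimes>\<^bsub>stalk E y\<^esub> (b \<oplus>\<^bsub>stalk E y\<^esub> b') = a \<otimes>\<^bsub>stalk E y\<^esub> b \<oplus>\<^bsub>stalk E y\<^esub> a \<otimes>\<^bsub>stalk E y\<^esub> b'"
      unfolding f g h stalk_ops by (simp add: algebra_simps)
  qed
  show "(\<lambda>b. b \<otimes>\<^bsub>stalk E y\<^esub> a) \<in> linear_maps (stalk E y) (stalk E y)"
  proof (rule linear_mapsI)
    fix b b' :: "('p => 'f) set" and c
    assume b: "b \<in> carrier (stalk E y)"
    obtain g where g: "b = germ E y g" using b by (rule stalkE)
    show "b \<otimes>\<^bsub>stalk E y\<^esub> a \<in> carrier (stalk E y)" by (rule stalk_closed(2)[OF b a])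
    show "(c \<odot>\<^bsub>stalk E y\<^esub> b) \<otimes>\<^bsub>stalk E y\<^esub> a = c \<odot>\<^bsub>stalk E y\<^esub> (b \<otimes>\<^bsub>stalk E y\<^esub> a)"
      unfolding f g stalk_ops by (simp add: algebra_simps)
    assume b': "b' \<in> carrier (stalk E y)"
    obtain h where h: "b' = germ E y h" using b' by (rule stalkE)
    show "(b \<oplus>\<^bsub>stalk E y\<^esub> b') \<otimes>\<^bsub>stalk E y\<^esub> a = b \<otimes>\<^bsub>stalk E y\<^esub> a \<oplus>\<^bsub>stalk E y\<^esub> b' \<otimes>\<^bsub>stalk E y\<^esub> a"
      unfolding f g h stalk_ops by (simp add: algebra_simps)
  qed
qed

lemma (in etmap) smooth_pull:
  fixes f :: "'q => 'f"
  assumes "openin (mtop E) U" "vsmooth F V f" "\<phi> ` U \<subseteq> V"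
  shows "vsmooth E U (\<lambda>y. f (\<phi> y))"
  using etale_smooth[OF et assms(1)] F.vsmooth_subset[OF assms(2,3)] by blast

lemma (in etmap) pullback_linear:
  assumes y: "y \<in> topspace (mtop E)"
  shows "germ_pullback E \<phi> y \<in> linear_maps (stalk F (\<phi> y) :: ('f, ('q => 'f) set) module) (stalk E y)"
proof (rule linear_mapsI)
  fix a b :: "('q => 'f) set" and c :: 'f
  assume a: "a \<in> carrier (stalk F (\<phi> y))"
  obtain f V where f: "a = germ F (\<phi> y) f" "openin (mtop F) V" "\<phi> y \<in> V" "vsmooth F V f" using a by (rule stalkE)
  have o: "openin (mtop E) {x \<in> topspace (mtop E). \<phi> x \<in> V}" by (rule etale_preimage[OF et f(2)])
  have "vsmooth E {x \<in> topspace (mtop E). \<phi> x \<in> V} (\<lambda>x. f (\<phi> x))"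
    by (rule smooth_pull[OF o f(4)]) auto
  then show "germ_pullback E \<phi> y a \<in> carrier (stalk E y)"
    unfolding f(1) pullback_germ[OF y] using y f(3) by (intro germ_in_stalk[OF o]) auto
  show "germ_pullback E \<phi> y (c \<odot>\<^bsub>stalk F (\<phi> y)\<^esub> a) = c \<odot>\<^bsub>stalk E y\<^esub> germ_pullback E \<phi> y a"
    unfolding f(1) stalk_ops pullback_germ[OF y] ..
  assume b: "b \<in> carrier (stalk F (\<phi> y))"
  obtain g where g: "b = germ F (\<phi> y) g" using b by (rule stalkE)
  show "germ_pullback E \<phi> y (a \<oplus>\<^bsub>stalk F (\<phi> y)\<^esub> b) = germ_pullback E \<phi> y a \<oplus>\<^bsub>stalk E y\<^esub> germ_pullback E \<phi> y b"
    unfolding f(1) g stalk_ops pullback_germ[OF y] ..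
qed

lemma (in smanifold) ext_mult: "ext_by_zero E U f \<otimes>\<^bsub>sections E\<^esub> ext_by_zero E U g = ext_by_zero E U (\<lambda>x. f x * g x)"
  by (rule ext) (simp add: sections_def ext_by_zero_def stalk_ops)

locale hbase = M: smanifold M for M :: "('m, 'e::{real_inner,heine_borel}) manifold" +
  assumes hM: "Hausdorff_space (mtop M)"
begin

abbreviation "X \<equiv> topspace (mtop M)"

lemma hX: "Hausdorff_space (subtopology (mtop M) X)" using hM by simp

text \<open>On a Hausdorff manifold every local piece extends by zero to a smooth function on all of
  \<open>X\<close>, so a sum of pieces is again one function. This makes computations in the base
  algebra pointwise.\<close>

lemma Cc_base_rep:
  assumes "u \<in> carrier (Cc M :: ('f::real_normed_field, ('m, 'f) germs) module)"
  obtains q where "local_fun M X q" "u = ext_by_zero M X q"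
proof -
  have "\<exists>q. local_fun M X q \<and> u = ext_by_zero M X q"
    using assms
  proof (induction rule: M.Cc_induct_ext)
    case zero
    have "ext_by_zero M X (\<lambda>_. 0 :: 'f) = \<zero>\<^bsub>sections M\<^esub>" by (rule M.ext_zero) simp_all
    then show ?case using M.local_fun_zero[OF openin_topspace hX] by (intro exI[of _ "\<lambda>_. 0"]) simp
  next
    case (ext U f)
    let ?q = "\<lambda>x. if x \<in> U then f x else 0"
    have U: "openin (mtop M) U" by (rule local_fun_openin[OF ext])
    have q: "local_fun M U ?q" by (rule M.local_fun_cong[OF ext]) simp
    have "local_fun M X ?q" by (rule M.local_fun_extend[OF q openin_topspace hX openin_subset[OF U]]) simp
    moreover have "ext_by_zero M X ?q = ext_by_zero M U ?q"
      by (rule M.ext_extend[OF q openin_topspace hX openin_subset[OF U]]) simp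
    moreover have "ext_by_zero M U f = ext_by_zero M U ?q" by (rule M.ext_cong[OF U]) simp
    ultimately show ?case by (intro exI[of _ ?q] conjI) simp_all
  next
    case (add u v)
    from add(3) obtain q where q: "local_fun M X q" "u = ext_by_zero M X q" by (elim exE conjE)
    from add(4) obtain q' where q': "local_fun M X q'" "v = ext_by_zero M X q'" by (elim exE conjE)
    show ?case unfolding q(2) q'(2) M.ext_add
      by (intro exI[of _ "\<lambda>x. q x + q' x"] conjI M.local_fun_add q(1) q'(1) refl)
  qed
  then show thesis using that by (elim exE conjE)
qed

lemma local_fun_base_mult: "local_fun M X f ==> local_fun M X g ==> local_fun M X (\<lambda>x. f x * g x)"
  by (rule M.local_fun_mult) (auto simp: local_fun_def)

lemma assoc_algebra_base: "assoc_algebra (Cc M :: ('f::real_normed_field, ('m, 'f) germs) module)"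
proof (rule assoc_algebra.intro)
  let ?R = "Cc M :: ('f, ('m, 'f) germs) module"
  show "module scalars ?R" by (rule vspace.module_scalars[OF M.vspace_Cc])
  fix a b d :: "('m, 'f) germs"
  assume a: "a \<in> carrier ?R" and b: "b \<in> carrier ?R"
  obtain f where f: "local_fun M X f" "a = ext_by_zero M X f" using a by (rule Cc_base_rep)
  obtain g where g: "local_fun M X g" "b = ext_by_zero M X g" using b by (rule Cc_base_rep)
  show "a \<otimes>\<^bsub>?R\<^esub> b \<in> carrier ?R" unfolding f g M.Cc_ops M.ext_mult by (intro M.ext_in_Cc local_fun_base_mult f g)
  assume d: "d \<in> carrier ?R"
  obtain h where h: "local_fun M X h" "d = ext_by_zero M X h" using d by (rule Cc_base_rep)
  show "a \<otimes>\<^bsub>?R\<^esub> b \<otimes>\<^bsub>?R\<^esub> d = a \<otimes>\<^bsub>?R\<^esub> (b \<otimes>\<^bsub>?R\<^esub> d)"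
    unfolding f g h M.Cc_ops M.ext_mult by (simp add: algebra_simps)
next
  let ?R = "Cc M :: ('f, ('m, 'f) germs) module"
  have lin: "(\<lambda>b. a \<otimes>\<^bsub>?R\<^esub> b) \<in> linear_maps ?R ?R \<and> (\<lambda>b. b \<otimes>\<^bsub>?R\<^esub> a) \<in> linear_maps ?R ?R" if a: "a \<in> carrier ?R" for a
  proof -
    obtain f where f: "local_fun M X f" "a = ext_by_zero M X f" using a by (rule Cc_base_rep)
    show ?thesis
    proof (intro conjI linear_mapsI, goal_cases)
      case (1 b)
      obtain g where g: "local_fun M X g" "b = ext_by_zero M X g" using 1 by (rule Cc_base_rep)
      show ?case unfolding f g M.Cc_ops M.ext_mult by (intro M.ext_in_Cc local_fun_base_mult f g)
    next
      case (2 b b')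
      obtain g where g: "local_fun M X g" "b = ext_by_zero M X g" using 2(1) by (rule Cc_base_rep)
      obtain h where h: "local_fun M X h" "b' = ext_by_zero M X h" using 2(2) by (rule Cc_base_rep)
      show ?case unfolding f g h M.Cc_ops M.ext_mult M.ext_add by (simp add: algebra_simps)
    next
      case (3 c b)
      obtain g where g: "local_fun M X g" "b = ext_by_zero M X g" using 3 by (rule Cc_base_rep)
      show ?case unfolding f g M.Cc_ops M.ext_mult M.ext_smult by (simp add: algebra_simps)
    next
      case (4 b)
      obtain g where g: "local_fun M X g" "b = ext_by_zero M X g" using 4 by (rule Cc_base_rep)
      show ?case unfolding f g M.Cc_ops M.ext_mult by (intro M.ext_in_Cc local_fun_base_mult f g)
    next
      case (5 b b')
      obtain g where g: "local_fun M X g" "b = ext_by_zero M X g" using 5(1) by (rule Cc_base_rep)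
      obtain h where h: "local_fun M X h" "b' = ext_by_zero M X h" using 5(2) by (rule Cc_base_rep)
      show ?case unfolding f g h M.Cc_ops M.ext_mult M.ext_add by (simp add: algebra_simps)
    next
      case (6 c b)
      obtain g where g: "local_fun M X g" "b = ext_by_zero M X g" using 6 by (rule Cc_base_rep)
      show ?case unfolding f g M.Cc_ops M.ext_mult M.ext_smult by (simp add: algebra_simps)
    qed
  qed
  show "(\<lambda>b. a \<otimes>\<^bsub>?R\<^esub> b) \<in> linear_maps ?R ?R" if "a \<in> carrier ?R" for a using lin[OF that] by simp
  show "(\<lambda>a. a \<otimes>\<^bsub>?R\<^esub> b) \<in> linear_maps ?R ?R" if "b \<in> carrier ?R" for b using lin[OF that] by simp
qed

lemma base_comm: "a \<in> carrier (Cc M :: ('f::real_normed_field, _) module) ==> b \<in> carrier (Cc M) ==> a \<otimes>\<^bsub>Cc M\<^esub> b = b \<otimes>\<^bsub>Cc M\<^esub> a"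
proof -
  assume a: "a \<in> carrier (Cc M :: ('f, _) module)" and b: "b \<in> carrier (Cc M)"
  obtain f where f: "local_fun M X f" "a = ext_by_zero M X f" using a by (rule Cc_base_rep)
  obtain g where g: "local_fun M X g" "b = ext_by_zero M X g" using b by (rule Cc_base_rep)
  show ?thesis unfolding f g M.Cc_ops M.ext_mult by (simp add: mult.commute)
qed

end

locale hmap = etmap E M TF \<pi> + hbase M
  for E :: "('p, 'e::{real_inner,heine_borel}) manifold" and M :: "('m, 'e) manifold"
    and TF :: "'f::real_normed_field itself" and \<pi> :: "'p => 'm"
begin

abbreviation "R \<equiv> Cc M :: ('f, ('m, 'f) germs) module"
abbreviation "XE \<equiv> Cc_mod E \<pi> :: ('f, ('m, 'f) germs, ('p, 'f) germs) rmodule"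

lemma Cc_mod_simps:
  "carrier XE = carrier CE" "add XE = add (sections E)" "zero XE = zero (sections E)" "smult XE = smult (sections E)"
  by (simp_all add: Cc_mod_def)

lemma vspace_XE: "vspace XE"
  by (rule vspace_cong[OF E.vspace_Cc]) (simp_all add: Cc_mod_simps)

lemma act_apply:
  "y \<in> topspace (mtop E) ==> act XE p u y = germ_pullback E \<pi> y (p (\<pi> y)) \<otimes>\<^bsub>stalk E y\<^esub> u y"
  by (simp add: Cc_mod_def)

text \<open>Germs multiply pointwise, so the formula holds for arbitrary functions; smoothness and
  compact support enter only through membership in \<open>Cc\<close>.\<close>

lemma act_ext_fun:
  "act XE (ext_by_zero M X q) (ext_by_zero E U f) = ext_by_zero E U (\<lambda>y. q (\<pi> y) * f y)"
proof
  fix y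
  show "act XE (ext_by_zero M X q) (ext_by_zero E U f) y = ext_by_zero E U (\<lambda>y. q (\<pi> y) * f y) y"
  proof (cases "y \<in> topspace (mtop E)")
    case True
    then have "\<pi> y \<in> X" using etale_in[OF et] by blast
    then show ?thesis using True
      by (simp add: act_apply ext_by_zero_def pullback_germ stalk_ops)
  qed (simp add: Cc_mod_def ext_by_zero_def)
qed

lemma local_fun_act:
  fixes q :: "'m => 'f"
  assumes "local_fun M X q" "local_fun E U f"
  shows "local_fun E U (\<lambda>y. q (\<pi> y) * f y)"
proof -
  have U: "openin (mtop E) U" by (rule local_fun_openin[OF assms(2)])
  have "vsmooth E U (\<lambda>y. q (\<pi> y))"
    by (rule smooth_pull[OF U]) (use assms(1) etale_in[OF et] openin_subset[OF U] in \<open>auto simp: local_fun_def\<close>)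
  from E.local_fun_mult[OF assms(2) this] show ?thesis by (simp add: mult.commute)
qed

lemma act_linear:
  assumes r: "r \<in> carrier R" shows "act XE r \<in> linear_maps CE CE"
proof -
  interpret CE: vspace CE by (rule E.vspace_Cc)
  obtain q where q: "local_fun M X q" "r = ext_by_zero M X q" using r by (rule Cc_base_rep)
  have pb: "germ_pullback E \<pi> y (r (\<pi> y)) \<in> carrier (stalk E y)" if y: "y \<in> topspace (mtop E)" for y
    by (rule linear_mapsD(1)[OF pullback_linear[OF y] F.Cc_in_stalk[OF r etale_in[OF et y]]])
  have add: "act XE r (u \<oplus>\<^bsub>sections E\<^esub> v) = act XE r u \<oplus>\<^bsub>sections E\<^esub> act XE r v" if u: "u \<in> carrier CE" and v: "v \<in> carrier CE" for u v
  proof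
    fix y
    show "act XE r (u \<oplus>\<^bsub>sections E\<^esub> v) y = (act XE r u \<oplus>\<^bsub>sections E\<^esub> act XE r v) y"
    proof (cases "y \<in> topspace (mtop E)")
      case True
      show ?thesis
        using linear_mapsD(2)[OF E.stalk_mult_linear(1)[OF pb[OF True]] E.Cc_in_stalk[OF u True] E.Cc_in_stalk[OF v True]]
        by (simp add: act_apply E.sections_ops True)
    qed (simp add: Cc_mod_def sections_def)
  qed
  have sm: "act XE r (c \<odot>\<^bsub>sections E\<^esub> u) = c \<odot>\<^bsub>sections E\<^esub> act XE r u" if u: "u \<in> carrier CE" for u c
  proof
    fix y
    show "act XE r (c \<odot>\<^bsub>sections E\<^esub> u) y = (c \<odot>\<^bsub>sections E\<^esub> act XE r u) y"
    proof (cases "y \<in> topspace (mtop E)")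
      case True
      show ?thesis
        using linear_mapsD(3)[OF E.stalk_mult_linear(1)[OF pb[OF True]] E.Cc_in_stalk[OF u True]]
        by (simp add: act_apply E.sections_ops True)
    qed (simp add: Cc_mod_def sections_def)
  qed
  have cl: "act XE r u \<in> carrier CE" if "u \<in> carrier CE" for u
    using that
  proof (induction rule: E.Cc_induct_ext)
    case zero
    have e: "ext_by_zero E {} (\<lambda>_. 0 :: 'f) = \<zero>\<^bsub>sections E\<^esub>" by (rule E.ext_zero) simp_all
    have "act XE r (ext_by_zero E {} (\<lambda>_. 0)) = ext_by_zero E {} (\<lambda>y. q (\<pi> y) * 0)" unfolding q(2) by (rule act_ext_fun)
    then show ?case using e CE.zero_closed by simp
  next
    case (ext U f)
    show ?case unfolding q(2) act_ext_fun by (rule E.ext_in_Cc[OF local_fun_act[OF q(1) ext]])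
  next
    case (add u v)
    then show ?case using CE.a_closed[of "act XE r u" "act XE r v"] by (simp add: \<open>\<And>u v. _ ==> _ ==> act XE r (u \<oplus>\<^bsub>sections E\<^esub> v) = _\<close>)
  qed
  show ?thesis by (rule linear_mapsI) (simp_all add: cl add sm)
qed

lemma act_in: "r \<in> carrier R ==> u \<in> carrier CE ==> act XE r u \<in> carrier CE"
  using linear_mapsD(1)[OF act_linear] by blast

lemma r_module_XE: "r_module R XE"
  unfolding r_module_def
proof (intro conjI ballI vspace_XE)
  fix r assume r: "r \<in> carrier R"
  show "act XE r \<in> linear_maps XE XE"
    using act_linear[OF r] by (simp add: linear_maps_def Cc_mod_simps)
next
  fix r r' u assume r: "r \<in> carrier R" and r': "r' \<in> carrier R" and u: "u \<in> carrier XE"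
  obtain q where q: "local_fun M X q" "r = ext_by_zero M X q" using r by (rule Cc_base_rep)
  obtain q' where q': "local_fun M X q'" "r' = ext_by_zero M X q'" using r' by (rule Cc_base_rep)
  have u': "u \<in> carrier CE" using u by (simp add: Cc_mod_simps)
  show "act XE r (act XE r' u) = act XE r' (act XE r u)"
  proof (rule E.Cc_linear_eqI_ext[OF linear_maps_compose[OF act_linear[OF r'] act_linear[OF r]]
        linear_maps_compose[OF act_linear[OF r] act_linear[OF r']] E.vspace_Cc u'])
    fix U and h :: "'p => 'f"
    show "act XE r (act XE r' (ext_by_zero E U h)) = act XE r' (act XE r (ext_by_zero E U h))"
      unfolding q q' act_ext_fun by (simp add: ac_simps)
  qed
qed

lemma act_mult:
  assumes r: "r \<in> carrier R" and r': "r' \<in> carrier R" and u: "u \<in> carrier CE"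
  shows "act XE (r \<otimes>\<^bsub>R\<^esub> r') u = act XE r (act XE r' u)"
proof -
  obtain q where q: "local_fun M X q" "r = ext_by_zero M X q" using r by (rule Cc_base_rep)
  obtain q' where q': "local_fun M X q'" "r' = ext_by_zero M X q'" using r' by (rule Cc_base_rep)
  have rr: "r \<otimes>\<^bsub>R\<^esub> r' \<in> carrier R" by (rule assoc_algebra.mult_closed[OF assoc_algebra_base r r'])
  show ?thesis
  proof (rule E.Cc_linear_eqI_ext[OF act_linear[OF rr]
        linear_maps_compose[OF act_linear[OF r'] act_linear[OF r]] E.vspace_Cc u])
    fix U and h :: "'p => 'f"
    show "act XE (r \<otimes>\<^bsub>R\<^esub> r') (ext_by_zero E U h) = act XE r (act XE r' (ext_by_zero E U h))"
      unfolding q q' F.Cc_ops F.ext_mult act_ext_fun by (simp add: ac_simps)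
  qed
qed

lemma act_linear_left:
  assumes u: "u \<in> carrier CE" shows "(\<lambda>r. act XE r u) \<in> linear_maps R CE"
proof (rule linear_mapsI)
  fix r r' c assume r: "r \<in> carrier R"
  show "act XE r u \<in> carrier CE" by (rule act_in[OF r u])
  have pb: "germ_pullback E \<pi> y (r (\<pi> y)) \<in> carrier (stalk E y)" if y: "y \<in> topspace (mtop E)" and r: "r \<in> carrier R" for y r
    by (rule linear_mapsD(1)[OF pullback_linear[OF y] F.Cc_in_stalk[OF r etale_in[OF et y]]])
  show "act XE (c \<odot>\<^bsub>R\<^esub> r) u = c \<odot>\<^bsub>CE\<^esub> act XE r u"
  proof
    fix y
    show "act XE (c \<odot>\<^bsub>R\<^esub> r) u y = (c \<odot>\<^bsub>CE\<^esub> act XE r u) y"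
    proof (cases "y \<in> topspace (mtop E)")
      case True
      note My = etale_in[OF et True]
      show ?thesis
        using linear_mapsD(3)[OF E.stalk_mult_linear(2)[OF E.Cc_in_stalk[OF u True]] pb[OF True r], of c]
          linear_mapsD(3)[OF pullback_linear[OF True] F.Cc_in_stalk[OF r My], of c]
        by (simp add: act_apply E.sections_ops F.sections_ops True My)
    qed (simp add: Cc_mod_def sections_def)
  qed
  assume r': "r' \<in> carrier R"
  show "act XE (r \<oplus>\<^bsub>R\<^esub> r') u = act XE r u \<oplus>\<^bsub>CE\<^esub> act XE r' u"
  proof
    fix y
    show "act XE (r \<oplus>\<^bsub>R\<^esub> r') u y = (act XE r u \<oplus>\<^bsub>CE\<^esub> act XE r' u) y"
    proof (cases "y \<in> topspace (mtop E)")
      case True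
      note My = etale_in[OF et True]
      show ?thesis
        using linear_mapsD(2)[OF E.stalk_mult_linear(2)[OF E.Cc_in_stalk[OF u True]] pb[OF True r] pb[OF True r']]
          linear_mapsD(2)[OF pullback_linear[OF True] F.Cc_in_stalk[OF r My] F.Cc_in_stalk[OF r' My]]
        by (simp add: act_apply E.sections_ops F.sections_ops True My)
    qed (simp add: Cc_mod_def sections_def)
  qed
qed

text \<open>The witness is a compact subset of the base instead of a single function: for several
  elements, or for two actions at once, the compact sets are united and one function equal to 1 on
  the union serves all.\<close>

lemma act_unit_support:
  assumes "u \<in> carrier CE"
  shows "\<exists>K. compactin (mtop M) K \<and> (\<forall>q. local_fun M X q \<longrightarrow> (\<forall>x\<in>K. q x = 1) \<longrightarrow> act XE (ext_by_zero M X q) u = u)"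
  using assms
proof (induction rule: E.Cc_induct_ext)
  case zero
  have e: "ext_by_zero E {} (\<lambda>_. 0 :: 'f) = \<zero>\<^bsub>sections E\<^esub>" by (rule E.ext_zero) simp_all
  have "act XE (ext_by_zero M X q) (ext_by_zero E {} (\<lambda>_. 0)) = ext_by_zero E {} (\<lambda>_. 0)" for q
    unfolding act_ext_fun by simp
  then show ?case unfolding e by (intro exI[of _ "{}"]) simp
next
  case (ext U f)
  then obtain K where K: "openin (mtop E) U" "compactin (mtop E) K" "K \<subseteq> U" "\<And>x. x \<in> U ==> x \<notin> K ==> f x = 0"
    by (rule local_funE) (rule that)
  have "act XE (ext_by_zero M X q) (ext_by_zero E U f) = ext_by_zero E U f" if q: "\<forall>x\<in>\<pi> ` K. q x = 1" for q
    unfolding act_ext_fun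
  proof (rule E.ext_cong[OF K(1)])
    fix x assume "x \<in> U"
    then show "q (\<pi> x) * f x = f x" using q K(4)[of x] by (cases "x \<in> K") auto
  qed
  then show ?case using image_compactin[OF K(2) etale_cont[OF et]] by (intro exI[of _ "\<pi> ` K"]) simp
next
  case (add u v)
  then obtain K L where K: "compactin (mtop M) K" "\<forall>q. local_fun M X q \<longrightarrow> (\<forall>x\<in>K. q x = 1) \<longrightarrow> act XE (ext_by_zero M X q) u = u"
    and L: "compactin (mtop M) L" "\<forall>q. local_fun M X q \<longrightarrow> (\<forall>x\<in>L. q x = 1) \<longrightarrow> act XE (ext_by_zero M X q) v = v" by (elim exE conjE)
  show ?case
  proof (intro exI[of _ "K \<union> L"] conjI allI impI compactin_Un K(1) L(1))
    fix q :: "'m => 'f" assume q: "local_fun M X q" "\<forall>x\<in>K \<union> L. q x = 1"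
    have uv: "act XE (ext_by_zero M X q) u = u" "act XE (ext_by_zero M X q) v = v"
      using K(2)[rule_format, OF q(1)] L(2)[rule_format, OF q(1)] q(2) by auto
    show "act XE (ext_by_zero M X q) (u \<oplus>\<^bsub>sections E\<^esub> v) = u \<oplus>\<^bsub>sections E\<^esub> v"
      using linear_mapsD(2)[OF act_linear[OF F.ext_in_Cc[OF q(1)]] add(1,2)] uv by simp
  qed
qed

lemma act_unit_support_finite:
  assumes "finite B" "B \<subseteq> carrier CE"
  shows "\<exists>K. compactin (mtop M) K \<and> (\<forall>q. local_fun M X q \<longrightarrow> (\<forall>x\<in>K. q x = 1) \<longrightarrow> (\<forall>u\<in>B. act XE (ext_by_zero M X q) u = u))"
  using assms
proof (induction B)
  case empty then show ?case by (intro exI[of _ "{}"]) simp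
next
  case (insert u B)
  then have "u \<in> carrier CE" by simp
  from act_unit_support[OF this] obtain K where K: "compactin (mtop M) K"
    "\<forall>q. local_fun M X q \<longrightarrow> (\<forall>x\<in>K. q x = 1) \<longrightarrow> act XE (ext_by_zero M X q) u = u" by (elim exE conjE)
  from insert obtain L where L: "compactin (mtop M) L"
    "\<forall>q. local_fun M X q \<longrightarrow> (\<forall>x\<in>L. q x = 1) \<longrightarrow> (\<forall>u\<in>B. act XE (ext_by_zero M X q) u = u)" by auto
  show ?case
  proof (intro exI[of _ "K \<union> L"] conjI allI impI compactin_Un K(1) L(1) ballI)
    fix q :: "'m => 'f" and v assume q: "local_fun M X q" "\<forall>x\<in>K \<union> L. q x = 1" and v: "v \<in> insert u B"
    show "act XE (ext_by_zero M X q) v = v"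
      using K(2)[rule_format, OF q(1)] L(2)[rule_format, OF q(1)] q(2) v by auto
  qed
qed

end

lemma (in hbase) hmap_id: "hmap TYPE('f::real_normed_field) M M (\<lambda>x. x)"
  by unfold_locales (rule etale_id)

lemma (in hbase) base_unit_fun:
  assumes "compactin (mtop M) K"
  obtains q :: "'m => 'f::real_normed_field" where "local_fun M X q" "\<And>x. x \<in> K ==> q x = 1"
proof -
  have "K \<subseteq> X" using assms by (simp add: compactin_def)
  then obtain N and c :: "'m => 'f" where c: "local_fun M X c" "K \<subseteq> N" "\<And>x. x \<in> N ==> c x = 1"
    by (rule M.cutoff_compact[OF openin_topspace hX assms]) (rule that)
  show thesis by (rule that[OF c(1)]) (use c(2,3) in blast)
qed

lemma (in hbase) comm_local_algebra_base:
  "comm_local_algebra (Cc M :: ('f::real_normed_field, ('m, 'f) germs) module)"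
proof (rule comm_local_algebra.intro[OF assoc_algebra_base], unfold_locales)
  let ?R = "Cc M :: ('f, ('m, 'f) germs) module"
  show "a \<otimes>\<^bsub>?R\<^esub> b = b \<otimes>\<^bsub>?R\<^esub> a" if "a \<in> carrier ?R" "b \<in> carrier ?R" for a b using that by (rule base_comm)
  fix B assume B: "finite B" "B \<subseteq> carrier ?R"
  interpret I: hmap M M "TYPE('f)" "\<lambda>x. x" by (rule hmap_id)
  obtain K where K: "compactin (mtop M) K"
    "\<forall>q. local_fun M X q \<longrightarrow> (\<forall>x\<in>K. q x = 1) \<longrightarrow> (\<forall>u\<in>B. act I.XE (ext_by_zero M X q) u = u)"
    using I.act_unit_support_finite[OF B] by (elim exE conjE)
  obtain q :: "'m => 'f" where q: "local_fun M X q" "\<And>x. x \<in> K ==> q x = 1" by (rule base_unit_fun[OF K(1)]) (rule that)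
  have "ext_by_zero M X q \<otimes>\<^bsub>?R\<^esub> b = b" if b: "b \<in> B" for b
  proof -
    have "b \<in> carrier ?R" using b B by blast
    then obtain f where f: "local_fun M X f" "b = ext_by_zero M X f" by (rule Cc_base_rep)
    have "act I.XE (ext_by_zero M X q) b = b" using K(2) q b by blast
    then show ?thesis unfolding f(2) I.act_ext_fun by (simp add: M.ext_mult)
  qed
  then show "\<exists>r\<in>carrier ?R. \<forall>b\<in>B. r \<otimes>\<^bsub>?R\<^esub> b = b" using M.ext_in_Cc[OF q(1)] by blast
qed

section \<open>The map \<open>\<Omega>\<close>\<close>

text \<open>The bilinear map behind \<open>Omega\<close>, named so that it can be studied before it
  is lifted to the tensor product.\<close>

definition box ::
  "('p, 'e::{real_inner,heine_borel}) manifold => ('p => 'm) => ('q, 'e) manifold => ('q => 'm)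
    => ('p => ('p => 'f)set) => (('q, 'f) germs) => ('p \<times> 'q => ('p \<times> 'q => 'f::real_normed_field) set)" where
  "box E \<pi> F \<xi> u v = (\<lambda>w\<in>topspace (mtop (fib_prod E \<pi> F \<xi>)).
        germ_pullback (fib_prod E \<pi> F \<xi>) fst w (u (fst w))
          \<otimes>\<^bsub>stalk (fib_prod E \<pi> F \<xi>) w\<^esub> germ_pullback (fib_prod E \<pi> F \<xi>) snd w (v (snd w)))"

lemma Omega_box: "Omega E \<pi> F \<xi> = tensor_lift (Cc (fib_prod E \<pi> F \<xi>)) (box E \<pi> F \<xi>)"
  unfolding Omega_def box_def[abs_def] ..

locale hfib = fib E F M TF \<pi> \<xi> + hbase M
  for E :: "('p, 'e::{real_inner,heine_borel}) manifold" and F :: "('q, 'e) manifold" and M :: "('m, 'e) manifold"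
    and TF :: "'f::real_normed_field itself" and \<pi> :: "'p => 'm" and \<xi> :: "'q => 'm"
begin

sublocale EM: hmap E M TF \<pi> by unfold_locales (rule \<pi>)
sublocale FM: hmap F M TF \<xi> by unfold_locales (rule \<xi>)
sublocale PE: etmap P E TF fst by unfold_locales (rule etale_fst)
sublocale PF: etmap P F TF snd by unfold_locales (rule etale_snd)

abbreviation "CP \<equiv> Cc P :: ('f, 'p \<times> 'q => ('p \<times> 'q => 'f) set) module"
abbreviation "bx \<equiv> box E \<pi> F \<xi> :: _ => _ => ('p \<times> 'q => ('p \<times> 'q => 'f) set)"
abbreviation "boxset U V \<equiv> {(y, z). y \<in> U \<and> z \<in> V \<and> \<pi> y = \<xi> z}"

sublocale TS: tensor_setup "EM.R" "EM.XE" "FM.XE"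
  by unfold_locales (rule EM.r_module_XE, rule FM.r_module_XE)

lemma topP: "w \<in> topspace (mtop P) ==> fst w \<in> topspace (mtop E) \<and> snd w \<in> topspace (mtop F) \<and> \<pi> (fst w) = \<xi> (snd w)"
  by (auto simp: topspace_P)

lemma box_apply: "w \<in> topspace (mtop P) ==> bx u v w = germ_pullback P fst w (u (fst w)) \<otimes>\<^bsub>stalk P w\<^esub> germ_pullback P snd w (v (snd w))"
  by (simp add: box_def)

text \<open>The support lies in the part of \<open>K \<times> L\<close> where both projections to
  the base agree. This condition is closed because \<open>M\<close> is Hausdorff, so it cuts a
  compact set out of a compact set. Hausdorffness of the box itself is inherited from
  \<open>U \<times> V\<close>.\<close>

lemma local_fun_box:
  fixes f :: "'p => 'f" and g :: "'q => 'f"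
  assumes f: "local_fun E U f" and g: "local_fun F V g"
  shows "local_fun P (boxset U V) (\<lambda>w. f (fst w) * g (snd w))"
proof -
  obtain K where K: "openin (mtop E) U" "Hausdorff_space (subtopology (mtop E) U)" "vsmooth E U f"
    "compactin (mtop E) K" "K \<subseteq> U" "\<And>x. x \<in> U ==> x \<notin> K ==> f x = 0" using f by (rule local_funE) (rule that)
  obtain L where L: "openin (mtop F) V" "Hausdorff_space (subtopology (mtop F) V)" "vsmooth F V g"
    "compactin (mtop F) L" "L \<subseteq> V" "\<And>x. x \<in> V ==> x \<notin> L ==> g x = 0" using g by (rule local_funE) (rule that)
  have o: "openin (mtop P) (boxset U V)" by (rule openin_box[OF K(1) L(1)])
  let ?D = "{w \<in> topspace (prod_topology (mtop E) (mtop F)). (\<pi> \<circ> fst) w = (\<xi> \<circ> snd) w}"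
  have D: "closedin (prod_topology (mtop E) (mtop F)) ?D"
    by (rule closedin_continuous_maps_eq[OF hM continuous_map_compose[OF continuous_map_fst etale_cont[OF \<pi>]]
          continuous_map_compose[OF continuous_map_snd etale_cont[OF \<xi>]]])
  have KL: "compactin (prod_topology (mtop E) (mtop F)) (K \<times> L)" using K(4) L(4) by (simp add: compactin_Times)
  have c: "compactin (mtop P) ((K \<times> L) \<inter> ?D)"
    unfolding mtop_P fib_top_def compactin_subtopology
    using compact_Int_closedin[OF KL D] by auto
  show ?thesis
  proof (rule local_funI[OF o _ _ c])
    have "subtopology (mtop P) (boxset U V) = subtopology (prod_topology (mtop E) (mtop F)) (boxset U V)"
    proof -
      have "{(y, z). \<pi> y = \<xi> z} \<inter> boxset U V = boxset U V" by auto
      then show ?thesis unfolding mtop_P fib_top_def subtopology_subtopology by simp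
    qed
    also have "\<dots> = subtopology (subtopology (prod_topology (mtop E) (mtop F)) (U \<times> V)) (boxset U V)"
    proof -
      have "(U \<times> V) \<inter> boxset U V = boxset U V" by auto
      then show ?thesis unfolding subtopology_subtopology by simp
    qed
    finally have e: "subtopology (mtop P) (boxset U V) = \<dots>" .
    show "Hausdorff_space (subtopology (mtop P) (boxset U V))"
      unfolding e subtopology_Times
      by (intro Hausdorff_space_subtopology) (use K(2) L(2) in \<open>simp add: Hausdorff_space_prod_topology\<close>)
    show "vsmooth P (boxset U V) (\<lambda>w. f (fst w) * g (snd w))"
      by (rule P.vsmooth_mult[OF o PE.smooth_pull[OF o K(3)] PF.smooth_pull[OF o L(3)]]) auto
    show "(K \<times> L) \<inter> ?D \<subseteq> boxset U V" using K(5) L(5) by auto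
    fix w assume w: "w \<in> boxset U V" "w \<notin> (K \<times> L) \<inter> ?D"
    then have "fst w \<in> U" "snd w \<in> V" "fst w \<in> topspace (mtop E)" "snd w \<in> topspace (mtop F)" "\<pi> (fst w) = \<xi> (snd w)"
      using openin_subset[OF K(1)] openin_subset[OF L(1)] by auto
    moreover from this have "fst w \<notin> K \<or> snd w \<notin> L" using w(2) by (cases w) auto
    ultimately show "f (fst w) * g (snd w) = 0" using K(6) L(6) by auto
  qed
qed

lemma box_ext: "bx (ext_by_zero E U f) (ext_by_zero F V g) = ext_by_zero P (boxset U V) (\<lambda>w. f (fst w) * g (snd w))"
proof
  fix w
  show "bx (ext_by_zero E U f) (ext_by_zero F V g) w = ext_by_zero P (boxset U V) (\<lambda>w. f (fst w) * g (snd w)) w"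
  proof (cases "w \<in> topspace (mtop P)")
    case True
    note t = topP[OF True]
    have a: "ext_by_zero E U f (fst w) = germ E (fst w) (if fst w \<in> U then f else (\<lambda>_. 0))"
      using t by (simp add: ext_by_zero_def stalk_ops)
    have b: "ext_by_zero F V g (snd w) = germ F (snd w) (if snd w \<in> V then g else (\<lambda>_. 0))"
      using t by (simp add: ext_by_zero_def stalk_ops)
    show ?thesis
      unfolding box_apply[OF True] a b PE.pullback_germ[OF True] PF.pullback_germ[OF True] stalk_ops
      using True t by (auto simp: ext_by_zero_def stalk_ops case_prod_unfold)
  qed (simp add: box_def ext_by_zero_def)
qed

lemma box_pb:
  assumes w: "w \<in> topspace (mtop P)"
  shows "u \<in> carrier EM.CE ==> germ_pullback P fst w (u (fst w)) \<in> carrier (stalk P w)"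
    and "v \<in> carrier FM.CE ==> germ_pullback P snd w (v (snd w)) \<in> carrier (stalk P w)"
  using linear_mapsD(1)[OF PE.pullback_linear[OF w] E.Cc_in_stalk] linear_mapsD(1)[OF PF.pullback_linear[OF w] F.Cc_in_stalk] topP[OF w]
  by blast+

lemma box_add1:
  assumes u: "u \<in> carrier EM.CE" "u' \<in> carrier EM.CE" and v: "v \<in> carrier FM.CE"
  shows "bx (u \<oplus>\<^bsub>sections E\<^esub> u') v = bx u v \<oplus>\<^bsub>sections P\<^esub> bx u' v"
proof
  fix w
  show "bx (u \<oplus>\<^bsub>sections E\<^esub> u') v w = (bx u v \<oplus>\<^bsub>sections P\<^esub> bx u' v) w"
  proof (cases "w \<in> topspace (mtop P)")
    case True
    then have t: "fst w \<in> topspace (mtop E)" using topP by blast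
    show ?thesis
      using linear_mapsD(2)[OF PE.pullback_linear[OF True] E.Cc_in_stalk[OF u(1) t] E.Cc_in_stalk[OF u(2) t]]
        linear_mapsD(2)[OF P.stalk_mult_linear(2)[OF box_pb(2)[OF True v]] box_pb(1)[OF True u(1)] box_pb(1)[OF True u(2)]]
      by (simp add: box_apply[OF True] E.sections_ops[OF t] P.sections_ops[OF True])
  qed (simp add: box_def sections_def)
qed

lemma box_smult1:
  assumes u: "u \<in> carrier EM.CE" and v: "v \<in> carrier FM.CE"
  shows "bx (c \<odot>\<^bsub>sections E\<^esub> u) v = c \<odot>\<^bsub>sections P\<^esub> bx u v"
proof
  fix w
  show "bx (c \<odot>\<^bsub>sections E\<^esub> u) v w = (c \<odot>\<^bsub>sections P\<^esub> bx u v) w"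
  proof (cases "w \<in> topspace (mtop P)")
    case True
    then have t: "fst w \<in> topspace (mtop E)" using topP by blast
    show ?thesis
      using linear_mapsD(3)[OF PE.pullback_linear[OF True] E.Cc_in_stalk[OF u(1) t], of c]
        linear_mapsD(3)[OF P.stalk_mult_linear(2)[OF box_pb(2)[OF True v]] box_pb(1)[OF True u(1)], of c]
      by (simp add: box_apply[OF True] E.sections_ops[OF t] P.sections_ops[OF True])
  qed (simp add: box_def sections_def)
qed

lemma box_add2:
  assumes u: "u \<in> carrier EM.CE" and v: "v \<in> carrier FM.CE" "v' \<in> carrier FM.CE"
  shows "bx u (v \<oplus>\<^bsub>sections F\<^esub> v') = bx u v \<oplus>\<^bsub>sections P\<^esub> bx u v'"
proof
  fix w
  show "bx u (v \<oplus>\<^bsub>sections F\<^esub> v') w = (bx u v \<oplus>\<^bsub>sections P\<^esub> bx u v') w"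
  proof (cases "w \<in> topspace (mtop P)")
    case True
    then have t: "snd w \<in> topspace (mtop F)" using topP by blast
    show ?thesis
      using linear_mapsD(2)[OF PF.pullback_linear[OF True] F.Cc_in_stalk[OF v(1) t] F.Cc_in_stalk[OF v(2) t]]
        linear_mapsD(2)[OF P.stalk_mult_linear(1)[OF box_pb(1)[OF True u]] box_pb(2)[OF True v(1)] box_pb(2)[OF True v(2)]]
      by (simp add: box_apply[OF True] F.sections_ops[OF t] P.sections_ops[OF True])
  qed (simp add: box_def sections_def)
qed

lemma box_smult2:
  assumes u: "u \<in> carrier EM.CE" and v: "v \<in> carrier FM.CE"
  shows "bx u (c \<odot>\<^bsub>sections F\<^esub> v) = c \<odot>\<^bsub>sections P\<^esub> bx u v"
proof
  fix w
  show "bx u (c \<odot>\<^bsub>sections F\<^esub> v) w = (c \<odot>\<^bsub>sections P\<^esub> bx u v) w"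
  proof (cases "w \<in> topspace (mtop P)")
    case True
    then have t: "snd w \<in> topspace (mtop F)" using topP by blast
    show ?thesis
      using linear_mapsD(3)[OF PF.pullback_linear[OF True] F.Cc_in_stalk[OF v(1) t], of c]
        linear_mapsD(3)[OF P.stalk_mult_linear(1)[OF box_pb(1)[OF True u]] box_pb(2)[OF True v(1)], of c]
      by (simp add: box_apply[OF True] F.sections_ops[OF t] P.sections_ops[OF True])
  qed (simp add: box_def sections_def)
qed

lemma zero_ext: "\<zero>\<^bsub>sections E\<^esub> = ext_by_zero E {} (\<lambda>_. 0 :: 'f)" "\<zero>\<^bsub>sections F\<^esub> = ext_by_zero F {} (\<lambda>_. 0 :: 'f)"
  by (rule E.ext_zero[symmetric]; simp) (rule F.ext_zero[symmetric]; simp)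

lemma box_in:
  assumes u: "u \<in> carrier EM.CE" and v: "v \<in> carrier FM.CE"
  shows "bx u v \<in> carrier CP"
proof -
  interpret CP: vspace CP by (rule P.vspace_Cc)
  have z: "ext_by_zero P {} (\<lambda>w. 0 :: 'f) \<in> carrier CP"
    by (rule P.ext_in_Cc[OF P.local_fun_zero]) (simp_all add: Hausdorff_space_def)
  have 1: "bx (ext_by_zero E U f) v \<in> carrier CP" if f: "local_fun E U f" for U and f :: "'p => 'f"
    using v
  proof (induction rule: F.Cc_induct_ext)
    case zero
    show ?case unfolding zero_ext box_ext using z by simp
  next
    case (ext V g) show ?case unfolding box_ext by (rule P.ext_in_Cc[OF local_fun_box[OF f ext]])
  next
    case (add v v')
    show ?case unfolding box_add2[OF E.ext_in_Cc[OF f] add(1,2)] using CP.a_closed[OF add(3,4)] by simp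
  qed
  show ?thesis using u
  proof (induction rule: E.Cc_induct_ext)
    case zero
    show ?case unfolding zero_ext(1) using v
    proof (induction rule: F.Cc_induct_ext)
      case zero then show ?case unfolding zero_ext box_ext using z by simp
    next
      case (ext V g) show ?case unfolding box_ext using z by simp
    next
      case (add v v')
      have "ext_by_zero E {} (\<lambda>_. 0 :: 'f) \<in> carrier EM.CE"
        by (rule E.ext_in_Cc[OF E.local_fun_zero]) (simp_all add: Hausdorff_space_def)
      then show ?case using box_add2[OF _ add(1,2)] CP.a_closed[OF add(3,4)] by simp
    qed
  next
    case (ext U f) then show ?case by (rule 1)
  next
    case (add u u')
    show ?case unfolding box_add1[OF add(1,2) v] using CP.a_closed[OF add(3,4)] by simp
  qed
qed

lemma box_linear2: "u \<in> carrier EM.CE ==> bx u \<in> linear_maps FM.CE CP"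
  by (rule linear_mapsI) (simp_all add: box_in box_add2 box_smult2)

lemma box_linear1: "v \<in> carrier FM.CE ==> (\<lambda>u. bx u v) \<in> linear_maps EM.CE CP"
  by (rule linear_mapsI) (simp_all add: box_in box_add1 box_smult1)

lemma box_act:
  assumes r: "r \<in> carrier EM.R" and u: "u \<in> carrier EM.CE" and v: "v \<in> carrier FM.CE"
  shows "bx (act EM.XE r u) v = bx u (act FM.XE r v)"
proof -
  obtain q where q: "local_fun M X q" "r = ext_by_zero M X q" using r by (rule Cc_base_rep)
  have loc: "bx (act EM.XE r (ext_by_zero E U f)) (ext_by_zero F V g) = bx (ext_by_zero E U f) (act FM.XE r (ext_by_zero F V g))"
    if f: "local_fun E U f" and g: "local_fun F V g" for U V and f :: "'p => 'f" and g :: "'q => 'f"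
    unfolding q(2) EM.act_ext_fun FM.act_ext_fun box_ext
    by (rule P.ext_cong[OF openin_box[OF local_fun_openin[OF f] local_fun_openin[OF g]]]) auto
  have 1: "bx (act EM.XE r (ext_by_zero E U f)) v = bx (ext_by_zero E U f) (act FM.XE r v)"
    if f: "local_fun E U f" for U and f :: "'p => 'f"
  proof (rule F.Cc_linear_eqI_ext[OF box_linear2 linear_maps_compose[OF FM.act_linear[OF r] box_linear2] P.vspace_Cc v])
    show "act EM.XE r (ext_by_zero E U f) \<in> carrier EM.CE" by (rule EM.act_in[OF r E.ext_in_Cc[OF f]])
    show "ext_by_zero E U f \<in> carrier EM.CE" by (rule E.ext_in_Cc[OF f])
  qed (rule loc[OF f])
  show ?thesis
    by (rule E.Cc_linear_eqI_ext[OF linear_maps_compose[OF EM.act_linear[OF r] box_linear1[OF v]]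
          box_linear1[OF FM.act_in[OF r v]] P.vspace_Cc u]) (rule 1)
qed

lemma box_balanced: "balanced EM.R EM.XE FM.XE CP bx"
proof (rule balancedI)
  show "bx x \<in> linear_maps FM.XE CP" if "x \<in> carrier EM.XE" for x
    using box_linear2[of x] that by (simp add: linear_maps_def EM.Cc_mod_simps FM.Cc_mod_simps)
  show "(\<lambda>x. bx x y) \<in> linear_maps EM.XE CP" if "y \<in> carrier FM.XE" for y
    using box_linear1[of y] that by (simp add: linear_maps_def EM.Cc_mod_simps FM.Cc_mod_simps)
qed (simp add: box_act EM.Cc_mod_simps FM.Cc_mod_simps)

lemma Omega_linear: "Omega E \<pi> F \<xi> \<in> linear_maps TS.T CP"
  unfolding Omega_box by (rule TS.lift_linear[OF P.vspace_Cc box_balanced])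

lemma Omega_pure: "u \<in> carrier EM.CE ==> v \<in> carrier FM.CE ==> Omega E \<pi> F \<xi> (TS.pt u v) = bx u v"
  unfolding Omega_box by (rule TS.lift_pure[OF P.vspace_Cc box_balanced]) (simp_all add: EM.Cc_mod_simps FM.Cc_mod_simps)

text \<open>\<open>Omega\<close> is linear over the base, which acts on functions on the fibre
  product through the common projection to \<open>M\<close>. The consequence for the kernel is what
  gets recorded.\<close>

lemma Omega_act:
  assumes r: "r \<in> carrier EM.R" and t: "t \<in> carrier TS.T" and z: "Omega E \<pi> F \<xi> t = \<zero>\<^bsub>sections P\<^esub>"
  shows "Omega E \<pi> F \<xi> (act TS.T r t) = \<zero>\<^bsub>sections P\<^esub>"
proof -
  interpret PM: hmap P M TF "\<lambda>w. \<pi> (fst w)" by unfold_locales (rule etale_compose[OF etale_fst \<pi>])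
  obtain q where q: "local_fun M X q" "r = ext_by_zero M X q" using r by (rule Cc_base_rep)
  have loc: "bx (act EM.XE r (ext_by_zero E U f)) (ext_by_zero F V g) = act PM.XE r (bx (ext_by_zero E U f) (ext_by_zero F V g))"
    for U V and f :: "'p => 'f" and g :: "'q => 'f"
    unfolding q(2) EM.act_ext_fun PM.act_ext_fun box_ext by (simp add: mult.assoc)
  have 1: "bx (act EM.XE r (ext_by_zero E U f)) v = act PM.XE r (bx (ext_by_zero E U f) v)"
    if f: "local_fun E U f" and v: "v \<in> carrier FM.CE" for U v and f :: "'p => 'f"
    by (rule F.Cc_linear_eqI_ext[OF box_linear2[OF EM.act_in[OF r E.ext_in_Cc[OF f]]]
          linear_maps_compose[OF box_linear2[OF E.ext_in_Cc[OF f]] PM.act_linear[OF r]] P.vspace_Cc v]) (rule loc)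
  have 2: "bx (act EM.XE r u) v = act PM.XE r (bx u v)" if u: "u \<in> carrier EM.CE" and v: "v \<in> carrier FM.CE" for u v
    by (rule E.Cc_linear_eqI_ext[OF linear_maps_compose[OF EM.act_linear[OF r] box_linear1[OF v]]
          linear_maps_compose[OF box_linear1[OF v] PM.act_linear[OF r]] P.vspace_Cc u]) (rule 1[OF _ v])
  have "Omega E \<pi> F \<xi> (act TS.T r t) = act PM.XE r (Omega E \<pi> F \<xi> t)"
  proof (rule TS.linear_eq_on_pure[OF linear_maps_compose[OF TS.act_T_linear[OF r] Omega_linear]
        linear_maps_compose[OF Omega_linear PM.act_linear[OF r]] t])
    fix x y assume "x \<in> carrier EM.XE" "y \<in> carrier FM.XE"
    then show "Omega E \<pi> F \<xi> (act TS.T r (TS.pt x y)) = act PM.XE r (Omega E \<pi> F \<xi> (TS.pt x y))"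
      using TS.act_closed(1)[OF r] by (simp add: TS.act_T_pure[OF r] Omega_pure EM.Cc_mod_simps FM.Cc_mod_simps 2)
  qed
  also have "\<dots> = \<zero>\<^bsub>CP\<^esub>"
    unfolding z using linear_maps_zero[OF PM.act_linear[OF r] P.vspace_Cc P.vspace_Cc] by simp
  finally show ?thesis by simp
qed

end

subsection \<open>Injectivity of \<open>\<Omega>\<close>\<close>

lemma linear_maps_add:
  assumes "f \<in> linear_maps A B" "g \<in> linear_maps A B" "vspace B"
  shows "(\<lambda>x. f x \<oplus>\<^bsub>B\<^esub> g x) \<in> linear_maps A B"
proof -
  interpret B: vspace B by fact
  show ?thesis
    by (rule linear_mapsI)
      (simp_all add: linear_mapsD[OF assms(1)] linear_mapsD[OF assms(2)] B.a_ac B.smult_add_right)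
qed

lemma linear_maps_const_zero: "vspace B ==> (\<lambda>_. \<zero>\<^bsub>B\<^esub>) \<in> linear_maps A B"
proof -
  assume "vspace B"
  then interpret B: vspace B .
  show ?thesis by (rule linear_mapsI) (simp_all add: B.smult_zero_right)
qed

text \<open>Actions are computed by \<open>act_ext_fun\<close> for functions given on all of
  \<open>X\<close>; this brings a function supported in a small \<open>W\<close> into that
  form.\<close>

lemma (in hbase) base_extend:
  fixes f :: "'m => 'f::real_normed_field"
  assumes f: "local_fun M W f"
  shows "local_fun M X (\<lambda>x. if x \<in> W then f x else 0)"
    and "ext_by_zero M W f = ext_by_zero M X (\<lambda>x. if x \<in> W then f x else 0)"
proof -
  let ?q = "\<lambda>x. if x \<in> W then f x else 0"
  have W: "openin (mtop M) W" by (rule local_fun_openin[OF f])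
  have q: "local_fun M W ?q" by (rule M.local_fun_cong[OF f]) simp
  show "local_fun M X ?q" by (rule M.local_fun_extend[OF q openin_topspace hX openin_subset[OF W]]) simp
  have "ext_by_zero M X ?q = ext_by_zero M W ?q"
    by (rule M.ext_extend[OF q openin_topspace hX openin_subset[OF W]]) simp
  moreover have "ext_by_zero M W f = ext_by_zero M W ?q" by (rule M.ext_cong[OF W]) simp
  ultimately show "ext_by_zero M W f = ext_by_zero M X ?q" by simp
qed

section \<open>Localization of sections near a point of the base\<close>

context hmap
begin

text \<open>A section with germ 1 at \<open>y\<close> whose carrier set \<open>U\<close> meets the
  fibre through \<open>y\<close> only in \<open>y\<close>, hence zero at all other points of that
  fibre. Such sections separate the points of a fibre.\<close>

definition unit_germ :: "'p => (('p, 'f) germs) => bool" where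
  "unit_germ y c \<longleftrightarrow> (\<exists>U e W. c = ext_by_zero E U e \<and> local_fun E U e \<and> inj_on \<pi> U \<and>
     openin (mtop E) W \<and> y \<in> W \<and> W \<subseteq> U \<and> (\<forall>x\<in>W. e x = 1))"

definition cu :: "'p => (('p, 'f) germs)" where
  "cu y = (SOME c. unit_germ y c)"

lemma cuE:
  assumes "y \<in> topspace (mtop E)"
  obtains U e W where "cu y = ext_by_zero E U e" "local_fun E U e" "inj_on \<pi> U"
    "openin (mtop E) W" "y \<in> W" "W \<subseteq> U" "\<forall>x\<in>W. e x = 1"
proof -
  obtain V where V: "openin (mtop E) V" "y \<in> V" "inj_on \<pi> V" using etale_inj[OF et assms] by (elim exE conjE)
  obtain U N and c :: "'p => 'f" where c: "U \<subseteq> V" "local_fun E U c" "openin (mtop E) N" "y \<in> N" "N \<subseteq> U"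
    "\<And>x. x \<in> N ==> c x = 1"
    by (rule E.cutoff_point[OF V(1,2)]) (rule that)
  have "unit_germ y (ext_by_zero E U c)"
    unfolding unit_germ_def
    by (intro exI[of _ U] exI[of _ c] exI[of _ N] conjI refl c(2-5) inj_on_subset[OF V(3) c(1)] ballI c(6))
  then have "unit_germ y (cu y)" unfolding cu_def by (rule someI[of "unit_germ y"])
  then show thesis unfolding unit_germ_def by (elim exE conjE) (rule that)
qed

lemma cu_in: "y \<in> topspace (mtop E) ==> cu y \<in> carrier CE"
  using cuE[of y] E.ext_in_Cc by metis

lemma cu_values:
  assumes "y \<in> topspace (mtop E)" "y' \<in> topspace (mtop E)" "\<pi> y' = \<pi> y"
  shows "cu y y' = germ E y' (\<lambda>_. if y' = y then 1 else 0)"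
proof -
  obtain U e W where c: "cu y = ext_by_zero E U e" "local_fun E U e" "inj_on \<pi> U"
    "openin (mtop E) W" "y \<in> W" "W \<subseteq> U" "\<forall>x\<in>W. e x = 1" by (rule cuE[OF assms(1)])
  show ?thesis
  proof (cases "y' = y")
    case True
    have "germ E y e = germ E y (\<lambda>_. 1)" by (rule germ_eqI[OF c(4,5)]) (use c(7) in blast)
    then show ?thesis using True c assms by (auto simp: ext_by_zero_def)
  next
    case False
    have "y' \<notin> U" using c(3,5,6) assms(3) False by (meson inj_onD subsetD)
    then show ?thesis using False assms by (simp add: c(1) ext_by_zero_def stalk_ops)
  qed
qed

text \<open>The module generated over the base by the sections \<open>cu y\<close> with
  \<open>y\<close> over \<open>x\<close>. Its elements are the normal forms to which sections are
  reduced near \<open>x\<close>.\<close>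

inductive_set fibre_span :: "'m => (('p, 'f) germs) set" for x where
  fs_zero: "\<zero>\<^bsub>sections E\<^esub> \<in> fibre_span x"
| fs_gen: "y \<in> topspace (mtop E) ==> \<pi> y = x ==> \<rho> \<in> carrier R ==> act XE \<rho> (cu y) \<in> fibre_span x"
| fs_add: "w \<in> fibre_span x ==> w' \<in> fibre_span x ==> w \<oplus>\<^bsub>sections E\<^esub> w' \<in> fibre_span x"

lemma fibre_span_in: "w \<in> fibre_span x ==> w \<in> carrier CE"
proof (induction rule: fibre_span.induct)
  case fs_zero then show ?case using abelian_monoid.zero_closed[OF abelian_group.axioms(1)[OF module.axioms(2)[OF vspace.module_scalars[OF E.vspace_Cc]]]] by simp
next
  case (fs_gen y \<rho>) then show ?case by (intro act_in cu_in)
next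
  case (fs_add w w')
  then show ?case using abelian_monoid.a_closed[OF abelian_group.axioms(1)[OF module.axioms(2)[OF vspace.module_scalars[OF E.vspace_Cc]]]] by simp
qed

text \<open>The support is bounded only from the base. As \<pi> is injective on \<open>U\<close>, a
  point of \<open>U\<close> over \<open>K\<close> already lies in \<open>V\<close>; and
  \<open>K\<close> is closed in the Hausdorff base, so the germ vanishes at every lost
  point.\<close>

lemma ext_shrink_base:
  fixes h :: "'p => 'f"
  assumes h: "local_fun E U h" and V: "openin (mtop E) V" "V \<subseteq> U" and inj: "inj_on \<pi> U"
    and K: "compactin (mtop M) K" "K \<subseteq> \<pi> ` V" and z: "\<And>y. y \<in> U ==> \<pi> y \<notin> K ==> h y = 0"
  shows "ext_by_zero E U h = ext_by_zero E V h"
proof (rule E.ext_eqI[OF h V])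
  fix y assume y: "y \<in> U" "y \<notin> V"
  have "\<pi> y \<notin> K"
  proof
    assume "\<pi> y \<in> K"
    then obtain y' where "y' \<in> V" "\<pi> y = \<pi> y'" using K(2) by blast
    then have "y = y'" using inj y V(2) by (meson inj_onD subsetD)
    then show False using y \<open>y' \<in> V\<close> by simp
  qed
  have U: "openin (mtop E) U" by (rule local_fun_openin[OF h])
  have KX: "K \<subseteq> X" using K(1) by (simp add: compactin_def)
  have "openin (mtop M) (X - K)" by (rule F.open_complement_compact[OF openin_topspace hX K(1) KX])
  then have o: "openin (mtop E) (U \<inter> {y \<in> topspace (mtop E). \<pi> y \<in> X - K})"
    using U etale_preimage[OF et] by blast
  show "germ E y h = germ E y (\<lambda>_. 0)"
    by (rule germ_eqI[OF o]) (use y \<open>\<pi> y \<notin> K\<close> z openin_subset[OF U] etale_in[OF et] in auto)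
qed simp

text \<open>Agreement near \<open>x\<close> is expressed by multiplying with all functions supported
  in a neighbourhood \<open>N\<close>, a formulation that makes sense for tensors as well. A set on
  which \<pi> is injective contains at most one point \<open>y\<close> over \<open>x\<close>, and
  near it the function is a base function times \<open>cu y\<close>.\<close>

lemma localize:
  assumes u: "u \<in> carrier CE" and x: "x \<in> X"
  shows "\<exists>w\<in>fibre_span x. \<exists>N. openin (mtop M) N \<and> x \<in> N \<and>
    (\<forall>W g. W \<subseteq> N \<longrightarrow> local_fun M W g \<longrightarrow> act XE (ext_by_zero M W g) u = act XE (ext_by_zero M W g) w)"
  using u
proof (induction rule: E.Cc_induct[where Q = "inj_on \<pi>"])
  case (basis y) then show ?case by (rule inj_basis)
next
  case zero
  show ?case by (rule bexI[OF _ fs_zero]) (use x in \<open>auto intro: exI[of _ X]\<close>)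
next
  case (ext U f)
  obtain K where K: "openin (mtop E) U" "compactin (mtop E) K" "K \<subseteq> U" "\<And>x. x \<in> U ==> x \<notin> K ==> f x = 0"
    using ext(1) by (rule local_funE) (rule that)
  have piK: "compactin (mtop M) (\<pi> ` K)" by (rule image_compactin[OF K(2) etale_cont[OF et]])
  show ?case
  proof (cases "x \<in> \<pi> ` U")
    case False
    have KX: "\<pi> ` K \<subseteq> X" using piK by (simp add: compactin_def)
    have o: "openin (mtop M) (X - \<pi> ` K)" by (rule F.open_complement_compact[OF openin_topspace hX piK KX])
    have "act XE (ext_by_zero M W g) (ext_by_zero E U f) = act XE (ext_by_zero M W g) \<zero>\<^bsub>sections E\<^esub>"
      if W: "W \<subseteq> X - \<pi> ` K" and g: "local_fun M W g" for W and g :: "'m => 'f"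
    proof -
      have "act XE (ext_by_zero M W g) (ext_by_zero E U f) = \<zero>\<^bsub>sections E\<^esub>"
        unfolding base_extend(2)[OF g] act_ext_fun
        by (rule E.ext_zero[OF K(1)]) (use W K(4) in auto)
      moreover have "act XE (ext_by_zero M W g) \<zero>\<^bsub>sections E\<^esub> = \<zero>\<^bsub>sections E\<^esub>"
        using linear_maps_zero[OF act_linear[OF F.ext_in_Cc[OF g]] E.vspace_Cc E.vspace_Cc] by simp
      ultimately show ?thesis by simp
    qed
    then show ?thesis using o False K(3) x
      by (intro bexI[OF _ fs_zero] exI[of _ "X - \<pi> ` K"]) auto
  next
    case True
    then obtain y where y: "y \<in> U" "\<pi> y = x" by blast
    have yE: "y \<in> topspace (mtop E)" using y openin_subset[OF K(1)] by blast
    obtain U' e W' where c: "cu y = ext_by_zero E U' e" "local_fun E U' e" "inj_on \<pi> U'"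
      "openin (mtop E) W'" "y \<in> W'" "W' \<subseteq> U'" "\<forall>x\<in>W'. e x = 1" by (rule cuE[OF yE])
    \<comment> \<open>The function \<open>f\<close> carried down to the base. As \<open>cu y\<close>
      is 1 near \<open>y\<close>, multiplying \<open>cu y\<close> by it recovers \<open>f\<close>
      there.\<close>
    define f1 where "f1 z = f (inv_into U \<pi> z)" for z
    have f1: "local_fun M (\<pi> ` U) f1" unfolding f1_def by (rule push_local_inv(1)[OF ext])
    define q1 where "q1 z = (if z \<in> \<pi> ` U then f1 z else 0)" for z
    have q1: "local_fun M X q1" unfolding q1_def by (rule base_extend(1)[OF f1])
    have q1v: "q1 (\<pi> y) = f y" if "y \<in> U" for y using that ext(2) by (simp add: q1_def f1_def)
    define \<rho> where "\<rho> = ext_by_zero M X q1"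
    have \<rho>: "\<rho> \<in> carrier R" unfolding \<rho>_def by (rule F.ext_in_Cc[OF q1])
    have oV: "openin (mtop E) (U \<inter> W')" using K(1) c(4) by blast
    have oN: "openin (mtop M) (\<pi> ` (U \<inter> W'))" by (rule etale_open[OF et oV])
    have xN: "x \<in> \<pi> ` (U \<inter> W')" using y c(5) by blast
    have "act XE (ext_by_zero M W g) (ext_by_zero E U f) = act XE (ext_by_zero M W g) (act XE \<rho> (cu y))"
      if W: "W \<subseteq> \<pi> ` (U \<inter> W')" and g: "local_fun M W g" for W and g :: "'m => 'f"
    proof -
      obtain L where L: "compactin (mtop M) L" "L \<subseteq> W" "\<And>x. x \<in> W ==> x \<notin> L ==> g x = 0"
        using g by (rule local_funE) (rule that)
      define q where "q z = (if z \<in> W then g z else 0)" for z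
      have q: "local_fun M X q" unfolding q_def by (rule base_extend(1)[OF g])
      have qL: "q z = 0" if "z \<notin> L" for z using that L(3) by (simp add: q_def)
      have r: "ext_by_zero M W g = ext_by_zero M X q" unfolding q_def by (rule base_extend(2)[OF g])
      have LV: "L \<subseteq> \<pi> ` (U \<inter> W')" using L(2) W by blast
      \<comment> \<open>Both products are supported over \<open>L\<close>, so each may be cut down
        to \<open>U \<inter> W'\<close>, where \<open>e\<close> is 1 and the two functions
        coincide.\<close>
      have "act XE (ext_by_zero M W g) (ext_by_zero E U f) = ext_by_zero E U (\<lambda>y. q (\<pi> y) * f y)"
        unfolding r act_ext_fun ..
      also have "\<dots> = ext_by_zero E (U \<inter> W') (\<lambda>y. q (\<pi> y) * f y)"
        by (rule ext_shrink_base[OF local_fun_act[OF q ext(1)] oV Int_lower1 ext(2) L(1) LV]) (simp add: qL)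
      also have "\<dots> = ext_by_zero E (U \<inter> W') (\<lambda>y. q (\<pi> y) * (q1 (\<pi> y) * e y))"
        by (rule E.ext_cong[OF oV]) (use c(7) q1v in auto)
      also have "\<dots> = ext_by_zero E U' (\<lambda>y. q (\<pi> y) * (q1 (\<pi> y) * e y))"
        by (rule ext_shrink_base[OF local_fun_act[OF q local_fun_act[OF q1 c(2)]] oV _ c(3) L(1) LV, symmetric])
          (use c(6) qL in auto)
      also have "\<dots> = act XE (ext_by_zero M W g) (act XE \<rho> (cu y))"
        unfolding r \<rho>_def c(1) act_ext_fun ..
      finally show ?thesis .
    qed
    then show ?thesis
      by (intro bexI[OF _ fs_gen[OF yE y(2) \<rho>]] exI[of _ "\<pi> ` (U \<inter> W')"] conjI allI impI oN xN)
  qed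
next
  case (add u v)
  from add(3) obtain w N where w: "w \<in> fibre_span x" "openin (mtop M) N" "x \<in> N"
    "\<forall>W g. W \<subseteq> N \<longrightarrow> local_fun M W g \<longrightarrow> act XE (ext_by_zero M W g) u = act XE (ext_by_zero M W g) w"
    by (elim bexE exE conjE)
  from add(4) obtain w' N' where w': "w' \<in> fibre_span x" "openin (mtop M) N'" "x \<in> N'"
    "\<forall>W g. W \<subseteq> N' \<longrightarrow> local_fun M W g \<longrightarrow> act XE (ext_by_zero M W g) v = act XE (ext_by_zero M W g) w'"
    by (elim bexE exE conjE)
  show ?case
  proof (intro bexI[OF _ fs_add[OF w(1) w'(1)]] exI[of _ "N \<inter> N'"] conjI allI impI openin_Int w(2) w'(2) IntI w(3) w'(3))
    fix W and g :: "'m => 'f" assume W: "W \<subseteq> N \<inter> N'" and g: "local_fun M W g"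
    note lin = linear_mapsD(2)[OF act_linear[OF F.ext_in_Cc[OF g]]]
    have "act XE (ext_by_zero M W g) u = act XE (ext_by_zero M W g) w" using w(4) W g by simp
    moreover have "act XE (ext_by_zero M W g) v = act XE (ext_by_zero M W g) w'" using w'(4) W g by simp
    ultimately show "act XE (ext_by_zero M W g) (u \<oplus>\<^bsub>sections E\<^esub> v) = act XE (ext_by_zero M W g) (w \<oplus>\<^bsub>sections E\<^esub> w')"
      using lin[OF add(1,2)] lin[OF fibre_span_in[OF w(1)] fibre_span_in[OF w'(1)]] by simp
  qed
qed

end

section \<open>Localization of tensors and the kernel of \<open>Omega\<close>\<close>

context hfib
begin

abbreviation "R \<equiv> EM.R"

sublocale RV: vspace R by (rule M.vspace_Cc)

lemma XE_eq: "carrier EM.XE = carrier EM.CE" "carrier FM.XE = carrier FM.CE"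
  by (simp_all add: EM.Cc_mod_simps FM.Cc_mod_simps)

lemma actT_mult:
  assumes "r \<in> carrier R" "r' \<in> carrier R" "t \<in> carrier TS.T"
  shows "act TS.T (r \<otimes>\<^bsub>R\<^esub> r') t = act TS.T r (act TS.T r' t)"
proof -
  have rr: "r \<otimes>\<^bsub>R\<^esub> r' \<in> carrier R" by (rule assoc_algebra.mult_closed[OF assoc_algebra_base assms(1,2)])
  show ?thesis
  proof (rule TS.linear_eq_on_pure[OF TS.act_T_linear[OF rr]
        linear_maps_compose[OF TS.act_T_linear[OF assms(2)] TS.act_T_linear[OF assms(1)]] assms(3)])
    fix x y assume xy: "x \<in> carrier EM.XE" "y \<in> carrier FM.XE"
    then have x: "x \<in> carrier EM.CE" by (simp add: XE_eq)
    have "act EM.XE (r \<otimes>\<^bsub>R\<^esub> r') x = act EM.XE r (act EM.XE r' x)" by (rule EM.act_mult[OF assms(1,2) x])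
    then show "act TS.T (r \<otimes>\<^bsub>R\<^esub> r') (TS.pt x y) = act TS.T r (act TS.T r' (TS.pt x y))"
      using xy TS.act_closed(1)[OF assms(2)] by (simp add: TS.act_T_pure rr assms del: M.Cc_ops)
  qed
qed

lemma actT_add:
  assumes "r \<in> carrier R" "r' \<in> carrier R" "t \<in> carrier TS.T"
  shows "act TS.T (r \<oplus>\<^bsub>R\<^esub> r') t = act TS.T r t \<oplus>\<^bsub>TS.T\<^esub> act TS.T r' t"
proof (rule TS.linear_eq_on_pure[OF TS.act_T_linear[OF RV.a_closed[OF assms(1,2)]]
      linear_maps_add[OF TS.act_T_linear[OF assms(1)] TS.act_T_linear[OF assms(2)] TS.vspace_T] assms(3)])
  fix x y assume xy: "x \<in> carrier EM.XE" "y \<in> carrier FM.XE"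
  then have x: "x \<in> carrier EM.CE" by (simp add: XE_eq)
  have e: "act EM.XE (r \<oplus>\<^bsub>R\<^esub> r') x = act EM.XE r x \<oplus>\<^bsub>EM.XE\<^esub> act EM.XE r' x"
    using linear_mapsD(2)[OF EM.act_linear_left[OF x] assms(1,2)] by (simp add: EM.Cc_mod_simps)
  show "act TS.T (r \<oplus>\<^bsub>R\<^esub> r') (TS.pt x y) = act TS.T r (TS.pt x y) \<oplus>\<^bsub>TS.T\<^esub> act TS.T r' (TS.pt x y)"
    unfolding TS.act_T_pure[OF RV.a_closed[OF assms(1,2)] xy] TS.act_T_pure[OF assms(1) xy] TS.act_T_pure[OF assms(2) xy] e
    by (rule linear_mapsD(2)[OF TS.pure_linear1[OF xy(2)] TS.act_closed(1)[OF assms(1) xy(1)] TS.act_closed(1)[OF assms(2) xy(1)]])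
qed

lemma actT_zero:
  assumes "t \<in> carrier TS.T" shows "act TS.T \<zero>\<^bsub>R\<^esub> t = \<zero>\<^bsub>TS.T\<^esub>"
proof (rule TS.linear_eq_on_pure[OF TS.act_T_linear[OF RV.zero_closed] linear_maps_const_zero[OF TS.vspace_T] assms])
  fix x y assume xy: "x \<in> carrier EM.XE" "y \<in> carrier FM.XE"
  then have x: "x \<in> carrier EM.CE" by (simp add: XE_eq)
  have e: "act EM.XE \<zero>\<^bsub>R\<^esub> x = \<zero>\<^bsub>EM.XE\<^esub>"
    using linear_maps_zero[OF EM.act_linear_left[OF x] M.vspace_Cc E.vspace_Cc] by (simp add: EM.Cc_mod_simps)
  show "act TS.T \<zero>\<^bsub>R\<^esub> (TS.pt x y) = \<zero>\<^bsub>TS.T\<^esub>"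
    unfolding TS.act_T_pure[OF RV.zero_closed xy] e
    by (rule linear_maps_zero[OF TS.pure_linear1[OF xy(2)] TS.X.vspace_axioms TS.vspace_T])
qed

inductive_set fibre_span2 :: "'m => ((('p, 'f) germs) \<times> (('q, 'f) germs) \<Rightarrow>\<^sub>0 'f) set set" for x where
  fs2_zero: "\<zero>\<^bsub>TS.T\<^esub> \<in> fibre_span2 x"
| fs2_gen: "p \<in> topspace (mtop P) ==> \<pi> (fst p) = x ==> \<rho> \<in> carrier R ==>
    act TS.T \<rho> (TS.pt (EM.cu (fst p)) (FM.cu (snd p))) \<in> fibre_span2 x"
| fs2_add: "w \<in> fibre_span2 x ==> w' \<in> fibre_span2 x ==> w \<oplus>\<^bsub>TS.T\<^esub> w' \<in> fibre_span2 x"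

lemma pt_cu_in: "p \<in> topspace (mtop P) ==> TS.pt (EM.cu (fst p)) (FM.cu (snd p)) \<in> carrier TS.T"
  using topP[of p] EM.cu_in FM.cu_in by (intro TS.pure_closed) (simp_all add: XE_eq)

lemma fibre_span2_in: "w \<in> fibre_span2 x ==> w \<in> carrier TS.T"
proof (induction rule: fibre_span2.induct)
  case (fs2_gen p \<rho>) then show ?case by (intro linear_mapsD(1)[OF TS.act_T_linear] pt_cu_in)
qed simp_all

text \<open>All coefficients are moved to the left factor and merged into one base element, so that
  only the tensors of \<open>cu y\<close> and \<open>cu z\<close> with \<open>(y, z)\<close> in the
  fibre product remain.\<close>

lemma pt_fibre_span:
  assumes w: "w \<in> EM.fibre_span x" and w': "w' \<in> FM.fibre_span x"
  shows "TS.pt w w' \<in> fibre_span2 x"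
proof -
  have 1: "TS.pt (act EM.XE \<rho> (EM.cu y)) w' \<in> fibre_span2 x"
    if y: "y \<in> topspace (mtop E)" "\<pi> y = x" and \<rho>: "\<rho> \<in> carrier R" for y \<rho>
    using w'
  proof (induction rule: FM.fibre_span.induct)
    have a: "act EM.XE \<rho> (EM.cu y) \<in> carrier EM.XE" using EM.act_in[OF \<rho> EM.cu_in[OF y(1)]] by (simp add: XE_eq)
    {
      case fs_zero
      show ?case using linear_maps_zero[OF TS.pure_linear2[OF a] TS.Y.vspace_axioms TS.vspace_T] fs2_zero
        by (simp add: FM.Cc_mod_simps)
    next
      case (fs_gen z \<sigma>)
      have p: "(y, z) \<in> topspace (mtop P)" using y fs_gen by (simp add: topspace_P)
      have cy: "EM.cu y \<in> carrier EM.XE" and cz: "FM.cu z \<in> carrier FM.XE"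
        using EM.cu_in[OF y(1)] FM.cu_in[OF fs_gen(1)] by (simp_all add: XE_eq)
      have "TS.pt (act EM.XE \<rho> (EM.cu y)) (act FM.XE \<sigma> (FM.cu z)) = TS.pt (act EM.XE \<sigma> (act EM.XE \<rho> (EM.cu y))) (FM.cu z)"
        using balancedD(3)[OF TS.pure_balanced fs_gen(3) a cz] by simp
      also have "\<dots> = act TS.T \<sigma> (act TS.T \<rho> (TS.pt (EM.cu y) (FM.cu z)))"
        using TS.act_T_pure[OF fs_gen(3) a cz] TS.act_T_pure[OF \<rho> cy cz] by simp
      also have "\<dots> = act TS.T (\<sigma> \<otimes>\<^bsub>R\<^esub> \<rho>) (TS.pt (EM.cu y) (FM.cu z))"
        by (rule actT_mult[OF fs_gen(3) \<rho>, symmetric]) (rule TS.pure_closed[OF cy cz])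
      also have "\<dots> \<in> fibre_span2 x"
        using fs2_gen[OF p _ assoc_algebra.mult_closed[OF assoc_algebra_base fs_gen(3) \<rho>], of x] y(2) by simp
      finally show ?case .
    next
      case (fs_add v v')
      have "v \<in> carrier FM.XE" "v' \<in> carrier FM.XE" using FM.fibre_span_in fs_add(1,2) by (simp_all add: XE_eq)
      from linear_mapsD(2)[OF TS.pure_linear2[OF a] this] show ?case
        using fs2_add[OF fs_add(3,4)] by (simp add: FM.Cc_mod_simps)
    }
  qed
  have b: "w' \<in> carrier FM.XE" using FM.fibre_span_in[OF w'] by (simp add: XE_eq)
  show ?thesis using w
  proof (induction rule: EM.fibre_span.induct)
    case fs_zero
    show ?case using linear_maps_zero[OF TS.pure_linear1[OF b] TS.X.vspace_axioms TS.vspace_T] fs2_zero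
      by (simp add: EM.Cc_mod_simps)
  next
    case (fs_gen y \<rho>) then show ?case by (rule 1)
  next
    case (fs_add v v')
    have "v \<in> carrier EM.XE" "v' \<in> carrier EM.XE" using EM.fibre_span_in fs_add(1,2) by (simp_all add: XE_eq)
    from linear_mapsD(2)[OF TS.pure_linear1[OF b] this] show ?case
      using fs2_add[OF fs_add(3,4)] by (simp add: EM.Cc_mod_simps)
  qed
qed

lemma localize_tensor:
  assumes t: "t \<in> carrier TS.T" and x: "x \<in> X"
  shows "\<exists>w\<in>fibre_span2 x. \<exists>N. openin (mtop M) N \<and> x \<in> N \<and>
    (\<forall>W g. W \<subseteq> N \<longrightarrow> local_fun M W g \<longrightarrow> act TS.T (ext_by_zero M W g) t = act TS.T (ext_by_zero M W g) w)"
  using t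
proof (induction rule: TS.tensor_induct)
  case (pure u v)
  then have u: "u \<in> carrier EM.CE" and v: "v \<in> carrier FM.CE" by (simp_all add: XE_eq)
  from EM.localize[OF u x] obtain w N where w: "w \<in> EM.fibre_span x" "openin (mtop M) N" "x \<in> N"
    "\<forall>W g. W \<subseteq> N \<longrightarrow> local_fun M W g \<longrightarrow> act EM.XE (ext_by_zero M W g) u = act EM.XE (ext_by_zero M W g) w"
    by (elim bexE exE conjE)
  from FM.localize[OF v x] obtain w' N' where w': "w' \<in> FM.fibre_span x" "openin (mtop M) N'" "x \<in> N'"
    "\<forall>W g. W \<subseteq> N' \<longrightarrow> local_fun M W g \<longrightarrow> act FM.XE (ext_by_zero M W g) v = act FM.XE (ext_by_zero M W g) w'"
    by (elim bexE exE conjE)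
  have wi: "w \<in> carrier EM.XE" "w' \<in> carrier FM.XE" using EM.fibre_span_in[OF w(1)] FM.fibre_span_in[OF w'(1)] by (simp_all add: XE_eq)
  show ?case
  proof (intro bexI[OF _ pt_fibre_span[OF w(1) w'(1)]] exI[of _ "N \<inter> N'"] conjI allI impI openin_Int w(2) w'(2) IntI w(3) w'(3))
    fix W and g :: "'m => 'f" assume W: "W \<subseteq> N \<inter> N'" and g: "local_fun M W g"
    \<comment> \<open>Writing \<open>g = g c\<close> lets the action of \<open>g\<close> on a tensor
      be distributed over both factors, so that both localizations can be applied.\<close>
    obtain c :: "'m => 'f" where c: "local_fun M W c" "\<And>x. x \<in> W ==> g x * c x = g x"
      by (rule M.local_unit[OF g]) (rule that)
    let ?r = "ext_by_zero M W g" and ?e = "ext_by_zero M W c"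
    have r: "?r \<in> carrier R" "?e \<in> carrier R" using g c by (auto intro: M.ext_in_Cc)
    have re: "?r \<otimes>\<^bsub>R\<^esub> ?e = ?r"
      unfolding M.Cc_ops M.ext_mult by (rule M.ext_cong[OF local_fun_openin[OF g]]) (rule c(2))
    have split: "act TS.T ?r (TS.pt a b) = TS.pt (act EM.XE ?r a) (act FM.XE ?e b)"
      if a: "a \<in> carrier EM.XE" and b: "b \<in> carrier FM.XE" for a b
    proof -
      have "act TS.T ?r (TS.pt a b) = act TS.T (?r \<otimes>\<^bsub>R\<^esub> ?e) (TS.pt a b)" by (simp only: re)
      also have "\<dots> = act TS.T ?r (act TS.T ?e (TS.pt a b))" by (rule actT_mult[OF r TS.pure_closed[OF a b]])
      also have "\<dots> = act TS.T ?r (TS.pt a (act FM.XE ?e b))"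
        unfolding TS.act_T_pure[OF r(2) a b] using balancedD(3)[OF TS.pure_balanced r(2) a b] by simp
      also have "\<dots> = TS.pt (act EM.XE ?r a) (act FM.XE ?e b)"
        by (rule TS.act_T_pure[OF r(1) a TS.act_closed(2)[OF r(2) b]])
      finally show ?thesis .
    qed
    have "act EM.XE ?r u = act EM.XE ?r w" using w(4) W g by simp
    moreover have "act FM.XE ?e v = act FM.XE ?e w'" using w'(4) W c(1) by simp
    ultimately show "act TS.T ?r (TS.pt u v) = act TS.T ?r (TS.pt w w')"
      using split[OF pure] split[OF wi] by simp
  qed
next
  case (add u v)
  from add(3) obtain w N where w: "w \<in> fibre_span2 x" "openin (mtop M) N" "x \<in> N"
    "\<forall>W g. W \<subseteq> N \<longrightarrow> local_fun M W g \<longrightarrow> act TS.T (ext_by_zero M W g) u = act TS.T (ext_by_zero M W g) w"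
    by (elim bexE exE conjE)
  from add(4) obtain w' N' where w': "w' \<in> fibre_span2 x" "openin (mtop M) N'" "x \<in> N'"
    "\<forall>W g. W \<subseteq> N' \<longrightarrow> local_fun M W g \<longrightarrow> act TS.T (ext_by_zero M W g) v = act TS.T (ext_by_zero M W g) w'"
    by (elim bexE exE conjE)
  show ?case
  proof (intro bexI[OF _ fs2_add[OF w(1) w'(1)]] exI[of _ "N \<inter> N'"] conjI allI impI openin_Int w(2) w'(2) IntI w(3) w'(3))
    fix W and g :: "'m => 'f" assume W: "W \<subseteq> N \<inter> N'" and g: "local_fun M W g"
    note lin = linear_mapsD(2)[OF TS.act_T_linear[OF M.ext_in_Cc[OF g]]]
    have "act TS.T (ext_by_zero M W g) u = act TS.T (ext_by_zero M W g) w" using w(4) W g by simp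
    moreover have "act TS.T (ext_by_zero M W g) v = act TS.T (ext_by_zero M W g) w'" using w'(4) W g by simp
    ultimately show "act TS.T (ext_by_zero M W g) (u \<oplus>\<^bsub>TS.T\<^esub> v) = act TS.T (ext_by_zero M W g) (w \<oplus>\<^bsub>TS.T\<^esub> w')"
      using lin[OF add(1,2)] lin[OF fibre_span2_in[OF w(1)] fibre_span2_in[OF w'(1)]] by simp
  qed
qed

abbreviation "fterm \<rho> p \<equiv> act TS.T (\<rho> p) (TS.pt (EM.cu (fst p)) (FM.cu (snd p)))"

lemma fterm_in: "p \<in> topspace (mtop P) ==> \<rho> p \<in> carrier R ==> fterm \<rho> p \<in> carrier TS.T"
  by (intro linear_mapsD(1)[OF TS.act_T_linear] pt_cu_in)

text \<open>Terms belonging to the same point are collected into one coefficient, as otherwise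
  evaluation at a point could not isolate it. Coefficients are zero off \<open>Z\<close>, which
  allows two expansions to be added over the union of their index sets.\<close>

lemma fibre_span2_expand:
  assumes "w \<in> fibre_span2 x"
  shows "\<exists>Z \<rho>. finite Z \<and> Z \<subseteq> {p \<in> topspace (mtop P). \<pi> (fst p) = x} \<and> (\<forall>p. \<rho> p \<in> carrier R) \<and>
    (\<forall>p. p \<notin> Z \<longrightarrow> \<rho> p = \<zero>\<^bsub>R\<^esub>) \<and> w = (\<Oplus>\<^bsub>TS.T\<^esub>p\<in>Z. fterm \<rho> p)"
  using assms
proof (induction rule: fibre_span2.induct)
  case fs2_zero
  show ?case by (intro exI[of _ "{}"] exI[of _ "\<lambda>_. \<zero>\<^bsub>R\<^esub>"]) (simp del: M.Cc_ops)
next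
  case (fs2_gen p r)
  let ?\<rho> = "\<lambda>p'. if p' = p then r else \<zero>\<^bsub>R\<^esub>"
  have "act TS.T r (TS.pt (EM.cu (fst p)) (FM.cu (snd p))) = (\<Oplus>\<^bsub>TS.T\<^esub>p\<in>{p}. fterm ?\<rho> p)"
    using TS.T.finsum_insert[of "{}" p "fterm ?\<rho>"] fterm_in[of p ?\<rho>] fs2_gen by simp
  note eq = this
  show ?case
  proof (intro exI[of _ "{p}"] exI[of _ ?\<rho>] conjI allI impI eq)
    show "{p} \<subseteq> {p \<in> topspace (mtop P). \<pi> (fst p) = x}" using fs2_gen(1,2) by blast
    show "?\<rho> p' \<in> carrier R" for p' using fs2_gen(3) RV.zero_closed by (cases "p' = p") (simp_all only: if_True if_False refl simp_thms)
    show "?\<rho> p' = \<zero>\<^bsub>R\<^esub>" if "p' \<notin> {p}" for p' by (rule if_not_P) (use that in blast)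
  qed simp
next
  case (fs2_add w w')
  from fs2_add(3) obtain Z \<rho> where Z: "finite Z" "Z \<subseteq> {p \<in> topspace (mtop P). \<pi> (fst p) = x}" "\<forall>p. \<rho> p \<in> carrier R"
    "\<forall>p. p \<notin> Z \<longrightarrow> \<rho> p = \<zero>\<^bsub>R\<^esub>" "w = (\<Oplus>\<^bsub>TS.T\<^esub>p\<in>Z. fterm \<rho> p)" by (elim exE conjE)
  from fs2_add(4) obtain Z' \<rho>' where Z': "finite Z'" "Z' \<subseteq> {p \<in> topspace (mtop P). \<pi> (fst p) = x}" "\<forall>p. \<rho>' p \<in> carrier R"
    "\<forall>p. p \<notin> Z' \<longrightarrow> \<rho>' p = \<zero>\<^bsub>R\<^esub>" "w' = (\<Oplus>\<^bsub>TS.T\<^esub>p\<in>Z'. fterm \<rho>' p)" by (elim exE conjE)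
  let ?Z = "Z \<union> Z'"
  have top: "p \<in> topspace (mtop P)" if "p \<in> ?Z" for p using that Z(2) Z'(2) by auto
  have f1: "fterm \<rho> \<in> ?Z \<rightarrow> carrier TS.T" by (intro Pi_I fterm_in top Z(3)[rule_format])
  have f2: "fterm \<rho>' \<in> ?Z \<rightarrow> carrier TS.T" by (intro Pi_I fterm_in top Z'(3)[rule_format])
  have e1: "w = (\<Oplus>\<^bsub>TS.T\<^esub>p\<in>?Z. fterm \<rho> p)" unfolding Z(5)
  proof (rule TS.T.add.finprod_mono_neutral_cong_left)
    fix p assume p: "p \<in> ?Z - Z"
    then have "p \<in> ?Z" "\<rho> p = \<zero>\<^bsub>R\<^esub>" using Z(4) by blast+
    then show "fterm \<rho> p = \<zero>\<^bsub>TS.T\<^esub>" by (simp only: actT_zero[OF pt_cu_in[OF top]])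
  qed (use Z(1) Z'(1) f1 in simp_all)
  have e2: "w' = (\<Oplus>\<^bsub>TS.T\<^esub>p\<in>?Z. fterm \<rho>' p)" unfolding Z'(5)
  proof (rule TS.T.add.finprod_mono_neutral_cong_left)
    fix p assume p: "p \<in> ?Z - Z'"
    then have "p \<in> ?Z" "\<rho>' p = \<zero>\<^bsub>R\<^esub>" using Z'(4) by blast+
    then show "fterm \<rho>' p = \<zero>\<^bsub>TS.T\<^esub>" by (simp only: actT_zero[OF pt_cu_in[OF top]])
  qed (use Z(1) Z'(1) f2 in simp_all)
  have "w \<oplus>\<^bsub>TS.T\<^esub> w' = (\<Oplus>\<^bsub>TS.T\<^esub>p\<in>?Z. fterm \<rho> p \<oplus>\<^bsub>TS.T\<^esub> fterm \<rho>' p)"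
    unfolding e1 e2 by (rule TS.T.finsum_addf[symmetric]) (use f1 f2 in simp_all)
  also have "\<dots> = (\<Oplus>\<^bsub>TS.T\<^esub>p\<in>?Z. fterm (\<lambda>p. \<rho> p \<oplus>\<^bsub>R\<^esub> \<rho>' p) p)"
  proof (rule TS.T.add.finprod_cong'[OF refl])
    show "fterm (\<lambda>p. \<rho> p \<oplus>\<^bsub>R\<^esub> \<rho>' p) \<in> ?Z \<rightarrow> carrier TS.T"
      by (intro Pi_I fterm_in top RV.a_closed Z(3)[rule_format] Z'(3)[rule_format])
    fix p assume p: "p \<in> ?Z"
    show "fterm \<rho> p \<oplus>\<^bsub>TS.T\<^esub> fterm \<rho>' p = fterm (\<lambda>p. \<rho> p \<oplus>\<^bsub>R\<^esub> \<rho>' p) p"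
      using actT_add[OF Z(3)[rule_format] Z'(3)[rule_format] pt_cu_in[OF top[OF p]]] by simp
  qed
  finally have eq: "w \<oplus>\<^bsub>TS.T\<^esub> w' = (\<Oplus>\<^bsub>TS.T\<^esub>p\<in>?Z. fterm (\<lambda>p. \<rho> p \<oplus>\<^bsub>R\<^esub> \<rho>' p) p)" .
  show ?case
  proof (intro exI[of _ ?Z] exI[of _ "\<lambda>p. \<rho> p \<oplus>\<^bsub>R\<^esub> \<rho>' p"] conjI allI impI eq finite_UnI Z(1) Z'(1) Un_least Z(2) Z'(2))
    show "\<rho> p \<oplus>\<^bsub>R\<^esub> \<rho>' p \<in> carrier R" for p by (rule RV.a_closed[OF Z(3)[rule_format] Z'(3)[rule_format]])
    show "\<rho> p \<oplus>\<^bsub>R\<^esub> \<rho>' p = \<zero>\<^bsub>R\<^esub>" if p: "p \<notin> ?Z" for p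
    proof -
      have "\<rho> p = \<zero>\<^bsub>R\<^esub>" "\<rho>' p = \<zero>\<^bsub>R\<^esub>" using p Z(4) Z'(4) by blast+
      then show ?thesis by (simp only: RV.r_zero[OF RV.zero_closed])
    qed
  qed
qed

text \<open>Along a fibre the sections \<open>cu\<close> have germs 0 or 1, so at \<open>p0\<close>
  only the term of \<open>p0\<close> itself leaves a trace, namely its coefficient pulled back from
  the base.\<close>

lemma fterm_value:
  assumes p: "p \<in> topspace (mtop P)" "\<pi> (fst p) = x" and p0: "p0 \<in> topspace (mtop P)" "\<pi> (fst p0) = x"
    and q: "local_fun M X q" and W: "local_fun M W g"
  shows "Omega E \<pi> F \<xi> (act TS.T (ext_by_zero M W g) (act TS.T (ext_by_zero M X q) (TS.pt (EM.cu (fst p)) (FM.cu (snd p))))) p0 =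
    germ P p0 (\<lambda>w. if p = p0 then (if \<pi> (fst w) \<in> W then g (\<pi> (fst w)) else 0) * q (\<pi> (fst w)) else 0)"
proof -
  note t = topP[OF p(1)] and t0 = topP[OF p0(1)]
  let ?h = "\<lambda>x. if x \<in> W then g x else 0"
  have r: "ext_by_zero M X q \<in> carrier R" "ext_by_zero M W g \<in> carrier R" using q W M.ext_in_Cc by auto
  have cy: "EM.cu (fst p) \<in> carrier EM.CE" and cz: "FM.cu (snd p) \<in> carrier FM.CE"
    using t EM.cu_in FM.cu_in by auto
  have a1: "act EM.XE (ext_by_zero M X q) (EM.cu (fst p)) \<in> carrier EM.CE" by (rule EM.act_in[OF r(1) cy])
  have a2: "act EM.XE (ext_by_zero M W g) (act EM.XE (ext_by_zero M X q) (EM.cu (fst p))) \<in> carrier EM.CE"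
    by (rule EM.act_in[OF r(2) a1])
  have "Omega E \<pi> F \<xi> (act TS.T (ext_by_zero M W g) (act TS.T (ext_by_zero M X q) (TS.pt (EM.cu (fst p)) (FM.cu (snd p))))) =
      bx (act EM.XE (ext_by_zero M W g) (act EM.XE (ext_by_zero M X q) (EM.cu (fst p)))) (FM.cu (snd p))"
    using cy cz a1 a2 by (simp add: TS.act_T_pure r XE_eq Omega_pure)
  moreover have "act EM.XE (ext_by_zero M W g) (act EM.XE (ext_by_zero M X q) (EM.cu (fst p))) (fst p0) =
      germ E (fst p0) (\<lambda>y. ?h (\<pi> y) * (q (\<pi> y) * (if fst p0 = fst p then 1 else 0)))"
  proof -
    have m: "\<pi> (fst p0) \<in> X" using t0 etale_in[OF \<pi>] by blast
    have "EM.cu (fst p) (fst p0) = germ E (fst p0) (\<lambda>_. if fst p0 = fst p then 1 else 0)"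
      by (rule EM.cu_values) (use t t0 p p0 in auto)
    then show ?thesis
      unfolding base_extend(2)[OF W]
      using conjunct1[OF t0] m by (simp add: EM.act_apply ext_by_zero_def EM.pullback_germ stalk_ops split del: if_split)
  qed
  moreover have "FM.cu (snd p) (snd p0) = germ F (snd p0) (\<lambda>_. if snd p0 = snd p then 1 else 0)"
    by (rule FM.cu_values) (use t t0 p p0 in auto)
  ultimately have "Omega E \<pi> F \<xi> (act TS.T (ext_by_zero M W g) (act TS.T (ext_by_zero M X q) (TS.pt (EM.cu (fst p)) (FM.cu (snd p))))) p0 =
      germ P p0 (\<lambda>w. (?h (\<pi> (fst w)) * (q (\<pi> (fst w)) * (if fst p0 = fst p then 1 else 0))) * (if snd p0 = snd p then 1 else 0))"
    by (simp only: box_apply[OF p0(1)] PE.pullback_germ[OF p0(1)] PF.pullback_germ[OF p0(1)] stalk_ops)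
  also have "\<dots> = germ P p0 (\<lambda>w. if p = p0 then ?h (\<pi> (fst w)) * q (\<pi> (fst w)) else 0)"
    by (rule germ_eqI[OF openin_topspace p0(1)]) (auto simp: prod_eq_iff)
  finally show ?thesis .
qed

text \<open>Evaluation at each point of the expansion isolates its coefficient, which must therefore
  have zero germ at \<open>x\<close>. Finitely many coefficients then vanish on a common
  neighbourhood, and there the tensor itself is annihilated, not just its image under
  \<open>Omega\<close>.\<close>

lemma Omega_kernel_local:
  assumes t: "t \<in> carrier TS.T" and z: "Omega E \<pi> F \<xi> t = \<zero>\<^bsub>sections P\<^esub>" and x: "x \<in> X"
  shows "\<exists>N. openin (mtop M) N \<and> x \<in> N \<and>
    (\<forall>W g. W \<subseteq> N \<longrightarrow> local_fun M W g \<longrightarrow> act TS.T (ext_by_zero M W g) t = \<zero>\<^bsub>TS.T\<^esub>)"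
proof -
  from localize_tensor[OF t x] obtain w N where w: "w \<in> fibre_span2 x" "openin (mtop M) N" "x \<in> N"
    "\<forall>W g. W \<subseteq> N \<longrightarrow> local_fun M W g \<longrightarrow> act TS.T (ext_by_zero M W g) t = act TS.T (ext_by_zero M W g) w"
    by (elim bexE exE conjE)
  from fibre_span2_expand[OF w(1)] obtain Z \<rho> where Z: "finite Z" "Z \<subseteq> {p \<in> topspace (mtop P). \<pi> (fst p) = x}"
    "\<forall>p. \<rho> p \<in> carrier R" and wZ: "w = (\<Oplus>\<^bsub>TS.T\<^esub>p\<in>Z. fterm \<rho> p)" by (elim exE conjE)
  have top: "p \<in> topspace (mtop P)" "\<pi> (fst p) = x" if "p \<in> Z" for p using that Z(2) by auto
  have fin: "fterm \<rho> \<in> Z \<rightarrow> carrier TS.T" by (intro Pi_I fterm_in top Z(3)[rule_format])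
  have "\<exists>q. local_fun M X q \<and> \<rho> p = ext_by_zero M X q" for p
    by (rule Cc_base_rep[OF Z(3)[rule_format, of p]]) (intro exI conjI)
  then obtain q where q: "\<And>p. local_fun M X (q p)" "\<And>p. \<rho> p = ext_by_zero M X (q p)" by metis
  \<comment> \<open>Cutting off by \<open>g0\<close> allows \<open>t\<close> to be replaced by its
    normal form \<open>w\<close>; as \<open>g0\<close> is 1 near \<open>x\<close>, the germs of the
    coefficients at \<open>x\<close> are unchanged.\<close>
  obtain W0 N0 and g0 :: "'m => 'f" where g0: "W0 \<subseteq> N" "local_fun M W0 g0" "openin (mtop M) N0" "x \<in> N0" "N0 \<subseteq> W0"
    "\<And>x. x \<in> N0 ==> g0 x = 1" by (rule M.cutoff_point[OF w(2,3)]) (rule that)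
  have r0: "ext_by_zero M W0 g0 \<in> carrier R" by (rule M.ext_in_Cc[OF g0(2)])
  have van: "\<exists>V. openin (mtop M) V \<and> x \<in> V \<and> (\<forall>y\<in>V. q p0 y = 0)" if p0Z: "p0 \<in> Z" for p0
  proof -
    note p0 = top[OF p0Z]
    have m: "\<pi> (fst p0) \<in> X" using x p0(2) by simp
    interpret S: vspace "stalk P p0 :: ('f, ('p \<times> 'q => 'f) set) module" by (rule P.vspace_stalk[OF p0(1)])
    let ?ev = "\<lambda>t. Omega E \<pi> F \<xi> (act TS.T (ext_by_zero M W0 g0) t) p0"
    have evl: "(\<lambda>u. u p0) \<in> linear_maps CP (stalk P p0)"
      by (rule linear_mapsI) (simp_all add: P.Cc_in_stalk p0 P.sections_ops)
    have lin: "?ev \<in> linear_maps TS.T (stalk P p0)"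
      by (rule linear_maps_compose[OF linear_maps_compose[OF TS.act_T_linear[OF r0] Omega_linear] evl])
    let ?G = "\<lambda>p. germ P p0 (\<lambda>w. if p = p0 then (if \<pi> (fst w) \<in> W0 then g0 (\<pi> (fst w)) else 0) * q p (\<pi> (fst w)) else 0)"
    have val: "?ev (fterm \<rho> p) = ?G p" if "p \<in> Z" for p
      unfolding q(2) by (rule fterm_value[OF top[OF that] p0 q(1) g0(2)])
    have Gin: "?G p \<in> carrier (stalk P p0)" if "p \<in> Z" for p
      unfolding val[OF that, symmetric]
      by (rule linear_mapsD(1)[OF lin fterm_in[where \<rho> = \<rho>, OF top(1)[OF that] Z(3)[rule_format]]])
    have "?ev w = (\<Oplus>\<^bsub>stalk P p0\<^esub>p\<in>Z. ?ev (fterm \<rho> p))"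
      unfolding wZ by (rule linear_maps_finsum[OF lin TS.vspace_T S.vspace_axioms Z(1) fin])
    also have "\<dots> = (\<Oplus>\<^bsub>stalk P p0\<^esub>p\<in>Z. if p0 = p then ?G p else \<zero>\<^bsub>stalk P p0\<^esub>)"
    proof (rule S.add.finprod_cong'[OF refl])
      show "(\<lambda>p. if p0 = p then ?G p else \<zero>\<^bsub>stalk P p0\<^esub>) \<in> Z \<rightarrow> carrier (stalk P p0)"
      proof (rule Pi_I)
        fix p assume "p \<in> Z"
        from Gin[OF this] show "(if p0 = p then ?G p else \<zero>\<^bsub>stalk P p0\<^esub>) \<in> carrier (stalk P p0)"
          by (cases "p0 = p") (simp_all only: if_True if_False simp_thms S.zero_closed)
      qed
      fix p assume p: "p \<in> Z"
      show "?ev (fterm \<rho> p) = (if p0 = p then ?G p else \<zero>\<^bsub>stalk P p0\<^esub>)"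
        unfolding val[OF p] by (cases "p = p0") (simp_all add: stalk_ops)
    qed
    also have "\<dots> = ?G p0"
    proof (rule S.finsum_singleton[OF p0Z Z(1)])
      show "?G \<in> Z \<rightarrow> carrier (stalk P p0)"
        by (intro Pi_I Gin)
    qed
    finally have 1: "?ev w = ?G p0" .
    have "act TS.T (ext_by_zero M W0 g0) t = act TS.T (ext_by_zero M W0 g0) w" using w(4) g0(1,2) by simp
    then have "?ev w = \<zero>\<^bsub>sections P\<^esub> p0" using Omega_act[OF r0 t z] by simp
    then have 2: "?G p0 = germ P p0 (\<lambda>_. 0)" using 1 p0 by (simp add: P.sections_ops stalk_ops)
    \<comment> \<open>The germ found to vanish lives on the fibre product. Pull-back along an etale
      map is injective on germs, which brings the conclusion down to \<open>M\<close>.\<close>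
    interpret PM: etmap P M TF "\<lambda>w. \<pi> (fst w)" by unfold_locales (rule etale_compose[OF etale_fst \<pi>])
    have g0q: "germ M x (\<lambda>y. (if y \<in> W0 then g0 y else 0) * q p0 y) = germ M x (q p0)"
      by (rule germ_eqI[OF g0(3,4)]) (use g0(5,6) in auto)
    have "germ_pullback P (\<lambda>w. \<pi> (fst w)) p0 (germ M x (q p0)) = germ_pullback P (\<lambda>w. \<pi> (fst w)) p0 (germ M x (\<lambda>_. 0))"
      unfolding g0q[symmetric] using 2 by (simp add: PM.pullback_germ[OF p0(1), unfolded p0(2)])
    moreover have "germ M x (q p0) \<in> carrier (stalk M x)"
      by (rule germ_in_stalk[OF openin_topspace x]) (use q(1) in \<open>simp add: local_fun_def\<close>)
    moreover have "germ M x (\<lambda>_. 0 :: 'f) \<in> carrier (stalk M x)"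
      by (rule germ_in_stalk[OF openin_topspace x M.vsmooth_const])
    ultimately have "germ M x (q p0) = germ M x (\<lambda>_. 0)"
      using PM.pullback_inj[OF p0(1)] by (simp add: p0(2) inj_on_def)
    then obtain V where "openin (mtop M) V" "x \<in> V" "\<And>y. y \<in> V ==> q p0 y = 0" using x by (rule germ_eqD) (rule that)
    then show ?thesis by blast
  qed
  then obtain V where V: "\<And>p. p \<in> Z ==> openin (mtop M) (V p) \<and> x \<in> V p \<and> (\<forall>y\<in>V p. q p y = 0)" by metis
  \<comment> \<open>\<open>X\<close> is included because the intersection over an empty
    \<open>Z\<close> would be the whole type.\<close>
  define N' where "N' = N \<inter> (X \<inter> \<Inter>(V ` Z))"
  have "openin (mtop M) (X \<inter> \<Inter>(V ` Z))"
    using Z(1) V by (cases "Z = {}") (auto intro!: openin_Int openin_Inter)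
  then have oN: "openin (mtop M) N'" unfolding N'_def using w(2) by blast
  have xN: "x \<in> N'" unfolding N'_def using w(3) x V by auto
  have "act TS.T (ext_by_zero M W g) t = \<zero>\<^bsub>TS.T\<^esub>" if W: "W \<subseteq> N'" and g: "local_fun M W g" for W and g :: "'m => 'f"
  proof -
    have r: "ext_by_zero M W g \<in> carrier R" by (rule M.ext_in_Cc[OF g])
    have "act TS.T (ext_by_zero M W g) t = act TS.T (ext_by_zero M W g) w" using w(4) W g by (simp add: N'_def)
    also have "\<dots> = (\<Oplus>\<^bsub>TS.T\<^esub>p\<in>Z. act TS.T (ext_by_zero M W g) (fterm \<rho> p))"
      unfolding wZ by (rule linear_maps_finsum[OF TS.act_T_linear[OF r] TS.vspace_T TS.vspace_T Z(1) fin])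
    also have "\<dots> = (\<Oplus>\<^bsub>TS.T\<^esub>p\<in>Z. \<zero>\<^bsub>TS.T\<^esub>)"
    proof (rule TS.T.add.finprod_cong'[OF refl])
      fix p assume p: "p \<in> Z"
      have "ext_by_zero M W g \<otimes>\<^bsub>R\<^esub> \<rho> p = ext_by_zero M X (\<lambda>x. (if x \<in> W then g x else 0) * q p x)"
        unfolding q(2) base_extend(2)[OF g] M.Cc_ops M.ext_mult ..
      also have "\<dots> = \<zero>\<^bsub>R\<^esub>"
        unfolding M.Cc_ops by (rule M.ext_zero[OF openin_topspace]) (use W V[OF p] p in \<open>auto simp: N'_def\<close>)
      finally have "act TS.T (ext_by_zero M W g \<otimes>\<^bsub>R\<^esub> \<rho> p) (TS.pt (EM.cu (fst p)) (FM.cu (snd p))) = \<zero>\<^bsub>TS.T\<^esub>"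
        using actT_zero[OF pt_cu_in[OF top(1)[OF p]]] by simp
      then show "act TS.T (ext_by_zero M W g) (fterm \<rho> p) = \<zero>\<^bsub>TS.T\<^esub>"
        unfolding actT_mult[OF r Z(3)[rule_format] pt_cu_in[OF top(1)[OF p]]] .
    qed simp
    also have "\<dots> = \<zero>\<^bsub>TS.T\<^esub>" by (rule TS.T.finsum_zero)
    finally show ?thesis .
  qed
  then show ?thesis using oN xN by (intro exI[of _ N'] conjI allI impI)
qed

lemma tensor_unit_support:
  assumes "t \<in> carrier TS.T"
  shows "\<exists>K. compactin (mtop M) K \<and> (\<forall>q. local_fun M X q \<longrightarrow> (\<forall>x\<in>K. q x = 1) \<longrightarrow> act TS.T (ext_by_zero M X q) t = t)"
  using assms
proof (induction rule: TS.tensor_induct)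
  case (pure u v)
  then have u: "u \<in> carrier EM.CE" by (simp add: XE_eq)
  from EM.act_unit_support[OF u] obtain K where K: "compactin (mtop M) K"
    "\<forall>q. local_fun M X q \<longrightarrow> (\<forall>x\<in>K. q x = 1) \<longrightarrow> act EM.XE (ext_by_zero M X q) u = u" by (elim exE conjE)
  show ?case
  proof (intro exI[of _ K] conjI allI impI K(1))
    fix q :: "'m => 'f" assume q: "local_fun M X q" "\<forall>x\<in>K. q x = 1"
    have "act EM.XE (ext_by_zero M X q) u = u" using K(2) q by simp
    then show "act TS.T (ext_by_zero M X q) (TS.pt u v) = TS.pt u v"
      unfolding TS.act_T_pure[OF M.ext_in_Cc[OF q(1)] pure] by simp
  qed
next
  case (add u v)
  from add(3) obtain K where K: "compactin (mtop M) K"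
    "\<forall>q. local_fun M X q \<longrightarrow> (\<forall>x\<in>K. q x = 1) \<longrightarrow> act TS.T (ext_by_zero M X q) u = u" by (elim exE conjE)
  from add(4) obtain L where L: "compactin (mtop M) L"
    "\<forall>q. local_fun M X q \<longrightarrow> (\<forall>x\<in>L. q x = 1) \<longrightarrow> act TS.T (ext_by_zero M X q) v = v" by (elim exE conjE)
  show ?case
  proof (intro exI[of _ "K \<union> L"] conjI allI impI compactin_Un K(1) L(1))
    fix q :: "'m => 'f" assume q: "local_fun M X q" "\<forall>x\<in>K \<union> L. q x = 1"
    have "act TS.T (ext_by_zero M X q) u = u" "act TS.T (ext_by_zero M X q) v = v"
      using K(2)[rule_format, OF q(1)] L(2)[rule_format, OF q(1)] q(2) by auto
    then show "act TS.T (ext_by_zero M X q) (u \<oplus>\<^bsub>TS.T\<^esub> v) = u \<oplus>\<^bsub>TS.T\<^esub> v"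
      using linear_mapsD(2)[OF TS.act_T_linear[OF M.ext_in_Cc[OF q(1)]] add(1,2)] by simp
  qed
qed

text \<open>The tensor is reproduced by some \<open>q\<close>, and \<open>q\<close> is a sum of
  functions supported in the small sets for which the local statement annihilates \<open>t\<close>.
  This takes the place of a partition of unity.\<close>

lemma Omega_kernel:
  assumes t: "t \<in> carrier TS.T" and z: "Omega E \<pi> F \<xi> t = \<zero>\<^bsub>sections P\<^esub>"
  shows "t = \<zero>\<^bsub>TS.T\<^esub>"
proof -
  from tensor_unit_support[OF t] obtain K where K: "compactin (mtop M) K"
    "\<forall>q. local_fun M X q \<longrightarrow> (\<forall>x\<in>K. q x = 1) \<longrightarrow> act TS.T (ext_by_zero M X q) t = t" by (elim exE conjE)
  obtain q :: "'m => 'f" where q: "local_fun M X q" "\<And>x. x \<in> K ==> q x = 1" by (rule base_unit_fun[OF K(1)]) (rule that)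
  have e: "ext_by_zero M X q \<in> carrier R" by (rule M.ext_in_Cc[OF q(1)])
  \<comment> \<open>The property is phrased for all functions supported in \<open>W\<close>, so that
    \<open>Cc_induct\<close> can use it as the choice of small sets.\<close>
  define Q where "Q W = (\<forall>g. local_fun M W g \<longrightarrow> act TS.T (ext_by_zero M W g) t = \<zero>\<^bsub>TS.T\<^esub>)" for W
  have "act TS.T (ext_by_zero M X q) t = \<zero>\<^bsub>TS.T\<^esub>"
    using e
  proof (induction rule: M.Cc_induct[where Q = Q])
    case (basis y)
    from Omega_kernel_local[OF t z basis] obtain N where N: "openin (mtop M) N" "y \<in> N"
      "\<forall>W g. W \<subseteq> N \<longrightarrow> local_fun M W g \<longrightarrow> act TS.T (ext_by_zero M W g) t = \<zero>\<^bsub>TS.T\<^esub>" by (elim exE conjE)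
    show ?case by (intro exI[of _ N] conjI N(1,2) allI impI) (simp add: Q_def N(3))
  next
    case zero show ?case using actT_zero[OF t] by simp
  next
    case (ext U f) then show ?case by (simp add: Q_def)
  next
    case (add u v)
    then show ?case using actT_add[OF add(1,2) t] TS.T.r_zero[OF TS.T.zero_closed] by simp
  qed
  then show ?thesis using K(2) q by simp
qed

lemma Omega_inj: "inj_on (Omega E \<pi> F \<xi>) (carrier TS.T)"
proof (rule inj_onI)
  fix s t assume s: "s \<in> carrier TS.T" and t: "t \<in> carrier TS.T" and eq: "Omega E \<pi> F \<xi> s = Omega E \<pi> F \<xi> t"
  interpret CP: vspace CP by (rule P.vspace_Cc)
  have neg: "(- 1) \<odot>\<^bsub>TS.T\<^esub> t \<in> carrier TS.T" by (rule TS.T.smult_in[OF t])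
  have Ot: "Omega E \<pi> F \<xi> t \<in> carrier CP" by (rule linear_mapsD(1)[OF Omega_linear t])
  have "Omega E \<pi> F \<xi> (s \<oplus>\<^bsub>TS.T\<^esub> (- 1) \<odot>\<^bsub>TS.T\<^esub> t) = Omega E \<pi> F \<xi> s \<oplus>\<^bsub>CP\<^esub> (- 1) \<odot>\<^bsub>CP\<^esub> Omega E \<pi> F \<xi> t"
    using linear_mapsD(2)[OF Omega_linear s neg] linear_mapsD(3)[OF Omega_linear t] by simp
  also have "\<dots> = \<zero>\<^bsub>CP\<^esub>" unfolding eq
  proof -
    show "Omega E \<pi> F \<xi> t \<oplus>\<^bsub>CP\<^esub> (- 1) \<odot>\<^bsub>CP\<^esub> Omega E \<pi> F \<xi> t = \<zero>\<^bsub>CP\<^esub>"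
      using CP.smult_add[OF Ot, of 1 "- 1"] Ot by (simp add: CP.smult_unit CP.smult_zero_left del: P.Cc_ops)
  qed
  finally have st: "s \<oplus>\<^bsub>TS.T\<^esub> (- 1) \<odot>\<^bsub>TS.T\<^esub> t = \<zero>\<^bsub>TS.T\<^esub>"
    by (intro Omega_kernel TS.T.a_closed s neg) simp
  have "s = s \<oplus>\<^bsub>TS.T\<^esub> ((- 1) \<odot>\<^bsub>TS.T\<^esub> t \<oplus>\<^bsub>TS.T\<^esub> t)"
    using TS.T.smult_add[OF t, of "- 1" 1] s t by (simp add: TS.T.smult_unit TS.T.smult_zero_left)
  also have "\<dots> = t" using s t neg st TS.T.a_assoc[OF s neg t] by simp
  finally show "s = t" .
qed

end

section \<open>Algebras over the base\<close>

lemma linear_maps_cong: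
  assumes "carrier A' = carrier A" "add A' = add A" "smult A' = smult A"
    and "carrier B' = carrier B" "add B' = add B" "smult B' = smult B"
  shows "linear_maps A' B' = linear_maps A B"
  unfolding linear_maps_def assms ..

lemma linear_maps_smult:
  assumes "f \<in> linear_maps A B" "vspace B"
  shows "(\<lambda>x. c \<odot>\<^bsub>B\<^esub> f x) \<in> linear_maps A B"
proof -
  interpret B: vspace B by fact
  show ?thesis
    by (rule linear_mapsI)
      (simp_all add: linear_mapsD[OF assms(1)] B.smult_in B.smult_add_right B.smult_mult[symmetric] mult.commute)
qed

lemma linear_maps_id: "(\<lambda>x. x) \<in> linear_maps A A"
  by (rule linear_mapsI) simp_all

text \<open>The part of \<open>hopf_algebroid\<close> required to form the tensor products and the
  maps on them. It is available for the convolution algebra before the remaining axioms are known,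
  and for every object of \<open>HoAlgd\<close>, so the same lemmas serve both.\<close>

locale alg_over =
  fixes R :: "('f::real_normed_field, 'r) module" and A :: "('f, 'r, 'a) hopf_data" (structure)
  assumes base: "comm_local_algebra R" and algebra: "assoc_algebra A"
    and inc_linear: "inc A \<in> linear_maps R A"
    and inc_mult: "r \<in> carrier R ==> r' \<in> carrier R ==> inc A (r \<otimes>\<^bsub>R\<^esub> r') = inc A r \<otimes> inc A r'"
begin

sublocale R: comm_local_algebra R by (rule base)
sublocale A: assoc_algebra A by (rule algebra)
sublocale VR: vspace R by (rule vspace.intro[OF R.vector_space])
sublocale VA: vspace A by (rule vspace.intro[OF A.vector_space])

lemma inc_in: "r \<in> carrier R ==> inc A r \<in> carrier A"
  by (rule linear_mapsD(1)[OF inc_linear])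

abbreviation "L \<equiv> left_mod A"
abbreviation "Rm \<equiv> right_mod A"

lemma L_simps [simp]:
  "carrier L = carrier A" "add L = add A" "zero L = zero A" "smult L = smult A" "act L r x = inc A r \<otimes> x"
  by (simp_all add: left_mod_def)

lemma Rm_simps [simp]:
  "carrier Rm = carrier A" "add Rm = add A" "zero Rm = zero A" "smult Rm = smult A" "act Rm r x = x \<otimes> inc A r"
  by (simp_all add: right_mod_def)

lemma lin_L: "linear_maps L N = linear_maps A N" "linear_maps N L = linear_maps N A"
  "linear_maps Rm N = linear_maps A N" "linear_maps N Rm = linear_maps N A"
  by (simp_all add: linear_maps_def)

lemma inc_commute: "r \<in> carrier R ==> r' \<in> carrier R ==> inc A r \<otimes> inc A r' = inc A r' \<otimes> inc A r"
  using inc_mult R.mult_comm by metis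

lemma act_L_mult: "r \<in> carrier R ==> r' \<in> carrier R ==> x \<in> carrier A ==>
    inc A r \<otimes> (inc A r' \<otimes> x) = inc A r' \<otimes> (inc A r \<otimes> x)"
  using A.mult_assoc[OF inc_in inc_in] inc_commute by metis

lemma act_R_mult: "r \<in> carrier R ==> r' \<in> carrier R ==> x \<in> carrier A ==>
    x \<otimes> inc A r \<otimes> inc A r' = x \<otimes> inc A r' \<otimes> inc A r"
  using A.mult_assoc[OF _ inc_in inc_in] inc_commute by metis

lemma r_module_L: "r_module R L"
  unfolding r_module_def
proof (intro conjI ballI)
  show "vspace L" by (rule vspace_cong[OF VA.vspace_axioms]) simp_all
  show "act L r \<in> linear_maps L L" if "r \<in> carrier R" for r
    by (rule linear_mapsI) (simp_all add: linear_mapsD[OF A.mult_linear_right[OF inc_in[OF that]]])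
qed (simp add: act_L_mult)

lemma r_module_R: "r_module R Rm"
  unfolding r_module_def
proof (intro conjI ballI)
  show "vspace Rm" by (rule vspace_cong[OF VA.vspace_axioms]) simp_all
  show "act Rm r \<in> linear_maps Rm Rm" if "r \<in> carrier R" for r
    by (rule linear_mapsI) (simp_all add: linear_mapsD[OF A.mult_linear_left[OF inc_in[OF that]]])
qed (simp add: act_R_mult)

sublocale LL: tensor_setup R L L by unfold_locales (rule r_module_L r_module_R)+
sublocale RL: tensor_setup R Rm L by unfold_locales (rule r_module_L r_module_R)+
sublocale LLL: tensor_setup R LL.T L by unfold_locales (rule LL.r_module_T, rule r_module_L)
sublocale LLR: tensor_setup R L LL.T by unfold_locales (rule r_module_L, rule LL.r_module_T)

lemma pt_closed: "a \<in> carrier A ==> b \<in> carrier A ==> LL.pt a b \<in> carrier LL.T"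
  by (rule LL.pure_closed) simp_all

lemma pt_balanced: "r \<in> carrier R ==> a \<in> carrier A ==> b \<in> carrier A ==> LL.pt (inc A r \<otimes> a) b = LL.pt a (inc A r \<otimes> b)"
  using balancedD(3)[OF LL.pure_balanced, of r a b] by simp

lemma act_pt: "r \<in> carrier R ==> a \<in> carrier A ==> b \<in> carrier A ==> act LL.T r (LL.pt a b) = LL.pt (inc A r \<otimes> a) b"
  using LL.act_T_pure[of r a b] by simp

lemma pt_lin: "a \<in> carrier A ==> LL.pt a \<in> linear_maps A LL.T" "b \<in> carrier A ==> (\<lambda>a. LL.pt a b) \<in> linear_maps A LL.T"
  using LL.pure_linear2[of a] LL.pure_linear1[of b] by (simp_all add: lin_L)

lemma balanced_LL_I:
  assumes "\<And>x. x \<in> carrier A ==> b x \<in> linear_maps A N" "\<And>y. y \<in> carrier A ==> (\<lambda>x. b x y) \<in> linear_maps A N"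
    "\<And>r x y. r \<in> carrier R ==> x \<in> carrier A ==> y \<in> carrier A ==> b (inc A r \<otimes> x) y = b x (inc A r \<otimes> y)"
  shows "balanced R L L N b"
  by (rule balancedI) (simp_all add: assms lin_L)

lemma lift_LL:
  assumes "vspace N" "balanced R L L N b"
  shows "tensor_lift N b \<in> linear_maps LL.T N"
    "x \<in> carrier A ==> y \<in> carrier A ==> tensor_lift N b (LL.pt x y) = b x y"
  using LL.lift_linear_pure[OF assms] by simp_all

lemma LL_eq_on_pure:
  assumes "f \<in> linear_maps LL.T N" "g \<in> linear_maps LL.T N" "t \<in> carrier LL.T"
    and "\<And>x y. x \<in> carrier A ==> y \<in> carrier A ==> f (LL.pt x y) = g (LL.pt x y)"
  shows "f t = g t"
  by (rule LL.linear_eq_on_pure[OF assms(1-3)]) (use assms(4) in simp)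

section \<open>Right actions, componentwise product, associativity and flip on the tensor
  products\<close>

lemma right_act:
  assumes r: "r \<in> carrier R"
  shows "right_act1 R A r \<in> linear_maps LL.T LL.T"
    and "a \<in> carrier A ==> b \<in> carrier A ==> right_act1 R A r (LL.pt a b) = LL.pt (a \<otimes> inc A r) b"
    and "right_act2 R A r \<in> linear_maps LL.T LL.T"
    and "a \<in> carrier A ==> b \<in> carrier A ==> right_act2 R A r (LL.pt a b) = LL.pt a (b \<otimes> inc A r)"
proof -
  note i = inc_in[OF r]
  have 1: "balanced R L L LL.T (\<lambda>a b. LL.pt (a \<otimes> inc A r) b)"
  proof (rule balanced_LL_I)
    fix s x y assume s: "s \<in> carrier R" and x: "x \<in> carrier A" and y: "y \<in> carrier A"
    show "LL.pt (inc A s \<otimes> x \<otimes> inc A r) y = LL.pt (x \<otimes> inc A r) (inc A s \<otimes> y)"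
      using pt_balanced[OF s A.mult_closed[OF x i] y] A.mult_assoc[OF inc_in[OF s] x i] by simp
  next
    fix x assume "x \<in> carrier A" then show "LL.pt (x \<otimes> inc A r) \<in> linear_maps A LL.T" by (intro pt_lin A.mult_closed i)
  next
    fix y assume "y \<in> carrier A" then show "(\<lambda>x. LL.pt (x \<otimes> inc A r) y) \<in> linear_maps A LL.T"
      by (rule linear_maps_compose[OF A.mult_linear_left[OF i] pt_lin(2)])
  qed
  have 2: "balanced R L L LL.T (\<lambda>a b. LL.pt a (b \<otimes> inc A r))"
  proof (rule balanced_LL_I)
    fix s x y assume s: "s \<in> carrier R" and x: "x \<in> carrier A" and y: "y \<in> carrier A"
    show "LL.pt (inc A s \<otimes> x) (y \<otimes> inc A r) = LL.pt x (inc A s \<otimes> y \<otimes> inc A r)"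
      using pt_balanced[OF s x A.mult_closed[OF y i]] A.mult_assoc[OF inc_in[OF s] y i] by simp
  next
    fix x assume "x \<in> carrier A" then show "(\<lambda>b. LL.pt x (b \<otimes> inc A r)) \<in> linear_maps A LL.T"
      by (rule linear_maps_compose[OF A.mult_linear_left[OF i] pt_lin(1)])
  next
    fix y assume "y \<in> carrier A" then show "(\<lambda>x. LL.pt x (y \<otimes> inc A r)) \<in> linear_maps A LL.T"
      by (intro pt_lin A.mult_closed i)
  qed
  show "right_act1 R A r \<in> linear_maps LL.T LL.T"
    and "a \<in> carrier A ==> b \<in> carrier A ==> right_act1 R A r (LL.pt a b) = LL.pt (a \<otimes> inc A r) b"
    unfolding right_act1_def using lift_LL[OF LL.vspace_T 1] by simp_all
  show "right_act2 R A r \<in> linear_maps LL.T LL.T"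
    and "a \<in> carrier A ==> b \<in> carrier A ==> right_act2 R A r (LL.pt a b) = LL.pt a (b \<otimes> inc A r)"
    unfolding right_act2_def using lift_LL[OF LL.vspace_T 2] by simp_all
qed

text \<open>Right multiplication by \<open>c\<close> and \<open>d\<close> in the two components,
  which is the inner lift of \<open>tensor_mult\<close>. It makes sense for every tensor, because
  right multiplication commutes with the left actions.\<close>

definition inner_mult where
  "inner_mult c d = tensor_lift LL.T (\<lambda>a b. LL.pt (a \<otimes> c) (b \<otimes> d))"

lemma inner_mult:
  assumes c: "c \<in> carrier A" and d: "d \<in> carrier A"
  shows "inner_mult c d \<in> linear_maps LL.T LL.T"
    "a \<in> carrier A ==> b \<in> carrier A ==> inner_mult c d (LL.pt a b) = LL.pt (a \<otimes> c) (b \<otimes> d)"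
proof -
  have "balanced R L L LL.T (\<lambda>a b. LL.pt (a \<otimes> c) (b \<otimes> d))"
  proof (rule balanced_LL_I)
    fix s x y assume s: "s \<in> carrier R" and x: "x \<in> carrier A" and y: "y \<in> carrier A"
    show "LL.pt (inc A s \<otimes> x \<otimes> c) (y \<otimes> d) = LL.pt (x \<otimes> c) (inc A s \<otimes> y \<otimes> d)"
      using pt_balanced[OF s A.mult_closed[OF x c] A.mult_closed[OF y d]]
        A.mult_assoc[OF inc_in[OF s] x c] A.mult_assoc[OF inc_in[OF s] y d] by simp
  next
    fix x assume "x \<in> carrier A" then show "(\<lambda>b. LL.pt (x \<otimes> c) (b \<otimes> d)) \<in> linear_maps A LL.T"
      by (intro linear_maps_compose[OF A.mult_linear_left[OF d] pt_lin(1)] A.mult_closed c)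
  next
    fix y assume "y \<in> carrier A" then show "(\<lambda>x. LL.pt (x \<otimes> c) (y \<otimes> d)) \<in> linear_maps A LL.T"
      by (intro linear_maps_compose[OF A.mult_linear_left[OF c] pt_lin(2)] A.mult_closed d)
  qed
  from lift_LL[OF LL.vspace_T this]
  show "inner_mult c d \<in> linear_maps LL.T LL.T"
    "a \<in> carrier A ==> b \<in> carrier A ==> inner_mult c d (LL.pt a b) = LL.pt (a \<otimes> c) (b \<otimes> d)"
    unfolding inner_mult_def by simp_all
qed

text \<open>The tensors on which the two right actions coincide; only for these is multiplication by \<open>t\<close>
  from the left well defined on the tensor product.\<close>

definition takeuchi where
  "takeuchi = {t \<in> carrier LL.T. \<forall>r\<in>carrier R. right_act1 R A r t = right_act2 R A r t}"

lemma tensor_mult_linear_pure: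
  assumes t: "t \<in> takeuchi"
  shows "tensor_mult R A t \<in> linear_maps LL.T LL.T"
    "c \<in> carrier A ==> d \<in> carrier A ==> tensor_mult R A t (LL.pt c d) = inner_mult c d t"
proof -
  have tc: "t \<in> carrier LL.T" using t by (simp add: takeuchi_def)
  have "balanced R L L LL.T (\<lambda>c d. inner_mult c d t)"
  proof (rule balanced_LL_I)
    fix c assume c: "c \<in> carrier A"
    show "(\<lambda>d. inner_mult c d t) \<in> linear_maps A LL.T"
    proof (rule linear_mapsI)
      fix d d' and k assume d: "d \<in> carrier A"
      show "inner_mult c d t \<in> carrier LL.T" by (rule linear_mapsD(1)[OF inner_mult(1)[OF c d] tc])
      show "inner_mult c (k \<odot> d) t = k \<odot>\<^bsub>LL.T\<^esub> inner_mult c d t"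
      proof (rule LL_eq_on_pure[OF inner_mult(1)[OF c VA.smult_in[OF d]] linear_maps_smult[OF inner_mult(1)[OF c d] LL.vspace_T] tc])
        fix x y assume x: "x \<in> carrier A" and y: "y \<in> carrier A"
        show "inner_mult c (k \<odot> d) (LL.pt x y) = k \<odot>\<^bsub>LL.T\<^esub> inner_mult c d (LL.pt x y)"
          unfolding inner_mult(2)[OF c d x y] inner_mult(2)[OF c VA.smult_in[OF d] x y] linear_mapsD(3)[OF A.mult_linear_right[OF y] d]
          by (rule linear_mapsD(3)[OF pt_lin(1)[OF A.mult_closed[OF x c]] A.mult_closed[OF y d]])
      qed
      assume d': "d' \<in> carrier A"
      show "inner_mult c (d \<oplus> d') t = inner_mult c d t \<oplus>\<^bsub>LL.T\<^esub> inner_mult c d' t"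
      proof (rule LL_eq_on_pure[OF inner_mult(1)[OF c VA.a_closed[OF d d']]
            linear_maps_add[OF inner_mult(1)[OF c d] inner_mult(1)[OF c d'] LL.vspace_T] tc])
        fix x y assume x: "x \<in> carrier A" and y: "y \<in> carrier A"
        show "inner_mult c (d \<oplus> d') (LL.pt x y) = inner_mult c d (LL.pt x y) \<oplus>\<^bsub>LL.T\<^esub> inner_mult c d' (LL.pt x y)"
          unfolding inner_mult(2)[OF c d x y] inner_mult(2)[OF c d' x y] inner_mult(2)[OF c VA.a_closed[OF d d'] x y]
            linear_mapsD(2)[OF A.mult_linear_right[OF y] d d']
          by (rule linear_mapsD(2)[OF pt_lin(1)[OF A.mult_closed[OF x c]] A.mult_closed[OF y d] A.mult_closed[OF y d']])
      qed
    qed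
  next
    fix d assume d: "d \<in> carrier A"
    show "(\<lambda>c. inner_mult c d t) \<in> linear_maps A LL.T"
    proof (rule linear_mapsI)
      fix c c' and k assume c: "c \<in> carrier A"
      show "inner_mult c d t \<in> carrier LL.T" by (rule linear_mapsD(1)[OF inner_mult(1)[OF c d] tc])
      show "inner_mult (k \<odot> c) d t = k \<odot>\<^bsub>LL.T\<^esub> inner_mult c d t"
      proof (rule LL_eq_on_pure[OF inner_mult(1)[OF VA.smult_in[OF c] d] linear_maps_smult[OF inner_mult(1)[OF c d] LL.vspace_T] tc])
        fix x y assume x: "x \<in> carrier A" and y: "y \<in> carrier A"
        show "inner_mult (k \<odot> c) d (LL.pt x y) = k \<odot>\<^bsub>LL.T\<^esub> inner_mult c d (LL.pt x y)"
          unfolding inner_mult(2)[OF c d x y] inner_mult(2)[OF VA.smult_in[OF c] d x y] linear_mapsD(3)[OF A.mult_linear_right[OF x] c]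
          by (rule linear_mapsD(3)[OF pt_lin(2)[OF A.mult_closed[OF y d]] A.mult_closed[OF x c]])
      qed
      assume c': "c' \<in> carrier A"
      show "inner_mult (c \<oplus> c') d t = inner_mult c d t \<oplus>\<^bsub>LL.T\<^esub> inner_mult c' d t"
      proof (rule LL_eq_on_pure[OF inner_mult(1)[OF VA.a_closed[OF c c'] d]
            linear_maps_add[OF inner_mult(1)[OF c d] inner_mult(1)[OF c' d] LL.vspace_T] tc])
        fix x y assume x: "x \<in> carrier A" and y: "y \<in> carrier A"
        show "inner_mult (c \<oplus> c') d (LL.pt x y) = inner_mult c d (LL.pt x y) \<oplus>\<^bsub>LL.T\<^esub> inner_mult c' d (LL.pt x y)"
          unfolding inner_mult(2)[OF c d x y] inner_mult(2)[OF c' d x y] inner_mult(2)[OF VA.a_closed[OF c c'] d x y]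
            linear_mapsD(2)[OF A.mult_linear_right[OF x] c c']
          by (rule linear_mapsD(2)[OF pt_lin(2)[OF A.mult_closed[OF y d]] A.mult_closed[OF x c] A.mult_closed[OF x c']])
      qed
    qed
  next
    fix r c d assume r: "r \<in> carrier R" and c: "c \<in> carrier A" and d: "d \<in> carrier A"
    note i = inc_in[OF r]
    \<comment> \<open>\<open>r\<close> in front of \<open>c\<close> turns into the right action on
      the first component of \<open>t\<close>; correspondingly, \<open>r\<close> in front of
      \<open>d\<close> turns into the right action on the second.\<close>
    have "inner_mult (inc A r \<otimes> c) d t = inner_mult c d (right_act1 R A r t)"
    proof (rule LL_eq_on_pure[OF inner_mult(1)[OF A.mult_closed[OF i c] d] linear_maps_compose[OF right_act(1)[OF r] inner_mult(1)[OF c d]] tc])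
      fix x y assume x: "x \<in> carrier A" and y: "y \<in> carrier A"
      show "inner_mult (inc A r \<otimes> c) d (LL.pt x y) = inner_mult c d (right_act1 R A r (LL.pt x y))"
        unfolding right_act(2)[OF r x y] inner_mult(2)[OF A.mult_closed[OF i c] d x y] inner_mult(2)[OF c d A.mult_closed[OF x i] y]
          A.mult_assoc[OF x i c] ..
    qed
    moreover have "inner_mult c (inc A r \<otimes> d) t = inner_mult c d (right_act2 R A r t)"
    proof (rule LL_eq_on_pure[OF inner_mult(1)[OF c A.mult_closed[OF i d]] linear_maps_compose[OF right_act(3)[OF r] inner_mult(1)[OF c d]] tc])
      fix x y assume x: "x \<in> carrier A" and y: "y \<in> carrier A"
      show "inner_mult c (inc A r \<otimes> d) (LL.pt x y) = inner_mult c d (right_act2 R A r (LL.pt x y))"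
        unfolding right_act(4)[OF r x y] inner_mult(2)[OF c A.mult_closed[OF i d] x y] inner_mult(2)[OF c d x A.mult_closed[OF y i]]
          A.mult_assoc[OF y i d] ..
    qed
    ultimately show "inner_mult (inc A r \<otimes> c) d t = inner_mult c (inc A r \<otimes> d) t"
      using t r by (simp add: takeuchi_def)
  qed
  from lift_LL[OF LL.vspace_T this]
  show "tensor_mult R A t \<in> linear_maps LL.T LL.T"
    "c \<in> carrier A ==> d \<in> carrier A ==> tensor_mult R A t (LL.pt c d) = inner_mult c d t"
    unfolding tensor_mult_def[abs_def] inner_mult_def by simp_all
qed

text \<open>\<open>tensor_mult\<close> is a lift in its right argument, and its left argument is
  restricted to \<open>takeuchi\<close>, so additivity in the latter is a separate statement.
  Multiplicativity of the comultiplication is extended to sums through it.\<close>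

lemma tensor_mult_add:
  assumes t: "t \<in> takeuchi" and t': "t' \<in> takeuchi" and s: "s \<in> carrier LL.T"
  shows "tensor_mult R A (t \<oplus>\<^bsub>LL.T\<^esub> t') s = tensor_mult R A t s \<oplus>\<^bsub>LL.T\<^esub> tensor_mult R A t' s"
proof -
  have c: "t \<in> carrier LL.T" "t' \<in> carrier LL.T" using t t' by (simp_all add: takeuchi_def)
  have tt: "t \<oplus>\<^bsub>LL.T\<^esub> t' \<in> takeuchi"
    using t t' c linear_mapsD(2)[OF right_act(1) c] linear_mapsD(2)[OF right_act(3) c] by (simp add: takeuchi_def)
  show ?thesis
  proof (rule LL_eq_on_pure[OF tensor_mult_linear_pure(1)[OF tt]
        linear_maps_add[OF tensor_mult_linear_pure(1)[OF t] tensor_mult_linear_pure(1)[OF t'] LL.vspace_T] s])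
    fix x y assume x: "x \<in> carrier A" and y: "y \<in> carrier A"
    show "tensor_mult R A (t \<oplus>\<^bsub>LL.T\<^esub> t') (LL.pt x y) = tensor_mult R A t (LL.pt x y) \<oplus>\<^bsub>LL.T\<^esub> tensor_mult R A t' (LL.pt x y)"
      unfolding tensor_mult_linear_pure(2)[OF tt x y] tensor_mult_linear_pure(2)[OF t x y] tensor_mult_linear_pure(2)[OF t' x y]
      by (rule linear_mapsD(2)[OF inner_mult(1)[OF x y] c])
  qed
qed

definition assoc_aux where
  "assoc_aux c = tensor_lift LLR.T (\<lambda>a b. LLR.pt a (LL.pt b c))"

lemma assoc_aux:
  assumes c: "c \<in> carrier A"
  shows "assoc_aux c \<in> linear_maps LL.T LLR.T"
    "a \<in> carrier A ==> b \<in> carrier A ==> assoc_aux c (LL.pt a b) = LLR.pt a (LL.pt b c)"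
proof -
  have "balanced R L L LLR.T (\<lambda>a b. LLR.pt a (LL.pt b c))"
  proof (rule balanced_LL_I)
    fix x assume "x \<in> carrier A"
    then show "(\<lambda>b. LLR.pt x (LL.pt b c)) \<in> linear_maps A LLR.T"
      by (intro linear_maps_compose[OF pt_lin(2)[OF c] LLR.pure_linear2]) simp
  next
    fix y assume y: "y \<in> carrier A"
    then show "(\<lambda>a. LLR.pt a (LL.pt y c)) \<in> linear_maps A LLR.T"
      using LLR.pure_linear1[OF pt_closed[OF y c]] by (simp add: lin_L)
  next
    fix r x y assume r: "r \<in> carrier R" and x: "x \<in> carrier A" and y: "y \<in> carrier A"
    show "LLR.pt (inc A r \<otimes> x) (LL.pt y c) = LLR.pt x (LL.pt (inc A r \<otimes> y) c)"
      using balancedD(3)[OF LLR.pure_balanced, of r x "LL.pt y c"] r x y pt_closed[OF y c] act_pt[OF r y c] by simp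
  qed
  from lift_LL[OF LLR.vspace_T this]
  show "assoc_aux c \<in> linear_maps LL.T LLR.T"
    "a \<in> carrier A ==> b \<in> carrier A ==> assoc_aux c (LL.pt a b) = LLR.pt a (LL.pt b c)"
    unfolding assoc_aux_def by simp_all
qed

text \<open>Two nested lifts. The inner one is balanced in the first two factors for fixed
  \<open>c\<close>; balancedness of the outer one holds because a base element can travel from the
  first factor through the second to the third.\<close>

lemma tensor_assoc_linear_pure:
  shows "tensor_assoc R A \<in> linear_maps LLL.T LLR.T"
    and "a \<in> carrier A ==> b \<in> carrier A ==> c \<in> carrier A ==>
      tensor_assoc R A (LLL.pt (LL.pt a b) c) = LLR.pt a (LL.pt b c)"
proof -
  have "balanced R LL.T L LLR.T (\<lambda>t c. assoc_aux c t)"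
  proof (rule balancedI)
    fix t assume t: "t \<in> carrier LL.T"
    have "(\<lambda>c. assoc_aux c t) \<in> linear_maps A LLR.T"
    proof (rule linear_mapsI)
      fix c c' and k assume c: "c \<in> carrier A"
      show "assoc_aux c t \<in> carrier LLR.T" by (rule linear_mapsD(1)[OF assoc_aux(1)[OF c] t])
      show "assoc_aux (k \<odot> c) t = k \<odot>\<^bsub>LLR.T\<^esub> assoc_aux c t"
      proof (rule LL_eq_on_pure[OF assoc_aux(1)[OF VA.smult_in[OF c]] linear_maps_smult[OF assoc_aux(1)[OF c] LLR.vspace_T] t])
        fix x y assume x: "x \<in> carrier A" and y: "y \<in> carrier A"
        show "assoc_aux (k \<odot> c) (LL.pt x y) = k \<odot>\<^bsub>LLR.T\<^esub> assoc_aux c (LL.pt x y)"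
          unfolding assoc_aux(2)[OF c x y] assoc_aux(2)[OF VA.smult_in[OF c] x y] linear_mapsD(3)[OF pt_lin(1)[OF y] c]
          by (rule linear_mapsD(3)[OF LLR.pure_linear2 pt_closed[OF y c]]) (simp add: x)
      qed
      assume c': "c' \<in> carrier A"
      show "assoc_aux (c \<oplus> c') t = assoc_aux c t \<oplus>\<^bsub>LLR.T\<^esub> assoc_aux c' t"
      proof (rule LL_eq_on_pure[OF assoc_aux(1)[OF VA.a_closed[OF c c']]
            linear_maps_add[OF assoc_aux(1)[OF c] assoc_aux(1)[OF c'] LLR.vspace_T] t])
        fix x y assume x: "x \<in> carrier A" and y: "y \<in> carrier A"
        show "assoc_aux (c \<oplus> c') (LL.pt x y) = assoc_aux c (LL.pt x y) \<oplus>\<^bsub>LLR.T\<^esub> assoc_aux c' (LL.pt x y)"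
          unfolding assoc_aux(2)[OF c x y] assoc_aux(2)[OF c' x y] assoc_aux(2)[OF VA.a_closed[OF c c'] x y] linear_mapsD(2)[OF pt_lin(1)[OF y] c c']
          by (rule linear_mapsD(2)[OF LLR.pure_linear2 pt_closed[OF y c] pt_closed[OF y c']]) (simp add: x)
      qed
    qed
    then show "(\<lambda>c. assoc_aux c t) \<in> linear_maps L LLR.T" by (simp add: lin_L)
  next
    fix c assume "c \<in> carrier L"
    then show "(\<lambda>t. assoc_aux c t) \<in> linear_maps LL.T LLR.T" using assoc_aux(1)[of c] by simp
  next
    fix r t c assume r: "r \<in> carrier R" and t: "t \<in> carrier LL.T" and "c \<in> carrier L"
    then have c: "c \<in> carrier A" by simp
    note i = inc_in[OF r]
    have "assoc_aux c (act LL.T r t) = assoc_aux (inc A r \<otimes> c) t"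
    proof (rule LL_eq_on_pure[OF linear_maps_compose[OF LL.act_T_linear[OF r] assoc_aux(1)[OF c]] assoc_aux(1)[OF A.mult_closed[OF i c]] t])
      fix x y assume x: "x \<in> carrier A" and y: "y \<in> carrier A"
      have "LLR.pt (inc A r \<otimes> x) (LL.pt y c) = LLR.pt x (LL.pt (inc A r \<otimes> y) c)"
        using balancedD(3)[OF LLR.pure_balanced, of r x "LL.pt y c"] r x y pt_closed[OF y c] act_pt[OF r y c] by simp
      then show "assoc_aux c (act LL.T r (LL.pt x y)) = assoc_aux (inc A r \<otimes> c) (LL.pt x y)"
        unfolding act_pt[OF r x y] assoc_aux(2)[OF c A.mult_closed[OF i x] y] assoc_aux(2)[OF A.mult_closed[OF i c] x y]
        using pt_balanced[OF r y c] by simp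
    qed
    then show "assoc_aux c (act LL.T r t) = assoc_aux (act L r c) t" by simp
  qed
  note l = LLL.lift_linear_pure[OF LLR.vspace_T this]
  have e: "tensor_assoc R A = tensor_lift LLR.T (\<lambda>t c. assoc_aux c t)"
    unfolding tensor_assoc_def assoc_aux_def ..
  show "tensor_assoc R A \<in> linear_maps LLL.T LLR.T" unfolding e by (rule l(1))
  show "a \<in> carrier A ==> b \<in> carrier A ==> c \<in> carrier A ==> tensor_assoc R A (LLL.pt (LL.pt a b) c) = LLR.pt a (LL.pt b c)"
    unfolding e using l(2)[OF pt_closed, of a b c] assoc_aux(2)[of c a b] by simp
qed

lemma flip_linear_pure:
  shows "tensor_lift LL.T (\<lambda>b c. LL.pt c b) \<in> linear_maps LL.T LL.T"
    and "a \<in> carrier A ==> b \<in> carrier A ==> tensor_lift LL.T (\<lambda>b c. LL.pt c b) (LL.pt a b) = LL.pt b a"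
proof -
  have "balanced R L L LL.T (\<lambda>b c. LL.pt c b)"
    by (rule balanced_LL_I) (simp_all add: pt_lin pt_balanced)
  from lift_LL[OF LL.vspace_T this] show "tensor_lift LL.T (\<lambda>b c. LL.pt c b) \<in> linear_maps LL.T LL.T"
    and "a \<in> carrier A ==> b \<in> carrier A ==> tensor_lift LL.T (\<lambda>b c. LL.pt c b) (LL.pt a b) = LL.pt b a" by simp_all
qed

lemma r_module_self: "r_module R (self_mod R)"
  unfolding r_module_def
proof (intro conjI ballI)
  show "vspace (self_mod R)" by (rule vspace_cong[OF VR.vspace_axioms]) (simp_all add: self_mod_def)
  show "act (self_mod R) r \<in> linear_maps (self_mod R) (self_mod R)" if "r \<in> carrier R" for r
    by (rule linear_mapsI) (simp_all add: self_mod_def linear_mapsD[OF R.mult_linear_right[OF that]])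
  fix r s x assume "r \<in> carrier R" "s \<in> carrier R" "x \<in> carrier (self_mod R)"
  then show "act (self_mod R) r (act (self_mod R) s x) = act (self_mod R) s (act (self_mod R) r x)"
    using R.mult_assoc[of r s x] R.mult_assoc[of s r x] R.mult_comm[of r s] by (simp add: self_mod_def)
qed

end

section \<open>The convolution algebra of an etale groupoid\<close>

lemma image_boxE:
  assumes "z \<in> m ` {(y, w). y \<in> U \<and> w \<in> V \<and> f y = g w}"
  obtains x y where "x \<in> U" "y \<in> V" "f x = g y" "z = m (x, y)"
  using assms by auto

locale hgroupoid = etale_groupoid M G + hbase M
  for M :: "('m, 'e::{real_inner,heine_borel}) manifold" and G :: "('g, 'm, 'e) groupoid" +
  fixes TF :: "'f::real_normed_field itself"
begin

sublocale A: smanifold "arr G" by unfold_locales (rule arrows)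
sublocale S: hmap "arr G" M TF "src G" by unfold_locales (rule local_diffeo_etale[OF arrows objects src])
sublocale T: hmap "arr G" M TF "tgt G" by unfold_locales (rule local_diffeo_etale[OF arrows objects tgt])
sublocale ST: hfib "arr G" "arr G" M TF "src G" "tgt G" by unfold_locales (rule S.et, rule T.et)
sublocale TT: hfib "arr G" "arr G" M TF "tgt G" "tgt G" by unfold_locales (rule T.et)+
sublocale MU: etmap ST.P "arr G" TF "mlt G"
  by unfold_locales (rule local_diffeo_etale[OF ST.smooth_manifold_P arrows mlt[unfolded comp_st_def]])
sublocale U: etmap M "arr G" TF "unt G"
  by unfold_locales (rule local_diffeo_etale[OF objects arrows unt])
sublocale I: etmap "arr G" "arr G" TF "ivt G"
  by unfold_locales (rule local_diffeo_etale[OF arrows arrows ivt])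

text \<open>The first projection is cancelled: \<open>fst\<close> after the diagonal is the
  identity.\<close>

lemma etale_diag: "etale TYPE('f) (arr G) TT.P (\<lambda>g. (g, g))"
proof (rule etale_cancel[OF arrows TT.smooth_manifold_P etale_id TT.etale_fst])
  show "continuous_map (mtop (arr G)) (mtop TT.P) (\<lambda>g. (g, g))"
    unfolding TT.mtop_P fib_top_def continuous_map_in_subtopology
    by (auto intro: continuous_map_paired[THEN iffD2])
qed simp

sublocale D: etmap "arr G" TT.P TF "\<lambda>g. (g, g)" by unfold_locales (rule etale_diag)

abbreviation "R \<equiv> S.R"
abbreviation "CA \<equiv> S.CE"
abbreviation "H \<equiv> convolution_hopf M G :: ('f, ('m, 'f) germs, ('g, 'f) germs) hopf_data"
abbreviation conv (infixl "\<star>" 70) where "a \<star> b \<equiv> a \<otimes>\<^bsub>H\<^esub> b"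
abbreviation "prodset U V \<equiv> mlt G ` ST.boxset U V"

lemma H_simps:
  "carrier H = carrier CA" "add H = add (sections (arr G))" "zero H = zero (sections (arr G))" "smult H = smult (sections (arr G))"
  "inc H = push M (arr G) (unt G)" "counit H = push (arr G) M (tgt G)" "antipode H = push (arr G) (arr G) (ivt G)"
  by (simp_all add: convolution_hopf_def)

lemma lin_H: "linear_maps H N = linear_maps CA N" "linear_maps N H = linear_maps N CA"
  by (simp_all add: linear_maps_def H_simps)

lemma vspace_H: "vspace H"
  by (rule vspace_cong[OF A.vspace_Cc]) (simp_all add: H_simps)

lemma conv_eq: "a \<in> carrier CA ==> b \<in> carrier CA ==> a \<star> b = push ST.P (arr G) (mlt G) (ST.bx a b)"
  by (simp add: convolution_hopf_def comp_st_def ST.Omega_pure)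

lemma conv_in: "a \<in> carrier CA ==> b \<in> carrier CA ==> a \<star> b \<in> carrier CA"
  unfolding conv_eq by (rule MU.push_in[OF ST.box_in])

lemma conv_linear:
  shows "a \<in> carrier CA ==> (\<lambda>b. a \<star> b) \<in> linear_maps CA CA"
    and "b \<in> carrier CA ==> (\<lambda>a. a \<star> b) \<in> linear_maps CA CA"
proof -
  have cl: "x \<oplus>\<^bsub>sections (arr G)\<^esub> y \<in> carrier CA" "c \<odot>\<^bsub>sections (arr G)\<^esub> x \<in> carrier CA"
    if "x \<in> carrier CA" "y \<in> carrier CA" for x y c
    using vspace.smult_in[OF A.vspace_Cc that(1), of c] abelian_monoid.a_closed[OF abelian_group.axioms(1)[OF module.axioms(2)[OF vspace.module_scalars[OF A.vspace_Cc]]] that] by simp_all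
  show "(\<lambda>b. a \<star> b) \<in> linear_maps CA CA" if a: "a \<in> carrier CA"
  proof -
    note l = linear_maps_compose[OF ST.box_linear2[OF a] MU.push_linear]
    show ?thesis
      by (rule linear_mapsI) (use linear_mapsD[OF l] cl in \<open>auto simp: conv_eq a\<close>)
  qed
  show "(\<lambda>a. a \<star> b) \<in> linear_maps CA CA" if b: "b \<in> carrier CA"
  proof -
    note l = linear_maps_compose[OF ST.box_linear1[OF b] MU.push_linear]
    show ?thesis
      by (rule linear_mapsI) (use linear_mapsD[OF l] cl in \<open>auto simp: conv_eq b\<close>)
  qed
qed

subsection \<open>Groupoid identities\<close>

lemma unt_in: "x \<in> X ==> unt G x \<in> arrows G"
  by (rule etale_in[OF U.et])

lemma ivt_in: "g \<in> arrows G ==> ivt G g \<in> arrows G"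
  by (rule etale_in[OF I.et])

lemma mlt_in: "g \<in> arrows G ==> h \<in> arrows G ==> src G g = tgt G h ==> mlt G (g, h) \<in> arrows G"
  by (rule etale_in[OF MU.et]) (simp add: ST.topspace_P)

lemma src_in: "g \<in> arrows G ==> src G g \<in> X" and tgt_in: "g \<in> arrows G ==> tgt G g \<in> X"
  by (rule etale_in[OF S.et], assumption) (rule etale_in[OF T.et])

lemma cancel_left:
  assumes "g \<in> arrows G" "h \<in> arrows G" "src G g = tgt G h"
  shows "mlt G (ivt G g, mlt G (g, h)) = h"
proof -
  have "mlt G (ivt G g, mlt G (g, h)) = mlt G (mlt G (ivt G g, g), h)"
    using assms by (intro mlt_assoc[symmetric] ivt_in) (simp_all add: src_ivt)
  then show ?thesis using assms by (simp add: ivt_left unt_left)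
qed

text \<open>The formulas for inverses of inverses, units and products all reduce to this, and so
  does the compatibility of homomorphisms with inverses.\<close>

lemma ivt_unique:
  assumes "g \<in> arrows G" "h \<in> arrows G" "src G g = tgt G h" "mlt G (g, h) = unt G (tgt G g)"
  shows "h = ivt G g"
proof -
  have "h = mlt G (ivt G g, unt G (tgt G g))" using cancel_left[OF assms(1-3)] assms(4) by simp
  also have "\<dots> = ivt G g" using unt_right[OF ivt_in[OF assms(1)]] by (simp add: src_ivt assms(1))
  finally show ?thesis .
qed

lemma ivt_ivt: "g \<in> arrows G ==> ivt G (ivt G g) = g"
  by (rule ivt_unique[symmetric]) (simp_all add: ivt_in src_ivt tgt_ivt ivt_left)

lemma ivt_unt: "x \<in> X ==> ivt G (unt G x) = unt G x"
  using unt_left[OF unt_in, of x] by (intro ivt_unique[symmetric]) (simp_all add: unt_in src_unt tgt_unt)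

lemma ivt_mlt:
  assumes "g \<in> arrows G" "h \<in> arrows G" "src G g = tgt G h"
  shows "ivt G (mlt G (g, h)) = mlt G (ivt G h, ivt G g)"
proof (rule ivt_unique[symmetric])
  note i = ivt_in[OF assms(1)] ivt_in[OF assms(2)]
  show "mlt G (g, h) \<in> arrows G" by (rule mlt_in[OF assms])
  show m: "mlt G (ivt G h, ivt G g) \<in> arrows G" by (rule mlt_in) (simp_all add: i src_ivt tgt_ivt assms)
  show "src G (mlt G (g, h)) = tgt G (mlt G (ivt G h, ivt G g))"
    by (simp add: src_mlt tgt_mlt assms i src_ivt tgt_ivt)
  have "mlt G (mlt G (g, h), mlt G (ivt G h, ivt G g)) = mlt G (g, mlt G (h, mlt G (ivt G h, ivt G g)))"
    by (rule mlt_assoc) (simp_all add: assms m tgt_mlt i src_ivt tgt_ivt)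
  also have "mlt G (h, mlt G (ivt G h, ivt G g)) = ivt G g"
    using cancel_left[OF i(2) i(1)] by (simp add: ivt_ivt assms src_ivt tgt_ivt)
  also have "mlt G (g, ivt G g) = unt G (tgt G (mlt G (g, h)))" by (simp add: ivt_right tgt_mlt assms)
  finally show "mlt G (mlt G (g, h), mlt G (ivt G h, ivt G g)) = unt G (tgt G (mlt G (g, h)))" .
qed

subsection \<open>Functions supported in bisections\<close>

definition bis :: "'g set => bool" where
  "bis U \<longleftrightarrow> inj_on (src G) U \<and> inj_on (tgt G) U"

lemma bis_basis:
  assumes "y \<in> arrows G"
  shows "\<exists>V. openin (mtop (arr G)) V \<and> y \<in> V \<and> (\<forall>W. openin (mtop (arr G)) W \<longrightarrow> W \<subseteq> V \<longrightarrow> bis W)"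
proof -
  obtain V where V: "openin (mtop (arr G)) V" "y \<in> V" "inj_on (src G) V" using etale_inj[OF S.et assms] by (elim exE conjE)
  obtain V' where V': "openin (mtop (arr G)) V'" "y \<in> V'" "inj_on (tgt G) V'" using etale_inj[OF T.et assms] by (elim exE conjE)
  show ?thesis
    by (rule exI[of _ "V \<inter> V'"]) (use V V' in \<open>auto simp: bis_def intro: inj_on_subset\<close>)
qed

text \<open>The set \<open>U\<close> is kept in the predicate because formulas such as that for the
  comultiplication compare two functions on one and the same set.\<close>

definition rep :: "(('g, 'f) germs) => 'g set => ('g => 'f) => bool" where
  "rep a U f \<longleftrightarrow> local_fun (arr G) U f \<and> bis U \<and> a = ext_by_zero (arr G) U f"

lemma repI: "local_fun (arr G) U f ==> bis U ==> rep (ext_by_zero (arr G) U f) U f"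
  by (simp add: rep_def)

lemma repD:
  assumes "rep a U f"
  shows "local_fun (arr G) U f" "bis U" "a = ext_by_zero (arr G) U f" "a \<in> carrier CA" "U \<subseteq> arrows G"
    "openin (mtop (arr G)) U" "inj_on (src G) U" "inj_on (tgt G) U"
proof -
  have l: "local_fun (arr G) U f" and "bis U" and e: "a = ext_by_zero (arr G) U f" using assms by (simp_all add: rep_def)
  then show "local_fun (arr G) U f" "bis U" "a = ext_by_zero (arr G) U f" "inj_on (src G) U" "inj_on (tgt G) U"
    by (simp_all add: bis_def)
  show "openin (mtop (arr G)) U" by (rule local_fun_openin[OF l])
  then show "U \<subseteq> arrows G" by (rule openin_subset)
  show "a \<in> carrier CA" unfolding e by (rule A.ext_in_Cc[OF l])
qed

lemma rep_eqI:
  assumes a: "rep a U f" and b: "rep b V g" and e: "U = V" "\<And>x. x \<in> U ==> f x = g x"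
  shows "a = b"
  unfolding repD(3)[OF a] repD(3)[OF b] e(1)[symmetric] by (rule A.ext_cong[OF repD(6)[OF a] e(2)])

lemma rep_unit:
  assumes "rep a U f"
  obtains a' f' where "rep a' U f'" "\<And>x. x \<in> U ==> f x * f' x = f x"
proof -
  obtain c :: "'g => 'f" where c: "local_fun (arr G) U c" "\<And>x. x \<in> U ==> f x * c x = f x"
    by (rule A.local_unit[OF repD(1)[OF assms]]) (rule that)
  show thesis by (rule that[OF repI[OF c(1) repD(2)[OF assms]] c(2)])
qed

lemma H_eqI:
  assumes "f \<in> linear_maps CA N" "g \<in> linear_maps CA N" "vspace N" and u: "u \<in> carrier CA"
    and ext: "\<And>a U h. rep a U h ==> f a = g a"
  shows "f u = g u"
  by (rule A.Cc_linear_eqI[where Q = bis, OF assms(1-4)]) (erule bis_basis, rule ext[OF repI])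

text \<open>The target of a product is that of its left factor, so injectivity of the target on
  \<open>U\<close> recovers the left factor, and cancellation recovers the right one.\<close>

lemma mlt_inj:
  assumes "U \<subseteq> arrows G" "V \<subseteq> arrows G" "inj_on (tgt G) U"
  shows "inj_on (mlt G) (ST.boxset U V)"
proof (rule inj_onI)
  fix p p' assume p: "p \<in> ST.boxset U V" and p': "p' \<in> ST.boxset U V" and eq: "mlt G p = mlt G p'"
  obtain g h where gh: "p = (g, h)" by (cases p)
  obtain g' h' where gh': "p' = (g', h')" by (cases p')
  have a: "g \<in> U" "h \<in> V" "src G g = tgt G h" "g' \<in> U" "h' \<in> V" "src G g' = tgt G h'" using p p' gh gh' by auto
  then have b: "g \<in> arrows G" "h \<in> arrows G" "g' \<in> arrows G" "h' \<in> arrows G" using assms by auto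
  have "tgt G g = tgt G g'" using tgt_mlt[OF b(1,2) a(3)] tgt_mlt[OF b(3,4) a(6)] eq gh gh' by simp
  then have g: "g = g'" using assms(3) a by (auto dest: inj_onD)
  have h: "h = h'"
    using cancel_left[OF b(1,2) a(3)] cancel_left[OF b(3,4) a(6)] eq unfolding gh gh' g by metis
  show "p = p'" unfolding gh gh' g h ..
qed

lemma prodsetE:
  assumes "z \<in> prodset U V"
  obtains x y where "x \<in> U" "y \<in> V" "src G x = tgt G y" "z = mlt G (x, y)"
  using assms by (rule image_boxE)

text \<open>By \<open>mlt_inj\<close> each arrow of the product set has a single factorization into
  \<open>U\<close> and \<open>V\<close>, so convolution involves no sum. An end point of the product
  determines the outer factor, and the matching condition then the other one; hence the product of
  bisections is a bisection.\<close>

lemma conv_rep: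
  assumes a: "rep a U f" and b: "rep b V g"
  obtains k where "rep (a \<star> b) (prodset U V) k"
    "\<And>x y. x \<in> U ==> y \<in> V ==> src G x = tgt G y ==> k (mlt G (x, y)) = f x * g y"
proof -
  note A1 = repD[OF a] and B1 = repD[OF b]
  define k where "k z = (\<lambda>w. f (fst w) * g (snd w)) (inv_into (ST.boxset U V) (mlt G) z)" for z
  have inj: "inj_on (mlt G) (ST.boxset U V)" by (rule mlt_inj[OF A1(5) B1(5) A1(8)])
  have k: "k (mlt G (x, y)) = f x * g y" if "x \<in> U" "y \<in> V" "src G x = tgt G y" for x y
    using inv_into_f_f[OF inj, of "(x, y)"] that by (simp add: k_def)
  have loc: "local_fun ST.P (ST.boxset U V) (\<lambda>w. f (fst w) * g (snd w))" by (rule ST.local_fun_box[OF A1(1) B1(1)])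
  have P: "local_fun (arr G) (prodset U V) k" "push ST.P (arr G) (mlt G) (ext_by_zero ST.P (ST.boxset U V) (\<lambda>w. f (fst w) * g (snd w))) = ext_by_zero (arr G) (prodset U V) k"
    using MU.push_local[OF loc inj, of k] k by auto
  have e: "a \<star> b = ext_by_zero (arr G) (prodset U V) k"
    unfolding conv_eq[OF A1(4) B1(4)] unfolding A1(3) B1(3) ST.box_ext by (rule P(2))
  have st: "src G (mlt G (x, y)) = src G y \<and> tgt G (mlt G (x, y)) = tgt G x" if "(x, y) \<in> ST.boxset U V" for x y
    using that A1(5) B1(5) src_mlt tgt_mlt by blast
  have "bis (prodset U V)"
    unfolding bis_def
  proof (intro conjI inj_onI)
    fix z z' assume z: "z \<in> prodset U V" and z': "z' \<in> prodset U V" and eq: "src G z = src G z'"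
    obtain x y where xy: "z = mlt G (x, y)" "(x, y) \<in> ST.boxset U V" using z by (auto simp del: mem_Collect_eq)
    obtain x' y' where xy': "z' = mlt G (x', y')" "(x', y') \<in> ST.boxset U V" using z' by (auto simp del: mem_Collect_eq)
    have "src G y = src G y'" using eq st[OF xy(2)] st[OF xy'(2)] xy(1) xy'(1) by simp
    then have y: "y = y'" by (rule inj_onD[OF B1(7)]) (use xy(2) xy'(2) in auto)
    then have "src G x = src G x'" using xy(2) xy'(2) by simp
    then have "x = x'" by (rule inj_onD[OF A1(7)]) (use xy(2) xy'(2) in auto)
    then show "z = z'" using y xy xy' by simp
  next
    fix z z' assume z: "z \<in> prodset U V" and z': "z' \<in> prodset U V" and eq: "tgt G z = tgt G z'"
    obtain x y where xy: "z = mlt G (x, y)" "(x, y) \<in> ST.boxset U V" using z by (auto simp del: mem_Collect_eq)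
    obtain x' y' where xy': "z' = mlt G (x', y')" "(x', y') \<in> ST.boxset U V" using z' by (auto simp del: mem_Collect_eq)
    have "tgt G x = tgt G x'" using eq st[OF xy(2)] st[OF xy'(2)] xy(1) xy'(1) by simp
    then have x: "x = x'" by (rule inj_onD[OF A1(8)]) (use xy(2) xy'(2) in auto)
    then have "tgt G y = tgt G y'" using xy(2) xy'(2) by simp
    then have "y = y'" by (rule inj_onD[OF B1(8)]) (use xy(2) xy'(2) in auto)
    then show "z = z'" using x xy xy' by simp
  qed
  then show thesis using that[of k] k P(1) by (simp add: e repI)
qed

lemma conv_assoc:
  assumes a: "a \<in> carrier CA" and b: "b \<in> carrier CA" and c: "c \<in> carrier CA"
  shows "a \<star> b \<star> c = a \<star> (b \<star> c)"
proof -
  have 1: "a \<star> b \<star> c = a \<star> (b \<star> c)" if a: "rep a U f" and b: "rep b V g" and c: "rep c W h" for a b c U V W f g h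
  proof -
    obtain k1 where k1: "rep (a \<star> b) (prodset U V) k1"
      "\<And>x y. x \<in> U ==> y \<in> V ==> src G x = tgt G y ==> k1 (mlt G (x, y)) = f x * g y" by (rule conv_rep[OF a b]) (rule that)
    obtain k2 where k2: "rep (a \<star> b \<star> c) (prodset (prodset U V) W) k2"
      "\<And>x y. x \<in> prodset U V ==> y \<in> W ==> src G x = tgt G y ==> k2 (mlt G (x, y)) = k1 x * h y" by (rule conv_rep[OF k1(1) c]) (rule that)
    obtain k3 where k3: "rep (b \<star> c) (prodset V W) k3"
      "\<And>x y. x \<in> V ==> y \<in> W ==> src G x = tgt G y ==> k3 (mlt G (x, y)) = g x * h y" by (rule conv_rep[OF b c]) (rule that)
    obtain k4 where k4: "rep (a \<star> (b \<star> c)) (prodset U (prodset V W)) k4"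
      "\<And>x y. x \<in> U ==> y \<in> prodset V W ==> src G x = tgt G y ==> k4 (mlt G (x, y)) = f x * k3 y" by (rule conv_rep[OF a k3(1)]) (rule that)
    note s = repD(5)[OF a] repD(5)[OF b] repD(5)[OF c]
    have L: "\<exists>x\<in>U. \<exists>y\<in>V. \<exists>w\<in>W. src G x = tgt G y \<and> src G y = tgt G w \<and> z = mlt G (mlt G (x, y), w)"
      if z: "z \<in> prodset (prodset U V) W" for z
    proof -
      obtain u w where u: "u \<in> prodset U V" "w \<in> W" "src G u = tgt G w" "z = mlt G (u, w)" using z by (rule prodsetE)
      obtain x y where xy: "x \<in> U" "y \<in> V" "src G x = tgt G y" "u = mlt G (x, y)" using u(1) by (rule prodsetE)
      have "x \<in> arrows G" "y \<in> arrows G" using xy s by auto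
      then have "src G y = tgt G w" using u(3) src_mlt[OF _ _ xy(3)] xy(4) by simp
      then show ?thesis using u(2,4) xy by (intro bexI[of _ x] bexI[of _ y] bexI[of _ w]) simp_all
    qed
    have Rr: "\<exists>x\<in>U. \<exists>y\<in>V. \<exists>w\<in>W. src G x = tgt G y \<and> src G y = tgt G w \<and> z = mlt G (x, mlt G (y, w))"
      if z: "z \<in> prodset U (prodset V W)" for z
    proof -
      obtain x u where u: "x \<in> U" "u \<in> prodset V W" "src G x = tgt G u" "z = mlt G (x, u)" using z by (rule prodsetE)
      obtain y w where yw: "y \<in> V" "w \<in> W" "src G y = tgt G w" "u = mlt G (y, w)" using u(2) by (rule prodsetE)
      have "y \<in> arrows G" "w \<in> arrows G" using yw s by auto
      then have "src G x = tgt G y" using u(3) tgt_mlt[OF _ _ yw(3)] yw(4) by simp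
      then show ?thesis using u(1,4) yw by (intro bexI[of _ x] bexI[of _ y] bexI[of _ w]) simp_all
    qed
    have pt: "mlt G (mlt G (x, y), w) = mlt G (x, mlt G (y, w)) \<and> mlt G (x, y) \<in> prodset U V \<and> mlt G (y, w) \<in> prodset V W \<and>
        src G (mlt G (x, y)) = tgt G w \<and> src G x = tgt G (mlt G (y, w))"
      if "x \<in> U" "y \<in> V" "w \<in> W" "src G x = tgt G y" "src G y = tgt G w" for x y w
    proof -
      have m: "x \<in> arrows G" "y \<in> arrows G" "w \<in> arrows G" using that s by auto
      show ?thesis using mlt_assoc[OF m that(4,5)] src_mlt[OF m(1,2) that(4)] tgt_mlt[OF m(2,3) that(5)] that by auto
    qed
    show ?thesis
    proof (rule rep_eqI[OF k2(1) k4(1)])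
      show "prodset (prodset U V) W = prodset U (prodset V W)"
      proof (intro equalityI subsetI)
        fix z assume "z \<in> prodset (prodset U V) W"
        then obtain x y w where xyw: "x \<in> U" "y \<in> V" "w \<in> W" "src G x = tgt G y" "src G y = tgt G w" "z = mlt G (mlt G (x, y), w)"
          using L by blast
        show "z \<in> prodset U (prodset V W)"
          by (rule image_eqI[of _ _ "(x, mlt G (y, w))"]) (use pt[OF xyw(1-5)] xyw in simp_all)
      next
        fix z assume "z \<in> prodset U (prodset V W)"
        then obtain x y w where xyw: "x \<in> U" "y \<in> V" "w \<in> W" "src G x = tgt G y" "src G y = tgt G w" "z = mlt G (x, mlt G (y, w))"
          using Rr by blast
        show "z \<in> prodset (prodset U V) W"
          by (rule image_eqI[of _ _ "(mlt G (x, y), w)"]) (use pt[OF xyw(1-5)] xyw in simp_all)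
      qed
      fix z assume "z \<in> prodset (prodset U V) W"
      then obtain x y w where xyw: "x \<in> U" "y \<in> V" "w \<in> W" "src G x = tgt G y" "src G y = tgt G w" "z = mlt G (mlt G (x, y), w)"
        using L by blast
      note p = pt[OF xyw(1-5)]
      have "k2 z = f x * g y * h w" unfolding xyw(6) using k2(2)[of "mlt G (x, y)" w] k1(2)[OF xyw(1,2,4)] p xyw by simp
      moreover have "k4 z = f x * (g y * h w)" unfolding xyw(6)
        using k4(2)[of x "mlt G (y, w)"] k3(2)[OF xyw(2,3,5)] p xyw by simp
      ultimately show "k2 z = k4 z" by (simp add: mult.assoc)
    qed
  qed
  \<comment> \<open>The identity is trilinear and is extended from bisections to all sections in one
    argument at a time.\<close>
  have 2: "a \<star> b \<star> c = a \<star> (b \<star> c)" if a: "rep a U f" and b: "rep b V g" and c: "c \<in> carrier CA" for a b c U V f g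
    by (rule H_eqI[OF conv_linear(1)[OF conv_in[OF repD(4)[OF a] repD(4)[OF b]]]
          linear_maps_compose[OF conv_linear(1)[OF repD(4)[OF b]] conv_linear(1)[OF repD(4)[OF a]]] A.vspace_Cc c]) (rule 1[OF a b])
  have 3: "a \<star> b \<star> c = a \<star> (b \<star> c)" if a: "rep a U f" and b: "b \<in> carrier CA" and c: "c \<in> carrier CA" for a b c U f
    by (rule H_eqI[OF linear_maps_compose[OF conv_linear(1)[OF repD(4)[OF a]] conv_linear(2)[OF c]]
          linear_maps_compose[OF conv_linear(2)[OF c] conv_linear(1)[OF repD(4)[OF a]]] A.vspace_Cc b]) (rule 2[OF a _ c])
  show ?thesis
    by (rule H_eqI[OF linear_maps_compose[OF conv_linear(2)[OF b] conv_linear(2)[OF c]] conv_linear(2)[OF conv_in[OF b c]] A.vspace_Cc a])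
      (rule 3[OF _ b c])
qed

lemma assoc_algebra_H: "assoc_algebra H"
  by (rule assoc_algebra.intro)
    (simp_all add: vspace.module_scalars[OF vspace_H] H_simps(1) lin_H conv_in conv_assoc conv_linear)

lemma inc_rep:
  assumes q: "local_fun M X q"
  obtains k where "rep (inc H (ext_by_zero M X q)) (unt G ` X) k" "\<And>x. x \<in> X ==> k (unt G x) = q x"
proof -
  have inj: "inj_on (unt G) X" by (rule inj_on_inverseI[where g = "src G"]) (simp add: src_unt)
  define k where "k z = q (inv_into X (unt G) z)" for z
  have k: "k (unt G x) = q x" if "x \<in> X" for x using that inj by (simp add: k_def)
  have b: "bis (unt G ` X)" by (auto simp: bis_def inj_on_def src_unt tgt_unt)
  have "local_fun (arr G) (unt G ` X) k" "push M (arr G) (unt G) (ext_by_zero M X q) = ext_by_zero (arr G) (unt G ` X) k"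
    using U.push_local[OF q inj, of k] k by auto
  then show thesis using that[of k] k b by (simp add: H_simps repI)
qed

text \<open>Multiplying by units does not move arrows, so the product set is \<open>V\<close> again
  and the base function is evaluated at the target. This makes the left module of the Hopf structure
  the geometric one.\<close>

lemma left_act:
  assumes r: "r \<in> carrier R" and u: "u \<in> carrier CA"
  shows "inc H r \<star> u = act T.XE r u"
proof -
  obtain q where q: "local_fun M X q" "r = ext_by_zero M X q" using r by (rule Cc_base_rep)
  obtain k where k: "rep (inc H r) (unt G ` X) k" "\<And>x. x \<in> X ==> k (unt G x) = q x" by (rule inc_rep[OF q(1), folded q(2)]) (rule that)
  show ?thesis
  proof (rule H_eqI[OF conv_linear(1)[OF repD(4)[OF k(1)]] T.act_linear[OF r] A.vspace_Cc u])
    fix a V f assume a: "rep a V f"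
    obtain k2 where k2: "rep (inc H r \<star> a) (prodset (unt G ` X) V) k2"
      "\<And>x y. x \<in> unt G ` X ==> y \<in> V ==> src G x = tgt G y ==> k2 (mlt G (x, y)) = k x * f y" by (rule conv_rep[OF k(1) a]) (rule that)
    have V: "V \<subseteq> arrows G" by (rule repD(5)[OF a])
    have m: "unt G (tgt G y) \<in> unt G ` X \<and> src G (unt G (tgt G y)) = tgt G y \<and> mlt G (unt G (tgt G y), y) = y" if "y \<in> V" for y
      using that V tgt_in src_unt unt_left by blast
    have set: "prodset (unt G ` X) V = V"
    proof (intro equalityI subsetI)
      fix z assume "z \<in> prodset (unt G ` X) V"
      then obtain x y where "x \<in> X" "y \<in> V" "src G (unt G x) = tgt G y" "z = mlt G (unt G x, y)" by auto
      then show "z \<in> V" using m[of y] src_unt[of x] by simp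
    next
      fix z assume z: "z \<in> V"
      show "z \<in> prodset (unt G ` X) V"
        by (rule image_eqI[of _ _ "(unt G (tgt G z), z)"]) (use m[OF z] z in simp_all)
    qed
    have "inc H r \<star> a = ext_by_zero (arr G) V k2" using repD(3)[OF k2(1)] set by simp
    also have "\<dots> = ext_by_zero (arr G) V (\<lambda>y. q (tgt G y) * f y)"
    proof (rule A.ext_cong[OF repD(6)[OF a]])
      fix y assume y: "y \<in> V"
      show "k2 y = q (tgt G y) * f y" using k2(2)[of "unt G (tgt G y)" y] m[OF y] y k(2)[OF tgt_in, of y] V by auto
    qed
    also have "\<dots> = act T.XE r a" unfolding q(2) repD(3)[OF a] T.act_ext_fun ..
    finally show "inc H r \<star> a = act T.XE r a" .
  qed
qed

lemma right_act:
  assumes r: "r \<in> carrier R" and u: "u \<in> carrier CA"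
  shows "u \<star> inc H r = act S.XE r u"
proof -
  obtain q where q: "local_fun M X q" "r = ext_by_zero M X q" using r by (rule Cc_base_rep)
  obtain k where k: "rep (inc H r) (unt G ` X) k" "\<And>x. x \<in> X ==> k (unt G x) = q x" by (rule inc_rep[OF q(1), folded q(2)]) (rule that)
  show ?thesis
  proof (rule H_eqI[OF conv_linear(2)[OF repD(4)[OF k(1)]] S.act_linear[OF r] A.vspace_Cc u])
    fix a V f assume a: "rep a V f"
    obtain k2 where k2: "rep (a \<star> inc H r) (prodset V (unt G ` X)) k2"
      "\<And>x y. x \<in> V ==> y \<in> unt G ` X ==> src G x = tgt G y ==> k2 (mlt G (x, y)) = f x * k y" by (rule conv_rep[OF a k(1)]) (rule that)
    have V: "V \<subseteq> arrows G" by (rule repD(5)[OF a])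
    have m: "unt G (src G y) \<in> unt G ` X \<and> tgt G (unt G (src G y)) = src G y \<and> mlt G (y, unt G (src G y)) = y" if "y \<in> V" for y
      using that V src_in tgt_unt unt_right by blast
    have set: "prodset V (unt G ` X) = V"
    proof (intro equalityI subsetI)
      fix z assume "z \<in> prodset V (unt G ` X)"
      then obtain x y where "x \<in> X" "y \<in> V" "src G y = tgt G (unt G x)" "z = mlt G (y, unt G x)" by auto
      then show "z \<in> V" using m[of y] tgt_unt[of x] by simp
    next
      fix z assume z: "z \<in> V"
      show "z \<in> prodset V (unt G ` X)"
        by (rule image_eqI[of _ _ "(z, unt G (src G z))"]) (use m[OF z] z in simp_all)
    qed
    have "a \<star> inc H r = ext_by_zero (arr G) V k2" using repD(3)[OF k2(1)] set by simp
    also have "\<dots> = ext_by_zero (arr G) V (\<lambda>y. q (src G y) * f y)"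
    proof (rule A.ext_cong[OF repD(6)[OF a]])
      fix y assume y: "y \<in> V"
      show "k2 y = q (src G y) * f y" using k2(2)[of y "unt G (src G y)"] m[OF y] y k(2)[OF src_in, of y] V by auto
    qed
    also have "\<dots> = act S.XE r a" unfolding q(2) repD(3)[OF a] S.act_ext_fun ..
    finally show "a \<star> inc H r = act S.XE r a" .
  qed
qed

lemma inc_linear_H: "inc H \<in> linear_maps R H"
  unfolding lin_H H_simps by (rule U.push_linear)

lemma inc_in_CA: "r \<in> carrier R ==> inc H r \<in> carrier CA"
  unfolding H_simps by (rule U.push_in)

lemma inc_mult_H:
  assumes r: "r \<in> carrier R" and r': "r' \<in> carrier R"
  shows "inc H (r \<otimes>\<^bsub>R\<^esub> r') = inc H r \<star> inc H r'"
proof -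
  obtain q where q: "local_fun M X q" "r = ext_by_zero M X q" using r by (rule Cc_base_rep)
  obtain q' where q': "local_fun M X q'" "r' = ext_by_zero M X q'" using r' by (rule Cc_base_rep)
  have rr: "r \<otimes>\<^bsub>R\<^esub> r' = ext_by_zero M X (\<lambda>x. q x * q' x)" unfolding q q' M.Cc_ops M.ext_mult ..
  obtain k where k: "rep (inc H r') (unt G ` X) k" "\<And>x. x \<in> X ==> k (unt G x) = q' x" by (rule inc_rep[OF q'(1), folded q'(2)]) (rule that)
  obtain k' where k': "rep (inc H (r \<otimes>\<^bsub>R\<^esub> r')) (unt G ` X) k'" "\<And>x. x \<in> X ==> k' (unt G x) = q x * q' x"
    by (rule inc_rep[OF local_fun_base_mult[OF q(1) q'(1)], folded rr]) (rule that)
  have "inc H r \<star> inc H r' = ext_by_zero (arr G) (unt G ` X) (\<lambda>y. q (tgt G y) * k y)"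
    unfolding left_act[OF r inc_in_CA[OF r']] unfolding q(2) repD(3)[OF k(1)] T.act_ext_fun ..
  also have "\<dots> = ext_by_zero (arr G) (unt G ` X) k'"
    by (rule A.ext_cong[OF repD(6)[OF k(1)]]) (auto simp: tgt_unt k(2) k'(2))
  finally show ?thesis using repD(3)[OF k'(1)] by simp
qed

sublocale AO: alg_over "Cc M :: ('f, ('m, 'f) germs) module" H
  by (rule alg_over.intro[OF comm_local_algebra_base assoc_algebra_H inc_linear_H inc_mult_H])

end

section \<open>The Hopf algebroid of an etale groupoid\<close>

text \<open>\<open>comult\<close> is given by \<open>inv_into\<close>, so its linearity rests on
  injectivity of \<open>f\<close> and on every \<open>g x\<close> actually being attained.\<close>

lemma inv_linear:
  assumes f: "f \<in> linear_maps A B" "inj_on f (carrier A)" and g: "g \<in> linear_maps C B"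
    and range: "\<And>x. x \<in> carrier C ==> g x \<in> f ` carrier A" and "vspace A" and "vspace C"
  shows "(\<lambda>x. inv_into (carrier A) f (g x)) \<in> linear_maps C A"
proof -
  interpret A: vspace A by fact
  interpret C: vspace C by fact
  let ?h = "\<lambda>x. inv_into (carrier A) f (g x)"
  have h: "?h x \<in> carrier A" "f (?h x) = g x" if "x \<in> carrier C" for x
    using inv_into_into[OF range[OF that]] f_inv_into_f[OF range[OF that]] by simp_all
  show ?thesis
  proof (rule linear_mapsI)
    fix x y and c
    assume x: "x \<in> carrier C"
    show "?h x \<in> carrier A" by (rule h(1)[OF x])
    show "?h (c \<odot>\<^bsub>C\<^esub> x) = c \<odot>\<^bsub>A\<^esub> ?h x"
    proof (rule inj_onD[OF f(2)])
      note cx = C.smult_in[OF x, of c]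
      show "f (?h (c \<odot>\<^bsub>C\<^esub> x)) = f (c \<odot>\<^bsub>A\<^esub> ?h x)"
        unfolding h(2)[OF cx] linear_mapsD(3)[OF f(1) h(1)[OF x]] h(2)[OF x] by (rule linear_mapsD(3)[OF g x])
    qed (rule h(1)[OF C.smult_in[OF x]], rule A.smult_in[OF h(1)[OF x]])
    assume y: "y \<in> carrier C"
    show "?h (x \<oplus>\<^bsub>C\<^esub> y) = ?h x \<oplus>\<^bsub>A\<^esub> ?h y"
    proof (rule inj_onD[OF f(2)])
      note xy = C.a_closed[OF x y]
      show "f (?h (x \<oplus>\<^bsub>C\<^esub> y)) = f (?h x \<oplus>\<^bsub>A\<^esub> ?h y)"
        unfolding h(2)[OF xy] linear_mapsD(2)[OF f(1) h(1)[OF x] h(1)[OF y]] h(2)[OF x] h(2)[OF y] by (rule linear_mapsD(2)[OF g x y])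
    qed (rule h(1)[OF C.a_closed[OF x y]], rule A.a_closed[OF h(1)[OF x] h(1)[OF y]])
  qed
qed

context alg_over
begin

sublocale SS: tensor_setup R "self_mod R" "self_mod R" by unfold_locales (rule r_module_self)+

lemma self_simps:
  "carrier (self_mod R) = carrier R" "add (self_mod R) = add R" "smult (self_mod R) = smult R" "act (self_mod R) = mult R"
  by (simp_all add: self_mod_def)

lemma lin_self: "linear_maps (self_mod R) N = linear_maps R N" "linear_maps N (self_mod R) = linear_maps N R"
  by (simp_all add: linear_maps_def self_simps)

lemma self_mult_lift:
  shows "tensor_lift R (mult R) \<in> linear_maps SS.T R"
    and "r \<in> carrier R ==> s \<in> carrier R ==> tensor_lift R (mult R) (SS.pt r s) = r \<otimes>\<^bsub>R\<^esub> s"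
proof -
  have b: "balanced R (self_mod R) (self_mod R) R (mult R)"
  proof (rule balancedI)
    show "mult R x \<in> linear_maps (self_mod R) R" if "x \<in> carrier (self_mod R)" for x
      using that R.mult_linear_right[of x] by (simp add: lin_self self_simps)
    show "(\<lambda>x. x \<otimes>\<^bsub>R\<^esub> y) \<in> linear_maps (self_mod R) R" if "y \<in> carrier (self_mod R)" for y
      using that R.mult_linear_left[of y] by (simp add: lin_self self_simps)
    fix r x y assume a: "r \<in> carrier R" "x \<in> carrier (self_mod R)" "y \<in> carrier (self_mod R)"
    then have c: "x \<in> carrier R" "y \<in> carrier R" by (simp_all add: self_simps)
    show "act (self_mod R) r x \<otimes>\<^bsub>R\<^esub> y = x \<otimes>\<^bsub>R\<^esub> act (self_mod R) r y"
      unfolding self_simps using R.mult_assoc[OF a(1) c] R.mult_assoc[OF c(1) a(1) c(2)] R.mult_comm[OF a(1) c(1)] by simp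
  qed
  show "tensor_lift R (mult R) \<in> linear_maps SS.T R" by (rule SS.lift_linear[OF VR.vspace_axioms b])
  show "r \<in> carrier R ==> s \<in> carrier R ==> tensor_lift R (mult R) (SS.pt r s) = r \<otimes>\<^bsub>R\<^esub> s"
    by (rule SS.lift_pure[OF VR.vspace_axioms b]) (simp_all add: self_simps)
qed

text \<open>Local identities replace the unit in the isomorphism of \<open>R\<close> with its tensor square.\<close>

lemma self_tensor_unit:
  assumes "t \<in> carrier SS.T"
  shows "\<exists>B. finite B \<and> B \<subseteq> carrier R \<and> (\<forall>e\<in>carrier R. (\<forall>b\<in>B. e \<otimes>\<^bsub>R\<^esub> b = b) \<longrightarrow> t = SS.pt (tensor_lift R (mult R) t) e)"
  using assms
proof (induction rule: SS.tensor_induct)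
  case (pure x y)
  then have x: "x \<in> carrier R" and y: "y \<in> carrier R" by (simp_all add: self_simps)
  have "SS.pt x y = SS.pt (x \<otimes>\<^bsub>R\<^esub> y) e" if e: "e \<in> carrier R" "e \<otimes>\<^bsub>R\<^esub> y = y" for e
    using balancedD(3)[OF SS.pure_balanced, of y x e] x y e R.mult_comm[of x y] R.mult_comm[of y e] by (simp add: self_simps)
  then show ?case unfolding self_mult_lift(2)[OF x y] by (intro exI[of _ "{y}"]) (simp add: y)
next
  case (add t t')
  obtain B where B: "finite B" "B \<subseteq> carrier R" "\<forall>e\<in>carrier R. (\<forall>b\<in>B. e \<otimes>\<^bsub>R\<^esub> b = b) \<longrightarrow> t = SS.pt (tensor_lift R (mult R) t) e"
    using add.IH(1) by (elim exE conjE)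
  obtain B' where B': "finite B'" "B' \<subseteq> carrier R" "\<forall>e\<in>carrier R. (\<forall>b\<in>B'. e \<otimes>\<^bsub>R\<^esub> b = b) \<longrightarrow> t' = SS.pt (tensor_lift R (mult R) t') e"
    using add.IH(2) by (elim exE conjE)
  have c: "tensor_lift R (mult R) t \<in> carrier R" "tensor_lift R (mult R) t' \<in> carrier R"
    by (rule linear_mapsD(1)[OF self_mult_lift(1)], fact)+
  have "t \<oplus>\<^bsub>SS.T\<^esub> t' = SS.pt (tensor_lift R (mult R) (t \<oplus>\<^bsub>SS.T\<^esub> t')) e"
    if e: "e \<in> carrier R" "\<forall>b\<in>B \<union> B'. e \<otimes>\<^bsub>R\<^esub> b = b" for e
  proof -
    have 1: "t = SS.pt (tensor_lift R (mult R) t) e" using B(3) e by simp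
    have 2: "t' = SS.pt (tensor_lift R (mult R) t') e" using B'(3) e by simp
    have "SS.pt (tensor_lift R (mult R) t \<oplus>\<^bsub>R\<^esub> tensor_lift R (mult R) t') e =
        SS.pt (tensor_lift R (mult R) t) e \<oplus>\<^bsub>SS.T\<^esub> SS.pt (tensor_lift R (mult R) t') e"
      using linear_mapsD(2)[OF SS.pure_linear1, of e] c e by (simp add: self_simps)
    then show ?thesis unfolding linear_mapsD(2)[OF self_mult_lift(1) add.hyps(1,2)] using 1 2 by simp
  qed
  then show ?case using B(1,2) B'(1,2) by (intro exI[of _ "B \<union> B'"]) simp
qed

text \<open>By \<open>self_tensor_unit\<close> a tensor is determined by its product, with a common
  local identity as second factor. So multiplication is injective, and the tensor of
  \<open>r\<close> with \<open>e\<close> is the preimage of \<open>r\<close>.\<close>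

lemma self_tensor_inv:
  assumes r: "r \<in> carrier R" and e: "e \<in> carrier R" "e \<otimes>\<^bsub>R\<^esub> r = r"
  shows "inv_into (carrier SS.T) (tensor_lift R (mult R)) r = SS.pt r e"
proof (rule inv_into_f_eq)
  show "SS.pt r e \<in> carrier SS.T" by (rule SS.pure_closed) (simp_all add: self_simps r e)
  show "tensor_lift R (mult R) (SS.pt r e) = r" using self_mult_lift(2)[OF r e(1)] R.mult_comm[OF r e(1)] e(2) by simp
  show "inj_on (tensor_lift R (mult R)) (carrier SS.T)"
  proof (rule inj_onI)
    fix t t' assume t: "t \<in> carrier SS.T" and t': "t' \<in> carrier SS.T" and eq: "tensor_lift R (mult R) t = tensor_lift R (mult R) t'"
    obtain B where B: "finite B" "B \<subseteq> carrier R" "\<forall>e\<in>carrier R. (\<forall>b\<in>B. e \<otimes>\<^bsub>R\<^esub> b = b) \<longrightarrow> t = SS.pt (tensor_lift R (mult R) t) e"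
      using self_tensor_unit[OF t] by (elim exE conjE)
    obtain B' where B': "finite B'" "B' \<subseteq> carrier R" "\<forall>e\<in>carrier R. (\<forall>b\<in>B'. e \<otimes>\<^bsub>R\<^esub> b = b) \<longrightarrow> t' = SS.pt (tensor_lift R (mult R) t') e"
      using self_tensor_unit[OF t'] by (elim exE conjE)
    obtain u where u: "u \<in> carrier R" "\<forall>b\<in>B \<union> B'. u \<otimes>\<^bsub>R\<^esub> b = b"
      using R.local_identities[OF finite_UnI[OF B(1) B'(1)] Un_least[OF B(2) B'(2)]] by (rule bexE)
    have "t = SS.pt (tensor_lift R (mult R) t) u" using B(3) u by simp
    also have "\<dots> = t'" using B'(3) u eq by simp
    finally show "t = t'" .
  qed
qed

lemma tensor_map_inc:
  assumes r: "r \<in> carrier R" and s: "s \<in> carrier R"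
  shows "tensor_map R L L (inc A) (inc A) (SS.pt r s) = LL.pt (inc A r) (inc A s)"
proof -
  interpret m: tensor_map_setup R "self_mod R" "self_mod R" L L "inc A" "inc A"
    by unfold_locales (simp_all add: lin_L lin_self inc_linear self_simps inc_mult)
  show ?thesis by (rule m.map_pure) (simp_all add: self_simps r s)
qed

end

context hgroupoid
begin

text \<open>The Hopf structure uses left multiplication by \<open>inc\<close>, whereas
  \<open>Omega\<close> uses the action through the target. By \<open>left_act\<close> the two agree
  on the carrier, which makes the tensor products equal and not just isomorphic.\<close>

lemma LL_eq:
  shows "AO.LL.pt = TT.TS.pt" "carrier AO.LL.T = carrier TT.TS.T" "add AO.LL.T = add TT.TS.T"
    "zero AO.LL.T = zero TT.TS.T" "smult AO.LL.T = smult TT.TS.T"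
proof -
  have a: "act AO.L r x = act T.XE r x" if "r \<in> carrier R" "x \<in> carrier T.XE" for r x
    using left_act[of r x] that by (simp only: AO.L_simps T.Cc_mod_simps)
  have b: "carrier AO.L = carrier T.XE" "add AO.L = add T.XE" "smult AO.L = smult T.XE"
    by (simp_all only: AO.L_simps T.Cc_mod_simps H_simps)
  note c = pure_tensor_cong[where R = R and X' = AO.L and Y' = AO.L and X = T.XE and Y = T.XE, OF b b a a]
  show "AO.LL.pt = TT.TS.pt" by (rule c(1))
  show "carrier AO.LL.T = carrier TT.TS.T" by (rule c(2))
  show "add AO.LL.T = add TT.TS.T" by (rule c(3))
  show "zero AO.LL.T = zero TT.TS.T" by (rule c(4))
  show "smult AO.LL.T = smult TT.TS.T" by (rule c(5))
qed

abbreviation "Om \<equiv> Omega (arr G) (tgt G) (arr G) (tgt G)"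

lemma comult_H:
  "comult H u = inv_into (carrier TT.TS.T) (Om) (push (arr G) TT.P (\<lambda>g. (g, g)) u)"
  by (simp add: convolution_hopf_def comp_tt_def)

lemma rep_zero: "rep \<zero>\<^bsub>sections (arr G)\<^esub> {} (\<lambda>_. 0)"
proof -
  have "ext_by_zero (arr G) {} (\<lambda>_. 0 :: 'f) = \<zero>\<^bsub>sections (arr G)\<^esub>" by (rule A.ext_zero) simp_all
  moreover have "local_fun (arr G) {} (\<lambda>_. 0 :: 'f)" by (rule A.local_fun_zero) (simp_all add: Hausdorff_space_def)
  ultimately show ?thesis by (simp add: rep_def bis_def)
qed

text \<open>As the target is injective on \<open>U\<close>, the fibre product of \<open>U\<close>
  with itself is the diagonal, and there the product of \<open>f\<close> and \<open>f'\<close> is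
  \<open>f\<close>.\<close>

lemma Omega_diag:
  assumes a: "rep a U f" and a': "rep a' U f'" and ff': "\<And>x. x \<in> U ==> f x * f' x = f x"
  shows "Om (TT.TS.pt a a') = push (arr G) TT.P (\<lambda>g. (g, g)) a"
proof -
  note A1 = repD[OF a] and B1 = repD[OF a']
  have set: "TT.boxset U U = (\<lambda>g. (g, g)) ` U"
    using A1(8) by (auto dest: inj_onD)
  have o: "openin (mtop TT.P) (TT.boxset U U)" by (rule local_fun_openin[OF TT.local_fun_box[OF A1(1) A1(1)]])
  have "Om (TT.TS.pt a a') = ext_by_zero TT.P (TT.boxset U U) (\<lambda>w. f (fst w) * f' (snd w))"
    unfolding TT.Omega_pure[OF A1(4) B1(4)] unfolding A1(3) B1(3) by (rule TT.box_ext)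
  also have "\<dots> = ext_by_zero TT.P (TT.boxset U U) (\<lambda>w. f (fst w))"
  proof (rule TT.P.ext_cong[OF o])
    fix w assume "w \<in> TT.boxset U U"
    then obtain g where w: "w = (g, g)" "g \<in> U" unfolding set by (rule imageE)
    show "f (fst w) * f' (snd w) = f (fst w)" unfolding w(1) fst_conv snd_conv by (rule ff'[OF w(2)])
  qed
  also have "\<dots> = push (arr G) TT.P (\<lambda>g. (g, g)) a"
    unfolding set A1(3) by (rule D.push_local(2)[OF A1(1), symmetric]) (simp_all add: inj_on_def)
  finally show ?thesis .
qed

lemma pt_in: "rep a U f ==> rep b V g ==> TT.TS.pt a b \<in> carrier TT.TS.T"
  by (rule TT.TS.pure_closed) (simp_all only: T.Cc_mod_simps repD(4))

text \<open>Without this the value of \<open>inv_into\<close> in \<open>comult\<close> would be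
  arbitrary. Attained values are closed under sums and include the pushed diagonals of all functions
  supported in bisections.\<close>

lemma diag_range:
  assumes u: "u \<in> carrier CA"
  shows "push (arr G) TT.P (\<lambda>g. (g, g)) u \<in> Om ` carrier TT.TS.T"
proof (rule A.Cc_induct[where Q = bis and P = "\<lambda>u. push (arr G) TT.P (\<lambda>g. (g, g)) u \<in> Om ` carrier TT.TS.T", OF u])
  have 1: "push (arr G) TT.P (\<lambda>g. (g, g)) a \<in> Om ` carrier TT.TS.T" if a: "rep a U f" for a U f
  proof -
    obtain a' f' where a': "rep a' U f'" "\<And>x. x \<in> U ==> f x * f' x = f x" by (rule rep_unit[OF a]) (rule that)
    have d: "Om (TT.TS.pt a a') = push (arr G) TT.P (\<lambda>g. (g, g)) a"
      by (rule Omega_diag[OF a a'(1)]) (rule a'(2))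
    show ?thesis unfolding d[symmetric] by (rule imageI[OF pt_in[OF a a'(1)]])
  qed
  show "push (arr G) TT.P (\<lambda>g. (g, g)) (\<zero>\<^bsub>sections (arr G)\<^esub> :: ('g, 'f) germs) \<in> Om ` carrier TT.TS.T"
    by (rule 1[OF rep_zero])
  show "push (arr G) TT.P (\<lambda>g. (g, g)) (ext_by_zero (arr G) U f) \<in> Om ` carrier TT.TS.T"
    if "local_fun (arr G) U f" "bis U" for U and f :: "'g => 'f" by (rule 1[OF repI[OF that]])
  fix u v :: "('g, 'f) germs" assume u: "u \<in> carrier CA" and v: "v \<in> carrier CA"
  assume "push (arr G) TT.P (\<lambda>g. (g, g)) u \<in> Om ` carrier TT.TS.T"
  then obtain s where s: "push (arr G) TT.P (\<lambda>g. (g, g)) u = Om s" "s \<in> carrier TT.TS.T" by (rule imageE)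
  assume "push (arr G) TT.P (\<lambda>g. (g, g)) v \<in> Om ` carrier TT.TS.T"
  then obtain t where t: "push (arr G) TT.P (\<lambda>g. (g, g)) v = Om t" "t \<in> carrier TT.TS.T" by (rule imageE)
  have "push (arr G) TT.P (\<lambda>g. (g, g)) (u \<oplus>\<^bsub>CA\<^esub> v) = Om (s \<oplus>\<^bsub>TT.TS.T\<^esub> t)"
    unfolding linear_mapsD(2)[OF D.push_linear u v] linear_mapsD(2)[OF TT.Omega_linear s(2) t(2)] s(1) t(1) ..
  then have "push (arr G) TT.P (\<lambda>g. (g, g)) (u \<oplus>\<^bsub>CA\<^esub> v) \<in> Om ` carrier TT.TS.T"
    by (rule image_eqI) (rule TT.TS.T.a_closed[OF s(2) t(2)])
  then show "push (arr G) TT.P (\<lambda>g. (g, g)) (u \<oplus>\<^bsub>sections (arr G)\<^esub> v) \<in> Om ` carrier TT.TS.T"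
    unfolding A.Cc_ops .
qed (erule bis_basis)

lemma lin_TT: "linear_maps N AO.LL.T = linear_maps N TT.TS.T"
  by (rule linear_maps_cong) (simp_all only: LL_eq)

lemma comult_linear: "comult H \<in> linear_maps CA AO.LL.T"
  unfolding lin_TT comult_H[abs_def]
  by (rule inv_linear[OF TT.Omega_linear TT.Omega_inj D.push_linear diag_range TT.TS.vspace_T A.vspace_Cc])

text \<open>The companion \<open>a'\<close> is not fixed: every \<open>f'\<close> with
  \<open>f f' = f\<close> gives the same tensor, and the verification of the axioms exploits this
  freedom.\<close>

lemma comult_rep:
  assumes a: "rep a U f" and a': "rep a' U f'" and ff': "\<And>x. x \<in> U ==> f x * f' x = f x"
  shows "comult H a = AO.LL.pt a a'"
proof -
  have d: "Om (TT.TS.pt a a') = push (arr G) TT.P (\<lambda>g. (g, g)) a"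
    by (rule Omega_diag[OF a a']) (rule ff')
  show ?thesis unfolding comult_H LL_eq(1) d[symmetric] by (rule inv_into_f_f[OF TT.Omega_inj pt_in[OF a a']])
qed

lemma counit_linear: "counit H \<in> linear_maps CA R" and antipode_linear: "antipode H \<in> linear_maps CA CA"
  unfolding H_simps by (rule T.push_linear) (rule I.push_linear)

lemma inc_linear_CA: "inc H \<in> linear_maps R CA"
  unfolding H_simps by (rule U.push_linear)

lemma counit_repE:
  assumes a: "rep a U f"
  obtains q where "local_fun M X q" "counit H a = ext_by_zero M X q" "\<And>y. y \<in> U ==> q (tgt G y) = f y"
    "\<And>x. x \<notin> tgt G ` U ==> q x = 0"
proof -
  note A1 = repD[OF a]
  note l = T.push_local_inv[OF A1(1,8)]
  show thesis
    by (rule that[OF base_extend(1)[OF l(1)]]) (simp_all add: H_simps A1(3) l(2) base_extend(2)[OF l(1)] A1(8))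
qed

lemma left_rep:
  assumes r: "r = ext_by_zero M X q" "local_fun M X q" and a: "rep a U f"
  shows "rep (inc H r \<star> a) U (\<lambda>y. q (tgt G y) * f y)"
proof -
  note A1 = repD[OF a]
  have "r \<in> carrier R" unfolding r(1) by (rule M.ext_in_Cc[OF r(2)])
  from left_act[OF this A1(4)] have "inc H r \<star> a = ext_by_zero (arr G) U (\<lambda>y. q (tgt G y) * f y)"
    unfolding r(1) A1(3) T.act_ext_fun .
  then show ?thesis using T.local_fun_act[OF r(2) A1(1)] A1(2) by (simp only: rep_def simp_thms)
qed

lemma right_rep:
  assumes r: "r = ext_by_zero M X q" "local_fun M X q" and a: "rep a U f"
  shows "rep (a \<star> inc H r) U (\<lambda>y. q (src G y) * f y)"
proof -
  note A1 = repD[OF a]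
  have "r \<in> carrier R" unfolding r(1) by (rule M.ext_in_Cc[OF r(2)])
  from right_act[OF this A1(4)] have "a \<star> inc H r = ext_by_zero (arr G) U (\<lambda>y. q (src G y) * f y)"
    unfolding r(1) A1(3) S.act_ext_fun .
  then show ?thesis using S.local_fun_act[OF r(2) A1(1)] A1(2) by (simp only: rep_def simp_thms)
qed

text \<open>The counit carries \<open>f\<close> to the base along the target, and the left action
  evaluates it at the target again, so on \<open>U\<close> the effect is multiplication by
  \<open>f\<close>.\<close>

lemma counit_act_rep:
  assumes a: "rep a U f" and b: "rep b U g"
  shows "rep (inc H (counit H a) \<star> b) U (\<lambda>y. f y * g y)"
proof -
  obtain q where q: "local_fun M X q" "counit H a = ext_by_zero M X q" "\<And>y. y \<in> U ==> q (tgt G y) = f y"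
    by (rule counit_repE[OF a]) (rule that)
  have l: "rep (inc H (counit H a) \<star> b) U (\<lambda>y. q (tgt G y) * g y)" by (rule left_rep[OF q(2,1) b])
  have c: "local_fun (arr G) U (\<lambda>y. f y * g y)" by (rule A.local_fun_cong[OF repD(1)[OF l]]) (simp only: q(3))
  have "inc H (counit H a) \<star> b = ext_by_zero (arr G) U (\<lambda>y. f y * g y)"
    by (rule rep_eqI[OF l repI[OF c repD(2)[OF l]]]) (simp_all only: q(3))
  then show ?thesis using c repD(2)[OF l] by (simp only: rep_def simp_thms)
qed

lemma rep_comult:
  assumes a: "rep a U f"
  obtains a' f' where "rep a' U f'" "\<And>x. x \<in> U ==> f x * f' x = f x" "comult H a = AO.LL.pt a a'"
proof -
  obtain a' f' where a': "rep a' U f'" "\<And>x. x \<in> U ==> f x * f' x = f x" by (rule rep_unit[OF a]) (rule that)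
  have c: "comult H a = AO.LL.pt a a'" by (rule comult_rep[OF a a'(1)]) (rule a'(2))
  show thesis by (rule that[OF a'(1) _ c]) (rule a'(2))
qed

lemma repH: "rep a U f ==> a \<in> carrier H"
  unfolding H_simps by (rule repD(4))

lemma comult_in: "a \<in> carrier CA ==> comult H a \<in> carrier AO.LL.T"
  by (rule linear_mapsD(1)[OF comult_linear])

lemma counit_in: "a \<in> carrier CA ==> counit H a \<in> carrier R"
  by (rule linear_mapsD(1)[OF counit_linear])

lemma antipode_in: "a \<in> carrier CA ==> antipode H a \<in> carrier CA"
  by (rule linear_mapsD(1)[OF antipode_linear])

section \<open>Axioms for the counit, the local identities and the comultiplication\<close>

lemma counit_inc: assumes r: "r \<in> carrier R" shows "counit H (inc H r) = r"
proof -
  interpret i: hmap M M "TYPE('f)" "\<lambda>x. x" by (rule hmap_id)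
  have "counit H (inc H r) = push M M (\<lambda>x. tgt G (unt G x)) r"
    unfolding H_simps by (rule push_compose[OF objects arrows objects U.et T.et r])
  also have "\<dots> = push M M (\<lambda>x. x) r" by (rule arg_cong[where f = "\<lambda>h. h r"], rule i.push_cong) (simp only: tgt_unt)
  also have "\<dots> = r" by (rule push_id[OF objects r])
  finally show ?thesis .
qed

lemma counit_left_linear:
  assumes r: "r \<in> carrier R" and a: "a \<in> carrier CA"
  shows "counit H (inc H r \<star> a) = r \<otimes>\<^bsub>R\<^esub> counit H a"
proof (rule H_eqI[OF linear_maps_compose[OF conv_linear(1)[OF inc_in_CA[OF r]] counit_linear]
      linear_maps_compose[OF counit_linear AO.R.mult_linear_right[OF r]] M.vspace_Cc a])
  fix a U f assume a: "rep a U f"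
  obtain q where q: "local_fun M X q" "r = ext_by_zero M X q" using r by (rule Cc_base_rep)
  obtain p where p: "counit H a = ext_by_zero M X p" "\<And>y. y \<in> U ==> p (tgt G y) = f y" "\<And>x. x \<notin> tgt G ` U ==> p x = 0"
    by (rule counit_repE[OF a]) (rule that)
  obtain p' where p': "counit H (inc H r \<star> a) = ext_by_zero M X p'" "\<And>y. y \<in> U ==> p' (tgt G y) = q (tgt G y) * f y"
    "\<And>x. x \<notin> tgt G ` U ==> p' x = 0"
    by (rule counit_repE[OF left_rep[OF q(2,1) a]]) (rule that)
  have "p' x = q x * p x" for x
  proof (cases "x \<in> tgt G ` U")
    case True
    then obtain y where "x = tgt G y" "y \<in> U" by (rule imageE)
    then show ?thesis by (simp only: p(2) p'(2))
  qed (simp add: p(3) p'(3))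
  then have pe: "p' = (\<lambda>x. q x * p x)" by (rule ext)
  have e: "r \<otimes>\<^bsub>R\<^esub> counit H a = ext_by_zero M X (\<lambda>x. q x * p x)" unfolding p(1) q(2) M.Cc_ops M.ext_mult ..
  show "counit H (inc H r \<star> a) = r \<otimes>\<^bsub>R\<^esub> counit H a" unfolding p'(1) e pe ..
qed

lemma local_identities_H:
  assumes B: "finite B" "B \<subseteq> carrier CA"
  shows "\<exists>r\<in>carrier R. \<forall>a\<in>B. inc H r \<star> a = a \<and> a \<star> inc H r = a"
proof -
  obtain K where K: "compactin (mtop M) K"
    "\<forall>q. local_fun M X q \<longrightarrow> (\<forall>x\<in>K. q x = 1) \<longrightarrow> (\<forall>u\<in>B. act T.XE (ext_by_zero M X q) u = u)"
    using T.act_unit_support_finite[OF B] by (elim exE conjE)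
  obtain L where L: "compactin (mtop M) L"
    "\<forall>q. local_fun M X q \<longrightarrow> (\<forall>x\<in>L. q x = 1) \<longrightarrow> (\<forall>u\<in>B. act S.XE (ext_by_zero M X q) u = u)"
    using S.act_unit_support_finite[OF B] by (elim exE conjE)
  obtain q :: "'m => 'f" where q: "local_fun M X q" "\<And>x. x \<in> K \<union> L ==> q x = 1"
    by (rule base_unit_fun[OF compactin_Un[OF K(1) L(1)]]) (rule that)
  have r: "ext_by_zero M X q \<in> carrier R" by (rule M.ext_in_Cc[OF q(1)])
  show ?thesis
  proof (rule bexI[OF _ r], rule ballI)
    fix a assume a: "a \<in> B"
    then have c: "a \<in> carrier CA" using B(2) by (rule rev_subsetD)
    show "inc H (ext_by_zero M X q) \<star> a = a \<and> a \<star> inc H (ext_by_zero M X q) = a"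
      unfolding left_act[OF r c] right_act[OF r c] using K(2) L(2) q a by simp
  qed
qed

lemma comult_left:
  assumes r: "r \<in> carrier R" and a: "a \<in> carrier CA"
  shows "comult H (inc H r \<star> a) = act AO.LL.T r (comult H a)"
proof (rule H_eqI[OF linear_maps_compose[OF conv_linear(1)[OF inc_in_CA[OF r]] comult_linear]
      linear_maps_compose[OF comult_linear AO.LL.act_T_linear[OF r]] AO.LL.vspace_T a])
  fix a U f assume a: "rep a U f"
  obtain q where q: "local_fun M X q" "r = ext_by_zero M X q" using r by (rule Cc_base_rep)
  obtain a' f' where a': "rep a' U f'" "\<And>x. x \<in> U ==> f x * f' x = f x" "comult H a = AO.LL.pt a a'"
    by (rule rep_comult[OF a]) (rule that)
  have "comult H (inc H r \<star> a) = AO.LL.pt (inc H r \<star> a) a'"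
    by (rule comult_rep[OF left_rep[OF q(2,1) a] a'(1)]) (simp only: mult.assoc a'(2))
  also have "\<dots> = act AO.LL.T r (comult H a)"
    unfolding a'(3) by (rule AO.act_pt[OF r repH[OF a] repH[OF a'(1)], symmetric])
  finally show "comult H (inc H r \<star> a) = act AO.LL.T r (comult H a)" .
qed

lemma counit_act_linear:
  shows "a \<in> carrier CA ==> (\<lambda>b. inc H (counit H a) \<star> b) \<in> linear_maps CA CA"
    and "b \<in> carrier CA ==> (\<lambda>a. inc H (counit H a) \<star> b) \<in> linear_maps CA CA"
  using conv_linear(1)[OF inc_in_CA[OF counit_in]]
    linear_maps_compose[OF counit_linear linear_maps_compose[OF inc_linear_CA conv_linear(2)]] by blast+

lemma counit_act_balanced:
  assumes r: "r \<in> carrier R" and x: "x \<in> carrier CA" and y: "y \<in> carrier CA"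
  shows "inc H (counit H (inc H r \<star> x)) \<star> y = inc H (counit H x) \<star> (inc H r \<star> y)"
  unfolding counit_left_linear[OF r x] inc_mult_H[OF r counit_in[OF x]] conv_assoc[OF inc_in_CA[OF r] inc_in_CA[OF counit_in[OF x]] y]
  by (rule AO.act_L_mult[OF r counit_in[OF x]]) (simp only: H_simps y)

lemma rep_fix:
  assumes a: "rep a U f" and b: "rep b U g" and e: "\<And>y. y \<in> U ==> g y = f y"
  shows "b = a"
  by (rule rep_eqI[OF b a refl]) (rule e)

text \<open>On the tensor of \<open>a\<close> and \<open>a'\<close>, the counit of one factor
  multiplies the other by the corresponding function, and \<open>f f' = f\<close>.\<close>

lemma counit_right:
  assumes a: "a \<in> carrier CA"
  shows "tensor_lift H (\<lambda>b c. inc H (counit H c) \<star> b) (comult H a) = a"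
proof -
  have b: "balanced R AO.L AO.L H (\<lambda>b c. inc H (counit H c) \<star> b)"
    by (rule AO.balanced_LL_I) (simp_all only: lin_H H_simps(1) counit_act_linear counit_act_balanced)
  note l = AO.lift_LL[OF vspace_H b]
  have c: "(\<lambda>a. tensor_lift H (\<lambda>b c. inc H (counit H c) \<star> b) (comult H a)) \<in> linear_maps CA CA"
    using linear_maps_compose[OF comult_linear l(1)] unfolding lin_H .
  show ?thesis
  proof (rule H_eqI[OF c linear_maps_id A.vspace_Cc a])
    fix a U f assume a: "rep a U f"
    obtain a' f' where a': "rep a' U f'" "\<And>x. x \<in> U ==> f x * f' x = f x" "comult H a = AO.LL.pt a a'"
      by (rule rep_comult[OF a]) (rule that)
    show "tensor_lift H (\<lambda>b c. inc H (counit H c) \<star> b) (comult H a) = a"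
      unfolding a'(3) l(2)[OF repH[OF a] repH[OF a'(1)]]
      by (rule rep_fix[OF a counit_act_rep[OF a'(1) a]]) (simp only: a'(2) mult.commute[of "f' _"])
  qed
qed

lemma counit_left:
  assumes a: "a \<in> carrier CA"
  shows "tensor_lift H (\<lambda>b c. inc H (counit H b) \<star> c) (comult H a) = a"
proof -
  have b: "balanced R AO.L AO.L H (\<lambda>b c. inc H (counit H b) \<star> c)"
    by (rule AO.balanced_LL_I) (simp_all only: lin_H H_simps(1) counit_act_linear counit_act_balanced)
  note l = AO.lift_LL[OF vspace_H b]
  have c: "(\<lambda>a. tensor_lift H (\<lambda>b c. inc H (counit H b) \<star> c) (comult H a)) \<in> linear_maps CA CA"
    using linear_maps_compose[OF comult_linear l(1)] unfolding lin_H .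
  show ?thesis
  proof (rule H_eqI[OF c linear_maps_id A.vspace_Cc a])
    fix a U f assume a: "rep a U f"
    obtain a' f' where a': "rep a' U f'" "\<And>x. x \<in> U ==> f x * f' x = f x" "comult H a = AO.LL.pt a a'"
      by (rule rep_comult[OF a]) (rule that)
    show "tensor_lift H (\<lambda>b c. inc H (counit H b) \<star> c) (comult H a) = a"
      unfolding a'(3) l(2)[OF repH[OF a] repH[OF a'(1)]]
      by (rule rep_fix[OF a counit_act_rep[OF a a'(1)]]) (simp only: a'(2))
  qed
qed

text \<open>\<open>inc H r\<close> is supported on the units, which form a bisection. An
  \<open>e\<close> with \<open>e r = r\<close> serves both as local identity in the base and, after
  inclusion, as companion in the comultiplication.\<close>

lemma comult_inc:
  assumes r: "r \<in> carrier R"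
  shows "comult H (inc H r) = tensor_map R AO.L AO.L (inc H) (inc H) (inv_into (carrier AO.SS.T) (tensor_lift R (mult R)) r)"
proof -
  obtain q where q: "local_fun M X q" "r = ext_by_zero M X q" using r by (rule Cc_base_rep)
  obtain c :: "'m => 'f" where c: "local_fun M X c" "\<And>x. x \<in> X ==> q x * c x = q x" by (rule M.local_unit[OF q(1)]) (rule that)
  define e where "e = ext_by_zero M X c"
  have e: "e \<in> carrier R" unfolding e_def by (rule M.ext_in_Cc[OF c(1)])
  have er: "e \<otimes>\<^bsub>R\<^esub> r = r"
    unfolding e_def q(2) M.Cc_ops M.ext_mult by (rule M.ext_cong[OF openin_topspace]) (simp only: c(2) mult.commute[of "c _"])
  obtain k where k: "rep (inc H r) (unt G ` X) k" "\<And>x. x \<in> X ==> k (unt G x) = q x" by (rule inc_rep[OF q(1), folded q(2)]) (rule that)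
  obtain k' where k': "rep (inc H e) (unt G ` X) k'" "\<And>x. x \<in> X ==> k' (unt G x) = c x" by (rule inc_rep[OF c(1), folded e_def]) (rule that)
  have "comult H (inc H r) = AO.LL.pt (inc H r) (inc H e)"
  proof (rule comult_rep[OF k(1) k'(1)])
    fix y assume "y \<in> unt G ` X"
    then obtain x where "y = unt G x" "x \<in> X" by (rule imageE)
    then show "k y * k' y = k y" by (simp only: k(2) k'(2) c(2))
  qed
  then show ?thesis unfolding AO.self_tensor_inv[OF r e er] AO.tensor_map_inc[OF r e] .
qed

text \<open>On a bisection a function of the source is also a function of the target. Hence right
  multiplication by \<open>r\<close> agrees there with left multiplication by a base element
  \<open>d\<close>, and left multiplication passes through the tensor sign.\<close>

lemma right_acts:
  assumes r: "r \<in> carrier R" and a: "a \<in> carrier CA"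
  shows "right_act1 R H r (comult H a) = right_act2 R H r (comult H a)"
proof (rule H_eqI[OF linear_maps_compose[OF comult_linear AO.right_act(1)[OF r]]
      linear_maps_compose[OF comult_linear AO.right_act(3)[OF r]] AO.LL.vspace_T a])
  fix a U f assume a: "rep a U f"
  obtain q where q: "local_fun M X q" "r = ext_by_zero M X q" using r by (rule Cc_base_rep)
  obtain a' f' where a': "rep a' U f'" "\<And>x. x \<in> U ==> f x * f' x = f x" "comult H a = AO.LL.pt a a'"
    by (rule rep_comult[OF a]) (rule that)
  obtain b g where b: "rep b U g" "\<And>x. x \<in> U ==> f' x * g x = f' x" by (rule rep_unit[OF a'(1)]) (rule that)
  have fg: "f x * g x = f x" if "x \<in> U" for x
    using a'(2)[OF that] b(2)[OF that] by (metis mult.assoc)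
  \<comment> \<open>At the target of \<open>y\<close> this takes the value of \<open>r\<close> at
    the source of \<open>y\<close>, times \<open>g y\<close>; the factor \<open>g\<close> is
    absorbed by both \<open>f\<close> and \<open>f'\<close>.\<close>
  define d where "d = counit H (b \<star> inc H r)"
  note bi = right_rep[OF q(2,1) b(1)]
  have d: "d \<in> carrier R" unfolding d_def by (rule counit_in[OF repD(4)[OF bi]])
  have eq: "inc H d \<star> c = c \<star> inc H r" if c: "rep c U h" and h: "\<And>x. x \<in> U ==> h x * g x = h x" for c h
    unfolding d_def by (rule rep_fix[OF right_rep[OF q(2,1) c] counit_act_rep[OF bi c]]) (simp only: mult.assoc mult.commute[of "g _"] h)
  have e1: "inc H d \<star> a = a \<star> inc H r" by (rule eq[OF a]) (rule fg)
  have e2: "inc H d \<star> a' = a' \<star> inc H r" by (rule eq[OF a'(1)]) (rule b(2))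
  have "right_act1 R H r (comult H a) = AO.LL.pt (inc H d \<star> a) a'"
    unfolding a'(3) AO.right_act(2)[OF r repH[OF a] repH[OF a'(1)]] e1 ..
  also have "\<dots> = AO.LL.pt a (inc H d \<star> a')" by (rule AO.pt_balanced[OF d repH[OF a] repH[OF a'(1)]])
  also have "\<dots> = right_act2 R H r (comult H a)"
    unfolding a'(3) AO.right_act(4)[OF r repH[OF a] repH[OF a'(1)]] e2 ..
  finally show "right_act1 R H r (comult H a) = right_act2 R H r (comult H a)" .
qed

lemma comult_takeuchi: "a \<in> carrier CA ==> comult H a \<in> AO.takeuchi"
  unfolding AO.takeuchi_def by (simp add: comult_in right_acts del: M.Cc_ops)

text \<open>The convolution of the two companions is a companion of the convolution, so on
  bisections both sides are the same pure tensor.\<close>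

lemma comult_mult:
  assumes a: "a \<in> carrier CA" and b: "b \<in> carrier CA"
  shows "comult H (a \<star> b) = tensor_mult R H (comult H a) (comult H b)"
proof -
  have 1: "comult H (a \<star> b) = tensor_mult R H (comult H a) (comult H b)" if a: "rep a U f" and b: "rep b V g" for a U f b V g
  proof -
    obtain a' f' where a': "rep a' U f'" "\<And>x. x \<in> U ==> f x * f' x = f x" "comult H a = AO.LL.pt a a'"
      by (rule rep_comult[OF a]) (rule that)
    obtain b' g' where b': "rep b' V g'" "\<And>x. x \<in> V ==> g x * g' x = g x" "comult H b = AO.LL.pt b b'"
      by (rule rep_comult[OF b]) (rule that)
    obtain k where k: "rep (a \<star> b) (prodset U V) k"
      "\<And>x y. x \<in> U ==> y \<in> V ==> src G x = tgt G y ==> k (mlt G (x, y)) = f x * g y" by (rule conv_rep[OF a b]) (rule that)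
    obtain k' where k': "rep (a' \<star> b') (prodset U V) k'"
      "\<And>x y. x \<in> U ==> y \<in> V ==> src G x = tgt G y ==> k' (mlt G (x, y)) = f' x * g' y" by (rule conv_rep[OF a'(1) b'(1)]) (rule that)
    note c = repH[OF a] repH[OF b] repH[OF a'(1)] repH[OF b'(1)]
    have "comult H (a \<star> b) = AO.LL.pt (a \<star> b) (a' \<star> b')"
    proof (rule comult_rep[OF k(1) k'(1)])
      fix z assume "z \<in> prodset U V"
      then obtain x y where z: "x \<in> U" "y \<in> V" "src G x = tgt G y" "z = mlt G (x, y)" by (rule prodsetE)
      have "f x * g y * (f' x * g' y) = (f x * f' x) * (g y * g' y)" by (simp only: mult_ac)
      then show "k z * k' z = k z" unfolding z(4) k(2)[OF z(1-3)] k'(2)[OF z(1-3)] a'(2)[OF z(1)] b'(2)[OF z(2)] .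
    qed
    also have "\<dots> = AO.inner_mult b b' (comult H a)" unfolding a'(3) by (rule AO.inner_mult(2)[OF c(2,4,1,3), symmetric])
    also have "\<dots> = tensor_mult R H (comult H a) (comult H b)"
      unfolding b'(3) by (rule AO.tensor_mult_linear_pure(2)[OF comult_takeuchi[OF repD(4)[OF a]] c(2,4), symmetric])
    finally show ?thesis .
  qed
  have 2: "comult H (a \<star> b) = tensor_mult R H (comult H a) (comult H b)" if a: "rep a U f" for a U f
    by (rule H_eqI[OF linear_maps_compose[OF conv_linear(1)[OF repD(4)[OF a]] comult_linear]
        linear_maps_compose[OF comult_linear AO.tensor_mult_linear_pure(1)[OF comult_takeuchi[OF repD(4)[OF a]]]] AO.LL.vspace_T b]) (rule 1[OF a])
  show ?thesis
  \<comment> \<open>In \<open>a\<close> the right-hand side is additive through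
    \<open>tensor_mult_add\<close>, for tensors in \<open>takeuchi\<close>; a direct induction uses
    this in place of \<open>H_eqI\<close>, which asks for linear maps.\<close>
  proof (rule A.Cc_induct[where Q = bis and P = "\<lambda>a. comult H (a \<star> b) = tensor_mult R H (comult H a) (comult H b)", OF a])
    show "comult H (\<zero>\<^bsub>sections (arr G)\<^esub> \<star> b) = tensor_mult R H (comult H \<zero>\<^bsub>sections (arr G)\<^esub>) (comult H b)" by (rule 2[OF rep_zero])
    show "comult H (ext_by_zero (arr G) U f \<star> b) = tensor_mult R H (comult H (ext_by_zero (arr G) U f)) (comult H b)"
      if "local_fun (arr G) U f" "bis U" for U and f :: "'g => 'f" by (rule 2[OF repI[OF that]])
    fix u v :: "('g, 'f) germs" assume u: "u \<in> carrier CA" and v: "v \<in> carrier CA"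
      and iu: "comult H (u \<star> b) = tensor_mult R H (comult H u) (comult H b)"
      and iv: "comult H (v \<star> b) = tensor_mult R H (comult H v) (comult H b)"
    have "comult H ((u \<oplus>\<^bsub>CA\<^esub> v) \<star> b) = tensor_mult R H (comult H (u \<oplus>\<^bsub>CA\<^esub> v)) (comult H b)"
      unfolding linear_mapsD(2)[OF conv_linear(2)[OF b] u v] linear_mapsD(2)[OF comult_linear conv_in[OF u b] conv_in[OF v b]]
        linear_mapsD(2)[OF comult_linear u v] AO.tensor_mult_add[OF comult_takeuchi[OF u] comult_takeuchi[OF v] comult_in[OF b]] iu iv ..
    then show "comult H ((u \<oplus>\<^bsub>sections (arr G)\<^esub> v) \<star> b) = tensor_mult R H (comult H (u \<oplus>\<^bsub>sections (arr G)\<^esub> v)) (comult H b)"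
      unfolding A.Cc_ops .
  qed (erule bis_basis)
qed

section \<open>Axioms for the antipode\<close>

lemma antipode_rep:
  assumes a: "rep a U f"
  obtains k where "rep (antipode H a) (ivt G ` U) k" "\<And>y. y \<in> U ==> k (ivt G y) = f y"
proof -
  note A1 = repD[OF a]
  have inj: "inj_on (ivt G) U"
    by (rule inj_on_inverseI[where g = "ivt G"], rule ivt_ivt, rule subsetD[OF A1(5)])
  define k where "k z = f (inv_into U (ivt G) z)" for z
  have k: "k (ivt G y) = f y" if "y \<in> U" for y unfolding k_def inv_into_f_f[OF inj that] ..
  have b: "bis (ivt G ` U)"
    unfolding bis_def
  proof (intro conjI inj_on_imageI)
    have "inj_on (tgt G) U = inj_on (src G \<circ> ivt G) U" by (rule inj_on_cong) (simp add: src_ivt subsetD[OF A1(5)])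
    then show "inj_on (src G \<circ> ivt G) U" using A1(8) by simp
    have "inj_on (src G) U = inj_on (tgt G \<circ> ivt G) U" by (rule inj_on_cong) (simp add: tgt_ivt subsetD[OF A1(5)])
    then show "inj_on (tgt G \<circ> ivt G) U" using A1(7) by simp
  qed
  have l: "local_fun (arr G) (ivt G ` U) k" "push (arr G) (arr G) (ivt G) (ext_by_zero (arr G) U f) = ext_by_zero (arr G) (ivt G ` U) k"
    by (rule I.push_local[OF A1(1) inj], erule k)+
  then have "rep (antipode H a) (ivt G ` U) k" using b by (simp only: rep_def H_simps A1(3) simp_thms)
  then show thesis by (rule that) (rule k)
qed

lemma antipode_inc: assumes r: "r \<in> carrier R" shows "antipode H (inc H r) = inc H r"
proof -
  have "antipode H (inc H r) = push M (arr G) (\<lambda>x. ivt G (unt G x)) r"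
    unfolding H_simps by (rule push_compose[OF objects arrows arrows U.et I.et r])
  also have "\<dots> = push M (arr G) (unt G) r"
    by (rule arg_cong[where f = "\<lambda>h. h r"], rule U.push_cong) (simp only: ivt_unt)
  finally show ?thesis unfolding H_simps .
qed

lemma antipode_antipode: assumes a: "a \<in> carrier CA" shows "antipode H (antipode H a) = a"
proof -
  interpret i: etmap "arr G" "arr G" "TYPE('f)" "\<lambda>x. x" by unfold_locales (rule etale_id)
  have "antipode H (antipode H a) = push (arr G) (arr G) (\<lambda>x. ivt G (ivt G x)) a"
    unfolding H_simps by (rule push_compose[OF arrows arrows arrows I.et I.et a])
  also have "\<dots> = push (arr G) (arr G) (\<lambda>x. x) a"
    by (rule arg_cong[where f = "\<lambda>h. h a"], rule i.push_cong) (simp only: ivt_ivt)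
  also have "\<dots> = a" by (rule push_id[OF arrows a])
  finally show ?thesis .
qed

lemma antipode_mult:
  assumes a: "a \<in> carrier CA" and b: "b \<in> carrier CA"
  shows "antipode H (a \<star> b) = antipode H b \<star> antipode H a"
proof -
  have 1: "antipode H (a \<star> b) = antipode H b \<star> antipode H a" if a: "rep a U f" and b: "rep b V g" for a U f b V g
  proof -
    obtain k where k: "rep (a \<star> b) (prodset U V) k"
      "\<And>x y. x \<in> U ==> y \<in> V ==> src G x = tgt G y ==> k (mlt G (x, y)) = f x * g y" by (rule conv_rep[OF a b]) (rule that)
    obtain k2 where k2: "rep (antipode H (a \<star> b)) (ivt G ` prodset U V) k2" "\<And>z. z \<in> prodset U V ==> k2 (ivt G z) = k z"
      by (rule antipode_rep[OF k(1)]) (rule that)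
    obtain p where p: "rep (antipode H a) (ivt G ` U) p" "\<And>y. y \<in> U ==> p (ivt G y) = f y" by (rule antipode_rep[OF a]) (rule that)
    obtain p' where p': "rep (antipode H b) (ivt G ` V) p'" "\<And>y. y \<in> V ==> p' (ivt G y) = g y" by (rule antipode_rep[OF b]) (rule that)
    obtain k3 where k3: "rep (antipode H b \<star> antipode H a) (prodset (ivt G ` V) (ivt G ` U)) k3"
      "\<And>x y. x \<in> ivt G ` V ==> y \<in> ivt G ` U ==> src G x = tgt G y ==> k3 (mlt G (x, y)) = p' x * p y"
      by (rule conv_rep[OF p'(1) p(1)]) (rule that)
    have e: "ivt G (mlt G (x, y)) = mlt G (ivt G y, ivt G x)" "src G (ivt G y) = tgt G (ivt G x)"
      if "x \<in> U" "y \<in> V" "src G x = tgt G y" for x y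
      using ivt_mlt[OF subsetD[OF repD(5)[OF a] that(1)] subsetD[OF repD(5)[OF b] that(2)] that(3)]
        src_ivt[OF subsetD[OF repD(5)[OF b] that(2)]] tgt_ivt[OF subsetD[OF repD(5)[OF a] that(1)]] that(3) by simp_all
    show ?thesis
    proof (rule rep_eqI[OF k2(1) k3(1)])
      show "ivt G ` prodset U V = prodset (ivt G ` V) (ivt G ` U)"
      proof (intro equalityI subsetI)
        fix z assume "z \<in> ivt G ` prodset U V"
        then obtain w where w: "z = ivt G w" "w \<in> prodset U V" by (rule imageE)
        obtain x y where xy: "x \<in> U" "y \<in> V" "src G x = tgt G y" "w = mlt G (x, y)" using w(2) by (rule prodsetE)
        show "z \<in> prodset (ivt G ` V) (ivt G ` U)"
          by (rule image_eqI[of _ _ "(ivt G y, ivt G x)"]) (use w(1) xy e[OF xy(1-3)] in simp_all)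
      next
        fix z assume "z \<in> prodset (ivt G ` V) (ivt G ` U)"
        then obtain y' x' where yx: "y' \<in> ivt G ` V" "x' \<in> ivt G ` U" "src G y' = tgt G x'" "z = mlt G (y', x')" by (rule prodsetE)
        obtain y where y: "y' = ivt G y" "y \<in> V" using yx(1) by (rule imageE)
        obtain x where x: "x' = ivt G x" "x \<in> U" using yx(2) by (rule imageE)
        have s: "src G x = tgt G y"
          using yx(3) unfolding x(1) y(1) src_ivt[OF subsetD[OF repD(5)[OF b] y(2)]] tgt_ivt[OF subsetD[OF repD(5)[OF a] x(2)]] by (rule sym)
        have "z = ivt G (mlt G (x, y))" unfolding e(1)[OF x(2) y(2) s] yx(4) x(1) y(1) ..
        moreover have "mlt G (x, y) \<in> prodset U V" by (rule imageI) (use x y s in simp)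
        ultimately show "z \<in> ivt G ` prodset U V" by (rule image_eqI)
      qed
      fix z assume "z \<in> ivt G ` prodset U V"
      then obtain w where w: "z = ivt G w" "w \<in> prodset U V" by (rule imageE)
      obtain x y where xy: "x \<in> U" "y \<in> V" "src G x = tgt G y" "w = mlt G (x, y)" using w(2) by (rule prodsetE)
      have "k2 z = f x * g y" unfolding w(1) k2(2)[OF w(2)] unfolding xy(4) by (rule k(2)[OF xy(1-3)])
      moreover have "k3 z = g y * f x"
        unfolding w(1) xy(4) e(1)[OF xy(1-3)] k3(2)[OF imageI[OF xy(2)] imageI[OF xy(1)] e(2)[OF xy(1-3)]] p(2)[OF xy(1)] p'(2)[OF xy(2)] ..
      ultimately show "k2 z = k3 z" by (simp only: mult.commute)
    qed
  qed
  have 2: "antipode H (a \<star> b) = antipode H b \<star> antipode H a" if a: "rep a U f" for a U f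
    by (rule H_eqI[OF linear_maps_compose[OF conv_linear(1)[OF repD(4)[OF a]] antipode_linear]
        linear_maps_compose[OF antipode_linear conv_linear(2)[OF antipode_in[OF repD(4)[OF a]]]] A.vspace_Cc b]) (rule 1[OF a])
  show ?thesis
    by (rule H_eqI[OF linear_maps_compose[OF conv_linear(2)[OF b] antipode_linear]
        linear_maps_compose[OF antipode_linear conv_linear(1)[OF antipode_in[OF b]]] A.vspace_Cc a]) (rule 2)
qed

lemma carrier_H: "carrier H = carrier CA"
  by (simp only: H_simps)

text \<open>Because the target is injective on \<open>U\<close>, an inverse of an element of
  \<open>U\<close> can be composed with an element of \<open>U\<close> only if both come from the
  same arrow, and the product is the unit at its source. Both sides are thus the push-forward of
  \<open>a\<close> along the map \<phi> that takes an arrow to the unit at its source.\<close>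

lemma antipode_comult:
  assumes a: "a \<in> carrier CA"
  shows "tensor_lift H (mult H) (tensor_map R AO.Rm AO.L (antipode H) (\<lambda>b. b) (comult H a)) = inc H (counit H (antipode H a))"
proof -
  interpret s: tensor_map_setup R AO.L AO.L AO.Rm AO.L "antipode H" "\<lambda>b. b"
  proof (rule tensor_map_setup.intro[OF AO.LL.tensor_setup_axioms AO.RL.tensor_setup_axioms tensor_map_setup_axioms.intro])
    show "antipode H \<in> linear_maps AO.L AO.Rm" unfolding AO.lin_L lin_H by (rule antipode_linear)
    show "(\<lambda>b. b) \<in> linear_maps AO.L AO.L" by (rule linear_maps_id)
    fix r x assume r: "r \<in> carrier R" and "x \<in> carrier AO.L"
    then have x: "x \<in> carrier CA" by (simp only: AO.L_simps carrier_H)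
    show "antipode H (act AO.L r x) = act AO.Rm r (antipode H x)"
      unfolding AO.L_simps AO.Rm_simps antipode_mult[OF inc_in_CA[OF r] x] antipode_inc[OF r] ..
  qed (rule refl)
  have b: "balanced R AO.Rm AO.L H (mult H)"
  proof (rule balancedI)
    show "mult H x \<in> linear_maps AO.L H" if "x \<in> carrier AO.Rm" for x
      unfolding AO.lin_L by (rule AO.A.mult_linear_right) (use that in \<open>simp only: AO.Rm_simps\<close>)
    show "(\<lambda>x. x \<star> y) \<in> linear_maps AO.Rm H" if "y \<in> carrier AO.L" for y
      unfolding AO.lin_L by (rule AO.A.mult_linear_left) (use that in \<open>simp only: AO.L_simps\<close>)
    show "act AO.Rm r x \<star> y = x \<star> act AO.L r y" if "r \<in> carrier R" "x \<in> carrier AO.Rm" "y \<in> carrier AO.L" for r x y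
      using that AO.A.mult_assoc[OF _ AO.inc_in, of x r y] by (simp only: AO.L_simps AO.Rm_simps)
  qed
  note l = AO.RL.lift_linear_pure[OF vspace_H b]
  have lin: "(\<lambda>a. tensor_lift H (mult H) (tensor_map R AO.Rm AO.L (antipode H) (\<lambda>b. b) (comult H a))) \<in> linear_maps CA CA"
    using linear_maps_compose[OF comult_linear linear_maps_compose[OF s.map_linear l(1)]] unfolding lin_H .
  show ?thesis
  proof (rule H_eqI[OF lin linear_maps_compose[OF antipode_linear linear_maps_compose[OF counit_linear inc_linear_CA]] A.vspace_Cc a])
    fix a U f assume a: "rep a U f"
    obtain a' f' where a': "rep a' U f'" "\<And>x. x \<in> U ==> f x * f' x = f x" "comult H a = AO.LL.pt a a'"
      by (rule rep_comult[OF a]) (rule that)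
    obtain p where p: "rep (antipode H a) (ivt G ` U) p" "\<And>y. y \<in> U ==> p (ivt G y) = f y" by (rule antipode_rep[OF a]) (rule that)
    obtain k where k: "rep (antipode H a \<star> a') (prodset (ivt G ` U) U) k"
      "\<And>x y. x \<in> ivt G ` U ==> y \<in> U ==> src G x = tgt G y ==> k (mlt G (x, y)) = p x * f' y" by (rule conv_rep[OF p(1) a'(1)]) (rule that)
    define \<phi> where "\<phi> x = unt G (src G x)" for x
    note U = subsetD[OF repD(5)[OF a]]
    have m: "mlt G (ivt G x, x) = \<phi> x" "src G (ivt G x) = tgt G x" if "x \<in> U" for x
      unfolding \<phi>_def using ivt_left[OF U[OF that]] src_ivt[OF U[OF that]] by simp_all
    have k\<phi>: "k (\<phi> x) = f x" if "x \<in> U" for x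
      unfolding m(1)[OF that, symmetric] k(2)[OF imageI[OF that] that m(2)[OF that]] p(2)[OF that] by (rule a'(2)[OF that])
    have set: "prodset (ivt G ` U) U = \<phi> ` U"
    proof (intro equalityI subsetI)
      fix z assume "z \<in> prodset (ivt G ` U) U"
      then obtain x' y where xy: "x' \<in> ivt G ` U" "y \<in> U" "src G x' = tgt G y" "z = mlt G (x', y)" by (rule prodsetE)
      obtain x where x: "x' = ivt G x" "x \<in> U" using xy(1) by (rule imageE)
      have "x = y" by (rule inj_onD[OF repD(8)[OF a] _ x(2) xy(2)]) (use xy(3) x m(2)[OF x(2)] in simp)
      then have "z = \<phi> y" unfolding xy(4) x(1) using m(1)[OF xy(2)] by simp
      then show "z \<in> \<phi> ` U" by (rule image_eqI) (rule xy(2))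
    next
      fix z assume "z \<in> \<phi> ` U"
      then obtain x where x: "z = \<phi> x" "x \<in> U" by (rule imageE)
      show "z \<in> prodset (ivt G ` U) U"
        by (rule image_eqI[of _ _ "(ivt G x, x)"]) (use x m[OF x(2)] in simp_all)
    qed
    have et: "etale TYPE('f) (arr G) (arr G) \<phi>" unfolding \<phi>_def[abs_def] by (rule etale_compose[OF S.et U.et])
    interpret F: etmap "arr G" "arr G" "TYPE('f)" \<phi> by unfold_locales (rule et)
    have inj: "inj_on \<phi> U"
    proof (rule inj_onI)
      fix x y assume xy: "x \<in> U" "y \<in> U" "\<phi> x = \<phi> y"
      have "src G x = src G y"
        using arg_cong[OF xy(3), of "src G"] unfolding \<phi>_def src_unt[OF src_in[OF U[OF xy(1)]]] src_unt[OF src_in[OF U[OF xy(2)]]] .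
      then show "x = y" by (rule inj_onD[OF repD(7)[OF a] _ xy(1,2)])
    qed
    have "inc H (counit H (antipode H a)) = push M (arr G) (unt G) (push (arr G) M (\<lambda>x. tgt G (ivt G x)) a)"
      unfolding H_simps by (rule arg_cong[OF push_compose[OF arrows arrows objects I.et T.et repD(4)[OF a]]])
    also have "push (arr G) M (\<lambda>x. tgt G (ivt G x)) a = push (arr G) M (src G) a"
      by (rule arg_cong[where f = "\<lambda>h. h a"], rule S.push_cong) (simp only: tgt_ivt)
    also have "push M (arr G) (unt G) (push (arr G) M (src G) a) = push (arr G) (arr G) \<phi> a"
      unfolding \<phi>_def[abs_def] by (rule push_compose[OF arrows objects arrows S.et U.et repD(4)[OF a]])
    also have "\<dots> = ext_by_zero (arr G) (\<phi> ` U) k"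
      unfolding repD(3)[OF a] by (rule F.push_local(2)[OF repD(1)[OF a] inj]) (rule k\<phi>)
    also have "\<dots> = antipode H a \<star> a'" unfolding set[symmetric] by (rule repD(3)[OF k(1), symmetric])
    also have "\<dots> = tensor_lift H (mult H) (tensor_map R AO.Rm AO.L (antipode H) (\<lambda>b. b) (comult H a))"
    proof -
      have c: "a \<in> carrier AO.L" "a' \<in> carrier AO.L" "antipode H a \<in> carrier AO.Rm"
        unfolding AO.L_simps AO.Rm_simps by (rule repH[OF a] repH[OF a'(1)] repH[OF p(1)])+
      show ?thesis unfolding a'(3) s.map_pure[OF c(1,2)] by (rule l(2)[OF c(3,2), symmetric])
    qed
    finally show "tensor_lift H (mult H) (tensor_map R AO.Rm AO.L (antipode H) (\<lambda>b. b) (comult H a)) = inc H (counit H (antipode H a))"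
      by (rule sym)
  qed
qed

section \<open>Coassociativity and cocommutativity\<close>

lemma coassociative_H: "coassociative R H"
proof -
  have act: "comult H (act AO.L r x) = act AO.LL.T r (comult H x)" if "r \<in> carrier R" "x \<in> carrier AO.L" for r x
    using that comult_left[of r x] by (simp only: AO.L_simps carrier_H)
  have lin: "comult H \<in> linear_maps AO.L AO.LL.T" unfolding AO.lin_L lin_H by (rule comult_linear)
  interpret s: tensor_map_setup R AO.L AO.L AO.LL.T AO.L "comult H" "\<lambda>b. b"
    by (rule tensor_map_setup.intro[OF AO.LL.tensor_setup_axioms AO.LLL.tensor_setup_axioms tensor_map_setup_axioms.intro,
          OF lin linear_maps_id act refl])
  interpret t: tensor_map_setup R AO.L AO.L AO.L AO.LL.T "\<lambda>b. b" "comult H"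
    by (rule tensor_map_setup.intro[OF AO.LL.tensor_setup_axioms AO.LLR.tensor_setup_axioms tensor_map_setup_axioms.intro,
          OF linear_maps_id lin refl act])
  show ?thesis
    unfolding coassociative_def carrier_H
  proof (rule ballI)
    fix a assume a: "a \<in> carrier CA"
    show "tensor_assoc R H (tensor_map R AO.LL.T AO.L (comult H) (\<lambda>b. b) (comult H a)) =
        tensor_map R AO.L AO.LL.T (\<lambda>b. b) (comult H) (comult H a)"
    proof (rule H_eqI[OF linear_maps_compose[OF comult_linear linear_maps_compose[OF s.map_linear AO.tensor_assoc_linear_pure(1)]]
          linear_maps_compose[OF comult_linear t.map_linear] AO.LLR.vspace_T a])
      fix a U f assume a: "rep a U f"
      obtain a' f' where a': "rep a' U f'" "\<And>x. x \<in> U ==> f x * f' x = f x" "comult H a = AO.LL.pt a a'"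
        by (rule rep_comult[OF a]) (rule that)
      obtain b g where b: "rep b U g" "\<And>x. x \<in> U ==> f' x * g x = f' x" "comult H a' = AO.LL.pt a' b"
        by (rule rep_comult[OF a'(1)]) (rule that)
      \<comment> \<open>The companion \<open>b\<close> of \<open>a'\<close> is also one of
        \<open>a\<close>, since \<open>f g = f f' g = f f' = f\<close>. Both sides then become the
        tensor of \<open>a\<close>, \<open>a'\<close> and \<open>b\<close>.\<close>
      have ab: "comult H a = AO.LL.pt a b"
        by (rule comult_rep[OF a b(1)]) (metis a'(2) b(2) mult.assoc)
      have c: "a \<in> carrier AO.L" "a' \<in> carrier AO.L" "b \<in> carrier AO.L"
        unfolding AO.L_simps by (rule repH[OF a] repH[OF a'(1)] repH[OF b(1)])+
      have "tensor_map R AO.LL.T AO.L (comult H) (\<lambda>b. b) (comult H a) = AO.LLL.pt (AO.LL.pt a a') b"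
        unfolding a'(3)[symmetric] unfolding ab s.map_pure[OF c(1,3)] ..
      then have "tensor_assoc R H (tensor_map R AO.LL.T AO.L (comult H) (\<lambda>b. b) (comult H a)) = AO.LLR.pt a (AO.LL.pt a' b)"
        using AO.tensor_assoc_linear_pure(2)[OF repH[OF a] repH[OF a'(1)] repH[OF b(1)]] by (simp only:)
      also have "\<dots> = tensor_map R AO.L AO.LL.T (\<lambda>b. b) (comult H) (comult H a)"
        unfolding b(3)[symmetric] a'(3) by (rule t.map_pure[OF c(1,2), symmetric])
      finally show "tensor_assoc R H (tensor_map R AO.LL.T AO.L (comult H) (\<lambda>b. b) (comult H a)) =
        tensor_map R AO.L AO.LL.T (\<lambda>b. b) (comult H) (comult H a)" .
    qed
  qed
qed

text \<open>\<open>a\<close> is \<open>a'\<close> multiplied from the left by the counit of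
  \<open>a\<close>. Moving this base element from the first factor to the second exchanges
  \<open>a\<close> and \<open>a'\<close>.\<close>

lemma cocommutative_H: "cocommutative R H"
  unfolding cocommutative_def carrier_H
proof (rule ballI)
  fix a assume a: "a \<in> carrier CA"
  show "tensor_lift AO.LL.T (\<lambda>b c. AO.LL.pt c b) (comult H a) = comult H a"
  proof (rule H_eqI[OF linear_maps_compose[OF comult_linear AO.flip_linear_pure(1)] comult_linear AO.LL.vspace_T a])
    fix a U f assume a: "rep a U f"
    obtain a' f' where a': "rep a' U f'" "\<And>x. x \<in> U ==> f x * f' x = f x" "comult H a = AO.LL.pt a a'"
      by (rule rep_comult[OF a]) (rule that)
    have d: "counit H a \<in> carrier R" by (rule counit_in[OF repD(4)[OF a]])
    have e: "inc H (counit H a) \<star> a' = a" by (rule rep_fix[OF a counit_act_rep[OF a a'(1)]]) (rule a'(2))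
    have "AO.LL.pt a a' = AO.LL.pt a' a"
      using AO.pt_balanced[OF d repH[OF a'(1)] repH[OF a'(1)]] unfolding e .
    then show "tensor_lift AO.LL.T (\<lambda>b c. AO.LL.pt c b) (comult H a) = comult H a"
      unfolding a'(3) AO.flip_linear_pure(2)[OF repH[OF a] repH[OF a'(1)]] by (rule sym)
  qed
qed

lemma inc_inj: "inj_on (inc H) (carrier R)"
  by (rule inj_on_inverseI[where g = "counit H"]) (rule counit_inc)

lemma hopf_algebroid_H: "hopf_algebroid R H"
  by (rule hopf_algebroid.intro, unfold lin_H carrier_H)
    (rule comm_local_algebra_base, rule assoc_algebra_H, rule inc_linear_CA, rule inc_mult_H, assumption+, rule inc_inj,
      rule local_identities_H, assumption+, rule comult_linear, rule counit_linear, rule antipode_linear,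
      rule comult_left, assumption+, rule counit_left_linear, assumption+, rule counit_right, assumption,
      rule counit_left, assumption, rule counit_inc, assumption, rule comult_inc, assumption, rule right_acts, assumption+,
      rule comult_mult, assumption+, rule antipode_inc, assumption, rule antipode_antipode, assumption,
      rule antipode_mult, assumption+, rule antipode_comult, assumption)

end

section \<open>Functoriality\<close>

locale hgroupoid_hom = P: hgroupoid M G TF + Q: hgroupoid M G' TF
  for M :: "('m, 'e::{real_inner,heine_borel}) manifold" and G :: "('g, 'm, 'e) groupoid" and G' :: "('h, 'm, 'e) groupoid"
    and TF :: "'f::real_normed_field itself" +
  fixes \<phi> :: "'g => 'h"
  assumes hom: "etale_hom M G G' \<phi>"
begin

lemma cont: "continuous_map (mtop (arr G)) (mtop (arr G')) \<phi>"
  using hom by (simp add: etale_hom_def smooth_map_def)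

lemma hom_in: "g \<in> arrows G ==> \<phi> g \<in> arrows G'"
  using cont by (auto simp: continuous_map_def)

lemma src_hom: "g \<in> arrows G ==> src G' (\<phi> g) = src G g"
  and tgt_hom: "g \<in> arrows G ==> tgt G' (\<phi> g) = tgt G g"
  and mlt_hom: "g \<in> arrows G ==> h \<in> arrows G ==> src G g = tgt G h ==> \<phi> (mlt G (g, h)) = mlt G' (\<phi> g, \<phi> h)"
  and unt_hom: "x \<in> topspace (mtop M) ==> \<phi> (unt G x) = unt G' x"
  using hom unfolding etale_hom_def by blast+

text \<open>Uniqueness of inverses turns preservation of products and units into preservation of
  inverses.\<close>

lemma ivt_hom: assumes g: "g \<in> arrows G" shows "\<phi> (ivt G g) = ivt G' (\<phi> g)"
proof (rule Q.ivt_unique)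
  note i = P.ivt_in[OF g]
  show "\<phi> g \<in> arrows G'" "\<phi> (ivt G g) \<in> arrows G'" by (rule hom_in[OF g] hom_in[OF i])+
  have s: "src G g = tgt G (ivt G g)" by (simp only: P.tgt_ivt[OF g])
  show "src G' (\<phi> g) = tgt G' (\<phi> (ivt G g))" unfolding src_hom[OF g] tgt_hom[OF i] by (rule s)
  show "mlt G' (\<phi> g, \<phi> (ivt G g)) = unt G' (tgt G' (\<phi> g))"
    unfolding mlt_hom[OF g i s, symmetric] P.ivt_right[OF g] tgt_hom[OF g] by (rule unt_hom[OF P.tgt_in[OF g]])
qed

text \<open>Commuting with the targets makes a continuous map between the arrow spaces etale, so
  push-forward along a homomorphism is available.\<close>

sublocale F: etmap "arr G" "arr G'" TF \<phi>
  by unfold_locales (rule etale_cancel[OF P.arrows Q.arrows P.T.et Q.T.et cont tgt_hom])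

abbreviation "\<alpha> \<equiv> push (arr G) (arr G') \<phi> :: (('g, 'f) germs) => _"

text \<open>\<phi> commutes with source and target, so it is injective on a bisection and maps it
  onto a bisection.\<close>

lemma hom_rep:
  assumes a: "P.rep a U f"
  obtains k where "Q.rep (\<alpha> a) (\<phi> ` U) k" "\<And>x. x \<in> U ==> k (\<phi> x) = f x"
proof -
  note A1 = P.repD[OF a] and U = subsetD[OF P.repD(5)[OF a]]
  have s: "inj_on (src G' \<circ> \<phi>) U" "inj_on (tgt G' \<circ> \<phi>) U"
    using A1(7,8) inj_on_cong[of U "src G' \<circ> \<phi>" "src G"] inj_on_cong[of U "tgt G' \<circ> \<phi>" "tgt G"] src_hom[OF U] tgt_hom[OF U]
    by simp_all
  have inj: "inj_on \<phi> U" by (rule inj_on_imageI2[OF s(1)])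
  define k where "k z = f (inv_into U \<phi> z)" for z
  have k: "k (\<phi> x) = f x" if "x \<in> U" for x unfolding k_def inv_into_f_f[OF inj that] ..
  have b: "Q.bis (\<phi> ` U)" unfolding Q.bis_def by (rule conjI[OF inj_on_imageI[OF s(1)] inj_on_imageI[OF s(2)]])
  have l: "local_fun (arr G') (\<phi> ` U) k" "\<alpha> (ext_by_zero (arr G) U f) = ext_by_zero (arr G') (\<phi> ` U) k"
    by (rule F.push_local[OF A1(1) inj], erule k)+
  then have "Q.rep (\<alpha> a) (\<phi> ` U) k" using b by (simp only: Q.rep_def A1(3) simp_thms)
  then show thesis by (rule that) (rule k)
qed

text \<open>Composability is preserved and reflected by \<phi>, so the product set is mapped onto
  the product of the images; on bisections both sides are then given by the same products of
  values.\<close>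

lemma hom_mult:
  assumes a: "a \<in> carrier P.CA" and b: "b \<in> carrier P.CA"
  shows "\<alpha> (a \<otimes>\<^bsub>P.H\<^esub> b) = \<alpha> a \<otimes>\<^bsub>Q.H\<^esub> \<alpha> b"
proof -
  have 1: "\<alpha> (a \<otimes>\<^bsub>P.H\<^esub> b) = \<alpha> a \<otimes>\<^bsub>Q.H\<^esub> \<alpha> b" if a: "P.rep a U f" and b: "P.rep b V g" for a U f b V g
  proof -
    obtain k where k: "P.rep (a \<otimes>\<^bsub>P.H\<^esub> b) (P.prodset U V) k"
      "\<And>x y. x \<in> U ==> y \<in> V ==> src G x = tgt G y ==> k (mlt G (x, y)) = f x * g y" by (rule P.conv_rep[OF a b]) (rule that)
    obtain k2 where k2: "Q.rep (\<alpha> (a \<otimes>\<^bsub>P.H\<^esub> b)) (\<phi> ` P.prodset U V) k2" "\<And>z. z \<in> P.prodset U V ==> k2 (\<phi> z) = k z"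
      by (rule hom_rep[OF k(1)]) (rule that)
    obtain p where p: "Q.rep (\<alpha> a) (\<phi> ` U) p" "\<And>y. y \<in> U ==> p (\<phi> y) = f y" by (rule hom_rep[OF a]) (rule that)
    obtain p' where p': "Q.rep (\<alpha> b) (\<phi> ` V) p'" "\<And>y. y \<in> V ==> p' (\<phi> y) = g y" by (rule hom_rep[OF b]) (rule that)
    obtain k3 where k3: "Q.rep (\<alpha> a \<otimes>\<^bsub>Q.H\<^esub> \<alpha> b) (Q.prodset (\<phi> ` U) (\<phi> ` V)) k3"
      "\<And>x y. x \<in> \<phi> ` U ==> y \<in> \<phi> ` V ==> src G' x = tgt G' y ==> k3 (mlt G' (x, y)) = p x * p' y"
      by (rule Q.conv_rep[OF p(1) p'(1)]) (rule that)
    note U = subsetD[OF P.repD(5)[OF a]] and V = subsetD[OF P.repD(5)[OF b]]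
    have e: "\<phi> (mlt G (x, y)) = mlt G' (\<phi> x, \<phi> y)" "src G' (\<phi> x) = tgt G' (\<phi> y)"
      if "x \<in> U" "y \<in> V" "src G x = tgt G y" for x y
      using mlt_hom[OF U[OF that(1)] V[OF that(2)] that(3)] src_hom[OF U[OF that(1)]] tgt_hom[OF V[OF that(2)]] that(3) by simp_all
    show ?thesis
    proof (rule Q.rep_eqI[OF k2(1) k3(1)])
      show "\<phi> ` P.prodset U V = Q.prodset (\<phi> ` U) (\<phi> ` V)"
      proof (intro equalityI subsetI)
        fix z assume "z \<in> \<phi> ` P.prodset U V"
        then obtain w where w: "z = \<phi> w" "w \<in> P.prodset U V" by (rule imageE)
        obtain x y where xy: "x \<in> U" "y \<in> V" "src G x = tgt G y" "w = mlt G (x, y)" using w(2) by (rule P.prodsetE)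
        show "z \<in> Q.prodset (\<phi> ` U) (\<phi> ` V)"
          by (rule image_eqI[of _ _ "(\<phi> x, \<phi> y)"]) (use w(1) xy e[OF xy(1-3)] in simp_all)
      next
        fix z assume "z \<in> Q.prodset (\<phi> ` U) (\<phi> ` V)"
        then obtain x' y' where yx: "x' \<in> \<phi> ` U" "y' \<in> \<phi> ` V" "src G' x' = tgt G' y'" "z = mlt G' (x', y')" by (rule Q.prodsetE)
        obtain y where y: "y' = \<phi> y" "y \<in> V" using yx(2) by (rule imageE)
        obtain x where x: "x' = \<phi> x" "x \<in> U" using yx(1) by (rule imageE)
        have s: "src G x = tgt G y" using yx(3) unfolding x(1) y(1) src_hom[OF U[OF x(2)]] tgt_hom[OF V[OF y(2)]] .
        have "z = \<phi> (mlt G (x, y))" unfolding e(1)[OF x(2) y(2) s] yx(4) x(1) y(1) ..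
        moreover have "mlt G (x, y) \<in> P.prodset U V" by (rule imageI) (use x y s in simp)
        ultimately show "z \<in> \<phi> ` P.prodset U V" by (rule image_eqI)
      qed
      fix z assume "z \<in> \<phi> ` P.prodset U V"
      then obtain w where w: "z = \<phi> w" "w \<in> P.prodset U V" by (rule imageE)
      obtain x y where xy: "x \<in> U" "y \<in> V" "src G x = tgt G y" "w = mlt G (x, y)" using w(2) by (rule P.prodsetE)
      have "k2 z = f x * g y" unfolding w(1) k2(2)[OF w(2)] unfolding xy(4) by (rule k(2)[OF xy(1-3)])
      moreover have "k3 z = f x * g y"
        unfolding w(1) xy(4) e(1)[OF xy(1-3)] k3(2)[OF imageI[OF xy(1)] imageI[OF xy(2)] e(2)[OF xy(1-3)]] p(2)[OF xy(1)] p'(2)[OF xy(2)] ..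
      ultimately show "k2 z = k3 z" by (simp only:)
    qed
  qed
  have 2: "\<alpha> (a \<otimes>\<^bsub>P.H\<^esub> b) = \<alpha> a \<otimes>\<^bsub>Q.H\<^esub> \<alpha> b" if a: "P.rep a U f" for a U f
    by (rule P.H_eqI[OF linear_maps_compose[OF P.conv_linear(1)[OF P.repD(4)[OF a]] F.push_linear]
        linear_maps_compose[OF F.push_linear Q.conv_linear(1)[OF F.push_in[OF P.repD(4)[OF a]]]] Q.A.vspace_Cc b]) (rule 1[OF a])
  show ?thesis
    by (rule P.H_eqI[OF linear_maps_compose[OF P.conv_linear(2)[OF b] F.push_linear]
        linear_maps_compose[OF F.push_linear Q.conv_linear(2)[OF F.push_in[OF b]]] Q.A.vspace_Cc a]) (rule 2)
qed

lemma hom_inc: assumes r: "r \<in> carrier (Cc M)" shows "\<alpha> (inc P.H r) = inc Q.H r"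
proof -
  have "\<alpha> (inc P.H r) = push M (arr G') (\<lambda>x. \<phi> (unt G x)) r"
    unfolding P.H_simps by (rule push_compose[OF P.objects P.arrows Q.arrows P.U.et F.et r])
  also have "\<dots> = push M (arr G') (unt G') r"
    by (rule arg_cong[where f = "\<lambda>h. h r"], rule Q.U.push_cong) (simp only: unt_hom)
  finally show ?thesis unfolding Q.H_simps .
qed

lemma hom_counit: assumes a: "a \<in> carrier P.CA" shows "counit Q.H (\<alpha> a) = counit P.H a"
proof -
  have "counit Q.H (\<alpha> a) = push (arr G) M (\<lambda>x. tgt G' (\<phi> x)) a"
    unfolding Q.H_simps by (rule push_compose[OF P.arrows Q.arrows P.objects F.et Q.T.et a])
  also have "\<dots> = push (arr G) M (tgt G) a"
    by (rule arg_cong[where f = "\<lambda>h. h a"], rule P.T.push_cong) (simp only: tgt_hom)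
  finally show ?thesis unfolding P.H_simps .
qed

lemma hom_antipode: assumes a: "a \<in> carrier P.CA" shows "antipode Q.H (\<alpha> a) = \<alpha> (antipode P.H a)"
proof -
  have e: "etale TYPE('f) (arr G) (arr G') (\<lambda>x. \<phi> (ivt G x))" by (rule etale_compose[OF P.I.et F.et])
  interpret E: etmap "arr G" "arr G'" "TYPE('f)" "\<lambda>x. \<phi> (ivt G x)" by unfold_locales (rule e)
  have "antipode Q.H (\<alpha> a) = push (arr G) (arr G') (\<lambda>x. ivt G' (\<phi> x)) a"
    unfolding Q.H_simps by (rule push_compose[OF P.arrows Q.arrows Q.arrows F.et Q.I.et a])
  also have "\<dots> = push (arr G) (arr G') (\<lambda>x. \<phi> (ivt G x)) a"
    by (rule arg_cong[where f = "\<lambda>h. h a"], rule E.push_cong) (simp only: ivt_hom)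
  also have "\<dots> = \<alpha> (antipode P.H a)"
    unfolding P.H_simps by (rule push_compose[OF P.arrows P.arrows Q.arrows P.I.et F.et a, symmetric])
  finally show ?thesis .
qed

text \<open>The pushed companion is a companion of the pushed function, because \<phi> transports
  the relation \<open>f f' = f\<close> pointwise from \<open>U\<close> to its image.\<close>

lemma hom_comult:
  assumes a: "a \<in> carrier P.CA"
  shows "tensor_map (Cc M) Q.AO.L Q.AO.L \<alpha> \<alpha> (comult P.H a) = comult Q.H (\<alpha> a)"
proof -
  have lin: "\<alpha> \<in> linear_maps P.AO.L Q.AO.L" unfolding P.AO.lin_L Q.AO.lin_L P.lin_H Q.lin_H by (rule F.push_linear)
  have act: "\<alpha> (act P.AO.L r x) = act Q.AO.L r (\<alpha> x)" if r: "r \<in> carrier P.R" and x: "x \<in> carrier P.AO.L" for r x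
  proof -
    have x': "x \<in> carrier P.CA" using x by (simp only: P.AO.L_simps P.carrier_H)
    show ?thesis unfolding P.AO.L_simps Q.AO.L_simps hom_mult[OF P.inc_in_CA[OF r] x'] hom_inc[OF r] ..
  qed
  interpret s: tensor_map_setup P.R P.AO.L P.AO.L Q.AO.L Q.AO.L \<alpha> \<alpha>
    by (rule tensor_map_setup.intro[OF P.AO.LL.tensor_setup_axioms Q.AO.LL.tensor_setup_axioms tensor_map_setup_axioms.intro,
          OF lin lin act act])
  show ?thesis
  proof (rule P.H_eqI[OF linear_maps_compose[OF P.comult_linear s.map_linear] linear_maps_compose[OF F.push_linear Q.comult_linear]
        Q.AO.LL.vspace_T a])
    fix a U f assume a: "P.rep a U f"
    obtain a' f' where a': "P.rep a' U f'" "\<And>x. x \<in> U ==> f x * f' x = f x" "comult P.H a = P.AO.LL.pt a a'"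
      by (rule P.rep_comult[OF a]) (rule that)
    obtain p where p: "Q.rep (\<alpha> a) (\<phi> ` U) p" "\<And>y. y \<in> U ==> p (\<phi> y) = f y" by (rule hom_rep[OF a]) (rule that)
    obtain p' where p': "Q.rep (\<alpha> a') (\<phi> ` U) p'" "\<And>y. y \<in> U ==> p' (\<phi> y) = f' y" by (rule hom_rep[OF a'(1)]) (rule that)
    have "comult Q.H (\<alpha> a) = Q.AO.LL.pt (\<alpha> a) (\<alpha> a')"
    proof (rule Q.comult_rep[OF p(1) p'(1)])
      fix z assume "z \<in> \<phi> ` U"
      then obtain x where x: "z = \<phi> x" "x \<in> U" by (rule imageE)
      show "p z * p' z = p z" unfolding x(1) p(2)[OF x(2)] p'(2)[OF x(2)] by (rule a'(2)[OF x(2)])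
    qed
    moreover have "tensor_map (Cc M) Q.AO.L Q.AO.L \<alpha> \<alpha> (P.AO.LL.pt a a') = Q.AO.LL.pt (\<alpha> a) (\<alpha> a')"
      by (rule s.map_pure; unfold P.AO.L_simps) (rule P.repH[OF a], rule P.repH[OF a'(1)])
    ultimately show "tensor_map (Cc M) Q.AO.L Q.AO.L \<alpha> \<alpha> (comult P.H a) = comult Q.H (\<alpha> a)" unfolding a'(3) by (simp only:)
  qed
qed

lemma hopf_hom_push: "hopf_hom (Cc M) P.H Q.H \<alpha>"
  unfolding hopf_hom_def P.carrier_H P.lin_H Q.lin_H
  by (intro conjI ballI) (rule F.push_linear hom_mult hom_inc hom_counit hom_comult hom_antipode; assumption?)+

end

section \<open>The category of Hopf algebroids\<close>

lemma hopf_algebroid_alg_over: "hopf_algebroid R A ==> alg_over R A"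
  by (rule alg_over.intro)
    (rule hopf_algebroid.base hopf_algebroid.algebra hopf_algebroid.inc_linear hopf_algebroid.inc_mult, assumption+)+

lemma hopf_homD:
  assumes "hopf_hom R A B \<alpha>"
  shows "\<alpha> \<in> linear_maps A B"
    and "a \<in> carrier A ==> b \<in> carrier A ==> \<alpha> (a \<otimes>\<^bsub>A\<^esub> b) = \<alpha> a \<otimes>\<^bsub>B\<^esub> \<alpha> b"
    and "r \<in> carrier R ==> \<alpha> (inc A r) = inc B r"
    and "a \<in> carrier A ==> counit B (\<alpha> a) = counit A a"
    and "a \<in> carrier A ==> tensor_map R (left_mod B) (left_mod B) \<alpha> \<alpha> (comult A a) = comult B (\<alpha> a)"
    and "a \<in> carrier A ==> antipode B (\<alpha> a) = \<alpha> (antipode A a)"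
  using assms unfolding hopf_hom_def by blast+

lemma tensor_map_setup_hom:
  assumes A: "alg_over R A" and B: "alg_over R B" and lin: "\<alpha> \<in> linear_maps A B"
    and mult: "\<And>a b. a \<in> carrier A ==> b \<in> carrier A ==> \<alpha> (a \<otimes>\<^bsub>A\<^esub> b) = \<alpha> a \<otimes>\<^bsub>B\<^esub> \<alpha> b"
    and inc: "\<And>r. r \<in> carrier R ==> \<alpha> (inc A r) = inc B r"
  shows "tensor_map_setup R (left_mod A) (left_mod A) (left_mod B) (left_mod B) \<alpha> \<alpha>"
proof -
  interpret A: alg_over R A by (rule A)
  interpret B: alg_over R B by (rule B)
  have l: "\<alpha> \<in> linear_maps A.L B.L" unfolding A.lin_L B.lin_L by (rule lin)
  have act: "\<alpha> (act A.L r x) = act B.L r (\<alpha> x)" if r: "r \<in> carrier R" and x: "x \<in> carrier A.L" for r x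
  proof -
    have "x \<in> carrier A" using x by (simp only: A.L_simps)
    then show ?thesis unfolding A.L_simps B.L_simps using mult[OF A.inc_in[OF r]] inc[OF r] by simp
  qed
  show ?thesis
    by (rule tensor_map_setup.intro[OF A.LL.tensor_setup_axioms B.LL.tensor_setup_axioms tensor_map_setup_axioms.intro, OF l l act act])
qed

text \<open>Morphisms are extensional, so the identity is restricted to the carrier. Its tensor
  square is shown to be the identity on the carrier of the tensor product, where the values of
  \<open>comult\<close> lie.\<close>

lemma hopf_hom_id:
  assumes "hopf_algebroid R A"
  shows "hopf_hom R A A (\<lambda>a\<in>carrier A. a)"
proof -
  interpret h: hopf_algebroid R A by fact
  interpret p: alg_over R A by (rule hopf_algebroid_alg_over[OF assms])
  let ?i = "\<lambda>a\<in>carrier A. a"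
  have lin: "?i \<in> linear_maps A A" by (rule linear_mapsI) (simp_all add: p.VA.a_closed p.VA.smult_in)
  interpret s: tensor_map_setup R p.L p.L p.L p.L ?i ?i
    by (rule tensor_map_setup_hom[OF p.alg_over_axioms p.alg_over_axioms lin]) (simp_all add: p.A.mult_closed p.inc_in)
  have T: "tensor_map R p.L p.L ?i ?i t = t" if t: "t \<in> carrier p.LL.T" for t
  proof (rule p.LL_eq_on_pure[OF s.map_linear linear_maps_id t])
    fix x y assume "x \<in> carrier A" "y \<in> carrier A"
    then show "tensor_map R p.L p.L ?i ?i (p.LL.pt x y) = p.LL.pt x y" using s.map_pure[of x y] by simp
  qed
  show ?thesis
    unfolding hopf_hom_def
    using lin p.A.mult_closed p.inc_in T[OF linear_mapsD(1)[OF h.comult_linear]] linear_mapsD(1)[OF h.antipode_linear]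
    by simp
qed

lemma hopf_hom_compose:
  assumes A: "hopf_algebroid R A" and B: "hopf_algebroid R B" and C: "hopf_algebroid R C"
    and \<alpha>: "hopf_hom R A B \<alpha>" and \<beta>: "hopf_hom R B C \<beta>"
  shows "hopf_hom R A C (compose (carrier A) \<beta> \<alpha>)"
proof -
  interpret h: hopf_algebroid R A by (rule A)
  interpret A: alg_over R A by (rule hopf_algebroid_alg_over[OF A])
  interpret B: alg_over R B by (rule hopf_algebroid_alg_over[OF B])
  interpret C: alg_over R C by (rule hopf_algebroid_alg_over[OF C])
  note a = hopf_homD[OF \<alpha>] and b = hopf_homD[OF \<beta>]
  let ?c = "compose (carrier A) \<beta> \<alpha>"
  have c: "?c x = \<beta> (\<alpha> x)" if "x \<in> carrier A" for x using that by (simp add: compose_def)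
  note ai = linear_mapsD(1)[OF a(1)]
  have lin: "?c \<in> linear_maps A C"
    by (rule linear_mapsI)
      (simp_all add: c A.VA.a_closed A.VA.smult_in linear_mapsD[OF a(1)] linear_mapsD[OF b(1)])
  have mult: "?c (x \<otimes>\<^bsub>A\<^esub> y) = ?c x \<otimes>\<^bsub>C\<^esub> ?c y" if "x \<in> carrier A" "y \<in> carrier A" for x y
    using that by (simp add: c A.A.mult_closed a(2) b(2) ai)
  have inc: "?c (inc A r) = inc C r" if "r \<in> carrier R" for r using that by (simp add: c A.inc_in a(3) b(3))
  interpret sa: tensor_map_setup R A.L A.L B.L B.L \<alpha> \<alpha>
    by (rule tensor_map_setup_hom[OF A.alg_over_axioms B.alg_over_axioms a(1-3)])
  interpret sb: tensor_map_setup R B.L B.L C.L C.L \<beta> \<beta>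
    by (rule tensor_map_setup_hom[OF B.alg_over_axioms C.alg_over_axioms b(1-3)])
  interpret sc: tensor_map_setup R A.L A.L C.L C.L ?c ?c
    by (rule tensor_map_setup_hom[OF A.alg_over_axioms C.alg_over_axioms lin mult inc])
  have T: "tensor_map R C.L C.L ?c ?c t = tensor_map R C.L C.L \<beta> \<beta> (tensor_map R B.L B.L \<alpha> \<alpha> t)" if t: "t \<in> carrier A.LL.T" for t
  proof (rule A.LL_eq_on_pure[OF sc.map_linear linear_maps_compose[OF sa.map_linear sb.map_linear] t])
    fix x y assume "x \<in> carrier A" "y \<in> carrier A"
    then show "tensor_map R C.L C.L ?c ?c (A.LL.pt x y) = tensor_map R C.L C.L \<beta> \<beta> (tensor_map R B.L B.L \<alpha> \<alpha> (A.LL.pt x y))"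
      using sc.map_pure[of x y] sa.map_pure[of x y] sb.map_pure[of "\<alpha> x" "\<alpha> y"] by (simp add: c ai)
  qed
  show ?thesis
    unfolding hopf_hom_def
  proof (intro conjI ballI lin mult inc)
    fix x assume x: "x \<in> carrier A"
    show "counit C (?c x) = counit A x" unfolding c[OF x] b(4)[OF ai[OF x]] by (rule a(4)[OF x])
    show "tensor_map R C.L C.L ?c ?c (comult A x) = comult C (?c x)"
      unfolding T[OF linear_mapsD(1)[OF h.comult_linear x]] c[OF x] a(5)[OF x] by (rule b(5)[OF ai[OF x]])
    show "antipode C (?c x) = ?c (antipode A x)"
      unfolding c[OF x] c[OF linear_mapsD(1)[OF h.antipode_linear x]] a(6)[OF x, symmetric] by (rule b(6)[OF ai[OF x]])
  qed
qed

lemma HoAlgd_category: "is_category (HoAlgd R)"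
proof -
  have fs: "f \<in> carrier A \<rightarrow> carrier B" if "hopf_hom R A B f" for A B f
    using linear_mapsD(1)[OF hopf_homD(1)[OF that]] by (rule Pi_I)
  show ?thesis
    by (rule is_category.intro; unfold HoAlgd_def cat.simps mem_Collect_eq; (elim conjE)?)
      (rule conjI[OF restrict_extensional hopf_hom_id], assumption,
        rule conjI[OF compose_extensional hopf_hom_compose[rotated 3]], assumption+,
        rule compose_Id[OF fs], assumption+, rule Id_compose[OF fs], assumption+, rule compose_assoc[OF fs, symmetric], assumption)
qed

lemma push_extensional: "push E F \<phi> \<in> extensional (carrier (Cc E))"
  unfolding push_def by (rule restrict_extensional)

section \<open>The category of etale groupoids and the functor laws\<close>

context hbase
begin

lemma etale_hom_id:
  assumes G: "etale_groupoid M G"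
  shows "etale_hom M G G (\<lambda>g\<in>arrows G. g)"
proof -
  \<comment> \<open>The category of groupoids does not mention the ground field; \<open>real\<close>
    merely instantiates the locale.\<close>
  interpret P: hgroupoid M G "TYPE(real)" by (rule hgroupoid.intro[OF G hbase_axioms])
  have s: "smooth_map (arr G) (arr G) (\<lambda>g\<in>arrows G. g)"
    by (rule smooth_map_cong[OF P.arrows P.arrows smooth_map_id[OF P.arrows]]) simp
  show ?thesis unfolding etale_hom_def using s P.mlt_in P.unt_in by simp
qed

lemma etale_hom_compose:
  assumes G: "etale_groupoid M G" and H: "etale_groupoid M H" and K: "etale_groupoid M K"
    and \<phi>: "etale_hom M G H \<phi>" and \<psi>: "etale_hom M H K \<psi>"
  shows "etale_hom M G K (compose (arrows G) \<psi> \<phi>)"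
proof -
  interpret P: hgroupoid_hom M G H "TYPE(real)" \<phi>
    by (rule hgroupoid_hom.intro[OF hgroupoid.intro[OF G hbase_axioms] hgroupoid.intro[OF H hbase_axioms] hgroupoid_hom_axioms.intro[OF \<phi>]])
  interpret Q: hgroupoid_hom M H K "TYPE(real)" \<psi>
    by (rule hgroupoid_hom.intro[OF hgroupoid.intro[OF H hbase_axioms] hgroupoid.intro[OF K hbase_axioms] hgroupoid_hom_axioms.intro[OF \<psi>]])
  have c: "compose (arrows G) \<psi> \<phi> g = \<psi> (\<phi> g)" if "g \<in> arrows G" for g using that by (simp add: compose_def)
  have s: "smooth_map (arr G) (arr K) (compose (arrows G) \<psi> \<phi>)"
  proof (rule smooth_map_cong[OF P.P.arrows Q.Q.arrows smooth_map_compose[OF P.P.arrows P.Q.arrows Q.Q.arrows]])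
    show "smooth_map (arr G) (arr H) \<phi>" "smooth_map (arr H) (arr K) \<psi>" using \<phi> \<psi> by (simp_all add: etale_hom_def)
    show "(\<psi> \<circ> \<phi>) g = compose (arrows G) \<psi> \<phi> g" if "g \<in> arrows G" for g using c[OF that] by simp
  qed
  show ?thesis
    unfolding etale_hom_def
  proof (intro conjI ballI impI s)
    fix g assume g: "g \<in> arrows G"
    show "src K (compose (arrows G) \<psi> \<phi> g) = src G g" "tgt K (compose (arrows G) \<psi> \<phi> g) = tgt G g"
      unfolding c[OF g] Q.src_hom[OF P.hom_in[OF g]] Q.tgt_hom[OF P.hom_in[OF g]] by (rule P.src_hom[OF g] P.tgt_hom[OF g])+
    fix h assume h: "h \<in> arrows G" and gh: "src G g = tgt G h"
    have s: "src H (\<phi> g) = tgt H (\<phi> h)" unfolding P.src_hom[OF g] P.tgt_hom[OF h] by (rule gh)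
    show "compose (arrows G) \<psi> \<phi> (mlt G (g, h)) = mlt K (compose (arrows G) \<psi> \<phi> g, compose (arrows G) \<psi> \<phi> h)"
      unfolding c[OF g] c[OF h] c[OF P.P.mlt_in[OF g h gh]] P.mlt_hom[OF g h gh] by (rule Q.mlt_hom[OF P.hom_in[OF g] P.hom_in[OF h] s])
  next
    fix x assume x: "x \<in> X"
    show "compose (arrows G) \<psi> \<phi> (unt G x) = unt K x" unfolding c[OF P.P.unt_in[OF x]] P.unt_hom[OF x] by (rule Q.unt_hom[OF x])
  qed
qed

lemma EtGrpd_category: "is_category (EtGrpd M)"
proof -
  have fs: "f \<in> arrows G \<rightarrow> arrows H" if "etale_hom M G H f" for G H f
    using that by (auto simp: etale_hom_def smooth_map_def continuous_map_def)
  show ?thesis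
    by (rule is_category.intro; unfold EtGrpd_def cat.simps mem_Collect_eq; (elim conjE)?)
      (rule conjI[OF restrict_extensional etale_hom_id], assumption,
        rule conjI[OF compose_extensional etale_hom_compose[rotated 3]], assumption+,
        rule compose_Id[OF fs], assumption+, rule Id_compose[OF fs], assumption+, rule compose_assoc[OF fs, symmetric], assumption)
qed

lemma push_idt:
  assumes G: "etale_groupoid M G"
  shows "push (arr G) (arr G) (\<lambda>g\<in>arrows G. g) =
    (\<lambda>a\<in>carrier (Cc (arr G) :: ('f::real_normed_field, _) module). a)"
proof -
  interpret P: hgroupoid M G "TYPE('f)" by (rule hgroupoid.intro[OF G hbase_axioms])
  interpret i: etmap "arr G" "arr G" "TYPE('f)" "\<lambda>g. g" by unfold_locales (rule etale_id)
  have e: "push (arr G) (arr G) (\<lambda>g\<in>arrows G. g) = (push (arr G) (arr G) (\<lambda>g. g) :: (('a, 'f) germs) => _)"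
    by (rule i.push_cong) simp
  show ?thesis
    unfolding e by (rule extensionalityI[OF push_extensional restrict_extensional]) (simp only: push_id[OF P.arrows] restrict_apply')
qed

lemma push_cmp:
  assumes G: "etale_groupoid M G" and H: "etale_groupoid M H" and K: "etale_groupoid M K"
    and \<phi>: "etale_hom M G H \<phi>" and \<psi>: "etale_hom M H K \<psi>"
  shows "push (arr G) (arr K) (compose (arrows G) \<psi> \<phi>) =
    compose (carrier (Cc (arr G) :: ('f::real_normed_field, _) module)) (push (arr H) (arr K) \<psi>) (push (arr G) (arr H) \<phi>)"
proof -
  interpret P: hgroupoid_hom M G H "TYPE('f)" \<phi>
    by (rule hgroupoid_hom.intro[OF hgroupoid.intro[OF G hbase_axioms] hgroupoid.intro[OF H hbase_axioms] hgroupoid_hom_axioms.intro[OF \<phi>]])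
  interpret Q: hgroupoid_hom M H K "TYPE('f)" \<psi>
    by (rule hgroupoid_hom.intro[OF hgroupoid.intro[OF H hbase_axioms] hgroupoid.intro[OF K hbase_axioms] hgroupoid_hom_axioms.intro[OF \<psi>]])
  interpret c: etmap "arr G" "arr K" "TYPE('f)" "\<lambda>g. \<psi> (\<phi> g)" by unfold_locales (rule etale_compose[OF P.F.et Q.F.et])
  have e: "push (arr G) (arr K) (compose (arrows G) \<psi> \<phi>) = (push (arr G) (arr K) (\<lambda>g. \<psi> (\<phi> g)) :: (('a, 'f) germs) => _)"
    by (rule c.push_cong) (simp add: compose_def)
  show ?thesis
    unfolding e
    by (rule extensionalityI[OF push_extensional compose_extensional])
      (simp only: compose_eq push_compose[OF P.P.arrows P.Q.arrows Q.Q.arrows P.F.et Q.F.et])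
qed

end

theorem proposition3p4:
  fixes M :: "('m, 'e::{real_inner,heine_borel}) manifold"
  assumes "smooth_manifold M" and "Hausdorff_space (mtop M)"
  shows "(\<forall>G :: ('g, 'm, 'e) groupoid. etale_groupoid M G \<longrightarrow>
            (let R = Cc M :: ('f::real_normed_field, 'm \<Rightarrow> ('m \<Rightarrow> 'f) set) module;
                 A = convolution_hopf M G
             in hopf_algebroid R A \<and> coassociative R A \<and> cocommutative R A)) \<and>
         is_functor
           (EtGrpd M :: (('g, 'm, 'e) groupoid, 'g \<Rightarrow> 'g) cat)
           (HoAlgd (Cc M :: ('f, 'm \<Rightarrow> ('m \<Rightarrow> 'f) set) module))
           (convolution_hopf M)
           (\<lambda>G H \<phi>. push (arr G) (arr H) \<phi>)"
proof -
  interpret hbase M by unfold_locales fact+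
  let ?R = "Cc M :: ('f, 'm \<Rightarrow> ('m \<Rightarrow> 'f) set) module"
  let ?A = "convolution_hopf M :: ('g, 'm, 'e) groupoid \<Rightarrow> ('f, 'm \<Rightarrow> ('m \<Rightarrow> 'f) set, 'g \<Rightarrow> ('g \<Rightarrow> 'f) set) hopf_data"
  have obj: "hopf_algebroid ?R (?A G)" "coassociative ?R (?A G)" "cocommutative ?R (?A G)" if G: "etale_groupoid M G" for G
  proof -
    interpret P: hgroupoid M G "TYPE('f)" by (rule hgroupoid.intro[OF G hbase_axioms])
    show "hopf_algebroid ?R (?A G)" "coassociative ?R (?A G)" "cocommutative ?R (?A G)"
      by (rule P.hopf_algebroid_H P.coassociative_H P.cocommutative_H)+
  qed
  have mor: "hopf_hom ?R (?A G) (?A H) (push (arr G) (arr H) \<phi>)"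
    if G: "etale_groupoid M G" and H: "etale_groupoid M H" and \<phi>: "etale_hom M G H \<phi>" for G H \<phi>
  proof -
    interpret P: hgroupoid_hom M G H "TYPE('f)" \<phi>
      by (rule hgroupoid_hom.intro[OF hgroupoid.intro[OF G hbase_axioms] hgroupoid.intro[OF H hbase_axioms] hgroupoid_hom_axioms.intro[OF \<phi>]])
    show ?thesis by (rule P.hopf_hom_push)
  qed
  have carrier: "carrier (?A G) = carrier (Cc (arr G))" for G by (simp add: convolution_hopf_def)
  have "is_functor (EtGrpd M) (HoAlgd ?R) ?A (\<lambda>G H \<phi>. push (arr G) (arr H) \<phi>)"
  proof (rule is_functor.intro[OF EtGrpd_category HoAlgd_category])
    show "?A G \<in> Obj (HoAlgd ?R)" if "G \<in> Obj (EtGrpd M)" for G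
      using obj(1)[of G] that by (simp add: EtGrpd_def HoAlgd_def)
    show "push (arr G) (arr H) \<phi> \<in> Hom (HoAlgd ?R) (?A G) (?A H)"
      if "G \<in> Obj (EtGrpd M)" "H \<in> Obj (EtGrpd M)" "\<phi> \<in> Hom (EtGrpd M) G H" for G H \<phi>
      using mor[of G H \<phi>] that by (simp add: EtGrpd_def HoAlgd_def carrier push_extensional)
    show "push (arr G) (arr G) (Idt (EtGrpd M) G) = Idt (HoAlgd ?R) (?A G)" if "G \<in> Obj (EtGrpd M)" for G
      using push_idt[of G] that by (simp add: EtGrpd_def HoAlgd_def carrier)
    show "push (arr G) (arr K) (Cmp (EtGrpd M) G H K \<psi> \<phi>) =
        Cmp (HoAlgd ?R) (?A G) (?A H) (?A K) (push (arr H) (arr K) \<psi>) (push (arr G) (arr H) \<phi>)"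
      if "G \<in> Obj (EtGrpd M)" "H \<in> Obj (EtGrpd M)" "K \<in> Obj (EtGrpd M)" "\<phi> \<in> Hom (EtGrpd M) G H" "\<psi> \<in> Hom (EtGrpd M) H K" for G H K \<phi> \<psi>
      using push_cmp[of G H K \<phi> \<psi>] that by (simp add: EtGrpd_def HoAlgd_def carrier)
  qed
  then show ?thesis using obj by (simp add: Let_def)
qed

end
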